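(* Let $\lambda$ be an uncountable cardinal. Then the forcing $\mathbb{C}_\lambda$ adding $\lambda$ Cohen reals forces that, for every regular cardinal $\kappa$ with $\aleph_1\le\kappa\le\lambda$, there is an ideal $J^\kappa$ on $\omega$ (which can moreover be taken maximal) such that $\mathfrak{b}_{J^\kappa}(\overline{\Omega})=\mathrm{add}(\mathcal{N}_{J^\kappa})=\mathrm{add}(\mathcal{N}^*_{J^\kappa})=\mathrm{cof}(\mathcal{N}^*_{J^\kappa})=\mathrm{cof}(\mathcal{N}_{J^\kappa})=\mathfrak{d}_{J^\kappa}(\overline{\Omega})=\kappa$.
   Context: An ideal on $\omega$ is a family $J\subseteq\mathcal{P}(\omega)$ closed under subsets and finite unions, containing all finite sets, with $\omega\notin J$; $J^+=\mathcal{P}(\omega)\setminus J$, $J^d=\{\omega\setminus a:a\in J\}$. ${}^\omega2$ has Lebesgue measure $\mu$; $\Omega$ is the set of clopen subsets. For $\bar c\in{}^\omega\Omega$: $N(\bar c)=\{x:x\in c_n\text{ for infinitely many }n\}$, $\overline{\Omega}=\{\bar c:\mu(N(\bar c))=0\}$, $N_J(\bar c)=\{x:\{n:x\in c_n\}\in J^+\}$, $N^*_J(\bar c)=\{x:\{n:x\in c_n\}\in J^d\}$, $\mathcal{N}_J=\{X\subseteq{}^\omega2:\exists\bar c\in\overline{\Omega}\ X\subseteq N_J(\bar c)\}$, $\mathcal{N}^*_J=\{X:\exists\bar c\in\overline{\Omega}\ X\subseteq N^*_J(\bar c)\}$. For $\bar c,\bar d\in\overline{\Omega}$, $\bar c\subseteq^J\bar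 d$ iff $\{n:c_n\not\subseteq d_n\}\in J$; $\mathfrak{b}_J(\overline{\Omega})$ is the least size of a subset of $\overline{\Omega}$ without a $\subseteq^J$-upper bound in $\overline{\Omega}$, and $\mathfrak{d}_J(\overline{\Omega})$ the least size of a $\subseteq^J$-cofinal subset of $\overline{\Omega}$. $\mathrm{add}$ and $\mathrm{cof}$ denote additivity and cofinality of an ideal. *)

theory Defs
  imports Main "HOL-Library.Countable_Set"
begin

section \<open>Names and the forcing relation\<close>

text \<open>
  Conditions of a forcing notion are the elements of a type of class \<open>order_top\<close>;
  \<open>q \<le> p\<close> means that \<open>q\<close> is the stronger condition.

  A name is a set of pairs of a name and a condition, given as the range \<open>elems x\<close> of a family
  indexed by a subset of \<open>'i\<close>. The names are thus those of hereditary size at most \<open>|'i|\<close>, and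
  quantifying over them is, for \<open>|'i|\<close> at least the number of conditions, quantifying over the sets
  of hereditary size at most \<open>|'i|\<close> in the generic extension. Any assertion about a power set is
  therefore evaluated correctly once \<open>'i\<close> is large enough.
\<close>

datatype ('i, 'p) name = Name "'i \<Rightarrow> (('i, 'p) name \<times> 'p) option"

primrec elems :: "('i, 'p) name \<Rightarrow> (('i, 'p) name \<times> 'p) set" where
  "elems (Name F) = ran F"

lemma wf_elems: "wf {(y, x). \<exists>s. (y, s) \<in> elems x}"
proof (rule wfUNIVI)
  fix P :: "('a, 'b) name \<Rightarrow> bool" and x
  assume *: "\<forall>x. (\<forall>y. (y, x) \<in> {(y, x). \<exists>s. (y, s) \<in> elems x} \<longrightarrow> P y) \<longrightarrow> P x"
  show "P x"
  proof (induction x)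
    case (Name F)
    have "P y" if "(y, s) \<in> ran F" for y s
    proof -
      from that obtain i where "F i = Some (y, s)" by (auto simp: ran_def)
      then have "Some (y, s) \<in> range F" by (metis rangeI)
      then show ?thesis using Name.IH[of "Some (y, s)" "(y, s)" y] by auto
    qed
    then show ?case using *[rule_format, of "Name F"] by auto
  qed
qed

type_synonym 'p fprop = "'p \<Rightarrow> bool"

text \<open>
  A formula \<open>\<phi>\<close> of the forcing language is represented by the predicate \<open>\<lambda>p. p forces \<phi>\<close>.
  The clauses are those of the usual recursive definition (Kunen's \<open>\<tturnstile>\<^sup>*\<close>): equality and membership
  by recursion on names, negation, conjunction and universal quantification over all names;
  the other connectives are the classical abbreviations.
\<close>

function (sequential) feq ::
    "('i, 'p::order_top) name \<Rightarrow> ('i, 'p) name \<Rightarrow> 'p fprop" (infix \<open>\<^bold>=\<close> 50) where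
  "(x \<^bold>= y) p =
    ((\<forall>(x', s)\<in>elems x. \<forall>q. q \<le> p \<and> q \<le> s \<longrightarrow>
        (\<exists>r\<le>q. \<exists>(y', t)\<in>elems y. r \<le> t \<and> (x' \<^bold>= y') r)) \<and>
     (\<forall>(y', t)\<in>elems y. \<forall>q. q \<le> p \<and> q \<le> t \<longrightarrow>
        (\<exists>r\<le>q. \<exists>(x', s)\<in>elems x. r \<le> s \<and> (x' \<^bold>= y') r)))"
  by pat_completeness auto
termination
  by (relation "inv_image {(y, x). \<exists>s. (y, s) \<in> elems x} fst") (auto simp: wf_elems)

declare feq.simps [simp del]

definition fmem :: "('i, 'p::order_top) name \<Rightarrow> ('i, 'p) name \<Rightarrow> 'p fprop" (infix \<open>\<^bold>\<in>\<close> 50) where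
  "(x \<^bold>\<in> y) p = (\<forall>q\<le>p. \<exists>r\<le>q. \<exists>(y', t)\<in>elems y. r \<le> t \<and> (x \<^bold>= y') r)"

definition fneg :: "'p::order_top fprop \<Rightarrow> 'p fprop" (\<open>\<^bold>\<not> _\<close> [40] 40) where
  "fneg \<phi> p = (\<forall>q\<le>p. \<not> \<phi> q)"

definition fconj :: "'p::order_top fprop \<Rightarrow> 'p fprop \<Rightarrow> 'p fprop" (infixr \<open>\<^bold>\<and>\<close> 35) where
  "fconj \<phi> \<psi> p = (\<phi> p \<and> \<psi> p)"

definition fall :: "(('i, 'p::order_top) name \<Rightarrow> 'p fprop) \<Rightarrow> 'p fprop" (binder \<open>\<^bold>\<forall>\<close> 10) where
  "fall \<Phi> p = (\<forall>x. \<Phi> x p)"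

definition fdisj :: "'p::order_top fprop \<Rightarrow> 'p fprop \<Rightarrow> 'p fprop" (infixr \<open>\<^bold>\<or>\<close> 30) where
  "(\<phi> \<^bold>\<or> \<psi>) = (\<^bold>\<not> (\<^bold>\<not> \<phi> \<^bold>\<and> \<^bold>\<not> \<psi>))"

definition fimp :: "'p::order_top fprop \<Rightarrow> 'p fprop \<Rightarrow> 'p fprop" (infixr \<open>\<^bold>\<longrightarrow>\<close> 25) where
  "(\<phi> \<^bold>\<longrightarrow> \<psi>) = (\<^bold>\<not> (\<phi> \<^bold>\<and> \<^bold>\<not> \<psi>))"

definition fiff :: "'p::order_top fprop \<Rightarrow> 'p fprop \<Rightarrow> 'p fprop" (infix \<open>\<^bold>\<longleftrightarrow>\<close> 25) where
  "(\<phi> \<^bold>\<longleftrightarrow> \<psi>) = ((\<phi> \<^bold>\<longrightarrow> \<psi>) \<^bold>\<and> (\<psi> \<^bold>\<longrightarrow> \<phi>))"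

definition fex :: "(('i, 'p::order_top) name \<Rightarrow> 'p fprop) \<Rightarrow> 'p fprop" (binder \<open>\<^bold>\<exists>\<close> 10) where
  "(\<^bold>\<exists>x. \<Phi> x) = (\<^bold>\<not> (\<^bold>\<forall>x. \<^bold>\<not> \<Phi> x))"

definition forced :: "'p::order_top fprop \<Rightarrow> bool" where
  "forced \<phi> \<longleftrightarrow> (\<forall>p. \<phi> p)"


section \<open>Canonical names\<close>

text \<open>The name \<open>{(x, 1) | x \<in> X}\<close>, for \<open>X\<close> of size at most \<open>|'i|\<close>.\<close>

definition canonical :: "('i, 'p::order_top) name set \<Rightarrow> ('i, 'p) name" where
  "canonical X = (SOME x. elems x = X \<times> {top})"

definition op :: "('i, 'p::order_top) name \<Rightarrow> ('i, 'p) name \<Rightarrow> ('i, 'p) name" where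
  "op x y = canonical {canonical {x}, canonical {x, y}}"

text \<open>
  For a well-order \<open>r\<close>, \<open>check_elem r a\<close> is the check name of the von Neumann ordinal which is the
  order type of the elements below \<open>a\<close>, and \<open>check_ord r\<close> that of the order type of \<open>r\<close>.
\<close>

definition check_elem :: "'a rel \<Rightarrow> 'a \<Rightarrow> ('i, 'p::order_top) name" where
  "check_elem r = wfrec (r - Id) (\<lambda>h a. canonical (h ` underS r a))"

definition check_ord :: "'a rel \<Rightarrow> ('i, 'p::order_top) name" where
  "check_ord r = canonical (check_elem r ` Field r)"

definition omega :: "('i, 'p::order_top) name" where
  "omega = check_ord natLeq"

definition two :: "('i, 'p::order_top) name" where
  "two = check_elem natLeq 2"


section \<open>Basic set theory in the forcing language\<close>

text \<open>Classes of the forcing language are functions from names to formulas.\<close>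

type_synonym ('i, 'p) fclass = "('i, 'p) name \<Rightarrow> 'p fprop"

definition fsub :: "('i, 'p::order_top) name \<Rightarrow> ('i, 'p) name \<Rightarrow> 'p fprop" (infix \<open>\<^bold>\<subseteq>\<close> 50) where
  "(x \<^bold>\<subseteq> y) = (\<^bold>\<forall>z. z \<^bold>\<in> x \<^bold>\<longrightarrow> z \<^bold>\<in> y)"

definition is_fun :: "('i, 'p::order_top) name \<Rightarrow> ('i, 'p) name \<Rightarrow> ('i, 'p) fclass \<Rightarrow> 'p fprop" where
  "is_fun f a B =
    ((\<^bold>\<forall>z. z \<^bold>\<in> f \<^bold>\<longrightarrow> (\<^bold>\<exists>x y. x \<^bold>\<in> a \<^bold>\<and> B y \<^bold>\<and> z \<^bold>= op x y)) \<^bold>\<and>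
     (\<^bold>\<forall>x. x \<^bold>\<in> a \<^bold>\<longrightarrow> (\<^bold>\<exists>y. op x y \<^bold>\<in> f \<^bold>\<and> (\<^bold>\<forall>y'. op x y' \<^bold>\<in> f \<^bold>\<longrightarrow> y' \<^bold>= y))))"

definition is_inj :: "('i, 'p::order_top) name \<Rightarrow> ('i, 'p) name \<Rightarrow> ('i, 'p) fclass \<Rightarrow> 'p fprop" where
  "is_inj f a B =
    (is_fun f a B \<^bold>\<and> (\<^bold>\<forall>x x' y. op x y \<^bold>\<in> f \<^bold>\<and> op x' y \<^bold>\<in> f \<^bold>\<longrightarrow> x \<^bold>= x'))"

definition equinum :: "('i, 'p::order_top) name \<Rightarrow> ('i, 'p) name \<Rightarrow> 'p fprop" where
  "equinum a b =
    (\<^bold>\<exists>f. is_inj f a (\<lambda>y. y \<^bold>\<in> b) \<^bold>\<and> (\<^bold>\<forall>y. y \<^bold>\<in> b \<^bold>\<longrightarrow> (\<^bold>\<exists>x. op x y \<^bold>\<in> f)))"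

definition is_finite :: "('i, 'p::order_top) fclass" where
  "is_finite a = (\<^bold>\<exists>n. n \<^bold>\<in> omega \<^bold>\<and> equinum n a)"

definition is_trans :: "('i, 'p::order_top) fclass" where
  "is_trans x = (\<^bold>\<forall>y. y \<^bold>\<in> x \<^bold>\<longrightarrow> y \<^bold>\<subseteq> x)"

definition is_ordinal :: "('i, 'p::order_top) fclass" where
  "is_ordinal x = (is_trans x \<^bold>\<and> (\<^bold>\<forall>y. y \<^bold>\<in> x \<^bold>\<longrightarrow> is_trans y))"

definition is_cardinal :: "('i, 'p::order_top) fclass" where
  "is_cardinal k = (is_ordinal k \<^bold>\<and> (\<^bold>\<forall>a. a \<^bold>\<in> k \<^bold>\<longrightarrow> \<^bold>\<not> equinum a k))"

definition is_regular_cardinal :: "('i, 'p::order_top) fclass" where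
  "is_regular_cardinal k =
    (is_cardinal k \<^bold>\<and> omega \<^bold>\<subseteq> k \<^bold>\<and>
     (\<^bold>\<forall>a f. a \<^bold>\<in> k \<^bold>\<and> is_fun f a (\<lambda>y. y \<^bold>\<in> k) \<^bold>\<longrightarrow>
        (\<^bold>\<exists>b. b \<^bold>\<in> k \<^bold>\<and> (\<^bold>\<forall>x y. op x y \<^bold>\<in> f \<^bold>\<longrightarrow> y \<^bold>\<in> b))))"

definition is_aleph1 :: "('i, 'p::order_top) fclass" where
  "is_aleph1 k =
    (is_cardinal k \<^bold>\<and> omega \<^bold>\<in> k \<^bold>\<and> (\<^bold>\<forall>a. a \<^bold>\<in> k \<^bold>\<longrightarrow> \<^bold>\<not> (is_cardinal a \<^bold>\<and> omega \<^bold>\<in> a)))"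

definition ord_le :: "('i, 'p::order_top) name \<Rightarrow> ('i, 'p) name \<Rightarrow> 'p fprop" where
  "ord_le a b = (a \<^bold>\<in> b \<^bold>\<or> a \<^bold>= b)"

text \<open>\<open>\<kappa> = min {|F| : \<Phi> F}\<close>\<close>

definition least_size :: "('i, 'p::order_top) fclass \<Rightarrow> ('i, 'p) fclass" where
  "least_size \<Phi> k =
    (is_cardinal k \<^bold>\<and> (\<^bold>\<exists>F. \<Phi> F \<^bold>\<and> equinum F k) \<^bold>\<and>
     (\<^bold>\<forall>F a. \<Phi> F \<^bold>\<and> a \<^bold>\<in> k \<^bold>\<longrightarrow> \<^bold>\<not> equinum F a))"

definition add_eq :: "('i, 'p::order_top) fclass \<Rightarrow> ('i, 'p) fclass" where
  "add_eq I k = least_size (\<lambda>F. (\<^bold>\<forall>X. X \<^bold>\<in> F \<^bold>\<longrightarrow> I X) \<^bold>\<and>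
     (\<^bold>\<exists>U. (\<^bold>\<forall>x. x \<^bold>\<in> U \<^bold>\<longleftrightarrow> (\<^bold>\<exists>X. X \<^bold>\<in> F \<^bold>\<and> x \<^bold>\<in> X)) \<^bold>\<and> \<^bold>\<not> I U)) k"

definition cof_eq :: "('i, 'p::order_top) fclass \<Rightarrow> ('i, 'p) fclass" where
  "cof_eq I k = least_size (\<lambda>F. (\<^bold>\<forall>X. X \<^bold>\<in> F \<^bold>\<longrightarrow> I X) \<^bold>\<and>
     (\<^bold>\<forall>X. I X \<^bold>\<longrightarrow> (\<^bold>\<exists>Y. Y \<^bold>\<in> F \<^bold>\<and> X \<^bold>\<subseteq> Y))) k"


section \<open>Cantor space and its measure in the forcing language\<close>

definition is_cantor :: "('i, 'p::order_top) fclass" where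
  "is_cantor x = is_fun x omega (\<lambda>j. j \<^bold>\<in> two)"

definition agree :: "('i, 'p::order_top) name \<Rightarrow> ('i, 'p) name \<Rightarrow> ('i, 'p) name \<Rightarrow> 'p fprop" where
  "agree n x y = (\<^bold>\<forall>k. k \<^bold>\<in> n \<^bold>\<longrightarrow> (\<^bold>\<forall>j. op k j \<^bold>\<in> x \<^bold>\<longleftrightarrow> op k j \<^bold>\<in> y))"

definition is_open_class :: "('i, 'p::order_top) fclass \<Rightarrow> 'p fprop" where
  "is_open_class U =
    ((\<^bold>\<forall>x. U x \<^bold>\<longrightarrow> is_cantor x) \<^bold>\<and>
     (\<^bold>\<forall>x. U x \<^bold>\<longrightarrow> (\<^bold>\<exists>n. n \<^bold>\<in> omega \<^bold>\<and> (\<^bold>\<forall>y. is_cantor y \<^bold>\<and> agree n x y \<^bold>\<longrightarrow> U y))))"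

definition is_open :: "('i, 'p::order_top) fclass" where
  "is_open U = is_open_class (\<lambda>x. x \<^bold>\<in> U)"

definition is_clopen :: "('i, 'p::order_top) fclass" where
  "is_clopen c = (is_open c \<^bold>\<and> is_open_class (\<lambda>x. is_cantor x \<^bold>\<and> \<^bold>\<not> x \<^bold>\<in> c))"

text \<open>
  \<open>\<mu>(c) \<le> 2\<^bsup>-k\<^esup>\<close> for clopen \<open>c\<close>: if \<open>c = {x. x restricted to n is in A}\<close> with \<open>A \<subseteq> \<^bsup>n\<^esup>2\<close>, then
  \<open>\<mu>(c) = |A| / 2\<^sup>n\<close>, and \<open>|A| * 2\<^sup>k \<le> 2\<^sup>n\<close> says that \<open>A \<times> \<^bsup>k\<^esup>2\<close> can be injected into \<open>\<^bsup>n\<^esup>2\<close>.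
\<close>

definition clopen_measure_le :: "('i, 'p::order_top) name \<Rightarrow> ('i, 'p) name \<Rightarrow> 'p fprop" where
  "clopen_measure_le c k =
    (\<^bold>\<exists>n A D g. n \<^bold>\<in> omega \<^bold>\<and>
       (\<^bold>\<forall>s. s \<^bold>\<in> A \<^bold>\<longrightarrow> is_fun s n (\<lambda>j. j \<^bold>\<in> two)) \<^bold>\<and>
       (\<^bold>\<forall>x. x \<^bold>\<in> c \<^bold>\<longleftrightarrow> (is_cantor x \<^bold>\<and> (\<^bold>\<exists>s. s \<^bold>\<in> A \<^bold>\<and> s \<^bold>\<subseteq> x))) \<^bold>\<and>
       (\<^bold>\<forall>z. z \<^bold>\<in> D \<^bold>\<longleftrightarrow>
          (\<^bold>\<exists>s t. s \<^bold>\<in> A \<^bold>\<and> is_fun t k (\<lambda>j. j \<^bold>\<in> two) \<^bold>\<and> z \<^bold>= op s t)) \<^bold>\<and>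
       is_inj g D (\<lambda>u. is_fun u n (\<lambda>j. j \<^bold>\<in> two)))"

text \<open>
  Lebesgue null: for every \<open>k\<close> the set is covered by an open \<open>U\<close> with \<open>\<mu>(U) \<le> 2\<^bsup>-k\<^esup>\<close>, where
  \<open>\<mu>(U)\<close> is the supremum of the measures of the clopen subsets of \<open>U\<close>.
\<close>

definition is_null :: "('i, 'p::order_top) fclass \<Rightarrow> 'p fprop" where
  "is_null X =
    (\<^bold>\<forall>k. k \<^bold>\<in> omega \<^bold>\<longrightarrow>
      (\<^bold>\<exists>U. is_open U \<^bold>\<and> (\<^bold>\<forall>x. X x \<^bold>\<longrightarrow> x \<^bold>\<in> U) \<^bold>\<and>
         (\<^bold>\<forall>c. is_clopen c \<^bold>\<and> c \<^bold>\<subseteq> U \<^bold>\<longrightarrow> clopen_measure_le c k)))"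


section \<open>Ideals on \<open>\<omega>\<close> and the associated null ideals, in the forcing language\<close>

definition is_ideal :: "('i, 'p::order_top) fclass" where
  "is_ideal J =
    ((\<^bold>\<forall>a. a \<^bold>\<in> J \<^bold>\<longrightarrow> a \<^bold>\<subseteq> omega) \<^bold>\<and>
     (\<^bold>\<forall>a b. a \<^bold>\<in> J \<^bold>\<and> b \<^bold>\<subseteq> a \<^bold>\<longrightarrow> b \<^bold>\<in> J) \<^bold>\<and>
     (\<^bold>\<forall>a b u. a \<^bold>\<in> J \<^bold>\<and> b \<^bold>\<in> J \<^bold>\<and> (\<^bold>\<forall>n. n \<^bold>\<in> u \<^bold>\<longleftrightarrow> (n \<^bold>\<in> a \<^bold>\<or> n \<^bold>\<in> b)) \<^bold>\<longrightarrow> u \<^bold>\<in> J) \<^bold>\<and>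
     (\<^bold>\<forall>a. a \<^bold>\<subseteq> omega \<^bold>\<and> is_finite a \<^bold>\<longrightarrow> a \<^bold>\<in> J) \<^bold>\<and>
     \<^bold>\<not> omega \<^bold>\<in> J)"

definition is_maximal_ideal :: "('i, 'p::order_top) fclass" where
  "is_maximal_ideal J =
    (is_ideal J \<^bold>\<and> (\<^bold>\<forall>K. is_ideal K \<^bold>\<and> J \<^bold>\<subseteq> K \<^bold>\<longrightarrow> K \<^bold>= J))"

definition positive :: "('i, 'p::order_top) name \<Rightarrow> ('i, 'p) fclass" where
  "positive J s = (s \<^bold>\<subseteq> omega \<^bold>\<and> \<^bold>\<not> s \<^bold>\<in> J)"

definition dual :: "('i, 'p::order_top) name \<Rightarrow> ('i, 'p) fclass" where
  "dual J s = (\<^bold>\<exists>a. a \<^bold>\<in> J \<^bold>\<and> (\<^bold>\<forall>n. n \<^bold>\<in> s \<^bold>\<longleftrightarrow> (n \<^bold>\<in> omega \<^bold>\<and> \<^bold>\<not> n \<^bold>\<in> a)))"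

text \<open>\<open>in_nth x c n\<close> is \<open>x \<in> c\<^sub>n\<close>; \<open>is_hit_set s x c\<close> is \<open>s = {n. x \<in> c\<^sub>n}\<close>.\<close>

definition in_nth :: "('i, 'p::order_top) name \<Rightarrow> ('i, 'p) name \<Rightarrow> ('i, 'p) name \<Rightarrow> 'p fprop" where
  "in_nth x c n = (\<^bold>\<exists>a. op n a \<^bold>\<in> c \<^bold>\<and> x \<^bold>\<in> a)"

definition is_hit_set :: "('i, 'p::order_top) name \<Rightarrow> ('i, 'p) name \<Rightarrow> ('i, 'p) name \<Rightarrow> 'p fprop" where
  "is_hit_set s x c = (\<^bold>\<forall>n. n \<^bold>\<in> s \<^bold>\<longleftrightarrow> (n \<^bold>\<in> omega \<^bold>\<and> in_nth x c n))"

definition N_inf :: "('i, 'p::order_top) name \<Rightarrow> ('i, 'p) fclass" where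
  "N_inf c x = (is_cantor x \<^bold>\<and> (\<^bold>\<exists>s. is_hit_set s x c \<^bold>\<and> \<^bold>\<not> is_finite s))"

definition Omega_bar :: "('i, 'p::order_top) fclass" where
  "Omega_bar c = (is_fun c omega is_clopen \<^bold>\<and> is_null (N_inf c))"

definition N_pos :: "('i, 'p::order_top) name \<Rightarrow> ('i, 'p) name \<Rightarrow> ('i, 'p) fclass" where
  "N_pos J c x = (is_cantor x \<^bold>\<and> (\<^bold>\<exists>s. is_hit_set s x c \<^bold>\<and> positive J s))"

definition N_dual :: "('i, 'p::order_top) name \<Rightarrow> ('i, 'p) name \<Rightarrow> ('i, 'p) fclass" where
  "N_dual J c x = (is_cantor x \<^bold>\<and> (\<^bold>\<exists>s. is_hit_set s x c \<^bold>\<and> dual J s))"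

definition null_ideal :: "('i, 'p::order_top) name \<Rightarrow> ('i, 'p) fclass" where
  "null_ideal J X = (\<^bold>\<exists>c. Omega_bar c \<^bold>\<and> (\<^bold>\<forall>x. x \<^bold>\<in> X \<^bold>\<longrightarrow> N_pos J c x))"

definition null_ideal_star :: "('i, 'p::order_top) name \<Rightarrow> ('i, 'p) fclass" where
  "null_ideal_star J X = (\<^bold>\<exists>c. Omega_bar c \<^bold>\<and> (\<^bold>\<forall>x. x \<^bold>\<in> X \<^bold>\<longrightarrow> N_dual J c x))"

definition sub_mod :: "('i, 'p::order_top) name \<Rightarrow> ('i, 'p) name \<Rightarrow> ('i, 'p) name \<Rightarrow> 'p fprop" where
  "sub_mod J c d =
    (\<^bold>\<exists>s. s \<^bold>\<in> J \<^bold>\<and>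
      (\<^bold>\<forall>n. n \<^bold>\<in> s \<^bold>\<longleftrightarrow>
         (n \<^bold>\<in> omega \<^bold>\<and> (\<^bold>\<exists>a b. op n a \<^bold>\<in> c \<^bold>\<and> op n b \<^bold>\<in> d \<^bold>\<and> \<^bold>\<not> a \<^bold>\<subseteq> b))))"

definition b_eq :: "('i, 'p::order_top) name \<Rightarrow> ('i, 'p) fclass" where
  "b_eq J k = least_size (\<lambda>F. (\<^bold>\<forall>c. c \<^bold>\<in> F \<^bold>\<longrightarrow> Omega_bar c) \<^bold>\<and>
     \<^bold>\<not> (\<^bold>\<exists>d. Omega_bar d \<^bold>\<and> (\<^bold>\<forall>c. c \<^bold>\<in> F \<^bold>\<longrightarrow> sub_mod J c d))) k"

definition d_eq :: "('i, 'p::order_top) name \<Rightarrow> ('i, 'p) fclass" where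
  "d_eq J k = least_size (\<lambda>F. (\<^bold>\<forall>c. c \<^bold>\<in> F \<^bold>\<longrightarrow> Omega_bar c) \<^bold>\<and>
     (\<^bold>\<forall>c. Omega_bar c \<^bold>\<longrightarrow> (\<^bold>\<exists>d. d \<^bold>\<in> F \<^bold>\<and> sub_mod J c d))) k"


section \<open>Cohen forcing\<close>

text \<open>
  Finite partial functions from \<open>\<lambda> \<times> \<omega>\<close> to \<open>2\<close>, ordered by reverse inclusion;
  \<open>\<lambda>\<close> is the cardinality of the type \<open>'l\<close>.
\<close>

typedef 'l cohen = "{p :: 'l \<times> nat \<Rightarrow> bool option. finite (dom p)}"
  by (rule exI[of _ Map.empty]) simp

instantiation cohen :: (type) order_top
begin

definition less_eq_cohen :: "'a cohen \<Rightarrow> 'a cohen \<Rightarrow> bool" where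
  "p \<le> q \<longleftrightarrow> Rep_cohen q \<subseteq>\<^sub>m Rep_cohen p"

definition less_cohen :: "'a cohen \<Rightarrow> 'a cohen \<Rightarrow> bool" where
  "(p :: 'a cohen) < q \<longleftrightarrow> p \<le> q \<and> p \<noteq> q"

definition top_cohen :: "'a cohen" where
  "top_cohen = Abs_cohen Map.empty"

instance
proof
  fix p q r :: "'a cohen"
  show anti: "p = q" if "p \<le> q" "q \<le> p"
    using that map_le_antisym Rep_cohen_inject unfolding less_eq_cohen_def by blast
  show "p < q \<longleftrightarrow> p \<le> q \<and> \<not> q \<le> p"
    using map_le_antisym Rep_cohen_inject unfolding less_eq_cohen_def less_cohen_def
    by (metis map_le_refl)
  show "p \<le> p" by (simp add: less_eq_cohen_def)
  show "p \<le> r" if "p \<le> q" "q \<le> r"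
    using that map_le_trans unfolding less_eq_cohen_def by blast
  show "p \<le> top"
    by (simp add: less_eq_cohen_def top_cohen_def Abs_cohen_inverse)
qed

end

end

theory Submission
  imports Defs Complex_Main "HOL-Library.Sublist" "HOL-Library.Nat_Bijection"
begin

text \<open>
  A countable set of ground model indices suffices to evaluate the name of a sequence of clopen
  sets. A Cohen real codes a sequence \<open>c\<close> of clopen sets with summable measures, and by genericity
  \<open>c\<^sub>n\<close> covers \<open>d\<^sub>n\<close> for infinitely many \<open>n\<close>, even for infinitely many \<open>n\<close> in any given infinite set,
  whenever the measures of the \<open>d\<^sub>n\<close> tend to \<open>0\<close> and \<open>d\<close> does not depend on that Cohen real. Members
  of \<open>\<Omega>\<close>-bar have measures tending to \<open>0\<close>.

  In the extension, \<open>\<kappa>\<close> is the check name of a set \<open>K\<close> of ordinals. Let \<open>c\<^sup>\<beta>\<close> be the sequence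
  coded by the Cohen real with index \<open>\<beta> \<in> K\<close>. The sets \<open>{n. d\<^sub>n \<subseteq> c\<^sup>\<beta>\<^sub>n}\<close>, where \<open>\<beta> \<in> K\<close> and \<open>d\<close> only
  depends on Cohen reals whose index is not in \<open>K\<close> or is below \<open>\<beta>\<close>, have the strong finite
  intersection property; the maximal ideal is the dual of an ultrafilter containing all of them.
  As \<open>\<kappa>\<close> has uncountable cofinality, the \<open>c\<^sup>\<beta>\<close> are increasing and cofinal in \<open>\<Omega>\<close>-bar and so are the
  sets they generate in the null ideals. The chain is strict: a real avoiding all \<open>c\<^sup>\<alpha>\<^sub>n\<close>, computed
  from the Cohen real with index \<open>\<alpha>\<close>, lies in the null set of \<open>c\<^sup>\<beta>\<close> for every larger \<open>\<beta>\<close>. A directed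
  order with a strictly increasing cofinal chain of regular length \<open>\<kappa>\<close> has both its bounding and its
  dominating number equal to \<open>\<kappa>\<close>.
\<close>

section \<open>The forcing relation as a classical logic\<close>

text \<open>Membership in \<open>Omega_bar\<close> is used through two one-sided measure conditions:
  \<open>tail\<close> implies it and holds for the coded sequences; \<open>vanishing\<close> follows
  from it and is all that domination needs, because a fresh entry of a Cohen real can cover finitely
  many sets of small measure at one late index. The costly direction is that a null limes superior
  gives \<open>vanishing\<close>: it needs a point of the extension outside a given small open set.
  With no generic over the universe, such points must be functions of g with the Baire property, so
  branches are taken leftmost and minima replace choices. Maximality of the ideal identifies
  positive with dual sets, so the two null ideals coincide and only two directed orders remain. In
  the extension \<kappa> is just a name; it is identified with a ground model set K only below some
  condition, and the ideal may depend on that condition. That countable subsets of K are bounded is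
  read off from the forced regularity of \<kappa> rather than from cardinal arithmetic in the ground
  model.\<close>

text \<open>
  The predicates obtained from formulas of the forcing language are regular open sets of conditions.
\<close>

definition reg :: "'p::order_top fprop \<Rightarrow> bool" where
  "reg \<phi> \<longleftrightarrow> (\<forall>p. \<phi> p \<longleftrightarrow> (\<forall>q\<le>p. \<exists>r\<le>q. \<phi> r))"

lemma reg_mono: "reg \<phi> \<Longrightarrow> \<phi> p \<Longrightarrow> q \<le> p \<Longrightarrow> \<phi> q"
  unfolding reg_def by (meson order_trans)

lemma reg_dense: "reg \<phi> \<Longrightarrow> (\<And>q. q \<le> p \<Longrightarrow> \<exists>r\<le>q. \<phi> r) \<Longrightarrow> \<phi> p"
  unfolding reg_def by blast

lemma regI:
  assumes "\<And>p q. \<phi> p \<Longrightarrow> q \<le> p \<Longrightarrow> \<phi> q"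
    and "\<And>p. (\<And>q. q \<le> p \<Longrightarrow> \<exists>r\<le>q. \<phi> r) \<Longrightarrow> \<phi> p"
  shows "reg \<phi>"
  unfolding reg_def using assms by blast

lemma feq_iff:
  "(x \<^bold>= y) p \<longleftrightarrow>
    (\<forall>x' s q. (x', s) \<in> elems x \<longrightarrow> q \<le> p \<longrightarrow> q \<le> s \<longrightarrow>
        (\<exists>r\<le>q. \<exists>y' t. (y', t) \<in> elems y \<and> r \<le> t \<and> (x' \<^bold>= y') r)) \<and>
    (\<forall>y' t q. (y', t) \<in> elems y \<longrightarrow> q \<le> p \<longrightarrow> q \<le> t \<longrightarrow>
        (\<exists>r\<le>q. \<exists>x' s. (x', s) \<in> elems x \<and> r \<le> s \<and> (x' \<^bold>= y') r))"
  by (subst feq.simps) (simp add: split_beta Ball_def Bex_def imp_conjL)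

lemma reg_feq [simp]: "reg (x \<^bold>= y)"
proof (rule regI)
  fix p q assume "(x \<^bold>= y) p" "q \<le> p"
  then show "(x \<^bold>= y) q"
    by (subst (asm) feq_iff, subst feq_iff) (meson order_trans)
next
  fix p assume *: "\<And>q. q \<le> p \<Longrightarrow> \<exists>r\<le>q. (x \<^bold>= y) r"
  show "(x \<^bold>= y) p"
  proof (subst feq_iff, intro conjI allI impI)
    fix x' s q assume a: "(x', s) \<in> elems x" "q \<le> p" "q \<le> s"
    obtain r where r: "r \<le> q" "(x \<^bold>= y) r" using * a by blast
    have "\<exists>r'\<le>r. \<exists>y' t. (y', t) \<in> elems y \<and> r' \<le> t \<and> (x' \<^bold>= y') r'"
      using r a by (subst (asm) feq_iff) (meson order_trans order_refl)
    then show "\<exists>r\<le>q. \<exists>y' t. (y', t) \<in> elems y \<and> r \<le> t \<and> (x' \<^bold>= y') r"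
      using r order_trans by blast
  next
    fix y' t q assume a: "(y', t) \<in> elems y" "q \<le> p" "q \<le> t"
    obtain r where r: "r \<le> q" "(x \<^bold>= y) r" using * a by blast
    have "\<exists>r'\<le>r. \<exists>x' t. (x', t) \<in> elems x \<and> r' \<le> t \<and> (x' \<^bold>= y') r'"
      using r a by (subst (asm) feq_iff) (meson order_trans order_refl)
    then show "\<exists>r\<le>q. \<exists>x' t. (x', t) \<in> elems x \<and> r \<le> t \<and> (x' \<^bold>= y') r"
      using r order_trans by blast
  qed
qed

text \<open>Closing under "densely below" produces a regular set whatever \<psi> is, so predicates
  defined by density need no property of their matrix; membership here and \<open>ult\<close> later
  have this shape.\<close>

lemma reg_closure [simp]: "reg (\<lambda>p. \<forall>q\<le>p. \<exists>r\<le>q. \<psi> r)"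
  by (rule regI) (meson order_trans order_refl)+

lemma reg_fmem [simp]: "reg (x \<^bold>\<in> y)"
proof -
  have "(x \<^bold>\<in> y) = (\<lambda>p. \<forall>q\<le>p. \<exists>r\<le>q. \<exists>(y', t)\<in>elems y. r \<le> t \<and> (x \<^bold>= y') r)"
    by (rule ext) (simp add: fmem_def)
  then show ?thesis by simp
qed

lemma reg_fneg [simp]: "reg \<phi> \<Longrightarrow> reg (\<^bold>\<not> \<phi>)"
  unfolding reg_def fneg_def by (meson order_trans order_refl)

lemma reg_fconj [simp]: assumes "reg \<phi>" "reg \<psi>" shows "reg (\<phi> \<^bold>\<and> \<psi>)"
proof (rule regI)
  show "(\<phi> \<^bold>\<and> \<psi>) q" if "(\<phi> \<^bold>\<and> \<psi>) p" "q \<le> p" for p q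
    using that assms reg_mono unfolding fconj_def by blast
  show "(\<phi> \<^bold>\<and> \<psi>) p" if "\<And>q. q \<le> p \<Longrightarrow> \<exists>r\<le>q. (\<phi> \<^bold>\<and> \<psi>) r" for p
    using that reg_dense[OF assms(1), of p] reg_dense[OF assms(2), of p] unfolding fconj_def by blast
qed

lemma reg_fall [simp]: assumes "\<And>x. reg (\<Phi> x)" shows "reg (fall \<Phi>)"
proof (rule regI)
  show "fall \<Phi> q" if "fall \<Phi> p" "q \<le> p" for p q
    using that assms reg_mono unfolding fall_def by blast
  show "fall \<Phi> p" if "\<And>q. q \<le> p \<Longrightarrow> \<exists>r\<le>q. fall \<Phi> r" for p
    using that reg_dense[OF assms, of p] unfolding fall_def by blast
qed

lemma reg_fdisj [simp]: "reg \<phi> \<Longrightarrow> reg \<psi> \<Longrightarrow> reg (\<phi> \<^bold>\<or> \<psi>)"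
  by (simp add: fdisj_def)

lemma reg_fimp [simp]: "reg \<phi> \<Longrightarrow> reg \<psi> \<Longrightarrow> reg (\<phi> \<^bold>\<longrightarrow> \<psi>)"
  by (simp add: fimp_def)

lemma reg_fiff [simp]: "reg \<phi> \<Longrightarrow> reg \<psi> \<Longrightarrow> reg (\<phi> \<^bold>\<longleftrightarrow> \<psi>)"
  by (simp add: fiff_def)

lemma reg_fex [simp]: "reg (fex \<Phi>)"
  unfolding reg_def fex_def fneg_def fall_def by (meson order_trans order_refl)

lemma fimp_iff: "reg \<phi> \<Longrightarrow> reg \<psi> \<Longrightarrow> (\<phi> \<^bold>\<longrightarrow> \<psi>) p \<longleftrightarrow> (\<forall>q\<le>p. \<phi> q \<longrightarrow> \<psi> q)"
  unfolding fimp_def fneg_def fconj_def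
  using reg_mono[of \<phi>] reg_dense[of \<psi>] by (metis order_trans order_refl)

lemma fiff_iff: "reg \<phi> \<Longrightarrow> reg \<psi> \<Longrightarrow> (\<phi> \<^bold>\<longleftrightarrow> \<psi>) p \<longleftrightarrow> (\<forall>q\<le>p. \<phi> q \<longleftrightarrow> \<psi> q)"
  by (auto simp: fiff_def fconj_def fimp_iff)

lemma fex_iff: "fex \<Phi> p \<longleftrightarrow> (\<forall>q\<le>p. \<exists>r\<le>q. \<exists>x. \<Phi> x r)"
  unfolding fex_def fall_def fneg_def by blast

lemma fdisj_iff: "(\<phi> \<^bold>\<or> \<psi>) p \<longleftrightarrow> (\<forall>q\<le>p. \<exists>r\<le>q. \<phi> r \<or> \<psi> r)"
  unfolding fdisj_def fconj_def fneg_def by blast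

lemmas fbasic = fall_def fconj_def fneg_def

lemma fimpI: "(\<And>q. q \<le> p \<Longrightarrow> \<phi> q \<Longrightarrow> \<psi> q) \<Longrightarrow> (\<phi> \<^bold>\<longrightarrow> \<psi>) p"
  unfolding fimp_def fneg_def fconj_def by blast

lemma fimpD: "(\<phi> \<^bold>\<longrightarrow> \<psi>) p \<Longrightarrow> reg \<phi> \<Longrightarrow> reg \<psi> \<Longrightarrow> q \<le> p \<Longrightarrow> \<phi> q \<Longrightarrow> \<psi> q"
  by (simp add: fimp_iff)

lemma fexI: "\<Phi> x p \<Longrightarrow> reg (\<Phi> x) \<Longrightarrow> fex \<Phi> p"
  unfolding fex_iff using reg_mono[of "\<Phi> x"] by blast

text \<open>Witnesses exist only densely below p and are not glued to a single name at p itself;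
  hence the goal has to be regular.\<close>

lemma fexE: "fex \<Phi> p \<Longrightarrow> reg \<psi> \<Longrightarrow> (\<And>r x. r \<le> p \<Longrightarrow> \<Phi> x r \<Longrightarrow> \<psi> r) \<Longrightarrow> \<psi> p"
  unfolding fex_iff using reg_dense[of \<psi> p] by (meson order_trans)

lemma reg_decide: "reg \<phi> \<Longrightarrow> \<exists>q\<le>p. \<phi> q \<or> (\<^bold>\<not> \<phi>) q"
  unfolding fneg_def by blast

lemma reg_contr: "reg \<phi> \<Longrightarrow> (\<And>q. q \<le> p \<Longrightarrow> (\<^bold>\<not> \<phi>) q \<Longrightarrow> False) \<Longrightarrow> \<phi> p"
  unfolding fneg_def using reg_dense[of \<phi> p] by blast

subsection \<open>Equality\<close>

lemma wf_elems_rel: "wfP (\<lambda>y x :: ('i, 'p) name. \<exists>s. (y, s) \<in> elems x)"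
  using wf_elems by (simp add: wfp_def)

lemma name_induct: "(\<And>x. (\<And>y s. (y, s) \<in> elems x \<Longrightarrow> P y) \<Longrightarrow> P x) \<Longrightarrow> P x"
  by (rule wfp_induct[OF wf_elems_rel]) blast

lemma feq_refl [simp]: "(x \<^bold>= x) p"
proof (induction x arbitrary: p rule: name_induct)
  case (1 x)
  show ?case by (subst feq_iff) (use 1 order_refl in blast)
qed

lemma feq_sym: "(x \<^bold>= y) p \<Longrightarrow> (y \<^bold>= x) p"
proof (induction x arbitrary: y p rule: name_induct)
  case (1 x)
  have "(y' \<^bold>= x') r" if "(x', s) \<in> elems x" "(x' \<^bold>= y') r" for x' y' s r using 1 that by blast
  with \<open>(x \<^bold>= y) p\<close> show ?case
    by (subst (asm) feq_iff, subst feq_iff) meson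
qed

lemma feq_elem1:
  "(x \<^bold>= y) p \<Longrightarrow> (x', s) \<in> elems x \<Longrightarrow> q \<le> p \<Longrightarrow> q \<le> s \<Longrightarrow>
    \<exists>r\<le>q. \<exists>y' t. (y', t) \<in> elems y \<and> r \<le> t \<and> (x' \<^bold>= y') r"
  by (subst (asm) feq_iff) blast

text \<open>Induction on x alone suffices: in the second half the element of x is found last, and
  the induction hypothesis is applied to it after reversing both equalities.\<close>

lemma feq_trans: "(x \<^bold>= y) p \<Longrightarrow> (y \<^bold>= z) p \<Longrightarrow> (x \<^bold>= z) p"
proof (induction x arbitrary: y z p rule: name_induct)
  case (1 x)
  have *: "\<exists>r\<le>q. \<exists>z' t. (z', t) \<in> elems z \<and> r \<le> t \<and> (x' \<^bold>= z') r"
    if a: "(x', s) \<in> elems x" "q \<le> p" "q \<le> s" for x' s q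
  proof -
    obtain r y' t where r: "r \<le> q" "(y', t) \<in> elems y" "r \<le> t" "(x' \<^bold>= y') r"
      using feq_elem1[OF 1(2) a] by blast
    obtain r' z' u where r': "r' \<le> r" "(z', u) \<in> elems z" "r' \<le> u" "(y' \<^bold>= z') r'"
      using feq_elem1[OF 1(3) r(2) _ r(3)] a r by (meson order_trans)
    have "(x' \<^bold>= z') r'"
      using 1(1)[OF a(1) _ r'(4), of ] r(4) r'(1) reg_mono reg_feq by blast
    then show ?thesis using r r' order_trans by blast
  qed
  have **: "\<exists>r\<le>q. \<exists>x' t. (x', t) \<in> elems x \<and> r \<le> t \<and> (x' \<^bold>= z') r"
    if a: "(z', s) \<in> elems z" "q \<le> p" "q \<le> s" for z' s q
  proof -
    obtain r y' t where r: "r \<le> q" "(y', t) \<in> elems y" "r \<le> t" "(z' \<^bold>= y') r"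
      using feq_elem1[OF feq_sym[OF 1(3)] a] by blast
    obtain r' x' u where r': "r' \<le> r" "(x', u) \<in> elems x" "r' \<le> u" "(y' \<^bold>= x') r'"
      using feq_elem1[OF feq_sym[OF 1(2)] r(2) _ r(3)] a r by (meson order_trans)
    have "(x' \<^bold>= z') r'"
      using 1(1)[OF r'(2)] feq_sym[OF r'(4)] feq_sym[OF reg_mono[OF reg_feq r(4) r'(1)]] by blast
    then show ?thesis using r r' order_trans by blast
  qed
  show ?case by (subst feq_iff) (use * ** in blast)
qed

lemma fmem_iff: "(x \<^bold>\<in> y) p \<longleftrightarrow> (\<forall>q\<le>p. \<exists>r\<le>q. \<exists>y' t. (y', t) \<in> elems y \<and> r \<le> t \<and> (x \<^bold>= y') r)"
  unfolding fmem_def by (simp add: split_beta Bex_def)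

lemma fmem_cong1: "(x \<^bold>= y) p \<Longrightarrow> (x \<^bold>\<in> z) p \<Longrightarrow> (y \<^bold>\<in> z) p"
  unfolding fmem_iff by (meson feq_trans feq_sym reg_mono[OF reg_feq] order_trans)

lemma fmem_elem: "(y, t) \<in> elems x \<Longrightarrow> p \<le> t \<Longrightarrow> (y \<^bold>\<in> x) p"
  unfolding fmem_iff by (meson order_trans order_refl feq_refl)

lemma fmem_cong2: assumes "(x \<^bold>= y) p" "(z \<^bold>\<in> x) p" shows "(z \<^bold>\<in> y) p"
proof (rule reg_dense[OF reg_fmem])
  fix q assume q: "q \<le> p"
  obtain r x' t where r: "r \<le> q" "(x', t) \<in> elems x" "r \<le> t" "(z \<^bold>= x') r"
    using assms(2) q unfolding fmem_iff by blast
  obtain r' y' u where "r' \<le> r" "(y', u) \<in> elems y" "r' \<le> u" "(x' \<^bold>= y') r'"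
    using feq_elem1[OF assms(1) r(2) _ r(3)] q r by (meson order_trans)
  then show "\<exists>r\<le>q. (z \<^bold>\<in> y) r"
    using r by (meson fmem_elem fmem_cong1 feq_sym feq_trans reg_mono[OF reg_feq] order_trans)
qed

lemma feqI:
  assumes "\<And>q z. q \<le> p \<Longrightarrow> (z \<^bold>\<in> x) q \<Longrightarrow> (z \<^bold>\<in> y) q"
    and "\<And>q z. q \<le> p \<Longrightarrow> (z \<^bold>\<in> y) q \<Longrightarrow> (z \<^bold>\<in> x) q"
  shows "(x \<^bold>= y) p"
proof (subst feq_iff, intro conjI allI impI)
  fix x' s q assume a: "(x', s) \<in> elems x" "q \<le> p" "q \<le> s"
  then have "(x' \<^bold>\<in> y) q" using assms fmem_elem by blast
  then show "\<exists>r\<le>q. \<exists>y' t. (y', t) \<in> elems y \<and> r \<le> t \<and> (x' \<^bold>= y') r" unfolding fmem_iff by blast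
next
  fix x' s q assume a: "(x', s) \<in> elems y" "q \<le> p" "q \<le> s"
  then have "(x' \<^bold>\<in> x) q" using assms fmem_elem by blast
  then have "\<exists>r\<le>q. \<exists>y' t. (y', t) \<in> elems x \<and> r \<le> t \<and> (x' \<^bold>= y') r" unfolding fmem_iff by blast
  then show "\<exists>r\<le>q. \<exists>y' t. (y', t) \<in> elems x \<and> r \<le> t \<and> (y' \<^bold>= x') r" using feq_sym by meson
qed

lemma feq_mono: "(x \<^bold>= y) p \<Longrightarrow> q \<le> p \<Longrightarrow> (x \<^bold>= y) q"
  by (rule reg_mono[OF reg_feq])

lemma fmem_mono: "(x \<^bold>\<in> y) p \<Longrightarrow> q \<le> p \<Longrightarrow> (x \<^bold>\<in> y) q"
  by (rule reg_mono[OF reg_fmem])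

lemma fmem_irrefl: "\<not> (x \<^bold>\<in> x) p"
proof (induction x arbitrary: p rule: name_induct)
  case (1 x)
  show ?case
  proof
    assume a: "(x \<^bold>\<in> x) p"
    then obtain r y t where r: "r \<le> p" "(y, t) \<in> elems x" "r \<le> t" "(x \<^bold>= y) r"
      unfolding fmem_iff by blast
    have "(y \<^bold>\<in> x) r" using r fmem_elem by blast
    then have "(y \<^bold>\<in> y) r" using r fmem_cong2 by blast
    then show False using 1 r by blast
  qed
qed

lemma fsub_iff: "(x \<^bold>\<subseteq> y) p \<longleftrightarrow> (\<forall>q\<le>p. \<forall>z. (z \<^bold>\<in> x) q \<longrightarrow> (z \<^bold>\<in> y) q)"
  unfolding fsub_def by (auto simp: fall_def fimp_iff)

lemma reg_fsub [simp]: "reg (x \<^bold>\<subseteq> y)"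
  unfolding fsub_def by simp

subsection \<open>Classes respecting equality\<close>

text \<open>Classes are arbitrary functions on names, so invariance under forced equality is not
  automatic; it is recovered along the structure of a formula by \<open>good_intros\<close>.\<close>

definition good :: "(('i, 'p::order_top) name \<Rightarrow> 'p fprop) \<Rightarrow> bool" where
  "good \<Phi> \<longleftrightarrow> (\<forall>x. reg (\<Phi> x)) \<and> (\<forall>x y p. (x \<^bold>= y) p \<longrightarrow> \<Phi> x p \<longrightarrow> \<Phi> y p)"

definition cong :: "(('i, 'p::order_top) name \<Rightarrow> ('i, 'p) name) \<Rightarrow> bool" where
  "cong f \<longleftrightarrow> (\<forall>x y p. (x \<^bold>= y) p \<longrightarrow> (f x \<^bold>= f y) p)"

named_theorems good_intros

lemma good_reg: "good \<Phi> \<Longrightarrow> reg (\<Phi> x)"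
  by (simp add: good_def)

lemma good_cong: "good \<Phi> \<Longrightarrow> (x \<^bold>= y) p \<Longrightarrow> \<Phi> x p \<Longrightarrow> \<Phi> y p"
  unfolding good_def by blast

lemma cong_id [good_intros]: "cong (\<lambda>x. x)" by (simp add: cong_def)
lemma cong_const [good_intros]: "cong (\<lambda>x. c)" by (simp add: cong_def)

lemma good_const: "reg \<phi> \<Longrightarrow> good (\<lambda>x. \<phi>)"
  by (simp add: good_def)

lemma good_feq [good_intros]: "cong f \<Longrightarrow> cong h \<Longrightarrow> good (\<lambda>x. f x \<^bold>= h x)"
  unfolding good_def cong_def by simp (metis feq_trans feq_sym)

lemma good_fmem [good_intros]: "cong f \<Longrightarrow> cong h \<Longrightarrow> good (\<lambda>x. f x \<^bold>\<in> h x)"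
  unfolding good_def cong_def by simp (metis fmem_cong1 fmem_cong2)

lemma good_fneg [good_intros]: "good \<Phi> \<Longrightarrow> good (\<lambda>x. \<^bold>\<not> \<Phi> x)"
  unfolding good_def by simp (metis fneg_def feq_sym feq_mono)

lemma good_fconj [good_intros]: "good \<Phi> \<Longrightarrow> good \<Psi> \<Longrightarrow> good (\<lambda>x. \<Phi> x \<^bold>\<and> \<Psi> x)"
  unfolding good_def by (auto simp: fconj_def)

lemma good_fall [good_intros]: "(\<And>y. good (\<lambda>x. \<Phi> x y)) \<Longrightarrow> good (\<lambda>x. fall (\<Phi> x))"
  unfolding good_def by (simp add: fall_def)

lemma good_fdisj [good_intros]: "good \<Phi> \<Longrightarrow> good \<Psi> \<Longrightarrow> good (\<lambda>x. \<Phi> x \<^bold>\<or> \<Psi> x)"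
  unfolding fdisj_def by (intro good_intros)

lemma good_fimp [good_intros]: "good \<Phi> \<Longrightarrow> good \<Psi> \<Longrightarrow> good (\<lambda>x. \<Phi> x \<^bold>\<longrightarrow> \<Psi> x)"
  unfolding fimp_def by (intro good_intros)

lemma good_fiff [good_intros]: "good \<Phi> \<Longrightarrow> good \<Psi> \<Longrightarrow> good (\<lambda>x. \<Phi> x \<^bold>\<longleftrightarrow> \<Psi> x)"
  unfolding fiff_def by (intro good_intros)

lemma good_fex [good_intros]: "(\<And>y. good (\<lambda>x. \<Phi> x y)) \<Longrightarrow> good (\<lambda>x. fex (\<Phi> x))"
  unfolding fex_def by (intro good_intros)

lemma good_fsub [good_intros]: "cong f \<Longrightarrow> cong h \<Longrightarrow> good (\<lambda>x. f x \<^bold>\<subseteq> h x)"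
  unfolding fsub_def by (intro good_intros)

section \<open>Constructing names\<close>

unbundle cardinal_syntax

text \<open>The choice is meaningful only if E has at most |'i| elements (\<open>elems_mk\<close>);
  otherwise the value is arbitrary, which is why smallness is carried along.\<close>

definition mk :: "(('i, 'p::order_top) name \<times> 'p) set \<Rightarrow> ('i, 'p) name" where
  "mk E = (SOME x. elems x = E)"

lemma canonical_eq_mk: "canonical X = mk (X \<times> {top})"
  by (simp add: canonical_def mk_def)

lemma elems_mk:
  fixes E :: "(('i, 'p::order_top) name \<times> 'p) set"
  assumes "|E| \<le>o |UNIV :: 'i set|"
  shows "elems (mk E) = E"
proof -
  have "\<exists>x :: ('i, 'p) name. elems x = E"
  proof (cases "E = {}")
    case True
    then have "elems (Name (\<lambda>_. None)) = E" by simp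
    then show ?thesis by blast
  next
    case False
    then obtain g :: "'i \<Rightarrow> _" where "range g = E"
      using assms card_of_ordLeq2[OF False, of "UNIV :: 'i set"] by blast
    then have "elems (Name (\<lambda>i. Some (g i))) = E" by (auto simp: ran_def) (metis rangeI)
    then show ?thesis by blast
  qed
  then show ?thesis unfolding mk_def by (rule someI_ex)
qed

text \<open>
  The parameter \<open>U\<close> only serves to fix the type \<open>'i\<close> throughout the locale.
\<close>

locale index =
  fixes U :: "'i set"
  assumes U_UNIV: "U = UNIV" and infinite_index: "infinite U"
begin

abbreviation small :: "'a set \<Rightarrow> bool" where "small X \<equiv> |X| \<le>o |U|"

lemma small_image: "small X \<Longrightarrow> small (f ` X)"
  using card_of_image ordLeq_transitive by blast

lemma small_subset: "small X \<Longrightarrow> Y \<subseteq> X \<Longrightarrow> small Y"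
  using card_of_mono1 ordLeq_transitive by blast

lemma small_nat: "small (X :: nat set)"
  by (rule small_subset[OF _ subset_UNIV]) (simp add: infinite_index infinite_iff_card_of_nat[symmetric])

lemma small_countable: "countable X \<Longrightarrow> small X"
  using small_image[OF small_nat, of "from_nat_into X" UNIV] small_subset[of _ X]
    subset_range_from_nat_into[of X] by blast

lemma small_finite: "finite X \<Longrightarrow> small X"
  by (rule small_countable[OF countable_finite])

lemma small_Times: "small X \<Longrightarrow> small Y \<Longrightarrow> small (X \<times> Y)"
  using infinite_index by (intro card_of_Sigma_ordLeq_infinite) auto

lemma small_UN: "small I \<Longrightarrow> (\<And>i. i \<in> I \<Longrightarrow> small (F i)) \<Longrightarrow> small (\<Union>i\<in>I. F i)"
  using infinite_index card_of_UNION_ordLeq_infinite[of U I F] by blast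

lemma small_range: "inj (f :: 'b \<Rightarrow> 'i) \<Longrightarrow> small (X :: 'b set)"
  unfolding U_UNIV by (meson card_of_ordLeqI inj_on_subset subset_UNIV UNIV_I)

lemma small_elems: "small (elems (x :: ('i, 'p) name))"
proof -
  obtain F where F: "x = Name F" by (cases x)
  have "elems x \<subseteq> (\<lambda>i. the (F i)) ` UNIV" unfolding F by (auto simp: ran_def) (metis option.sel rangeI)
  then show ?thesis unfolding U_UNIV using card_of_image card_of_mono1 ordLeq_transitive by blast
qed

lemma fmem_mk:
  fixes E :: "(('i, 'p::order_top) name \<times> 'p) set"
  assumes "|E| \<le>o |U|"
  shows "(x \<^bold>\<in> mk E) p \<longleftrightarrow> (\<forall>q\<le>p. \<exists>r\<le>q. \<exists>y t. (y, t) \<in> E \<and> r \<le> t \<and> (x \<^bold>= y) r)"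
  by (simp add: fmem_iff elems_mk[OF assms[unfolded U_UNIV]])

lemma fmem_canonical:
  assumes "small X"
  shows "((x :: ('i, 'p::order_top) name) \<^bold>\<in> canonical X) p \<longleftrightarrow> (\<forall>q\<le>p. \<exists>r\<le>q. \<exists>y\<in>X. (x \<^bold>= y) r)"
proof -
  have "small (X \<times> {top :: 'p})" by (rule small_Times[OF assms small_finite]) simp
  then show ?thesis unfolding canonical_eq_mk by (simp add: fmem_mk Bex_def)
qed

lemma fmem_canonicalI: "small X \<Longrightarrow> x \<in> X \<Longrightarrow> ((x :: ('i, 'p::order_top) name) \<^bold>\<in> canonical X) p"
  by (simp add: fmem_canonical) (meson order_refl feq_refl)

text \<open>Densely below any condition an element of the name equals a listed one, whose instance
  is forced at p already; goodness transports the instance and regularity glues. Quantifiers over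
  omega and over natural numbers become ground model quantifiers this way.\<close>

lemma fall_canonical:
  assumes "small X" "good (\<Phi> :: ('i, 'p::order_top) fclass)"
  shows "(\<forall>q\<le>p. \<forall>x. (x \<^bold>\<in> canonical X) q \<longrightarrow> \<Phi> x q) \<longleftrightarrow> (\<forall>x\<in>X. \<Phi> x p)"
proof safe
  fix x assume "\<forall>q\<le>p. \<forall>x. (x \<^bold>\<in> canonical X) q \<longrightarrow> \<Phi> x q" "x \<in> X"
  then show "\<Phi> x p" using fmem_canonicalI[OF assms(1)] by blast
next
  fix q x assume a: "\<forall>x\<in>X. \<Phi> x p" "q \<le> p" "(x \<^bold>\<in> canonical X) q"
  show "\<Phi> x q"
  proof (rule reg_dense[OF good_reg[OF assms(2)]])
    fix q' assume "q' \<le> q"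
    then obtain r y where "r \<le> q'" "y \<in> X" "(x \<^bold>= y) r"
      using a(3) unfolding fmem_canonical[OF assms(1)] by blast
    moreover have "\<Phi> y r"
      by (rule reg_mono[OF good_reg[OF assms(2)], of y p]) (use a calculation \<open>q' \<le> q\<close> in auto)
    ultimately show "\<exists>r\<le>q'. \<Phi> x r" using good_cong[OF assms(2)] feq_sym by blast
  qed
qed

lemma fmem_canonicalE:
  assumes "((x :: ('i, 'p::order_top) name) \<^bold>\<in> canonical X) p" "small X"
  obtains r y where "r \<le> p" "y \<in> X" "(x \<^bold>= y) r"
  using assms by (auto simp: fmem_canonical)

lemma canonical_single: "((x :: ('i, 'p::order_top) name) \<^bold>\<in> canonical {y}) p \<longleftrightarrow> (x \<^bold>= y) p"
  by (simp add: fmem_canonical small_finite) (meson reg_dense[OF reg_feq] feq_mono order_refl)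

lemma canonical_pair:
  "((x :: ('i, 'p::order_top) name) \<^bold>\<in> canonical {y, z}) p \<longleftrightarrow> (\<forall>q\<le>p. \<exists>r\<le>q. (x \<^bold>= y) r \<or> (x \<^bold>= z) r)"
  by (auto simp: fmem_canonical small_finite)

lemma canonical_cong:
  assumes "small X" "small Y" "\<And>x. x \<in> X \<Longrightarrow> \<exists>y\<in>Y. (x \<^bold>= y) p" "\<And>y. y \<in> Y \<Longrightarrow> \<exists>x\<in>X. (x \<^bold>= y) p"
  shows "(canonical X \<^bold>= (canonical Y :: ('i, 'p::order_top) name)) p"
proof (rule feqI)
  fix q z assume a: "q \<le> p" "(z \<^bold>\<in> canonical X) q"
  then show "(z \<^bold>\<in> canonical Y) q"
    unfolding fmem_canonical[OF assms(1)] fmem_canonical[OF assms(2)]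
    by (meson assms(3) feq_trans feq_mono order_trans)
next
  fix q z assume a: "q \<le> p" "(z \<^bold>\<in> canonical Y) q"
  then show "(z \<^bold>\<in> canonical X) q"
    unfolding fmem_canonical[OF assms(1)] fmem_canonical[OF assms(2)]
    by (meson assms(4) feq_trans feq_sym feq_mono order_trans)
qed

subsection \<open>Ordered pairs\<close>

lemma op_cong:
  assumes "(x \<^bold>= x') p" "(y \<^bold>= y') p"
  shows "(op x y \<^bold>= (op x' y' :: ('i, 'p::order_top) name)) p"
proof -
  have 1: "(canonical {x} \<^bold>= canonical {x'}) p" by (rule canonical_cong) (auto simp: small_finite assms)
  have 2: "(canonical {x, y} \<^bold>= canonical {x', y'}) p" by (rule canonical_cong) (auto simp: small_finite assms)
  show ?thesis unfolding op_def by (rule canonical_cong) (auto simp: small_finite 1 2)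
qed

lemma op_snd_aux:
  assumes "(op x y \<^bold>= (op a b :: ('i, 'p::order_top) name)) p"
  shows "(y \<^bold>\<in> canonical {a, b}) p"
proof (rule reg_dense[OF reg_fmem])
  fix q assume q: "q \<le> p"
  have "(canonical {x, y} \<^bold>\<in> op x y) q" unfolding op_def by (rule fmem_canonicalI) (auto simp: small_finite)
  then have "(canonical {x, y} \<^bold>\<in> op a b) q" using assms q feq_mono fmem_cong2 by blast
  then obtain r where r: "r \<le> q" "(canonical {x, y} \<^bold>= canonical {a}) r \<or> (canonical {x, y} \<^bold>= canonical {a, b}) r"
    unfolding op_def canonical_pair by blast
  have "(y \<^bold>\<in> canonical {x, y}) r" by (rule fmem_canonicalI) (auto simp: small_finite)
  then have "(y \<^bold>\<in> canonical {a}) r \<or> (y \<^bold>\<in> canonical {a, b}) r" using r fmem_cong2 by blast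
  then have "(y \<^bold>\<in> canonical {a, b}) r"
    unfolding canonical_single canonical_pair using feq_mono by blast
  then show "\<exists>r\<le>q. (y \<^bold>\<in> canonical {a, b}) r" using r by blast
qed

lemma op_fst:
  assumes "(op x y \<^bold>= (op a b :: ('i, 'p::order_top) name)) p"
  shows "(x \<^bold>= a) p"
proof (rule reg_dense[OF reg_feq])
  fix q assume q: "q \<le> p"
  have "(canonical {x} \<^bold>\<in> op x y) q" unfolding op_def by (rule fmem_canonicalI) (auto simp: small_finite)
  then have "(canonical {x} \<^bold>\<in> op a b) q" using assms q feq_mono fmem_cong2 by blast
  then obtain r where r: "r \<le> q" "(canonical {x} \<^bold>= canonical {a}) r \<or> (canonical {x} \<^bold>= canonical {a, b}) r"
    unfolding op_def canonical_pair by blast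
  have "(a \<^bold>\<in> canonical {a}) r" "(a \<^bold>\<in> canonical {a, b}) r"
    by (rule fmem_canonicalI; auto simp: small_finite)+
  then have "(a \<^bold>\<in> canonical {x}) r" using r fmem_cong2 feq_sym by blast
  then show "\<exists>r\<le>q. (x \<^bold>= a) r" using r feq_sym canonical_single by blast
qed

text \<open>For the second coordinate, y is a or b and, symmetrically, b is x or y; the one
  combination that does not give y = b outright is y = a with b = x, and there x = a closes the
  gap.\<close>

lemma op_eq_iff: "(op x y \<^bold>= (op a b :: ('i, 'p::order_top) name)) p \<longleftrightarrow> (x \<^bold>= a) p \<and> (y \<^bold>= b) p"
proof safe
  assume *: "(op x y \<^bold>= op a b) p"
  show xa: "(x \<^bold>= a) p" using op_fst[OF *] .
  show "(y \<^bold>= b) p"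
  proof (rule reg_dense[OF reg_feq])
    fix q assume q: "q \<le> p"
    obtain r where r: "r \<le> q" "(y \<^bold>= a) r \<or> (y \<^bold>= b) r"
      using op_snd_aux[OF *] q unfolding canonical_pair by blast
    obtain r' where r': "r' \<le> r" "(b \<^bold>= x) r' \<or> (b \<^bold>= y) r'"
      using op_snd_aux[OF feq_sym[OF *]] r q unfolding canonical_pair by (meson order_trans)
    have "(x \<^bold>= a) r'" using xa feq_mono r r' q by (meson order_trans)
    then have "(y \<^bold>= b) r'" using r r' by (meson feq_trans feq_sym feq_mono)
    then show "\<exists>r\<le>q. (y \<^bold>= b) r" using r r' by (meson order_trans)
  qed
qed (rule op_cong)

lemma cong_op [good_intros]:
  "cong f \<Longrightarrow> cong h \<Longrightarrow> cong (\<lambda>x. op (f x) (h x) :: ('i, 'p::order_top) name)"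
  unfolding cong_def by (auto intro: op_cong)

subsection \<open>Functions\<close>

lemma is_fun_iff:
  assumes "\<And>y. reg (B y)"
  shows "is_fun f a B (p :: 'p::order_top) \<longleftrightarrow>
    (\<forall>q\<le>p. \<forall>z. (z \<^bold>\<in> f) q \<longrightarrow> (\<forall>q'\<le>q. \<exists>r\<le>q'. \<exists>x. \<forall>q\<le>r. \<exists>r\<le>q. \<exists>y. (x \<^bold>\<in> a) r \<and> B y r \<and> (z \<^bold>= op x y) r)) \<and>
    (\<forall>q\<le>p. \<forall>x. (x \<^bold>\<in> a) q \<longrightarrow>
      (\<forall>q'\<le>q. \<exists>r\<le>q'. \<exists>y. (op x y \<^bold>\<in> f) r \<and> (\<forall>y'. \<forall>s\<le>r. (op x y' \<^bold>\<in> f) s \<longrightarrow> (y' \<^bold>= y) s)))"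
  unfolding is_fun_def by (auto simp: fbasic fimp_iff fex_iff assms)

lemma good_is_fun [good_intros]:
  assumes "cong f" "cong a" "\<And>y. good (\<lambda>x. B x y)"
  shows "good (\<lambda>x :: ('i, 'p::order_top) name. is_fun (f x) (a x) (B x))"
  unfolding is_fun_def by (intro good_intros assms)

lemma reg_is_fun [simp]: "(\<And>y. reg (B y)) \<Longrightarrow> reg (is_fun f a B)"
  unfolding is_fun_def by simp

lemma is_fun_mem:
  fixes f :: "('i, 'p::order_top) name"
  assumes f: "is_fun f a B p" and B: "good B" and q: "q \<le> p" "(op x y \<^bold>\<in> f) q"
  shows "(x \<^bold>\<in> a) q" "B y q"
proof -
  have *: "\<exists>r\<le>q'. \<exists>x' y'. (x' \<^bold>\<in> a) r \<and> B y' r \<and> (op x y \<^bold>= op x' y') r" if "q' \<le> q" for q'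
    using f q that unfolding is_fun_iff[OF good_reg[OF B]] by (meson order_refl order_trans)
  show "(x \<^bold>\<in> a) q"
    by (rule reg_dense[OF reg_fmem]) (meson * op_eq_iff fmem_cong1 feq_sym)
  show "B y q"
    by (rule reg_dense[OF good_reg[OF B]]) (meson * op_eq_iff good_cong[OF B] feq_sym)
qed

lemma is_fun_ex:
  fixes f :: "('i, 'p::order_top) name"
  assumes f: "is_fun f a B p" and B: "good B" and q: "q \<le> p" "(x \<^bold>\<in> a) q"
  obtains r y where "r \<le> q" "(op x y \<^bold>\<in> f) r" "B y r"
proof -
  have "\<exists>r\<le>q. \<exists>y. (op x y \<^bold>\<in> f) r"
    using f q unfolding is_fun_iff[OF good_reg[OF B]] by (meson order_refl)
  then show ?thesis using that is_fun_mem[OF f B] q by (meson order_trans)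
qed

lemma is_fun_unique:
  fixes f :: "('i, 'p::order_top) name"
  assumes f: "is_fun f a B p" and B: "good B" and q: "q \<le> p" "(op x y \<^bold>\<in> f) q" "(op x y' \<^bold>\<in> f) q"
  shows "(y \<^bold>= y') q"
proof (rule reg_dense[OF reg_feq])
  fix q' assume q': "q' \<le> q"
  have "(x \<^bold>\<in> a) q" using is_fun_mem[OF f B q(1,2)] by simp
  then obtain r z where r: "r \<le> q'" "\<And>y' s. s \<le> r \<Longrightarrow> (op x y' \<^bold>\<in> f) s \<Longrightarrow> (y' \<^bold>= z) s"
    using f q(1) q' unfolding is_fun_iff[OF good_reg[OF B]] by meson
  have "(y \<^bold>= z) r" "(y' \<^bold>= z) r" using r q q' fmem_mono by (meson order_trans order_refl)+
  then show "\<exists>r\<le>q'. (y \<^bold>= y') r" using r feq_trans feq_sym by blast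
qed

lemma is_funI:
  fixes f :: "('i, 'p::order_top) name"
  assumes B: "\<And>y. reg (B y)"
    and 1: "\<And>q z. q \<le> p \<Longrightarrow> (z \<^bold>\<in> f) q \<Longrightarrow> \<exists>r\<le>q. \<exists>x y. (x \<^bold>\<in> a) r \<and> B y r \<and> (z \<^bold>= op x y) r"
    and 2: "\<And>q x. q \<le> p \<Longrightarrow> (x \<^bold>\<in> a) q \<Longrightarrow> \<exists>r\<le>q. \<exists>y. (op x y \<^bold>\<in> f) r"
    and 3: "\<And>q x y y'. q \<le> p \<Longrightarrow> (x \<^bold>\<in> a) q \<Longrightarrow> (op x y \<^bold>\<in> f) q \<Longrightarrow> (op x y' \<^bold>\<in> f) q \<Longrightarrow> (y \<^bold>= y') q"
  shows "is_fun f a B p"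
  unfolding is_fun_iff[OF B]
proof (intro conjI allI impI)
  fix q z q' assume q: "q \<le> p" "(z \<^bold>\<in> f) q" "q' \<le> q"
  then obtain r x y where r: "r \<le> q'" "(x \<^bold>\<in> a) r" "B y r" "(z \<^bold>= op x y) r"
    using 1[of q' z] fmem_mono by (meson order_trans)
  then have "\<forall>q\<le>r. \<exists>r\<le>q. \<exists>y. (x \<^bold>\<in> a) r \<and> B y r \<and> (z \<^bold>= op x y) r"
    using fmem_mono feq_mono reg_mono[OF B] by blast
  then show "\<exists>r\<le>q'. \<exists>x. \<forall>q\<le>r. \<exists>r\<le>q. \<exists>y. (x \<^bold>\<in> a) r \<and> B y r \<and> (z \<^bold>= op x y) r" using r by blast
next
  fix q x q' assume q: "q \<le> p" "(x \<^bold>\<in> a) q" "q' \<le> q"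
  then obtain r y where r: "r \<le> q'" "(op x y \<^bold>\<in> f) r" using 2[of q' x] fmem_mono by (meson order_trans)
  have "(y' \<^bold>= y) s" if "s \<le> r" "(op x y' \<^bold>\<in> f) s" for y' s
    using 3[of s x y' y] that r q fmem_mono by (meson order_trans)
  then show "\<exists>r\<le>q'. \<exists>y. (op x y \<^bold>\<in> f) r \<and> (\<forall>y'. \<forall>s\<le>r. (op x y' \<^bold>\<in> f) s \<longrightarrow> (y' \<^bold>= y) s)"
    using r by blast
qed

definition fn :: "'c set \<Rightarrow> ('c \<Rightarrow> ('i, 'p::order_top) name) \<Rightarrow> ('c \<Rightarrow> ('i, 'p) name) \<Rightarrow> ('i, 'p) name" where
  "fn I d h = canonical ((\<lambda>x. op (d x) (h x)) ` I)"

lemma op_fn_iff: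
  assumes "small I"
  shows "(op x y \<^bold>\<in> (fn I d h :: ('i, 'p::order_top) name)) p \<longleftrightarrow> (\<forall>q\<le>p. \<exists>r\<le>q. \<exists>z\<in>I. (x \<^bold>= d z) r \<and> (y \<^bold>= h z) r)"
  unfolding fn_def by (simp add: fmem_canonical[OF small_image[OF assms]] op_eq_iff)

lemma op_fnI: "small I \<Longrightarrow> x \<in> I \<Longrightarrow> (op (d x) (h x) \<^bold>\<in> (fn I d h :: ('i, 'p::order_top) name)) p"
  by (simp add: op_fn_iff) (meson order_refl feq_refl)

text \<open>Distinct indices may have names \<open>d x\<close>, \<open>d x'\<close> that become
  equal only below some condition, so the hypothesis on h is required at every q below p.\<close>

lemma is_fun_fn:
  assumes I: "small I" and B: "\<And>y. reg (B y)" "\<And>x. x \<in> I \<Longrightarrow> B (h x) p"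
    and h: "\<And>x x' q. x \<in> I \<Longrightarrow> x' \<in> I \<Longrightarrow> q \<le> p \<Longrightarrow> (d x \<^bold>= d x') q \<Longrightarrow> (h x \<^bold>= h x') q"
  shows "is_fun (fn I d h :: ('i, 'p::order_top) name) (canonical (d ` I)) B p"
proof (rule is_funI[OF B(1)])
  fix q z assume q: "q \<le> p" "(z \<^bold>\<in> fn I d h) q"
  then obtain r x where r: "r \<le> q" "x \<in> I" "(z \<^bold>= op (d x) (h x)) r"
    unfolding fn_def fmem_canonical[OF small_image[OF I]] by blast
  then have "B (h x) r" using reg_mono[OF B(1)] B(2) q by (meson order_trans)
  then show "\<exists>r\<le>q. \<exists>x y. (x \<^bold>\<in> canonical (d ` I)) r \<and> B y r \<and> (z \<^bold>= op x y) r"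
    using r fmem_canonicalI[OF small_image[OF I]] by blast
next
  fix q x assume q: "q \<le> p" "(x \<^bold>\<in> canonical (d ` I)) q"
  then obtain r y where r: "r \<le> q" "y \<in> I" "(x \<^bold>= d y) r"
    unfolding fmem_canonical[OF small_image[OF I]] by blast
  have "(op (d y) (h y) \<^bold>\<in> fn I d h) r" using op_fnI[OF I r(2)] .
  then have "(op x (h y) \<^bold>\<in> fn I d h) r" using r fmem_cong1 op_cong feq_sym feq_refl by blast
  then show "\<exists>r\<le>q. \<exists>y. (op x y \<^bold>\<in> fn I d h) r" using r by blast
next
  fix q x y y' assume q: "q \<le> p" "(op x y \<^bold>\<in> fn I d h) q" "(op x y' \<^bold>\<in> fn I d h) q"
  show "(y \<^bold>= y') q"
  proof (rule reg_dense[OF reg_feq])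
    fix q' assume q': "q' \<le> q"
    obtain r z where r: "r \<le> q'" "z \<in> I" "(x \<^bold>= d z) r" "(y \<^bold>= h z) r"
      using q(2) q' unfolding op_fn_iff[OF I] by blast
    obtain r' z' where r': "r' \<le> r" "z' \<in> I" "(x \<^bold>= d z') r'" "(y' \<^bold>= h z') r'"
      using q(3) q' r unfolding op_fn_iff[OF I] by (meson order_trans)
    have "(d z \<^bold>= d z') r'" using r r' feq_mono feq_trans feq_sym by meson
    then have "(h z \<^bold>= h z') r'" using h r r' q q' by (meson order_trans)
    then have "(y \<^bold>= y') r'" using r r' feq_mono feq_trans feq_sym by meson
    then show "\<exists>r\<le>q'. (y \<^bold>= y') r" using r r' order_trans by blast
  qed
qed

lemma is_inj_fn:
  assumes I: "small I" and B: "\<And>y. reg (B y)" "\<And>x. x \<in> I \<Longrightarrow> B (h x) p"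
    and h: "\<And>x x' q. x \<in> I \<Longrightarrow> x' \<in> I \<Longrightarrow> q \<le> p \<Longrightarrow> (d x \<^bold>= d x') q \<longleftrightarrow> (h x \<^bold>= h x') q"
  shows "is_inj (fn I d h :: ('i, 'p::order_top) name) (canonical (d ` I)) B p"
proof -
  have "(x \<^bold>= x') q" if q: "q \<le> p" "(op x y \<^bold>\<in> fn I d h) q" "(op x' y \<^bold>\<in> fn I d h) q" for x x' y q
  proof (rule reg_dense[OF reg_feq])
    fix q' assume q': "q' \<le> q"
    obtain r z where r: "r \<le> q'" "z \<in> I" "(x \<^bold>= d z) r" "(y \<^bold>= h z) r"
      using q(2) q' unfolding op_fn_iff[OF I] by blast
    obtain r' z' where r': "r' \<le> r" "z' \<in> I" "(x' \<^bold>= d z') r'" "(y \<^bold>= h z') r'"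
      using q(3) q' r unfolding op_fn_iff[OF I] by (meson order_trans)
    have "(h z \<^bold>= h z') r'" using r r' feq_mono feq_trans feq_sym by meson
    then have "(d z \<^bold>= d z') r'" using h r r' q q' by (meson order_trans)
    then have "(x \<^bold>= x') r'" using r r' feq_mono feq_trans feq_sym by meson
    then show "\<exists>r\<le>q'. (x \<^bold>= x') r" using r r' order_trans by blast
  qed
  moreover have "is_fun (fn I d h) (canonical (d ` I)) B p" 
    by (rule is_fun_fn[OF I]) (use B h in auto)
  ultimately show ?thesis unfolding is_inj_def by (auto simp: fbasic fimp_iff)
qed

lemma equinum_fn:
  assumes I: "small I"
    and h: "\<And>x x' q. x \<in> I \<Longrightarrow> x' \<in> I \<Longrightarrow> q \<le> p \<Longrightarrow> (d x \<^bold>= d x') q \<longleftrightarrow> (h x \<^bold>= h x') q"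
  shows "equinum (canonical (d ` I)) (canonical (h ` I) :: ('i, 'p::order_top) name) p"
proof -
  let ?f = "fn I d h :: ('i, 'p) name"
  have "is_inj ?f (canonical (d ` I)) (\<lambda>y. y \<^bold>\<in> canonical (h ` I)) p"
    by (rule is_inj_fn[OF I _ _ h]) (auto intro!: fmem_canonicalI small_image[OF I])
  moreover have "\<exists>r\<le>q'. \<exists>x. (op x y \<^bold>\<in> ?f) r" if q: "(y \<^bold>\<in> canonical (h ` I)) q" "q' \<le> q" for y q q'
  proof -
    obtain r x where r: "r \<le> q'" "x \<in> I" "(y \<^bold>= h x) r"
      using q unfolding fmem_canonical[OF small_image[OF I]] by blast
    have "(op (d x) (h x) \<^bold>\<in> ?f) r" using op_fnI[OF I r(2)] .
    then have "(op (d x) y \<^bold>\<in> ?f) r" using r fmem_cong1 op_cong feq_sym feq_refl by blast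
    then show ?thesis using r by blast
  qed
  ultimately have "(is_inj ?f (canonical (d ` I)) (\<lambda>y. y \<^bold>\<in> canonical (h ` I)) \<^bold>\<and>
      (\<^bold>\<forall>y. y \<^bold>\<in> canonical (h ` I) \<^bold>\<longrightarrow> (\<^bold>\<exists>x. op x y \<^bold>\<in> ?f))) p"
    by (auto simp: fbasic fimp_iff fex_iff)
  then show ?thesis unfolding equinum_def by (rule fexI) (simp add: is_inj_def)
qed

lemma reg_is_inj [simp]: "(\<And>y. reg (B y)) \<Longrightarrow> reg (is_inj f a B)"
  unfolding is_inj_def by simp

lemma reg_equinum [simp]: "reg (equinum a b)"
  unfolding equinum_def by simp

lemma good_equinum [good_intros]:
  "cong f \<Longrightarrow> cong h \<Longrightarrow> good (\<lambda>x :: ('i, 'p::order_top) name. equinum (f x) (h x))"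
  unfolding equinum_def is_inj_def by (intro good_intros)

subsection \<open>Check names of ordinals\<close>

lemma check_elem_unfold:
  assumes "Well_order r"
  shows "check_elem r a = canonical (check_elem r ` underS r a)"
proof -
  have wf: "wf (r - Id)" using assms by (simp add: well_order_on_def)
  have "check_elem r a = canonical (cut (check_elem r) (r - Id) a ` underS r a)"
    unfolding check_elem_def by (subst wfrec[OF wf]) (rule refl)
  also have "cut (check_elem r) (r - Id) a ` underS r a = check_elem r ` underS r a"
    by (rule image_cong) (auto simp: cut_def underS_def)
  finally show ?thesis .
qed

lemma check_elem_mem:
  assumes "Well_order r" "small (Field r)" "(a, b) \<in> r" "a \<noteq> b"
  shows "(check_elem r a \<^bold>\<in> (check_elem r b :: ('i, 'p::order_top) name)) p"
proof -
  have "small (check_elem r ` underS r b)"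
    by (rule small_image, rule small_subset[OF assms(2)]) (auto simp: underS_def Field_def)
  then show ?thesis using assms
    by (subst (2) check_elem_unfold) (auto intro!: fmem_canonicalI simp: underS_def)
qed

text \<open>Distinct indices are comparable in the ground model order, so a forced equality would
  make a name a member of itself. Hence no condition can influence such equalities.\<close>

lemma check_elem_eq_iff:
  assumes "Well_order r" "small (Field r)" "a \<in> Field r" "b \<in> Field r"
  shows "(check_elem r a \<^bold>= (check_elem r b :: ('i, 'p::order_top) name)) p \<longleftrightarrow> a = b"
proof -
  have "a = b" if "(check_elem r a \<^bold>= (check_elem r b :: ('i, 'p) name)) p"
  proof (rule ccontr)
    assume "a \<noteq> b"
    then have "(a, b) \<in> r \<or> (b, a) \<in> r"
      using assms unfolding well_order_on_def linear_order_on_def total_on_def by blast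
    then show False
      using check_elem_mem[OF assms(1,2), of a b p] check_elem_mem[OF assms(1,2), of b a p] that \<open>a \<noteq> b\<close>
        fmem_irrefl fmem_cong2 fmem_cong1 by (metis feq_sym)
  qed
  then show ?thesis by auto
qed

lemma check_elem_mem_iff:
  assumes "Well_order r" "small (Field r)" "a \<in> Field r" "b \<in> Field r"
  shows "(check_elem r a \<^bold>\<in> (check_elem r b :: ('i, 'p::order_top) name)) p \<longleftrightarrow> (a, b) \<in> r \<and> a \<noteq> b"
proof -
  have "(a, b) \<in> r \<and> a \<noteq> b" if "(check_elem r a \<^bold>\<in> (check_elem r b :: ('i, 'p) name)) p"
  proof -
    have "small (check_elem r ` underS r b)"
      by (rule small_image, rule small_subset[OF assms(2)]) (auto simp: underS_def Field_def)
    with that obtain q c where "c \<in> underS r b" "(check_elem r a \<^bold>= (check_elem r c :: ('i, 'p) name)) q"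
      by (subst (asm) (2) check_elem_unfold[OF assms(1)]) (auto elim!: fmem_canonicalE)
    then show ?thesis using check_elem_eq_iff[OF assms(1,2,3), of c q]
      by (auto simp: underS_def Field_def)
  qed
  then show ?thesis using check_elem_mem[OF assms(1,2)] by blast
qed

abbreviation nn :: "nat \<Rightarrow> ('i, 'p::order_top) name" where "nn \<equiv> check_elem natLeq"

lemma nn_unfold: "nn n = canonical (nn ` {..<n})"
proof -
  have "underS natLeq n = {..<n}" by (auto simp: underS_def natLeq_def)
  then show ?thesis using check_elem_unfold[OF natLeq_Well_order, of n] by simp
qed

lemma nn_eq_iff [simp]: "(nn m \<^bold>= (nn n :: ('i, 'p::order_top) name)) p \<longleftrightarrow> m = n"
  by (rule check_elem_eq_iff[OF natLeq_Well_order small_nat]) (auto simp: Field_natLeq)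

lemma nn_mem_iff [simp]: "(nn m \<^bold>\<in> (nn n :: ('i, 'p::order_top) name)) p \<longleftrightarrow> m < n"
  by (subst check_elem_mem_iff[OF natLeq_Well_order small_nat]) (auto simp: Field_natLeq, auto simp: natLeq_def)

lemma omega_unfold: "omega = canonical (range nn)"
  unfolding omega_def check_ord_def by (simp add: Field_natLeq)

lemma small_nn: "small (nn ` X)" by (rule small_image[OF small_nat])

lemma nn_mem_omega [simp]: "(nn n \<^bold>\<in> (omega :: ('i, 'p::order_top) name)) p"
  unfolding omega_unfold by (rule fmem_canonicalI[OF small_nn]) simp

lemma mem_omega_iff: "((x :: ('i, 'p::order_top) name) \<^bold>\<in> omega) p \<longleftrightarrow> (\<forall>q\<le>p. \<exists>r\<le>q. \<exists>n. (x \<^bold>= nn n) r)"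
  unfolding omega_unfold by (simp add: fmem_canonical[OF small_nn])

lemma mem_nn_iff: "((x :: ('i, 'p::order_top) name) \<^bold>\<in> nn m) p \<longleftrightarrow> (\<forall>q\<le>p. \<exists>r\<le>q. \<exists>n<m. (x \<^bold>= nn n) r)"
  by (subst nn_unfold) (simp add: fmem_canonical[OF small_nn] Bex_def)

lemma all_omega:
  "good (\<Phi> :: ('i, 'p::order_top) fclass) \<Longrightarrow>
    (\<forall>q\<le>p. \<forall>x. (x \<^bold>\<in> omega) q \<longrightarrow> \<Phi> x q) \<longleftrightarrow> (\<forall>n. \<Phi> (nn n) p)"
  unfolding omega_unfold by (subst fall_canonical[OF small_nn]) auto

lemma all_nn:
  "good (\<Phi> :: ('i, 'p::order_top) fclass) \<Longrightarrow>
    (\<forall>q\<le>p. \<forall>x. (x \<^bold>\<in> nn m) q \<longrightarrow> \<Phi> x q) \<longleftrightarrow> (\<forall>n<m. \<Phi> (nn n) p)"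
  by (subst nn_unfold, subst fall_canonical[OF small_nn]) auto

end

section \<open>Sufficiently generic evaluation of Cohen names\<close>

text \<open>
  A total function \<open>g\<close> plays the role of the generic object. As there are no generics over the
  universe, statements about \<open>g\<close> are only required for all \<open>g\<close> meeting countably many given dense
  sets (\<open>ae\<close>), and are used only when they are decided by conditions in this sense (\<open>bp\<close>); \<open>bp S Q\<close>
  says in addition that conditions with support in \<open>S\<close> suffice.
\<close>

type_synonym 'l gen = "'l \<times> nat \<Rightarrow> bool"

section \<open>Cohen conditions: restriction to a support and amalgamation\<close>

definition ext :: "'l cohen \<Rightarrow> 'l gen \<Rightarrow> bool" where
  "ext p g \<longleftrightarrow> Rep_cohen p \<subseteq>\<^sub>m (\<lambda>x. Some (g x))"

definition rs :: "'l set \<Rightarrow> 'l cohen \<Rightarrow> 'l cohen" where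
  "rs S p = Abs_cohen (Rep_cohen p |` (S \<times> UNIV))"

text \<open>The second argument wins on conflicts, so the result is always below q; being below p
  needs compatibility, as in \<open>amalg\<close> and \<open>ext_compat\<close>.\<close>

definition join :: "'l cohen \<Rightarrow> 'l cohen \<Rightarrow> 'l cohen" where
  "join p q = Abs_cohen (Rep_cohen p ++ Rep_cohen q)"

lemma finite_Rep: "finite (dom (Rep_cohen p))"
  using Rep_cohen by blast

lemma Rep_rs: "Rep_cohen (rs S p) = Rep_cohen p |` (S \<times> UNIV)"
  unfolding rs_def by (rule Abs_cohen_inverse) (simp add: finite_Rep)

lemma Rep_join: "Rep_cohen (join p q) = Rep_cohen p ++ Rep_cohen q"
  unfolding join_def by (rule Abs_cohen_inverse) (simp add: finite_Rep)

lemma ext_mono: "q \<le> p \<Longrightarrow> ext q g \<Longrightarrow> ext p g"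
  unfolding ext_def less_eq_cohen_def by (rule map_le_trans)

lemma rs_ge: "p \<le> rs S p"
  by (auto simp: less_eq_cohen_def Rep_rs map_le_def)

lemma rs_mono: "p \<le> q \<Longrightarrow> rs S p \<le> rs S q"
  by (auto simp: less_eq_cohen_def Rep_rs map_le_def restrict_map_def)

lemma rs_rs: "rs S (rs S' p) = rs (S \<inter> S') p"
  by (rule Rep_cohen_inject[THEN iffD1]) (auto simp: Rep_rs restrict_map_def fun_eq_iff)

lemma rs_UNIV [simp]: "rs UNIV p = p"
  by (rule Rep_cohen_inject[THEN iffD1]) (auto simp: Rep_rs)

lemma rs_id_mono: "S \<subseteq> S' \<Longrightarrow> rs S p = p \<Longrightarrow> rs S' p = p"
  by (metis rs_rs Int_absorb1)

lemma rs_idI: assumes "fst ` dom (Rep_cohen p) \<subseteq> S" shows "rs S p = p"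
proof (rule Rep_cohen_inject[THEN iffD1], rule ext)
  fix x
  have "x \<in> S \<times> UNIV" if "Rep_cohen p x \<noteq> None" using assms that by (cases x) force
  then show "Rep_cohen (rs S p) x = Rep_cohen p x"
    unfolding Rep_rs restrict_map_def by (metis (full_types))
qed

lemma join_le2: "join p q \<le> q"
  by (simp add: less_eq_cohen_def Rep_join)

text \<open>The product structure of Cohen forcing: outside S the condition q says nothing, inside S
  it extends p, so the two are compatible and nothing new is added inside S.\<close>

lemma amalg:
  assumes "rs S q = q" "q \<le> rs S p"
  shows "join p q \<le> p" "rs S (join p q) = q"
proof -
  have *: "Rep_cohen p |` (S \<times> UNIV) \<subseteq>\<^sub>m Rep_cohen q" using assms(2) by (simp add: less_eq_cohen_def Rep_rs)
  have **: "Rep_cohen q x = (if fst x \<in> S then Rep_cohen q x else None)" for x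
    using fun_cong[OF arg_cong[OF assms(1), of Rep_cohen], of x]
    by (auto simp: Rep_rs restrict_map_def mem_Times_iff split: if_splits)
  show "join p q \<le> p"
    unfolding less_eq_cohen_def Rep_join map_le_def
  proof
    fix x assume x: "x \<in> dom (Rep_cohen p)"
    show "Rep_cohen p x = (Rep_cohen p ++ Rep_cohen q) x"
    proof (cases "fst x \<in> S")
      case True
      then have "x \<in> S \<times> UNIV" by (simp add: mem_Times_iff)
      then have "Rep_cohen q x = Rep_cohen p x"
        using bspec[OF *[unfolded map_le_def], of x] x by simp
      then show ?thesis by (simp add: map_add_def split: option.split)
    next
      case False
      then show ?thesis using **[of x] by (simp add: map_add_def)
    qed
  qed
  show "rs S (join p q) = q"
  proof (rule Rep_cohen_inject[THEN iffD1], rule ext)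
    fix x
    show "Rep_cohen (rs S (join p q)) x = Rep_cohen q x"
    proof (cases "fst x \<in> S")
      case True
      then have xS: "x \<in> S \<times> UNIV" by (simp add: mem_Times_iff)
      show ?thesis
      proof (cases "Rep_cohen q x")
        case None
        then have "Rep_cohen p x = None"
          using bspec[OF *[unfolded map_le_def], of x] xS by (cases "Rep_cohen p x") auto
        then show ?thesis using None xS by (simp add: Rep_rs Rep_join map_add_def)
      qed (use xS in \<open>simp add: Rep_rs Rep_join map_add_def\<close>)
    next
      case False
      then show ?thesis using **[of x] by (auto simp: Rep_rs restrict_map_def mem_Times_iff)
    qed
  qed
qed

lemma ext_compat:
  assumes "ext p g" "ext q g"
  shows "ext (join p q) g" "join p q \<le> p" "join p q \<le> q"
proof -
  show "ext (join p q) g"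
    using assms unfolding ext_def Rep_join map_le_def by (auto simp: map_add_def split: option.splits) force+
  have "Rep_cohen p x = (Rep_cohen p ++ Rep_cohen q) x" if "x \<in> dom (Rep_cohen p)" for x
  proof (cases "Rep_cohen q x")
    case (Some b)
    then have "Some b = Some (g x)" "Rep_cohen p x = Some (g x)"
      using assms that unfolding ext_def map_le_def by (metis domI)+
    then show ?thesis using Some by simp
  qed (simp add: map_add_def)
  then show "join p q \<le> p" by (simp add: less_eq_cohen_def Rep_join map_le_def)
  show "join p q \<le> q" by (rule join_le2)
qed

section \<open>Sufficiently generic functions and truth for all of them\<close>

definition dns :: "'l cohen set \<Rightarrow> bool" where
  "dns D \<longleftrightarrow> (\<forall>p. \<exists>q\<le>p. q \<in> D)"

definition meets :: "'l gen \<Rightarrow> (nat \<Rightarrow> 'l cohen set) \<Rightarrow> bool" where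
  "meets g D \<longleftrightarrow> (\<forall>n. \<exists>r\<in>D n. ext r g)"

text \<open>The Rasiowa-Sikorski descent through countably many dense sets; coordinates that are
  never decided get the value False.\<close>

lemma generic_exists:
  assumes "\<And>n. dns (D n)"
  shows "\<exists>g. ext p g \<and> meets g D"
proof -
  define s where "s = rec_nat p (\<lambda>n q. SOME r. r \<le> q \<and> r \<in> D n)"
  have s0: "s 0 = p" by (simp add: s_def)
  have sS: "s (Suc n) \<le> s n \<and> s (Suc n) \<in> D n" for n
  proof -
    have "s (Suc n) = (SOME r. r \<le> s n \<and> r \<in> D n)" by (simp add: s_def)
    moreover have "\<exists>r. r \<le> s n \<and> r \<in> D n" using assms unfolding dns_def by blast
    ultimately show ?thesis by (metis (mono_tags, lifting) someI_ex)
  qed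
  have dec: "s n \<le> s m" if "m \<le> n" for m n
    by (rule lift_Suc_antimono_le[of s, OF _ that]) (use sS in blast)
  define g where "g x = (\<exists>n. Rep_cohen (s n) x = Some True)" for x
  have "ext (s n) g" for n
    unfolding ext_def map_le_def
  proof
    fix x assume "x \<in> dom (Rep_cohen (s n))"
    then obtain b where b: "Rep_cohen (s n) x = Some b" by blast
    have "b = b'" if "Rep_cohen (s m) x = Some b'" for m b'
    proof -
      have "s (max m n) \<le> s m" "s (max m n) \<le> s n" by (rule dec; simp)+
      then have "Rep_cohen (s (max m n)) x = Some b" "Rep_cohen (s (max m n)) x = Some b'"
        using b that unfolding less_eq_cohen_def map_le_def by (metis domI)+
      then show ?thesis by simp
    qed
    then show "Rep_cohen (s n) x = Some (g x)" unfolding g_def using b by (cases b) auto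
  qed
  then have "ext p g" "meets g D" using s0 sS unfolding meets_def by metis+
  then show ?thesis by blast
qed

definition dec :: "(nat \<Rightarrow> 'l cohen set) \<Rightarrow> ('l gen \<Rightarrow> bool) \<Rightarrow> 'l cohen \<Rightarrow> bool" where
  "dec D Q p \<longleftrightarrow> (\<forall>g. ext p g \<longrightarrow> meets g D \<longrightarrow> Q g)"

definition ae :: "'l cohen \<Rightarrow> ('l gen \<Rightarrow> bool) \<Rightarrow> bool" where
  "ae p Q \<longleftrightarrow> (\<exists>D. (\<forall>n. dns (D n)) \<and> dec D Q p)"

lemma dec_mono: "dec D Q p \<Longrightarrow> q \<le> p \<Longrightarrow> dec D Q q"
  unfolding dec_def using ext_mono by blast

lemma ae_mono: "ae p Q \<Longrightarrow> q \<le> p \<Longrightarrow> ae q Q"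
  unfolding ae_def using dec_mono by blast

text \<open>Each statement comes with its own countable family of dense sets; pairing merges
  countably many families into one. Uncountable conjunctions are out of reach of this
  method.\<close>

lemma ae_all_nat: assumes "\<And>n :: nat. ae p (Q n)" shows "ae p (\<lambda>g. \<forall>n. Q n g)"
proof -
  obtain D where D: "\<And>n m. dns (D n m)" "\<And>n. dec (D n) (Q n) p"
    using assms unfolding ae_def by metis
  let ?D = "\<lambda>k. D (fst (prod_decode k)) (snd (prod_decode k))"
  have "meets g (D n)" if "meets g ?D" for g n
    using that unfolding meets_def by (metis fst_conv snd_conv prod_encode_inverse)
  then have "dec ?D (\<lambda>g. \<forall>n. Q n g) p" using D(2) unfolding dec_def by blast
  then show ?thesis unfolding ae_def using D(1) by (intro exI[of _ ?D]) auto
qed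

lemma ae_mp: "ae p Q \<Longrightarrow> (\<And>g. ext p g \<Longrightarrow> Q g \<Longrightarrow> R g) \<Longrightarrow> ae p R"
  unfolding ae_def dec_def by blast

lemma aeI: "(\<And>g. ext p g \<Longrightarrow> Q g) \<Longrightarrow> ae p Q"
  unfolding ae_def dec_def dns_def by (rule exI[of _ "\<lambda>_. UNIV"]) auto

lemma ae_all: assumes "\<And>x :: 'c::countable. ae p (Q x)" shows "ae p (\<lambda>g. \<forall>x. Q x g)"
  by (rule ae_mp[OF ae_all_nat[of p "\<lambda>n. Q (from_nat n)"]]) (use assms in \<open>auto, metis from_nat_to_nat\<close>)

lemma ae_all_iff: "ae p (\<lambda>g. \<forall>x :: 'c::countable. Q x g) \<longleftrightarrow> (\<forall>x. ae p (Q x))"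
  using ae_all[of p Q] by (auto elim: ae_mp)

lemma ae_conj: assumes "ae p Q" "ae p R" shows "ae p (\<lambda>g. Q g \<and> R g)"
proof -
  have "ae p (\<lambda>g. if b then Q g else R g)" for b using assms by (cases b) simp_all
  then have "ae p (\<lambda>g. \<forall>b :: bool. (if b then Q g else R g))" by (rule ae_all)
  then show ?thesis by (rule ae_mp) (metis (full_types))
qed

lemma ae_conj_iff: "ae p (\<lambda>g. Q g \<and> R g) \<longleftrightarrow> ae p Q \<and> ae p R"
  using ae_conj[of p Q R] by (auto elim: ae_mp)

lemma ae_mp2: "ae p Q \<Longrightarrow> ae p R \<Longrightarrow> (\<And>g. ext p g \<Longrightarrow> Q g \<Longrightarrow> R g \<Longrightarrow> W g) \<Longrightarrow> ae p W"
  using ae_mp[OF ae_conj] by blast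

lemma ae_mp3: "ae p Q \<Longrightarrow> ae p R \<Longrightarrow> ae p W \<Longrightarrow> (\<And>g. ext p g \<Longrightarrow> Q g \<Longrightarrow> R g \<Longrightarrow> W g \<Longrightarrow> V g) \<Longrightarrow> ae p V"
  using ae_mp2[OF ae_conj] by blast

lemma ae_ball: "finite F \<Longrightarrow> (\<And>x. x \<in> F \<Longrightarrow> ae p (Q x)) \<Longrightarrow> ae p (\<lambda>g. \<forall>x\<in>F. Q x g)"
  by (induction F rule: finite_induct) (auto intro: aeI simp: ae_conj_iff)

lemma ae_witness: "ae p Q \<Longrightarrow> \<exists>g. ext p g \<and> Q g"
  unfolding ae_def dec_def using generic_exists by blast

lemma ae_False [simp]: "\<not> ae p (\<lambda>g. False)"
  using ae_witness by blast

lemma ae_const [simp]: "ae p (\<lambda>g. c) \<longleftrightarrow> c"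
  by (cases c) (auto intro: aeI)

subsection \<open>The Baire property with a given support\<close>

definition bp :: "'l set \<Rightarrow> ('l gen \<Rightarrow> bool) \<Rightarrow> bool" where
  "bp S Q \<longleftrightarrow> (\<exists>D. (\<forall>n. dns (D n)) \<and>
     (\<forall>p. rs S p = p \<longrightarrow> (\<exists>q\<le>p. rs S q = q \<and> (dec D Q q \<or> dec D (\<lambda>g. \<not> Q g) q))))"

named_theorems bp_intros

text \<open>The decision is made below the restriction of p to S and amalgamated with p; cutting
  back to S' keeps it below q because S is contained in S'.\<close>

lemma bp_mono:
  assumes "bp S Q" "S \<subseteq> S'" shows "bp S' Q"
proof -
  obtain D where D: "\<And>n. dns (D n)"
    "\<And>p. rs S p = p \<Longrightarrow> \<exists>q\<le>p. rs S q = q \<and> (dec D Q q \<or> dec D (\<lambda>g. \<not> Q g) q)"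
    using assms(1) unfolding bp_def by blast
  have "\<exists>q\<le>p. rs S' q = q \<and> (dec D Q q \<or> dec D (\<lambda>g. \<not> Q g) q)" if p: "rs S' p = p" for p
  proof -
    obtain q where q: "q \<le> rs S p" "rs S q = q" "dec D Q q \<or> dec D (\<lambda>g. \<not> Q g) q"
      using D(2)[of "rs S p"] rs_rs by (metis Int_absorb)
    let ?r = "rs S' (join p q)"
    have "?r \<le> p" using rs_mono[OF amalg(1)[OF q(2,1)], of S'] p by simp
    moreover have "?r \<le> q"
      using rs_mono[OF join_le2[of p q], of S'] rs_id_mono[OF assms(2) q(2)] by simp
    moreover have "rs S' ?r = ?r" by (simp add: rs_rs)
    ultimately show ?thesis using q(3) dec_mono by blast
  qed
  then show ?thesis unfolding bp_def using D(1) by blast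
qed

lemma bp_UNIV: "bp S Q \<Longrightarrow> bp UNIV Q"
  by (rule bp_mono) auto

lemma bp_not [bp_intros]: "bp S Q \<Longrightarrow> bp S (\<lambda>g. \<not> Q g)"
  unfolding bp_def by (auto simp: disj_commute)

lemma bp_const [bp_intros]: "bp S (\<lambda>g. c)"
  unfolding bp_def dec_def dns_def by (rule exI[of _ "\<lambda>_. UNIV"]) auto

text \<open>Generics are made to meet also the sets \<open>E n\<close> of conditions whose S-part
  decides \<open>Q n\<close>. If no S-supported extension of p refutes any \<open>Q n\<close>, all
  these decisions are positive along a generic below p, and p itself decides the
  conjunction.\<close>

lemma bp_all_nat:
  assumes "\<And>n :: nat. bp S (Q n)" shows "bp S (\<lambda>g. \<forall>n. Q n g)"
proof -
  obtain D where D: "\<And>n m. dns (D n m)"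
    "\<And>n p. rs S p = p \<Longrightarrow> \<exists>q\<le>p. rs S q = q \<and> (dec (D n) (Q n) q \<or> dec (D n) (\<lambda>g. \<not> Q n g) q)"
    using assms unfolding bp_def by metis
  define E where "E n = {q. dec (D n) (Q n) (rs S q) \<or> dec (D n) (\<lambda>g. \<not> Q n g) (rs S q)}" for n
  \<comment> \<open>Row n lists \<open>E n\<close> first and the original dense sets for
    \<open>Q n\<close> after it.\<close>
  define C where "C k = (let (n, m) = prod_decode k in case m of 0 \<Rightarrow> E n | Suc m \<Rightarrow> D n m)" for k
  have E: "dns (E n)" for n
    unfolding dns_def
  proof
    fix p
    obtain q where q: "q \<le> rs S p" "rs S q = q" "dec (D n) (Q n) q \<or> dec (D n) (\<lambda>g. \<not> Q n g) q"
      using D(2)[of "rs S p"] rs_rs by (metis Int_absorb)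
    then show "\<exists>q\<le>p. q \<in> E n" using amalg[OF q(2,1)] unfolding E_def by auto
  qed
  have C: "dns (C k)" for k
    unfolding C_def using E D(1) by (auto split: prod.split nat.split)
  have mC: "meets g (D n)" "\<exists>r\<in>E n. ext r g" if "meets g C" for g n
  proof -
    have *: "\<exists>r\<in>C (prod_encode (n, m)). ext r g" for m using that unfolding meets_def by blast
    show "\<exists>r\<in>E n. ext r g" using *[of 0] by (simp add: C_def)
    show "meets g (D n)" unfolding meets_def using *[of "Suc _"] by (simp add: C_def)
  qed
  have "\<exists>q\<le>p. rs S q = q \<and> (dec C (\<lambda>g. \<forall>n. Q n g) q \<or> dec C (\<lambda>g. \<not> (\<forall>n. Q n g)) q)"
    if p: "rs S p = p" for p
  proof (cases "\<exists>n. \<exists>q\<le>p. rs S q = q \<and> dec (D n) (\<lambda>g. \<not> Q n g) q")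
    case True
    then obtain n q where q: "q \<le> p" "rs S q = q" "dec (D n) (\<lambda>g. \<not> Q n g) q" by blast
    then have "dec C (\<lambda>g. \<not> (\<forall>n. Q n g)) q" unfolding dec_def using mC by blast
    then show ?thesis using q by blast
  next
    case False
    have "Q n g" if g: "ext p g" "meets g C" for g n
    proof -
      obtain r where r: "r \<in> E n" "ext r g" using mC g by blast
      have gr: "ext (rs S r) g" using r rs_ge ext_mono by blast
      have j: "join p (rs S r) \<le> p" "join p (rs S r) \<le> rs S r" "ext (join p (rs S r)) g"
        using ext_compat[OF g(1) gr] by auto
      have "rs S (join p (rs S r)) \<le> p" using rs_mono[OF j(1), of S] p by simp
      moreover have "rs S (join p (rs S r)) \<le> rs S r" using rs_mono[OF j(2), of S] by (simp add: rs_rs)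
      moreover have "rs S (rs S (join p (rs S r))) = rs S (join p (rs S r))" by (simp add: rs_rs)
      ultimately have "\<not> dec (D n) (\<lambda>g. \<not> Q n g) (rs S r)" using False dec_mono by blast
      then have "dec (D n) (Q n) (rs S r)" using r unfolding E_def by blast
      then show ?thesis using gr mC g unfolding dec_def by blast
    qed
    then have "dec C (\<lambda>g. \<forall>n. Q n g) p" unfolding dec_def by blast
    then show ?thesis using p by blast
  qed
  then show ?thesis unfolding bp_def using C by blast
qed

lemma bp_cong: "bp S Q \<Longrightarrow> (\<And>g. Q g \<longleftrightarrow> R g) \<Longrightarrow> bp S R"
  by (subgoal_tac "Q = R") auto

lemma bp_all [bp_intros]:
  assumes "\<And>x :: 'c::countable. bp S (Q x)" shows "bp S (\<lambda>g. \<forall>x. Q x g)"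
  by (rule bp_cong[OF bp_all_nat[of S "\<lambda>n. Q (from_nat n)"]]) (use assms in \<open>auto, metis from_nat_to_nat\<close>)

lemma bp_ex [bp_intros]:
  assumes "\<And>x :: 'c::countable. bp S (Q x)" shows "bp S (\<lambda>g. \<exists>x. Q x g)"
  by (rule bp_cong[OF bp_not[OF bp_all[OF bp_not[OF assms]]]]) auto

lemma bp_conj [bp_intros]: assumes "bp S Q" "bp S R" shows "bp S (\<lambda>g. Q g \<and> R g)"
proof -
  have "bp S (\<lambda>g. if b then Q g else R g)" for b using assms by (cases b) simp_all
  then have "bp S (\<lambda>g. \<forall>b :: bool. (if b then Q g else R g))" by (rule bp_all)
  then show ?thesis by (rule bp_cong) (metis (full_types))
qed

lemma bp_disj [bp_intros]: assumes "bp S Q" "bp S R" shows "bp S (\<lambda>g. Q g \<or> R g)"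
  by (rule bp_cong[OF bp_not[OF bp_conj[OF bp_not[OF assms(1)] bp_not[OF assms(2)]]]]) auto

lemma bp_imp [bp_intros]: assumes "bp S Q" "bp S R" shows "bp S (\<lambda>g. Q g \<longrightarrow> R g)"
  by (rule bp_cong[OF bp_disj[OF bp_not[OF assms(1)] assms(2)]]) auto

lemma bp_finite_ball: "finite F \<Longrightarrow> (\<And>x. x \<in> F \<Longrightarrow> bp S (Q x)) \<Longrightarrow> bp S (\<lambda>g. \<forall>x\<in>F. Q x g)"
  by (induction F rule: finite_induct) (auto intro: bp_const bp_conj)

text \<open>
  The truth value of a formula under \<open>g\<close>, inverse to \<open>ae\<close>.
\<close>

definition ev :: "'l cohen fprop \<Rightarrow> 'l gen \<Rightarrow> bool" where
  "ev \<phi> g \<longleftrightarrow> (\<exists>r. ext r g \<and> \<phi> r)"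

definition supp :: "'l set \<Rightarrow> 'l cohen fprop \<Rightarrow> bool" where
  "supp S \<phi> \<longleftrightarrow> (\<forall>p. \<phi> p \<longrightarrow> \<phi> (rs S p))"

lemma bp_ev:
  assumes \<phi>: "reg \<phi>" and S: "supp S \<phi>" shows "bp S (ev \<phi>)"
  unfolding bp_def
proof (intro exI[of _ "\<lambda>_. UNIV"] conjI allI impI)
  show "dns UNIV" by (auto simp: dns_def)
  fix p assume p: "rs S p = p"
  obtain q where q: "q \<le> p" "\<phi> q \<or> (\<^bold>\<not> \<phi>) q" using reg_decide[OF \<phi>] by blast
  have "rs S q \<le> p" using rs_mono[OF q(1), of S] p by simp
  moreover have "rs S (rs S q) = rs S q" by (simp add: rs_rs)
  moreover have "dec (\<lambda>_. UNIV) (ev \<phi>) (rs S q) \<or> dec (\<lambda>_. UNIV) (\<lambda>g. \<not> ev \<phi> g) (rs S q)"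
    using q(2)
  proof
    assume "\<phi> q"
    then have "\<phi> (rs S q)" using S by (simp add: supp_def)
    then show ?thesis unfolding dec_def ev_def by blast
  next
    \<comment> \<open>A function extending the S-part of q at which \<phi> is true would give an
      S-supported condition below \<open>rs S q\<close> forcing \<phi>; amalgamated with q it
      contradicts q forcing the negation.\<close>
    assume nq: "(\<^bold>\<not> \<phi>) q"
    have "\<not> ev \<phi> g" if g: "ext (rs S q) g" for g
    proof
      assume "ev \<phi> g"
      then obtain r where r: "ext r g" "\<phi> r" unfolding ev_def by blast
      let ?t = "join r (rs S q)"
      have "\<phi> (rs S ?t)" using S reg_mono[OF \<phi> r(2) ext_compat(2)[OF r(1) g]] by (simp add: supp_def)
      moreover have "rs S ?t \<le> rs S q" using rs_mono[OF join_le2[of r "rs S q"], of S] by (simp add: rs_rs)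
      ultimately have "\<phi> (join q (rs S ?t))" using reg_mono[OF \<phi> _ join_le2] by blast
      moreover have "join q (rs S ?t) \<le> q"
        using amalg(1)[of S "rs S ?t" q] \<open>rs S ?t \<le> rs S q\<close> by (simp add: rs_rs)
      ultimately show False using nq by (simp add: fneg_def)
    qed
    then show ?thesis unfolding dec_def by blast
  qed
  ultimately show "\<exists>q\<le>p. rs S q = q \<and>
      (dec (\<lambda>_. UNIV) (ev \<phi>) q \<or> dec (\<lambda>_. UNIV) (\<lambda>g. \<not> ev \<phi> g) q)" by blast
qed

section \<open>Density, decision and restriction of supports\<close>

lemma supp_UNIV [simp]: "supp UNIV \<phi>" by (simp add: supp_def)

lemma supp_mono: assumes "supp S \<phi>" "S \<subseteq> S'" "reg \<phi>" shows "supp S' \<phi>"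
proof -
  have "\<phi> (rs S' p)" if "\<phi> p" for p
  proof -
    have "rs S' p \<le> rs S p" using rs_ge[of "rs S' p" S] assms(2) by (simp add: rs_rs Int_absorb2)
    then show ?thesis using reg_mono[OF assms(3)] assms(1) that unfolding supp_def by blast
  qed
  then show ?thesis by (simp add: supp_def)
qed

text \<open>The conditions r come with their own dense families, possibly too many to merge. The one
  family given by \<open>bp\<close> decides Q anyway; the r only rule out that it decides
  negatively.\<close>

lemma ae_dense:
  assumes "bp S Q" "\<And>q. q \<le> p \<Longrightarrow> \<exists>r\<le>q. ae r Q"
  shows "ae p Q"
proof -
  obtain D where D: "\<And>n. dns (D n)" "\<And>p. \<exists>q\<le>p. dec D Q q \<or> dec D (\<lambda>g. \<not> Q g) q"
    using bp_UNIV[OF assms(1)] unfolding bp_def by auto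
  let ?E = "{q. dec D Q q \<or> dec D (\<lambda>g. \<not> Q g) q}"
  let ?C = "case_nat ?E D"
  have C: "dns (?C n)" for n using D by (cases n) (auto simp: dns_def)
  have "Q g" if g: "ext p g" "meets g ?C" for g
  proof -
    have m: "meets g D" using g(2) unfolding meets_def by (metis nat.case(2))
    obtain q where q: "q \<in> ?E" "ext q g" using g(2) unfolding meets_def by (metis nat.case(1))
    have "\<not> dec D (\<lambda>g. \<not> Q g) q"
    proof
      assume n: "dec D (\<lambda>g. \<not> Q g) q"
      obtain r where r: "r \<le> join p q" "ae r Q" using assms(2) ext_compat[OF g(1) q(2)] by blast
      have "ae r (\<lambda>g. \<not> Q g)"
        unfolding ae_def using D(1) dec_mono[OF n] r(1) join_le2 by (meson order_trans)
      then show False using ae_conj[OF r(2)] ae_witness by blast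
    qed
    then show ?thesis using q m unfolding dec_def by blast
  qed
  then have "dec ?C Q p" unfolding dec_def by blast
  then show ?thesis unfolding ae_def using C by blast
qed

lemma ae_decide: "bp S Q \<Longrightarrow> \<exists>q\<le>p. ae q Q \<or> ae q (\<lambda>g. \<not> Q g)"
  using bp_UNIV[of S Q] unfolding bp_def ae_def by (metis rs_UNIV)

lemma ae_contr: "ae p Q \<Longrightarrow> ae p (\<lambda>g. \<not> Q g) \<Longrightarrow> False"
  using ae_witness[OF ae_conj, of p Q "\<lambda>g. \<not> Q g"] by blast

lemma reg_ae: assumes "bp S Q" shows "reg (\<lambda>p. ae p Q)"
  by (rule regI, erule (1) ae_mono, rule ae_dense[OF assms], blast)

lemma ae_not_iff: assumes "bp S Q" shows "ae p (\<lambda>g. \<not> Q g) \<longleftrightarrow> (\<forall>q\<le>p. \<not> ae q Q)"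
proof
  assume *: "\<forall>q\<le>p. \<not> ae q Q"
  show "ae p (\<lambda>g. \<not> Q g)"
    by (rule ae_dense[OF bp_not[OF assms]]) (metis * ae_decide[OF assms] order_trans)
qed (metis ae_contr ae_mono)

lemma ae_ex:
  assumes "\<And>x :: 'c::countable. bp S (Q x)" "ae p (\<lambda>g. \<exists>x. Q x g)"
  obtains q x where "q \<le> p" "ae q (Q x)"
proof (rule ccontr)
  assume "\<not> thesis"
  then have "ae p (\<lambda>g. \<not> Q x g)" for x using that ae_not_iff[OF assms(1)] by blast
  then have "ae p (\<lambda>g. \<forall>x. \<not> Q x g)" by (rule ae_all)
  then show False using assms(2) ae_contr[of p "\<lambda>g. \<exists>x. Q x g"] by simp
qed

lemma ae_value:
  assumes "\<And>c :: 'c::countable. bp S (\<lambda>g. f g = c)"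
  obtains q c where "q \<le> p" "ae q (\<lambda>g. f g = c)"
  using ae_ex[of S "\<lambda>c g. f g = c" p] assms by (auto intro: aeI)

text \<open>A statement with support S is decided by S-supported conditions, and those below the
  S-part of p are compatible with p, so they cannot refute what p makes true. This frees the
  coordinates outside S for new information.\<close>

lemma ae_rs:
  assumes "bp S Q" "ae p Q" shows "ae (rs S p) Q"
proof (rule ae_dense[OF assms(1)])
  fix q assume q: "q \<le> rs S p"
  obtain D where D: "\<And>n. dns (D n)"
    "\<And>p. rs S p = p \<Longrightarrow> \<exists>q\<le>p. rs S q = q \<and> (dec D Q q \<or> dec D (\<lambda>g. \<not> Q g) q)"
    using assms(1) unfolding bp_def by blast
  obtain q' where q': "q' \<le> rs S q" "rs S q' = q'" "dec D Q q' \<or> dec D (\<lambda>g. \<not> Q g) q'"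
    using D(2)[of "rs S q"] by (auto simp: rs_rs)
  have "q' \<le> rs S p" using q' rs_mono[OF q, of S] by (simp add: rs_rs)
  then have "join p q' \<le> p" using amalg q' by blast
  then have "ae (join p q') Q" using assms(2) ae_mono by blast
  then have "\<not> dec D (\<lambda>g. \<not> Q g) q'"
    using ae_contr[of "join p q'" Q] D(1) dec_mono[OF _ join_le2] unfolding ae_def by blast
  then have "ae q' Q" using q' D(1) unfolding ae_def by blast
  then show "\<exists>r\<le>q. ae r Q" using amalg(1)[OF q'(2,1)] join_le2 ae_mono by blast
qed

text \<open>The truth lemma of forcing in this setting; regularity enters because a condition not
  forcing \<phi> then has an extension forcing the negation.\<close>

lemma ae_ev: assumes "reg \<phi>" shows "ae p (ev \<phi>) \<longleftrightarrow> \<phi> p"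
proof
  assume a: "ae p (ev \<phi>)"
  show "\<phi> p"
  proof (rule reg_contr[OF assms])
    fix q assume q: "q \<le> p" "(\<^bold>\<not> \<phi>) q"
    obtain g where g: "ext q g" "ev \<phi> g" using ae_witness ae_mono[OF a q(1)] by blast
    then obtain r where "ext r g" "\<phi> r" unfolding ev_def by blast
    then show False using q(2) ext_compat[OF g(1)] reg_mono[OF assms] unfolding fneg_def by blast
  qed
qed (rule aeI, auto simp: ev_def)

lemma bp_ev_UNIV [bp_intros]: "reg \<phi> \<Longrightarrow> bp UNIV (ev \<phi>)"
  by (rule bp_ev) auto

subsection \<open>Countable supports\<close>

lemma countable_conditions:
  assumes "countable S" shows "countable {p :: 'l cohen. rs S p = p}"
proof -
  let ?G = "\<lambda>p :: 'l cohen. {(x, b). Rep_cohen p x = Some b}"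
  have "?G ` {p. rs S p = p} \<subseteq> {F. finite F \<and> F \<subseteq> (S \<times> UNIV) \<times> UNIV}"
  proof safe
    fix p :: "'l cohen" assume p: "rs S p = p"
    have "?G p = (\<lambda>x. (x, the (Rep_cohen p x))) ` dom (Rep_cohen p)" by force
    then show "finite (?G p)" using finite_Rep[of p] by simp
    fix a n b assume "Rep_cohen p (a, n) = Some b"
    then have "Rep_cohen (rs S p) (a, n) = Some b" using p by simp
    then show "a \<in> S" by (auto simp: Rep_rs restrict_map_def split: if_splits)
  qed auto
  moreover have "countable {F. finite F \<and> F \<subseteq> (S \<times> (UNIV :: nat set)) \<times> (UNIV :: bool set)}"
    by (rule countable_Collect_finite_subset) (simp add: assms)
  ultimately have c: "countable (?G ` {p. rs S p = p})" using countable_subset by blast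
  have "inj ?G"
  proof (rule injI)
    fix p q assume e: "?G p = ?G q"
    have "Rep_cohen p x = Rep_cohen q x" for x
    proof (cases "Rep_cohen p x")
      case None
      then have "(x, b) \<notin> ?G q" for b unfolding e[symmetric] by simp
      then show ?thesis using None by (cases "Rep_cohen q x") auto
    next
      case (Some b)
      then have "(x, b) \<in> ?G q" unfolding e[symmetric] by simp
      then show ?thesis using Some by simp
    qed
    then show "p = q" using Rep_cohen_inject by blast
  qed
  then show ?thesis using countable_image_inj_on[OF c] inj_on_subset[of ?G UNIV] by blast
qed

lemma finite_subset_mono_UN:
  assumes "finite A" "A \<subseteq> (\<Union>n. F n)" "\<And>m n :: nat. m \<le> n \<Longrightarrow> F m \<subseteq> F n"
  shows "\<exists>n. A \<subseteq> F n"
  using assms(1,2)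
proof (induction A rule: finite_induct)
  case (insert x A)
  then obtain m n where "A \<subseteq> F m" "x \<in> F n" by blast
  then have "insert x A \<subseteq> F (max m n)" using assms(3)[of m "max m n"] assms(3)[of n "max m n"] by auto
  then show ?case by blast
qed simp

text \<open>A Loewenheim-Skolem closure in place of maximal antichains: S is closed under
  \<open>w\<close>, which extends a condition not forcing \<phi> to one forcing the negation. If p
  forced \<phi> but its S-part did not, \<open>w\<close> of the S-part would be supported in S,
  hence compatible with p.\<close>

lemma countable_supp:
  assumes "reg \<phi>" shows "\<exists>S :: 'l set. countable S \<and> supp S \<phi>"
proof -
  define w where "w p = (SOME q. q \<le> p \<and> (\<^bold>\<not> \<phi>) q)" for p
  have w: "w p \<le> p" "(\<^bold>\<not> \<phi>) (w p)" if "\<not> \<phi> p" for p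
  proof -
    have "\<exists>q. q \<le> p \<and> (\<^bold>\<not> \<phi>) q" using that reg_contr[OF assms, of p] by blast
    then have "w p \<le> p \<and> (\<^bold>\<not> \<phi>) (w p)" unfolding w_def by (rule someI_ex)
    then show "w p \<le> p" "(\<^bold>\<not> \<phi>) (w p)" by auto
  qed
  \<comment> \<open>Only countably many conditions are supported in a countable set, so each stage
    stays countable; a finite support lies in one stage, so the union is closed under
    \<open>w\<close>.\<close>
  define st where "st S = S \<union> (\<Union>p\<in>{p. rs S p = p}. fst ` dom (Rep_cohen (w p)))" for S
  define Sn where "Sn n = (st ^^ n) {}" for n
  have Sn_Suc: "Sn (Suc n) = st (Sn n)" for n by (simp add: Sn_def)
  have cnt: "countable (Sn n)" for n
  proof (induction n)
    case (Suc n)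
    have "countable (fst ` dom (Rep_cohen (w p)))" for p by (intro countable_finite finite_imageI finite_Rep)
    then show ?case unfolding Sn_Suc st_def
      by (intro countable_Un countable_UN Suc countable_conditions) simp
  qed (simp add: Sn_def)
  have mono: "Sn m \<subseteq> Sn n" if "m \<le> n" for m n
    by (rule lift_Suc_mono_le[of Sn, OF _ that]) (auto simp: Sn_Suc st_def)
  let ?S = "\<Union>n. Sn n"
  have "\<phi> (rs ?S p)" if "\<phi> p" for p
  proof (rule ccontr)
    assume n: "\<not> \<phi> (rs ?S p)"
    let ?p = "rs ?S p"
    have "\<exists>n. fst ` dom (Rep_cohen ?p) \<subseteq> Sn n"
    proof -
      have 1: "finite (fst ` dom (Rep_cohen ?p))" by (simp add: finite_Rep)
      have 2: "fst ` dom (Rep_cohen ?p) \<subseteq> ?S" by (auto simp: Rep_rs restrict_map_def split: if_splits)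
      show ?thesis by (rule finite_subset_mono_UN[OF 1 2 mono])
    qed
    then obtain n where n': "fst ` dom (Rep_cohen ?p) \<subseteq> Sn n" by blast
    have "rs (Sn n) ?p = ?p" by (rule rs_idI[OF n'])
    then have "fst ` dom (Rep_cohen (w ?p)) \<subseteq> Sn (Suc n)" unfolding Sn_Suc st_def by blast
    then have "fst ` dom (Rep_cohen (w ?p)) \<subseteq> ?S" by blast
    then have ws: "rs ?S (w ?p) = w ?p" by (rule rs_idI)
    have "join p (w ?p) \<le> p" using amalg[OF ws] w(1)[OF n] by blast
    then have "\<phi> (join p (w ?p))" using that reg_mono[OF assms] by blast
    then show False using w(2)[OF n] join_le2 unfolding fneg_def by blast
  qed
  then show ?thesis using cnt by (intro exI[of _ ?S]) (auto simp: supp_def)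
qed

subsection \<open>Functions with the Baire property\<close>

definition bpf :: "'l set \<Rightarrow> ('l gen \<Rightarrow> 'c) \<Rightarrow> bool" where
  "bpf S f \<longleftrightarrow> (\<forall>c. bp S (\<lambda>g. f g = c))"

lemma bpfD: "bpf S f \<Longrightarrow> bp S (\<lambda>g. f g = c)" by (simp add: bpf_def)

lemma bpf_mono: "bpf S f \<Longrightarrow> S \<subseteq> S' \<Longrightarrow> bpf S' f"
  unfolding bpf_def using bp_mono by blast

lemma bpf_UNIV: "bpf S f \<Longrightarrow> bpf UNIV f"
  by (rule bpf_mono) auto

lemma bpf_const [bp_intros]: "bpf S (\<lambda>g. c)"
  by (simp add: bpf_def bp_const)

lemma bpf_bool: "bpf S Q \<longleftrightarrow> bp S Q"
proof
  assume "bpf S Q" then have "bp S (\<lambda>g. Q g = True)" by (rule bpfD) then show "bp S Q" by simp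
next
  assume *: "bp S Q"
  have "bp S (\<lambda>g. Q g = c)" for c using * bp_not[OF *] by (cases c) simp_all
  then show "bpf S Q" by (simp add: bpf_def)
qed

lemma bp_subst: assumes "bpf S (f :: _ \<Rightarrow> 'c::countable)" "\<And>c. bp S (Q c)" shows "bp S (\<lambda>g. Q (f g) g)"
  by (rule bp_cong[OF bp_ex[OF bp_conj[OF bpfD[OF assms(1)] assms(2)]]]) auto

lemma bpf_app: assumes "bpf S (f :: _ \<Rightarrow> 'c::countable)" shows "bpf S (\<lambda>g. h (f g))"
  unfolding bpf_def
proof
  fix c
  show "bp S (\<lambda>g. h (f g) = c)" by (rule bp_subst[OF assms, of "\<lambda>x g. h x = c"]) (rule bp_const)
qed

lemma bpf_app2:
  assumes "bpf S (f :: _ \<Rightarrow> 'c::countable)" "bpf S (f' :: _ \<Rightarrow> 'd::countable)"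
  shows "bpf S (\<lambda>g. h (f g) (f' g))"
  unfolding bpf_def
proof
  fix c
  show "bp S (\<lambda>g. h (f g) (f' g) = c)"
    by (rule bp_subst[OF assms(1), of "\<lambda>x g. h x (f' g) = c"], rule bp_subst[OF assms(2)]) (rule bp_const)
qed

lemma bp_app: "bpf S (f :: _ \<Rightarrow> 'c::countable) \<Longrightarrow> bp S (\<lambda>g. h (f g))"
  using bpf_app[of S f h] by (simp add: bpf_bool)

lemma bp_app2: "bpf S (f :: _ \<Rightarrow> 'c::countable) \<Longrightarrow> bpf S (f' :: _ \<Rightarrow> 'd::countable) \<Longrightarrow> bp S (\<lambda>g. h (f g) (f' g))"
  using bpf_app2[of S f f' h] by (simp add: bpf_bool)

lemma bpf_if [bp_intros]:
  assumes "bp S Q" "bpf S f" "bpf S h" shows "bpf S (\<lambda>g. if Q g then f g else h g)"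
  unfolding bpf_def
proof
  fix c
  show "bp S (\<lambda>g. (if Q g then f g else h g) = c)"
    by (rule bp_cong[of S "\<lambda>g. (Q g \<and> f g = c) \<or> (\<not> Q g \<and> h g = c)"])
       (auto intro!: bp_intros assms bpfD[OF assms(2)] bpfD[OF assms(3)])
qed

lemma bpf_Least [bp_intros]:
  assumes "\<And>n. bp S (Q n)" shows "bpf S (\<lambda>g. LEAST n :: nat. Q n g)"
  unfolding bpf_def
proof
  fix c
  \<comment> \<open>The second disjunct is the case without any such n, where \<open>LEAST\<close>
    has an unspecified but fixed value.\<close>
  have *: "(Q c g \<and> (\<forall>m. m < c \<longrightarrow> \<not> Q m g)) \<or> ((\<forall>n. \<not> Q n g) \<and> c = (LEAST n. False))
      \<longleftrightarrow> (LEAST n. Q n g) = c" for g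
  proof (cases "\<exists>n. Q n g")
    case True
    then show ?thesis by (metis LeastI_ex Least_le not_less_Least linorder_neqE_nat not_less)
  next
    case False
    then have "(LEAST n. Q n g) = (LEAST n. False)" by simp
    then show ?thesis using False by auto
  qed
  show "bp S (\<lambda>g. (LEAST n. Q n g) = c)"
    by (rule bp_cong[OF _ *]) (intro bp_intros assms)
qed

lemma bpf_map:
  assumes "\<And>i. bpf S (f i :: _ \<Rightarrow> 'c::countable)" shows "bpf S (\<lambda>g. map (\<lambda>i. f i g) [0..<n])"
proof (induction n)
  case (Suc n)
  have "bpf S (\<lambda>g. map (\<lambda>i. f i g) [0..<n] @ [f n g])" by (rule bpf_app2[OF Suc assms])
  then show ?case by simp
qed (simp add: bpf_const)

section \<open>Clopen subsets of Cantor space\<close>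

definition pre :: "bool list \<Rightarrow> (nat \<Rightarrow> bool) \<Rightarrow> bool" where
  "pre s x \<longleftrightarrow> (\<forall>i<length s. s ! i = x i)"

text \<open>
  A clopen set is coded by a list of finite strings, standing for the union of the basic sets they determine.
\<close>

type_synonym code = "bool list list"

definition clop :: "code \<Rightarrow> (nat \<Rightarrow> bool) set" where
  "clop e = {x. \<exists>s\<in>set e. pre s x}"

text \<open>Faithful to \<open>clop e\<close> only for N at least \<open>mx e\<close>: strings of e
  longer than N contribute nothing.\<close>

definition lev :: "nat \<Rightarrow> code \<Rightarrow> bool list set" where
  "lev N e = {t. length t = N \<and> (\<exists>s\<in>set e. prefix s t)}"

definition mx :: "code \<Rightarrow> nat" where
  "mx e = Max (insert 0 (length ` set e))"

definition mu :: "code \<Rightarrow> real" where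
  "mu e = card (lev (mx e) e) / 2 ^ mx e"

abbreviation rst :: "(nat \<Rightarrow> bool) \<Rightarrow> nat \<Rightarrow> bool list" where
  "rst x n \<equiv> map x [0..<n]"

lemma pre_rst [simp]: "pre (rst x n) x"
  by (simp add: pre_def)

lemma pre_eq_rst: "pre s x \<longleftrightarrow> s = rst x (length s)"
  unfolding pre_def by (subst list_eq_iff_nth_eq) simp

lemma pre_append: "pre (s @ t) x \<Longrightarrow> pre s x"
  unfolding pre_def by (metis length_append nth_append trans_less_add1)

lemma prefix_pre: "prefix s t \<Longrightarrow> pre t x \<Longrightarrow> pre s x"
  by (auto simp: prefix_def pre_append)

lemma pre_prefix: "pre s x \<Longrightarrow> pre t x \<Longrightarrow> length s \<le> length t \<Longrightarrow> prefix s t"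
proof -
  assume a: "pre s x" "pre t x" "length s \<le> length t"
  have "s = take (length s) t" using a by (auto simp: pre_def intro!: nth_equalityI)
  then show ?thesis by (metis take_is_prefix)
qed

lemma pre_exists: "\<exists>x. pre t x"
  by (rule exI[of _ "\<lambda>i. t ! i"]) (simp add: pre_def)

lemma le_mx: "s \<in> set e \<Longrightarrow> length s \<le> mx e"
  unfolding mx_def by (rule Max_ge) auto

lemma lev_iff_all: "mx e \<le> length t \<Longrightarrow> t \<in> lev (length t) e \<longleftrightarrow> (\<forall>x. pre t x \<longrightarrow> x \<in> clop e)"
proof safe
  fix x assume "t \<in> lev (length t) e" "pre t x"
  then show "x \<in> clop e" unfolding lev_def clop_def using prefix_pre by blast
next
  assume a: "mx e \<le> length t" "\<forall>x. pre t x \<longrightarrow> x \<in> clop e"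
  obtain x where x: "pre t x" using pre_exists by blast
  then obtain s where s: "s \<in> set e" "pre s x" using a by (auto simp: clop_def)
  then have "prefix s t" using x pre_prefix le_mx a by (meson le_trans)
  then show "t \<in> lev (length t) e" using s by (auto simp: lev_def)
qed

lemma lev_iff_ex: "mx e \<le> length t \<Longrightarrow> pre t x \<Longrightarrow> t \<in> lev (length t) e \<longleftrightarrow> x \<in> clop e"
proof safe
  assume "mx e \<le> length t" "pre t x" "t \<in> lev (length t) e"
  then show "x \<in> clop e" using lev_iff_all by blast
next
  assume a: "mx e \<le> length t" "pre t x" "x \<in> clop e"
  then obtain s where s: "s \<in> set e" "pre s x" by (auto simp: clop_def)
  then have "prefix s t" using a pre_prefix le_mx by (meson le_trans)
  then show "t \<in> lev (length t) e" using s by (auto simp: lev_def)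
qed

lemma lev_rst: "mx e \<le> N \<Longrightarrow> rst x N \<in> lev N e \<longleftrightarrow> x \<in> clop e"
  using lev_iff_ex[of e "rst x N" x] by simp

lemma lev_length: "t \<in> lev N e \<Longrightarrow> length t = N" by (simp add: lev_def)

lemma lev_mem: "mx e \<le> N \<Longrightarrow> t \<in> lev N e \<longleftrightarrow> length t = N \<and> (\<forall>x. pre t x \<longrightarrow> x \<in> clop e)"
  using lev_iff_all[of e t] lev_length[of t N e] by auto

lemma finite_strings: "finite {t :: bool list. length t = N}"
  using finite_lists_length_eq[of "UNIV :: bool set" N] by simp

lemma card_strings: "card {t :: bool list. length t = N} = 2 ^ N"
  using card_lists_length_eq[of "UNIV :: bool set" N] by simp

lemma finite_lev [simp]: "finite (lev N e)"
  by (rule finite_subset[OF _ finite_strings[of N]]) (auto simp: lev_def)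

lemma card_lev_Suc: assumes "mx e \<le> N" shows "card (lev (Suc N) e) = 2 * card (lev N e)"
proof -
  have "lev (Suc N) e = (\<lambda>(t, b). t @ [b]) ` (lev N e \<times> UNIV)"
  proof safe
    fix t assume t: "t \<in> lev (Suc N) e"
    then obtain s b where sb: "t = s @ [b]" "length s = N"
      by (metis lev_length length_Suc_conv_rev)
    obtain u where u: "u \<in> set e" "prefix u t" using t by (auto simp: lev_def)
    then have "prefix u s" using sb le_mx[OF u(1)] assms by (auto simp: prefix_snoc)
    then have "s \<in> lev N e" using u sb by (auto simp: lev_def)
    then show "t \<in> (\<lambda>(t, b). t @ [b]) ` (lev N e \<times> UNIV)" using sb by force
  next
    fix t b assume "t \<in> lev N e"
    then show "t @ [b] \<in> lev (Suc N) e" by (auto simp: lev_def)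
  qed
  moreover have "inj_on (\<lambda>(t, b). t @ [b]) (lev N e \<times> (UNIV :: bool set))" by (auto simp: inj_on_def)
  ultimately have "card (lev (Suc N) e) = card (lev N e \<times> (UNIV :: bool set))" by (simp add: card_image)
  then show ?thesis by (simp add: card_cartesian_product)
qed

lemma mu_lev: assumes "mx e \<le> N" shows "card (lev N e) = mu e * 2 ^ N"
  using assms
proof (induction N rule: dec_induct)
  case base then show ?case by (simp add: mu_def)
next
  case (step N) then show ?case using card_lev_Suc[of e N] by simp
qed

lemma mu_eq_lev: "mx e \<le> N \<Longrightarrow> mu e = card (lev N e) / 2 ^ N"
  using mu_lev[of e N] by (simp add: field_simps)

lemma mu_mono: assumes "clop e \<subseteq> clop e'" shows "mu e \<le> mu e'"
proof -
  define N where "N = max (mx e) (mx e')"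
  have "lev N e \<subseteq> lev N e'" 
  proof
    fix t assume "t \<in> lev N e"
    then have "length t = N \<and> (\<forall>x. pre t x \<longrightarrow> x \<in> clop e)" using lev_mem[of e N t] by (simp add: N_def)
    then show "t \<in> lev N e'" using assms lev_mem[of e' N t] unfolding N_def by fastforce
  qed
  then have "card (lev N e) \<le> card (lev N e')" by (simp add: card_mono)
  then show ?thesis using mu_eq_lev[of e N] mu_eq_lev[of e' N] by (simp add: N_def divide_right_mono)
qed

lemma clop_append [simp]: "clop (e @ e') = clop e \<union> clop e'" by (auto simp: clop_def)
lemma clop_Nil [simp]: "clop [] = {}" by (simp add: clop_def)
lemma clop_concat: "clop (concat es) = (\<Union>e\<in>set es. clop e)" by (auto simp: clop_def)

lemma mx_append: "mx (e @ e') = max (mx e) (mx e')"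
  unfolding mx_def by (simp add: image_Un flip: Max_Un)

lemma lev_append: "lev N (e @ e') = lev N e \<union> lev N e'" by (auto simp: lev_def)

lemma mu_append: "mu (e @ e') \<le> mu e + mu e'"
proof -
  define N where "N = max (mx e) (mx e')"
  have "card (lev N (e @ e')) \<le> card (lev N e) + card (lev N e')" by (simp add: lev_append card_Un_le)
  then have "real (card (lev N (e @ e'))) \<le> real (card (lev N e)) + real (card (lev N e'))" by linarith
  then show ?thesis using mu_eq_lev[of e N] mu_eq_lev[of e' N] mu_eq_lev[of "e @ e'" N]
    by (simp add: N_def mx_append add_divide_distrib[symmetric] divide_right_mono)
qed

lemma mu_Nil [simp]: "mu [] = 0" by (simp add: mu_def lev_def)

lemma mu_le_1: "mu e \<le> 1"
proof -
  have "card (lev (mx e) e) \<le> 2 ^ mx e"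
    unfolding card_strings[symmetric] by (rule card_mono[OF finite_strings]) (auto simp: lev_def)
  then have "real (card (lev (mx e) e)) \<le> 2 ^ mx e" by (metis of_nat_le_iff of_nat_numeral of_nat_power)
  then show ?thesis by (simp add: mu_def)
qed

lemma mu_single: "mu [s] = 1 / 2 ^ length s"
proof -
  have "lev (length s) [s] = {s}" by (auto simp: lev_def prefix_def)
  then show ?thesis by (simp add: mu_def mx_def)
qed

lemma mu_concat_le:
  fixes c :: real
  assumes "\<And>d. d \<in> set ds \<Longrightarrow> mu d \<le> c" "0 \<le> c"
  shows "mu (concat ds) \<le> length ds * c"
  using assms(1)
proof (induction ds)
  case (Cons d ds)
  have "mu (concat (d # ds)) \<le> mu d + mu (concat ds)" by (simp add: mu_append)
  also have "\<dots> \<le> c + length ds * c" using Cons by (intro add_mono) auto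
  finally show ?case by (simp add: algebra_simps)
qed simp

lemma mu_concat_geometric:
  assumes "\<And>k. mu (E k) \<le> 1 / 2 ^ (k + 2)" "a \<le> b"
  shows "mu (concat (map E [a..<b])) \<le> 1 / 2 ^ (a + 1) - 1 / 2 ^ (b + 1)"
  using assms(2)
proof (induction b rule: dec_induct)
  case (step b)
  have "mu (concat (map E [a..<Suc b])) \<le> mu (concat (map E [a..<b])) + mu (E b)"
    using step by (simp add: mu_append)
  also have "\<dots> \<le> 1 / 2 ^ (a + 1) - 1 / 2 ^ (b + 1) + 1 / 2 ^ (b + 2)" using step assms(1)[of b] by simp
  finally show ?case by (simp add: field_simps)
qed simp

text \<open>The weaker of two measure conditions on sequences: \<open>Omega_bar_vanishing\<close>
  obtains it from membership in \<open>Omega_bar\<close>, while \<open>tail\<close> below yields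
  membership (\<open>Omega_bar_tail\<close>). Measuring finite unions in \<open>tail\<close> avoids
  infinite sums.\<close>

definition vanishing :: "(nat \<Rightarrow> code) \<Rightarrow> bool" where
  "vanishing d \<longleftrightarrow> (\<forall>k. \<exists>m. \<forall>n\<ge>m. mu (d n) \<le> 1 / 2 ^ k)"

definition tail :: "(nat \<Rightarrow> code) \<Rightarrow> bool" where
  "tail d \<longleftrightarrow> (\<forall>k. \<exists>m. \<forall>M. mu (concat (map d [m..<M])) \<le> 1 / 2 ^ k)"

lemma tail_imp_vanishing: assumes "tail d" shows "vanishing d"
  unfolding vanishing_def
proof
  fix k
  obtain m where m: "\<And>M. mu (concat (map d [m..<M])) \<le> 1 / 2 ^ k" using assms unfolding tail_def by blast
  have "mu (d n) \<le> 1 / 2 ^ k" if "n \<ge> m" for n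
  proof -
    have "mu (d n) \<le> mu (concat (map d [m..<Suc n]))"
      by (rule mu_mono) (use that in \<open>auto simp: clop_concat\<close>)
    also have "\<dots> \<le> 1 / 2 ^ k" by (rule m)
    finally show ?thesis .
  qed
  then show "\<exists>m. \<forall>n\<ge>m. mu (d n) \<le> 1 / 2 ^ k" by blast
qed

text \<open>Shrinking cones around x turn a single real into a sequence; a sequence that covers
  these cones on a set of the ultrafilter has x in its null set.\<close>

definition sq :: "(nat \<Rightarrow> bool) \<Rightarrow> nat \<Rightarrow> code" where
  "sq x n = [rst x n]"

lemma mem_clop_sq [simp]: "x \<in> clop (sq x n)" by (simp add: clop_def sq_def)

lemma tail_sq: "tail (sq x)"
  unfolding tail_def
proof
  fix k
  have "mu (concat (map (sq x) [k..<M])) \<le> 1 / 2 ^ k" for M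
  proof -
    have "clop (concat (map (sq x) [k..<M])) \<subseteq> clop [rst x k]"
      by (auto simp: clop_concat sq_def clop_def pre_def)
    then have "mu (concat (map (sq x) [k..<M])) \<le> mu [rst x k]" by (rule mu_mono)
    then show ?thesis by (simp add: mu_single)
  qed
  then show "\<exists>m. \<forall>M. mu (concat (map (sq x) [m..<M])) \<le> 1 / 2 ^ k" by blast
qed

subsection \<open>Leftmost branches\<close>

definition inf_above :: "(bool list \<Rightarrow> bool) \<Rightarrow> bool list \<Rightarrow> bool" where
  "inf_above T s \<longleftrightarrow> (\<forall>N. \<exists>t. length t = N \<and> T (s @ t))"

text \<open>Going left whenever the left subtree is infinite makes the branch a countable Boolean
  combination of the values of T, so it inherits the Baire property from T
  (\<open>bp_lb\<close>).\<close>

primrec br :: "(bool list \<Rightarrow> bool) \<Rightarrow> nat \<Rightarrow> bool list" where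
  "br T 0 = []"
| "br T (Suc n) = br T n @ [\<not> inf_above T (br T n @ [False])]"

definition lb :: "(bool list \<Rightarrow> bool) \<Rightarrow> nat \<Rightarrow> bool" where
  "lb T n = (\<not> inf_above T (br T n @ [False]))"

lemma rst_lb: "rst (lb T) n = br T n"
  by (induction n) (simp_all add: lb_def)

lemma konig:
  assumes "\<And>s t. T (s @ t) \<Longrightarrow> T s" "\<And>N. \<exists>t. length t = N \<and> T t"
  shows "T (rst (lb T) n)"
proof -
  have step: "inf_above T (s @ [True])" if s: "inf_above T s" and n: "\<not> inf_above T (s @ [False])" for s
    unfolding inf_above_def
  proof
    fix N
    obtain N' where N': "\<And>t. length t = N' \<Longrightarrow> \<not> T ((s @ [False]) @ t)"
      using n unfolding inf_above_def by blast
    \<comment> \<open>Long enough for both purposes: cut at N' it would refute a left turn, cut at N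
      it is the required node after the right turn.\<close>
    obtain t where t: "length t = Suc (max N N')" "T (s @ t)" using s unfolding inf_above_def by blast
    then obtain b u where bu: "t = b # u" "length u = max N N'" by (cases t) auto
    have *: "T ((s @ [b]) @ take M u)" for M
      by (rule assms(1)[of _ "drop M u"]) (use t bu in simp)
    have b: "b"
    proof (rule ccontr)
      assume "\<not> b"
      then have "T ((s @ [False]) @ take N' u)" using *[of N'] by simp
      then show False using N'[of "take N' u"] bu by simp
    qed
    show "\<exists>t. length t = N \<and> T ((s @ [True]) @ t)"
      by (rule exI[of _ "take N u"]) (use *[of N] b bu in simp)
  qed
  have "inf_above T (br T n)"
  proof (induction n)
    case 0 then show ?case using assms(2) by (simp add: inf_above_def)
  next
    case (Suc n)
    then show ?case using step[of "br T n"] by (cases "inf_above T (br T n @ [False])") auto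
  qed
  then show ?thesis unfolding rst_lb inf_above_def by (metis append_Nil2 length_0_conv)
qed

text \<open>An infinite branch is a point of \<open>clop e\<close> outside all \<open>d n\<close>
  with m \<le> n; an empty level N means that the finitely many \<open>d n\<close> with m \<le> n <
  N cover \<open>clop e\<close>. The bound n < \<open>length s\<close> keeps every node's
  requirement finite.\<close>

definition covT :: "(nat \<Rightarrow> code) \<Rightarrow> nat \<Rightarrow> code \<Rightarrow> bool list \<Rightarrow> bool" where
  "covT d m e s \<longleftrightarrow> (\<exists>x. pre s x \<and> x \<in> clop e) \<and>
     (\<forall>n. m \<le> n \<and> n < length s \<longrightarrow> \<not> (\<forall>x. pre s x \<longrightarrow> x \<in> clop (d n)))"

lemma covT_prefix: "covT d m e (s @ t) \<Longrightarrow> covT d m e s"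
  unfolding covT_def using pre_append by (metis length_append trans_less_add1)

lemma covT_branch:
  assumes "\<And>n. covT d m e (rst x n)"
  shows "x \<in> clop e" "\<And>n. m \<le> n \<Longrightarrow> x \<notin> clop (d n)"
proof -
  obtain y where y: "pre (rst x (mx e)) y" "y \<in> clop e" using assms[of "mx e"] unfolding covT_def by blast
  then show "x \<in> clop e"
    using lev_iff_ex[of e "rst x (mx e)" y] lev_iff_ex[of e "rst x (mx e)" x] by simp
  show "x \<notin> clop (d n)" if "m \<le> n" for n
  proof
    assume x: "x \<in> clop (d n)"
    \<comment> \<open>At this length the cone around x lies inside \<open>clop (d n)\<close>, and n
      is among the indices the node tests.\<close>
    define N where "N = max (mx (d n)) (Suc n)"
    have "\<forall>y. pre (rst x N) y \<longrightarrow> y \<in> clop (d n)"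
      using x lev_rst[of "d n" N x] lev_mem[of "d n" N "rst x N"] by (simp add: N_def)
    moreover have "n < length (rst x N)" by (simp add: N_def)
    ultimately show False using assms[of N] that unfolding covT_def by blast
  qed
qed

lemma covT_finite:
  assumes "\<And>s. length s = N \<Longrightarrow> \<not> covT d m e s"
  shows "clop e \<subseteq> clop (concat (map d [m..<N]))"
proof
  fix x assume x: "x \<in> clop e"
  then obtain n where "m \<le> n" "n < N" "\<forall>y. pre (rst x N) y \<longrightarrow> y \<in> clop (d n)"
    using assms[of "rst x N"] unfolding covT_def by (metis pre_rst length_map length_upt minus_nat.diff_0)
  then show "x \<in> clop (concat (map d [m..<N]))" using pre_rst by (auto simp: clop_concat intro!: bexI[of _ n])
qed

text \<open>An empty level would cover e by a finite union of smaller measure, so the tree has nodes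
  of every length and the leftmost branch applies.\<close>

lemma covT_small_branch:
  assumes "\<And>M. mu (concat (map d [m..<M])) < mu e"
  shows "lb (covT d m e) \<in> clop e" "\<And>n. m \<le> n \<Longrightarrow> lb (covT d m e) \<notin> clop (d n)"
proof -
  have "\<exists>t. length t = N \<and> covT d m e t" for N
  proof (rule ccontr)
    assume "\<not> ?thesis"
    then have "clop e \<subseteq> clop (concat (map d [m..<N]))" using covT_finite by blast
    then show False using mu_mono assms[of N] by (simp add: linorder_not_le[symmetric])
  qed
  then have "covT d m e (rst (lb (covT d m e)) n)" for n using konig[of "covT d m e"] covT_prefix by blast
  then show "lb (covT d m e) \<in> clop e" "\<And>n. m \<le> n \<Longrightarrow> lb (covT d m e) \<notin> clop (d n)"
    using covT_branch by blast+
qed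

subsection \<open>A null limes superior has terms of measure tending to zero\<close>

text \<open>
  If infinitely many of the \<open>d\<^sub>n\<close> (those with \<open>a n\<close>) have measure above \<open>2\<^bsup>-k\<^esup>\<close>, split \<open>\<omega>\<close> into
  intervals so that the union over the \<open>i\<close>-th interval exhausts up to \<open>2\<^bsup>-(k+i+3)\<^esup>\<close> the measure still
  obtainable. The set of points in all these unions then keeps measure above \<open>2\<^bsup>-(k+1)\<^esup>\<close> and is not
  covered by an open set \<open>u\<close> of smaller measure. A point outside \<open>u\<close> is found as a branch of a tree, so
  that it can be computed from the data.
\<close>

definition BB :: "(nat \<Rightarrow> bool) \<Rightarrow> (nat \<Rightarrow> code) \<Rightarrow> nat \<Rightarrow> nat \<Rightarrow> code" where
  "BB a d m M = concat (map d (filter a [m..<M]))"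

definition good_step :: "(nat \<Rightarrow> bool) \<Rightarrow> (nat \<Rightarrow> code) \<Rightarrow> nat \<Rightarrow> nat \<Rightarrow> nat \<Rightarrow> nat \<Rightarrow> bool" where
  "good_step a d k i m M \<longleftrightarrow> m < M \<and> (\<forall>M'. mu (BB a d m M') \<le> mu (BB a d m M) + 1 / 2 ^ (k + i + 3))"

primrec Ms :: "(nat \<Rightarrow> bool) \<Rightarrow> (nat \<Rightarrow> code) \<Rightarrow> nat \<Rightarrow> nat \<Rightarrow> nat" where
  "Ms a d k 0 = 0"
| "Ms a d k (Suc i) = (LEAST M. good_step a d k i (Ms a d k i) M)"

abbreviation Bi :: "(nat \<Rightarrow> bool) \<Rightarrow> (nat \<Rightarrow> code) \<Rightarrow> nat \<Rightarrow> nat \<Rightarrow> code" where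
  "Bi a d k i \<equiv> BB a d (Ms a d k i) (Ms a d k (Suc i))"

text \<open>Here u marks the strings whose cones lie in the open set to be avoided.\<close>

definition hit_tree :: "(nat \<Rightarrow> bool) \<Rightarrow> (nat \<Rightarrow> code) \<Rightarrow> nat \<Rightarrow> (bool list \<Rightarrow> bool) \<Rightarrow> bool list \<Rightarrow> bool" where
  "hit_tree a d k u s \<longleftrightarrow> \<not> u s \<and> (\<forall>i. i < length s \<longrightarrow> (\<exists>x. pre s x \<and> x \<in> clop (Bi a d k i)))"

lemma clop_BB: "clop (BB a d m M) = (\<Union>n\<in>{n. a n \<and> m \<le> n \<and> n < M}. clop (d n))"
  unfolding BB_def clop_concat by auto

lemma good_step_exists: "\<exists>M. good_step a d k i m M"
proof -
  let ?S = "range (\<lambda>M. mu (BB a d m M))" and ?\<delta> = "1 / 2 ^ (k + i + 3) :: real"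
  have bdd: "bdd_above ?S" by (rule bdd_aboveI[of _ 1]) (auto simp: mu_le_1)
  have "Sup ?S - ?\<delta> < Sup ?S" by simp
  then obtain M0 where M0: "Sup ?S - ?\<delta> < mu (BB a d m M0)"
    using less_cSup_iff[OF _ bdd, of "Sup ?S - ?\<delta>"] by auto
  have le: "mu (BB a d m M') \<le> Sup ?S" for M' by (rule cSup_upper[OF _ bdd]) simp
  \<comment> \<open>Passing to the maximum with \<open>Suc m\<close> secures m < M and does not
    shrink the union.\<close>
  have "mu (BB a d m M0) \<le> mu (BB a d m (max M0 (Suc m)))"
    by (rule mu_mono) (auto simp: clop_BB)
  then have "mu (BB a d m M') \<le> mu (BB a d m (max M0 (Suc m))) + ?\<delta>" for M' using le[of M'] M0 by linarith
  then show ?thesis unfolding good_step_def by (intro exI[of _ "max M0 (Suc m)"]) auto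
qed

lemma Ms_step: "good_step a d k i (Ms a d k i) (Ms a d k (Suc i))"
  using LeastI_ex[OF good_step_exists] by simp

lemma Ms_mono: "i \<le> j \<Longrightarrow> Ms a d k i \<le> Ms a d k j"
  using lift_Suc_mono_le[of "Ms a d k" i j] Ms_step[of a d k] unfolding good_step_def by (meson less_imp_le)

lemma Ms_ge: "i \<le> Ms a d k i"
proof (induction i)
  case (Suc i)
  have "Ms a d k i < Ms a d k (Suc i)" using Ms_step unfolding good_step_def by blast
  then show ?case using Suc by linarith
qed simp

lemma card_Int_ge:
  fixes N :: nat
  assumes "finite A"
  shows "card A \<le> card {x\<in>A. \<forall>i<N. x \<in> B i} + (\<Sum>i<N. card (A - B i))"
proof -
  have "A \<subseteq> {x\<in>A. \<forall>i<N. x \<in> B i} \<union> (\<Union>i<N. A - B i)" by auto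
  then have "card A \<le> card ({x\<in>A. \<forall>i<N. x \<in> B i} \<union> (\<Union>i<N. A - B i))"
    by (rule card_mono[rotated]) (use assms in auto)
  also have "\<dots> \<le> card {x\<in>A. \<forall>i<N. x \<in> B i} + card (\<Union>i<N. A - B i)" by (rule card_Un_le)
  also have "card (\<Union>i<N. A - B i) \<le> (\<Sum>i<N. card (A - B i))" by (rule card_UN_le) simp
  finally show ?thesis by simp
qed

lemma geom_sum: "(\<Sum>i<N. 1 / 2 ^ (k + i + 3)) = 1 / 2 ^ (k + 2) - (1 / 2 ^ (k + N + 2) :: real)"
proof (induction N)
  case (Suc N)
  then show ?case by (simp add: power_add)
qed simp

text \<open>Start from the N-th union, of measure above 2^-k - 2^-(k+N+3). Missing the i-th union
  costs at most 2^-(k+i+3), since both lie in one union starting where the i-th does, which the i-th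
  nearly exhausts. These costs total less than 2^-(k+2), leaving more than the 2^-(k+1) that u can
  occupy.\<close>

lemma hit_tree_level:
  assumes inf: "\<And>m. \<exists>n\<ge>m. a n" and big: "\<And>n. a n \<Longrightarrow> 1 / 2 ^ k < mu (d n)"
    and up: "\<And>s t. u s \<Longrightarrow> u (s @ t)"
    and u: "\<And>N. card {s. length s = N \<and> u s} * 2 ^ (k + 1) \<le> (2 :: nat) ^ N"
  shows "\<exists>s. length s = N \<and> hit_tree a d k u s"
proof -
  let ?B = "Bi a d k" and ?m = "Ms a d k"
  \<comment> \<open>A common level at which all the unions up to N are represented
    faithfully.\<close>
  define L where "L = max N (Max ((\<lambda>i. mx (?B i)) ` {..N}))"
  have L: "mx (?B i) \<le> L" if "i \<le> N" for i
    unfolding L_def using that by (intro max.coboundedI2 Max_ge) auto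
  let ?A = "lev L (?B N)" and ?C = "\<lambda>i. lev L (?B i)"
  have diff: "real (card (?A - ?C i)) \<le> 1 / 2 ^ (k + i + 3) * 2 ^ L" if i: "i < N" for i
  proof -
    have "card (?A \<union> ?C i) = card (?A - ?C i) + card (?C i)"
      by (metis Un_Diff_cancel2 card_Un_disjoint finite_Diff finite_lev Diff_disjoint Int_commute)
    then have "real (card (?A - ?C i)) = card (?A \<union> ?C i) - real (card (?C i))" by simp
    also have "card (?A \<union> ?C i) = mu (?B N @ ?B i) * 2 ^ L"
      unfolding lev_append[symmetric] by (rule mu_lev) (use L i in \<open>simp add: mx_append\<close>)
    also have "real (card (?C i)) = mu (?B i) * 2 ^ L" by (rule mu_lev) (use L i in simp)
    also have "mu (?B N @ ?B i) \<le> mu (BB a d (?m i) (?m (Suc N)))"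
    proof (rule mu_mono)
      have "?m i \<le> ?m N" "?m (Suc i) \<le> ?m (Suc N)" by (rule Ms_mono; use i in simp)+
      then show "clop (?B N @ ?B i) \<subseteq> clop (BB a d (?m i) (?m (Suc N)))"
        unfolding clop_append clop_BB by auto
    qed
    also have "\<dots> \<le> mu (?B i) + 1 / 2 ^ (k + i + 3)" using Ms_step unfolding good_step_def by blast
    finally show ?thesis by (simp add: algebra_simps)
  qed
  have "1 / 2 ^ k - 1 / 2 ^ (k + N + 3) < mu (?B N)"
  proof -
    obtain n where n: "n \<ge> ?m N" "a n" using inf by blast
    have "mu (d n) \<le> mu (BB a d (?m N) (Suc n))" by (rule mu_mono) (use n in \<open>auto simp: clop_BB\<close>)
    also have "\<dots> \<le> mu (?B N) + 1 / 2 ^ (k + N + 3)" using Ms_step unfolding good_step_def by blast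
    finally show ?thesis using big[OF n(2)] by linarith
  qed
  then have "(1 / 2 ^ k - 1 / 2 ^ (k + N + 3)) * 2 ^ L < mu (?B N) * 2 ^ L"
    by (rule mult_strict_right_mono) simp
  also have "mu (?B N) * 2 ^ L = card ?A" by (rule mu_lev[symmetric]) (use L in simp)
  finally have f1: "(1 / 2 ^ k - 1 / 2 ^ (k + N + 3)) * 2 ^ L < real (card ?A)" .
  have f2: "real (card ?A) \<le> real (card {x\<in>?A. \<forall>i<N. x \<in> ?C i}) + real (\<Sum>i<N. card (?A - ?C i))"
    unfolding of_nat_add[symmetric] of_nat_le_iff by (rule card_Int_ge) simp
  have "real (\<Sum>i<N. card (?A - ?C i)) \<le> (\<Sum>i<N. 1 / 2 ^ (k + i + 3) * 2 ^ L)"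
    unfolding of_nat_sum by (rule sum_mono, rule diff) simp
  then have f3: "real (\<Sum>i<N. card (?A - ?C i)) \<le> (1 / 2 ^ (k + 2) - 1 / 2 ^ (k + N + 2)) * 2 ^ L"
    unfolding sum_distrib_right[symmetric] geom_sum .
  \<comment> \<open>The right side equals 3/4 * 2^-k + 1/8 * 2^-(k+N).\<close>
  have "1 / 2 ^ (k + 1) \<le> (1 / 2 ^ k - 1 / 2 ^ (k + N + 3)) - (1 / 2 ^ (k + 2) - 1 / 2 ^ (k + N + 2) :: real)"
  proof -
    have "1 / 2 ^ (k + 1) = 1 / 2 * (1 / 2 ^ k :: real)" "1 / 2 ^ (k + 2) = 1 / 4 * (1 / 2 ^ k :: real)"
      "1 / 2 ^ (k + N + 3) = 1 / 8 * (1 / 2 ^ (k + N) :: real)" "1 / 2 ^ (k + N + 2) = 1 / 4 * (1 / 2 ^ (k + N) :: real)"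
      by (simp_all add: power_add)
    moreover have "0 \<le> (1 / 2 ^ k :: real)" "0 \<le> (1 / 2 ^ (k + N) :: real)" by simp_all
    ultimately show ?thesis by linarith
  qed
  then have "1 / 2 ^ (k + 1) * 2 ^ L \<le>
      ((1 / 2 ^ k - 1 / 2 ^ (k + N + 3)) - (1 / 2 ^ (k + 2) - 1 / 2 ^ (k + N + 2))) * (2 ^ L :: real)"
    by (rule mult_right_mono) simp
  then have "1 / 2 ^ (k + 1) * 2 ^ L < real (card {x\<in>?A. \<forall>i<N. x \<in> ?C i})"
    using f1 f2 f3 unfolding left_diff_distrib[of "1 / 2 ^ k - 1 / 2 ^ (k + N + 3)"] by linarith
  moreover have "real (card {s. length s = L \<and> u s}) \<le> 1 / 2 ^ (k + 1) * 2 ^ L"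
  proof -
    have "real (card {s. length s = L \<and> u s} * 2 ^ (k + 1)) \<le> real (2 ^ L)" using u of_nat_le_iff by blast
    then show ?thesis by (simp add: field_simps)
  qed
  ultimately have "card {s. length s = L \<and> u s} < card {x\<in>?A. \<forall>i<N. x \<in> ?C i}" by linarith
  then have "\<not> {x\<in>?A. \<forall>i<N. x \<in> ?C i} \<subseteq> {s. length s = L \<and> u s}"
    using card_mono[OF finite_subset[OF _ finite_strings[of L]], of "{s. length s = L \<and> u s}"]
    by (metis (no_types, lifting) mem_Collect_eq subsetI linorder_not_le)
  then obtain t where t: "t \<in> ?A" "\<And>i. i < N \<Longrightarrow> t \<in> ?C i" "length t = L" "\<not> u t"
    using lev_length by blast
  \<comment> \<open>The count takes place at level L; the prefix of length N is the node wanted, and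
    it avoids u because u is closed under extension.\<close>
  let ?s = "take N t"
  have len: "length ?s = N" using t L_def by simp
  obtain x where x: "pre t x" using pre_exists by blast
  have p: "pre ?s x" using x pre_append[of ?s "drop N t" x] by simp
  have c: "x \<in> clop (?B i)" if "i < N" for i
    using t(2)[OF that] x L[OF less_imp_le[OF that]] lev_mem[of "?B i" L t] by simp
  have n: "\<not> u ?s"
  proof
    assume "u ?s"
    then have "u (?s @ drop N t)" by (rule up)
    then show False using t(4) by simp
  qed
  have "hit_tree a d k u ?s" unfolding hit_tree_def len using p c n by (simp only: simp_thms) metis
  then show ?thesis using len by (intro exI[of _ ?s]) simp
qed

lemma hit_tree_branch:
  assumes inf: "\<And>m. \<exists>n\<ge>m. a n" and big: "\<And>n. a n \<Longrightarrow> 1 / 2 ^ k < mu (d n)"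
    and up: "\<And>s t. u s \<Longrightarrow> u (s @ t)"
    and u: "\<And>N. card {s. length s = N \<and> u s} * 2 ^ (k + 1) \<le> (2 :: nat) ^ N"
  defines "x \<equiv> lb (hit_tree a d k u)"
  shows "\<not> u (rst x n)" "\<exists>n\<ge>m. a n \<and> x \<in> clop (d n)"
proof -
  have "hit_tree a d k u s" if "hit_tree a d k u (s @ t)" for s t
    using that up pre_append unfolding hit_tree_def by (metis length_append trans_less_add1)
  moreover have "\<exists>s. length s = N \<and> hit_tree a d k u s" for N
    by (rule hit_tree_level) (use inf big up u in auto)
  ultimately have T: "hit_tree a d k u (rst x n)" for n
    unfolding x_def using konig[of "hit_tree a d k u"] by blast
  show "\<not> u (rst x n)" using T unfolding hit_tree_def by blast
  \<comment> \<open>Beyond m so that the node tests the m-th union, and long enough for the cone to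
    decide membership in it; by \<open>Ms_ge\<close> the index found there is at least m.\<close>
  define N where "N = max (mx (Bi a d k m)) (Suc m)"
  have "m < length (rst x N)" by (simp add: N_def)
  then obtain y where y: "pre (rst x N) y" "y \<in> clop (Bi a d k m)" using T[of N] unfolding hit_tree_def by blast
  have "x \<in> clop (Bi a d k m)"
    using y lev_iff_ex[of "Bi a d k m" "rst x N" y] lev_iff_ex[of "Bi a d k m" "rst x N" x]
    by (simp add: N_def)
  then obtain n where "a n" "Ms a d k m \<le> n" "x \<in> clop (d n)" unfolding clop_BB by blast
  then show "\<exists>n\<ge>m. a n \<and> x \<in> clop (d n)" using Ms_ge[of m a d k] le_trans by blast
qed

subsection \<open>The clopen sequence read off a Cohen real\<close>

text \<open>
  The Cohen real with index \<open>\<alpha>\<close> is read as an infinite sequence of pairs \<open>(n, e)\<close>. The \<open>k\<close>-th pair adds the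
  clopen set \<open>e\<close> to the \<open>n\<close>-th term of the sequence, provided that its measure is at most \<open>2\<^bsup>-(k+2)\<^esup>\<close>
  and \<open>k \<le> n\<close>.
\<close>

definition cohen_code :: "'l \<Rightarrow> 'l gen \<Rightarrow> nat \<Rightarrow> nat \<times> code" where
  "cohen_code \<alpha> g k = from_nat (LEAST j. g (\<alpha>, prod_encode (k, j)))"

text \<open>The bounds 2^-(k+2) add up to 1/2. Summability puts every coded sequence in
  \<open>Omega_bar\<close>, and the total being below 1 leaves a point outside all its terms
  (\<open>avoid_real\<close>).\<close>

definition cut :: "nat \<Rightarrow> nat \<times> code \<Rightarrow> code" where
  "cut k c = (if mu (snd c) \<le> 1 / 2 ^ (k + 2) then snd c else [])"

text \<open>Restricting to k \<le> n keeps each term a finite union, hence a code. This does not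
  hurt domination, since the index to be covered can be taken beyond any given k.\<close>

definition cohen_seq :: "'l \<Rightarrow> 'l gen \<Rightarrow> nat \<Rightarrow> code" where
  "cohen_seq \<alpha> g n = concat (map (\<lambda>k. if fst (cohen_code \<alpha> g k) = n then cut k (cohen_code \<alpha> g k) else []) [0..<Suc n])"

lemma mu_cut: "mu (cut k c) \<le> 1 / 2 ^ (k + 2)" by (simp add: cut_def)

lemma clop_cohen_seq: "clop (cohen_seq \<alpha> g n) = (\<Union>k\<in>{k. k \<le> n \<and> fst (cohen_code \<alpha> g k) = n}. clop (cut k (cohen_code \<alpha> g k)))"
proof -
  have "clop (cohen_seq \<alpha> g n) = (\<Union>k\<in>{..n}. clop (if fst (cohen_code \<alpha> g k) = n then cut k (cohen_code \<alpha> g k) else []))"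
    unfolding cohen_seq_def clop_concat set_map set_upt atLeast0LessThan lessThan_Suc_atMost by blast
  also have "\<dots> = (\<Union>k\<in>{k. k \<le> n \<and> fst (cohen_code \<alpha> g k) = n}. clop (cut k (cohen_code \<alpha> g k)))"
    by (auto split: if_splits)
  finally show ?thesis .
qed

text \<open>Only the requests from K on can contribute to the terms from m on, and their bounds form
  a geometric tail.\<close>

lemma mu_cohen_seq_interval:
  assumes "\<And>n k. m \<le> n \<Longrightarrow> k < K \<Longrightarrow> fst (cohen_code \<alpha> g k) \<noteq> n"
  shows "mu (concat (map (cohen_seq \<alpha> g) [m..<M])) \<le> 1 / 2 ^ (K + 1)"
proof -
  let ?E = "\<lambda>k. cut k (cohen_code \<alpha> g k)"
  have "clop (concat (map (cohen_seq \<alpha> g) [m..<M])) \<subseteq> clop (concat (map ?E [K..<K + M]))"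
  proof
    fix x assume "x \<in> clop (concat (map (cohen_seq \<alpha> g) [m..<M]))"
    then obtain n k where "m \<le> n" "n < M" "k \<le> n" "fst (cohen_code \<alpha> g k) = n" "x \<in> clop (?E k)"
      by (auto simp: clop_concat clop_cohen_seq)
    moreover have "K \<le> k" using assms calculation by (metis not_le)
    ultimately show "x \<in> clop (concat (map ?E [K..<K + M]))" by (auto simp: clop_concat intro!: bexI[of _ k])
  qed
  then have "mu (concat (map (cohen_seq \<alpha> g) [m..<M])) \<le> mu (concat (map ?E [K..<K + M]))" by (rule mu_mono)
  also have "\<dots> \<le> 1 / 2 ^ (K + 1) - 1 / 2 ^ (K + M + 1)" 
    by (rule mu_concat_geometric[OF mu_cut]) simp
  also have "\<dots> \<le> 1 / 2 ^ (K + 1)" by simp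
  finally show ?thesis .
qed

text \<open>Take m beyond the indices of the finitely many requests up to k. The argument works for
  every g, generic or not.\<close>

lemma tail_cohen_seq: "tail (cohen_seq \<alpha> g)"
  unfolding tail_def
proof
  fix k
  define m where "m = Suc (Max ((\<lambda>i. fst (cohen_code \<alpha> g i)) ` {..k}))"
  have "fst (cohen_code \<alpha> g i) < m" if "i \<le> k" for i
    unfolding m_def using that by (intro le_imp_less_Suc Max_ge) auto
  then have "mu (concat (map (cohen_seq \<alpha> g) [m..<M])) \<le> 1 / 2 ^ (k + 1)" for M
    by (intro mu_cohen_seq_interval) (metis less_imp_le not_less)
  moreover have "1 / 2 ^ (k + 1) \<le> (1 / 2 ^ k :: real)" by (simp add: field_simps)
  ultimately show "\<exists>m. \<forall>M. mu (concat (map (cohen_seq \<alpha> g) [m..<M])) \<le> 1 / 2 ^ k" by (meson order_trans)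
qed

text \<open>The code \<open>[[]]\<close> is the whole space, of measure 1, so the tree looks for a
  point outside all terms. The real depends only on the Cohen real with index \<alpha>, which later
  makes it available to all larger indices.\<close>

definition avoid_real :: "'l \<Rightarrow> 'l gen \<Rightarrow> nat \<Rightarrow> bool" where
  "avoid_real \<alpha> g = lb (covT (cohen_seq \<alpha> g) 0 [[]])"

lemma avoid_real_avoids: "avoid_real \<alpha> g \<notin> clop (cohen_seq \<alpha> g n)"
proof -
  have "mu (concat (map (cohen_seq \<alpha> g) [0..<M])) < mu [[]]" for M
    using mu_cohen_seq_interval[of 0 0 \<alpha> g M] mu_single[of "[]"] by simp
  then show ?thesis unfolding avoid_real_def using covT_small_branch(2)[of "cohen_seq \<alpha> g" 0 "[[]]" n] by simp
qed

section \<open>Names for reals and clopen sets\<close>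

lemma inj_Times_nat:
  assumes "infinite (UNIV :: 'a set)"
  obtains f :: "'a \<times> nat \<Rightarrow> 'a" where "inj f"
proof -
  have "|(UNIV :: 'a set) \<times> (UNIV :: nat set)| \<le>o |UNIV :: 'a set|"
    by (rule card_of_Sigma_ordLeq_infinite[OF assms])
       (use assms infinite_iff_card_of_nat in \<open>auto simp: card_of_refl ordIso_imp_ordLeq\<close>)
  then obtain f :: "'a \<times> nat \<Rightarrow> 'a" where "inj_on f (UNIV \<times> UNIV)"
    unfolding card_of_ordLeq[symmetric] by blast
  then show thesis using that by simp
qed

text \<open>This count sets the required size of 'i: the name of a clopen set lists names for
  functions from generics to reals, and there are at most as many of these as elements of
  \<open>'l set set\<close>.\<close>

lemma inj_gen_fun:
  assumes "infinite (UNIV :: 'l set)"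
  obtains F :: "('l gen \<Rightarrow> nat \<Rightarrow> bool) \<Rightarrow> 'l set set" where "inj F"
proof -
  obtain f :: "'l \<times> nat \<Rightarrow> 'l" where f: "inj f" using inj_Times_nat[OF assms] .
  have inf: "infinite (UNIV :: 'l set set)" using assms by (simp add: Finite_Set.finite_set)
  obtain h :: "'l set \<times> nat \<Rightarrow> 'l set" where h: "inj h" using inj_Times_nat[OF inf] .
  define c where "c g = f ` {x. g x}" for g :: "'l gen"
  have c: "inj c"
  proof (rule injI)
    fix g g' assume "c g = c g'"
    then have "{x. g x} = {x. g' x}" unfolding c_def inj_image_eq_iff[OF f] .
    then show "g = g'" by (simp add: set_eq_iff fun_eq_iff)
  qed
  define F where "F X = h ` {(c g, n) |g n. X g n}" for X :: "'l gen \<Rightarrow> nat \<Rightarrow> bool"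
  have "inj F"
  proof (rule injI)
    fix X Y assume "F X = F Y"
    then have e: "{(c g, n) |g n. X g n} = {(c g, n) |g n. Y g n}"
      unfolding F_def inj_image_eq_iff[OF h] .
    have "X g n \<longleftrightarrow> Y g n" for g n
    proof -
      have "X g n \<longleftrightarrow> (c g, n) \<in> {(c g, n) |g n. X g n}" by (auto simp: inj_eq[OF c])
      also have "\<dots> \<longleftrightarrow> Y g n" unfolding e by (auto simp: inj_eq[OF c])
      finally show ?thesis .
    qed
    then show "X = Y" by (simp add: fun_eq_iff)
  qed
  then show thesis by (rule that)
qed

lemma inj_cohen_gen_fun: "\<exists>F :: 'l cohen \<Rightarrow> ('l gen \<Rightarrow> nat \<Rightarrow> bool). inj F"
proof -
  define a where "a b p = (\<lambda>x. Rep_cohen p x = Some b)" for b and p :: "'l cohen"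
  define F where "F p = (\<lambda>g n. (n = (0 :: nat) \<and> g = a True p) \<or> (n = 1 \<and> g = a False p))" for p :: "'l cohen"
  have "inj F"
  proof (rule injI)
    fix p q assume e: "F p = F q"
    have t: "F q (a True p) 0" "F q (a False p) 1" unfolding e[symmetric] by (simp_all add: F_def)
    have "a b p = a b q" for b using t by (cases b) (simp_all add: F_def)
    then have "Rep_cohen p x = Some b \<longleftrightarrow> Rep_cohen q x = Some b" for x b unfolding a_def by metis
    then have "Rep_cohen p x = Rep_cohen q x" for x by (metis not_None_eq)
    then show "p = q" using Rep_cohen_inject by blast
  qed
  then show ?thesis by blast
qed

locale cohen_setting = index U for U :: "'i set" +
  fixes e0 :: "'l set set \<Rightarrow> 'i"
  assumes inj_e0: "inj e0" and infinite_l: "infinite (UNIV :: 'l set)"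
begin

lemma small_gen_fun: "small (S :: ('l gen \<Rightarrow> nat \<Rightarrow> bool) set)"
proof -
  obtain F :: "('l gen \<Rightarrow> nat \<Rightarrow> bool) \<Rightarrow> 'l set set" where "inj F" using inj_gen_fun[OF infinite_l] .
  then have "inj (e0 \<circ> F)" by (simp add: inj_compose inj_e0)
  then show ?thesis by (rule small_range)
qed

lemma small_cohen: "small (S :: 'l cohen set)"
proof -
  obtain F :: "'l cohen \<Rightarrow> ('l gen \<Rightarrow> nat \<Rightarrow> bool)" where F: "inj F" using inj_cohen_gen_fun by blast
  obtain H :: "('l gen \<Rightarrow> nat \<Rightarrow> bool) \<Rightarrow> 'l set set" where "inj H" using inj_gen_fun[OF infinite_l] .
  then have "inj (e0 \<circ> H \<circ> F)" using F by (simp add: inj_compose inj_e0)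
  then show ?thesis by (rule small_range)
qed

lemma small_l: "small (S :: 'l set)"
proof -
  have "inj (\<lambda>x :: 'l. e0 {{x}})" using inj_e0 by (auto simp: inj_def)
  then show ?thesis by (rule small_range)
qed

definition fam :: "'c set \<Rightarrow> ('c \<Rightarrow> ('i, 'l cohen) name) \<Rightarrow> ('c \<Rightarrow> 'l cohen fprop) \<Rightarrow> ('i, 'l cohen) name" where
  "fam C f P = mk {(f c, p) |c p. c \<in> C \<and> P c p}"

lemma fmem_fam:
  assumes "small C" "\<And>c. c \<in> C \<Longrightarrow> reg (P c)"
  shows "(x \<^bold>\<in> fam C f P) p \<longleftrightarrow> (\<forall>q\<le>p. \<exists>r\<le>q. \<exists>c\<in>C. P c r \<and> (x \<^bold>= f c) r)"
proof -
  have "{(f c, p) |c p. c \<in> C \<and> P c p} \<subseteq> (\<lambda>(c, p). (f c, p)) ` (C \<times> UNIV)" by auto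
  then have s: "small {(f c, p) |c p. c \<in> C \<and> P c p}"
    using small_subset[OF small_image[OF small_Times[OF assms(1) small_cohen]]] by blast
  have "(\<exists>y t. (y, t) \<in> {(f c, p) |c p. c \<in> C \<and> P c p} \<and> r \<le> t \<and> (x \<^bold>= y) r)
      \<longleftrightarrow> (\<exists>c\<in>C. P c r \<and> (x \<^bold>= f c) r)" for r
    using reg_mono[OF assms(2)] by blast
  then show ?thesis unfolding fam_def fmem_mk[OF s] by simp
qed

lemma fmem_famI:
  assumes "small C" "\<And>c. c \<in> C \<Longrightarrow> reg (P c)" "c \<in> C" "P c p" shows "(f c \<^bold>\<in> fam C f P) p"
proof -
  have "P c r" if "r \<le> p" for r using reg_mono[OF assms(2)[OF assms(3)] assms(4) that] .
  then show ?thesis by (subst fmem_fam[where C = C and P = P]) (use assms(1-3) feq_refl in blast)+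
qed

text \<open>Another index may name the same element, so membership of \<open>f c\<close> amounts to
  \<open>P c\<close> only if P respects forced equality of the listed names.\<close>

lemma fmem_fam_self:
  assumes "small C" "\<And>c. c \<in> C \<Longrightarrow> reg (P c)" "c \<in> C"
    and "\<And>c' r. c' \<in> C \<Longrightarrow> (f c \<^bold>= f c') r \<Longrightarrow> P c' r \<Longrightarrow> P c r"
  shows "(f c \<^bold>\<in> fam C f P) p \<longleftrightarrow> P c p"
proof
  assume "(f c \<^bold>\<in> fam C f P) p"
  then have *: "\<forall>q\<le>p. \<exists>r\<le>q. \<exists>c'\<in>C. P c' r \<and> (f c \<^bold>= f c') r"
    using fmem_fam[where C = C and P = P and f = f and x = "f c" and p = p] assms(1,2) by simp
  show "P c p"
  proof (rule reg_dense[OF assms(2)[OF assms(3)]])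
    fix q assume "q \<le> p"
    then obtain r c' where "r \<le> q" "c' \<in> C" "P c' r" "(f c \<^bold>= f c') r" using * by meson
    then show "\<exists>r\<le>q. P c r" using assms(4) by blast
  qed
qed (rule fmem_famI[OF assms(1-3)])

lemma ae_cong: assumes "ae p (\<lambda>g. Q g \<longleftrightarrow> R g)" shows "ae p Q \<longleftrightarrow> ae p R"
proof
  assume "ae p Q" then show "ae p R" by (rule ae_mp2[OF assms]) simp
next
  assume "ae p R" then show "ae p Q" by (rule ae_mp2[OF assms]) simp
qed

subsection \<open>Subsets of omega\<close>

text \<open>
  Functions \<open>A\<close> with \<open>rl A\<close> represent subsets of \<open>\<omega>\<close>, and also points of Cantor space.
\<close>

definition rl :: "('l gen \<Rightarrow> nat \<Rightarrow> bool) \<Rightarrow> bool" where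
  "rl A \<longleftrightarrow> (\<forall>n. bp UNIV (\<lambda>g. A g n))"

lemma rlD: "rl A \<Longrightarrow> bp UNIV (\<lambda>g. A g n)" by (simp add: rl_def)

definition setname :: "('l gen \<Rightarrow> nat \<Rightarrow> bool) \<Rightarrow> ('i, 'l cohen) name" where
  "setname A = fam UNIV nn (\<lambda>n p. ae p (\<lambda>g. A g n))"

lemma nn_mem_setname: "rl A \<Longrightarrow> (nn n \<^bold>\<in> setname A) p \<longleftrightarrow> ae p (\<lambda>g. A g n)"
  unfolding setname_def by (rule fmem_fam_self) (auto simp: small_nat intro: reg_ae rlD)

lemma setname_sub_omega: "rl A \<Longrightarrow> (setname A \<^bold>\<subseteq> omega) p"
  unfolding setname_def fsub_iff mem_omega_iff
  by (subst fmem_fam) (auto simp: small_nat intro: reg_ae rlD, blast)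

lemma subset_omega_eqI:
  assumes x: "(x \<^bold>\<subseteq> omega) p" and y: "((y :: ('i, 'l cohen) name) \<^bold>\<subseteq> omega) p"
    and e: "\<And>n q. q \<le> p \<Longrightarrow> (nn n \<^bold>\<in> x) q \<longleftrightarrow> (nn n \<^bold>\<in> y) q"
  shows "(x \<^bold>= y) p"
proof -
  have *: "(z \<^bold>\<in> y) q"
    if q: "q \<le> p" "(z \<^bold>\<in> x) q" and x: "(x \<^bold>\<subseteq> omega) p"
      and e: "\<And>n q. q \<le> p \<Longrightarrow> (nn n \<^bold>\<in> x) q \<Longrightarrow> (nn n \<^bold>\<in> y) q" for z q and x y :: "('i, 'l cohen) name"
  proof (rule reg_dense[OF reg_fmem])
    fix q' assume q': "q' \<le> q"
    have "(z \<^bold>\<in> omega) q" using x q unfolding fsub_iff by blast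
    then obtain r n where r: "r \<le> q'" "(z \<^bold>= nn n) r" using q' unfolding mem_omega_iff by blast
    have rp: "r \<le> p" "r \<le> q" using r q q' by (meson order_trans)+
    have "(nn n \<^bold>\<in> x) r" using fmem_cong1[OF r(2) fmem_mono[OF q(2) rp(2)]] .
    then have "(z \<^bold>\<in> y) r" using e[OF rp(1)] fmem_cong1[OF feq_sym[OF r(2)]] by blast
    then show "\<exists>r\<le>q'. (z \<^bold>\<in> y) r" using r by blast
  qed
  show ?thesis by (rule feqI) (use *[of _ _ x y] *[of _ _ y x] x y e in blast)+
qed

lemma rl_ev: "(\<And>n. reg (\<phi> n)) \<Longrightarrow> rl (\<lambda>g n. ev (\<phi> n) g)"
  by (simp add: rl_def bp_ev_UNIV)

text \<open>The set is recovered from the truth values of its membership statements, so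
  quantification over names of subsets of \<omega> becomes quantification over functions with
  \<open>rl\<close>.\<close>

lemma setname_rep:
  assumes "((x :: ('i, 'l cohen) name) \<^bold>\<subseteq> omega) p"
  shows "(x \<^bold>= setname (\<lambda>g n. ev (nn n \<^bold>\<in> x) g)) p"
  by (rule subset_omega_eqI[OF assms setname_sub_omega[OF rl_ev]]) (auto simp: nn_mem_setname rl_ev ae_ev)

subsection \<open>Functions into two\<close>

definition dg :: "bool \<Rightarrow> ('i, 'l cohen) name" where
  "dg b = nn (if b then 1 else 0)"

lemma dg_eq_iff [simp]: "(dg b \<^bold>= dg c) p \<longleftrightarrow> b = c"
  by (simp add: dg_def)

lemma mem_two_iff: "((x :: ('i, 'l cohen) name) \<^bold>\<in> two) p \<longleftrightarrow> (\<forall>q\<le>p. \<exists>r\<le>q. \<exists>b. (x \<^bold>= dg b) r)"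
proof -
  have "(\<exists>n<2. (x \<^bold>= nn n) r) \<longleftrightarrow> (\<exists>b. (x \<^bold>= dg b) r)" for r
    unfolding dg_def by (auto simp: less_2_cases_iff split: if_splits)
  then show ?thesis unfolding two_def mem_nn_iff by simp
qed

lemma dg_mem_two [simp]: "(dg b \<^bold>\<in> two) p"
  unfolding mem_two_iff by (meson feq_refl order_refl)

abbreviation fun2 :: "('i, 'l cohen) name \<Rightarrow> ('i, 'l cohen) name \<Rightarrow> 'l cohen fprop" where
  "fun2 x a \<equiv> is_fun x a (\<lambda>j. j \<^bold>\<in> two)"

lemma good_mem: "good (\<lambda>j. j \<^bold>\<in> (a :: ('i, 'l cohen) name))"
  by (intro good_intros)

lemma fun2_mono: "fun2 x a p \<Longrightarrow> q \<le> p \<Longrightarrow> fun2 x a q"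
  by (rule reg_mono[of "fun2 x a"]) simp_all

lemma fun2_mem:
  assumes x: "fun2 x (canonical (nn ` I)) p" and q: "q \<le> p" "(z \<^bold>\<in> x) q"
  obtains r i b where "r \<le> q" "i \<in> I" "(z \<^bold>= op (nn i) (dg b)) r" "(op (nn i) (dg b) \<^bold>\<in> x) r"
proof -
  obtain r a c where r: "r \<le> q" "(a \<^bold>\<in> canonical (nn ` I)) r" "(c \<^bold>\<in> two) r" "(z \<^bold>= op a c) r"
    using x q unfolding is_fun_iff[OF good_reg[OF good_mem]] by (meson order_refl order_trans)
  obtain s i where s: "s \<le> r" "i \<in> I" "(a \<^bold>= nn i) s"
    using r(2) unfolding fmem_canonical[OF small_nn] by blast
  obtain t b where t: "t \<le> s" "(c \<^bold>= dg b) t" using fmem_mono[OF r(3) s(1)] unfolding mem_two_iff by blast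
  have "(op a c \<^bold>= op (nn i) (dg b)) t" using s t feq_mono by (auto simp: op_eq_iff)
  then have z: "(z \<^bold>= op (nn i) (dg b)) t" using r(4) s(1) t(1) feq_mono feq_trans by blast
  have "t \<le> q" using r s t by (meson order_trans)
  then show thesis using that[OF _ s(2) z] fmem_cong1[OF z fmem_mono[OF q(2)]] by blast
qed

lemma fun2_subI:
  assumes x: "fun2 x (canonical (nn ` I)) p"
    and e: "\<And>i b q. q \<le> p \<Longrightarrow> i \<in> I \<Longrightarrow> (op (nn i) (dg b) \<^bold>\<in> x) q \<Longrightarrow> (op (nn i) (dg b) \<^bold>\<in> y) q"
  shows "(x \<^bold>\<subseteq> y) p"
  unfolding fsub_iff
proof (intro allI impI)
  fix q z assume q: "q \<le> p" "(z \<^bold>\<in> x) q"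
  show "(z \<^bold>\<in> y) q"
  proof (rule reg_dense[OF reg_fmem])
    fix q' assume q': "q' \<le> q"
    have q'p: "q' \<le> p" using q q' by (meson order_trans)
    obtain r i b where r: "r \<le> q'" "i \<in> I" "(z \<^bold>= op (nn i) (dg b)) r" "(op (nn i) (dg b) \<^bold>\<in> x) r"
      using fun2_mem[OF x q'p fmem_mono[OF q(2) q']] by blast
    have "r \<le> p" using r q'p by (meson order_trans)
    then have "(z \<^bold>\<in> y) r" using e r fmem_cong1[OF feq_sym[OF r(3)]] by blast
    then show "\<exists>r\<le>q'. (z \<^bold>\<in> y) r" using r by blast
  qed
qed

lemma feq_sub: "(x \<^bold>\<subseteq> y) p \<Longrightarrow> (y \<^bold>\<subseteq> x) p \<Longrightarrow> (x \<^bold>= y) p"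
  by (rule feqI) (auto simp: fsub_iff)

lemma fun2_unique:
  assumes "fun2 x a p" "(op i (dg b) \<^bold>\<in> x) p" "(op i (dg c) \<^bold>\<in> x) p" shows "b = c"
  using is_fun_unique[OF assms(1) good_mem order_refl assms(2,3)] by simp

lemma fun2_decide:
  assumes "fun2 x (canonical (nn ` I)) p" "i \<in> I" "q \<le> p"
  obtains r b where "r \<le> q" "(op (nn i) (dg b) \<^bold>\<in> x) r"
proof -
  have "(nn i \<^bold>\<in> canonical (nn ` I)) q" by (rule fmem_canonicalI[OF small_nn]) (use assms in simp)
  then obtain r y where r: "r \<le> q" "(op (nn i) y \<^bold>\<in> x) r" "(y \<^bold>\<in> two) r"
    using is_fun_ex[OF assms(1) good_mem assms(3)] by blast
  then obtain s b where s: "s \<le> r" "(y \<^bold>= dg b) s" unfolding mem_two_iff by blast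
  have "(op (nn i) (dg b) \<^bold>\<in> x) s"
    using fmem_cong1[OF op_cong[OF feq_refl s(2)] fmem_mono[OF r(2) s(1)]] .
  then show thesis using that r s by (meson order_trans)
qed

text \<open>One inclusion suffices: a digit of y that differed from the decided digit of x would
  give y two values at the same place.\<close>

lemma fun2_eqI:
  assumes x: "fun2 x (canonical (nn ` I)) p" and y: "fun2 y (canonical (nn ` I)) p"
    and e: "\<And>i b q. q \<le> p \<Longrightarrow> i \<in> I \<Longrightarrow> (op (nn i) (dg b) \<^bold>\<in> x) q \<Longrightarrow> (op (nn i) (dg b) \<^bold>\<in> y) q"
  shows "(x \<^bold>= y) p"
proof (rule feq_sub)
  show "(x \<^bold>\<subseteq> y) p" by (rule fun2_subI[OF x e])
  show "(y \<^bold>\<subseteq> x) p"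
  proof (rule fun2_subI[OF y])
    fix i b q assume a: "q \<le> p" "i \<in> I" "(op (nn i) (dg b) \<^bold>\<in> y) q"
    show "(op (nn i) (dg b) \<^bold>\<in> x) q"
    proof (rule reg_dense[OF reg_fmem])
      fix q' assume q': "q' \<le> q"
      then have "q' \<le> p" using a by (meson order_trans)
      then obtain r c where r: "r \<le> q'" "(op (nn i) (dg c) \<^bold>\<in> x) r" using fun2_decide[OF x a(2)] by blast
      have rp: "r \<le> p" "r \<le> q" using r q' a by (meson order_trans)+
      have "b = c"
        by (rule fun2_unique[OF fun2_mono[OF y rp(1)] fmem_mono[OF a(3) rp(2)] e[OF rp(1) a(2) r(2)]])
      then show "\<exists>r\<le>q'. (op (nn i) (dg b) \<^bold>\<in> x) r" using r by blast
    qed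
  qed
qed

subsection \<open>Reals\<close>

definition realname :: "('l gen \<Rightarrow> nat \<Rightarrow> bool) \<Rightarrow> ('i, 'l cohen) name" where
  "realname X = fam UNIV (\<lambda>(n, b). op (nn n) (dg b)) (\<lambda>(n, b) p. ae p (\<lambda>g. X g n = b))"

lemma rl_eq: "rl X \<Longrightarrow> bp UNIV (\<lambda>g. X g n = b)"
  using rlD[of X n] bpfD[of UNIV "\<lambda>g. X g n" b] by (simp add: bpf_bool)

lemma small_nat_bool: "small (S :: (nat \<times> bool) set)"
  by (rule small_countable) simp

lemma reg_realname_aux: "rl X \<Longrightarrow> reg ((\<lambda>(n, b) p. ae p (\<lambda>g. X g n = b)) c)"
  by (cases c) (auto intro: reg_ae[OF rl_eq])

lemma mem_realname_iff:
  assumes "rl X"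
  shows "(z \<^bold>\<in> realname X) p \<longleftrightarrow>
    (\<forall>q\<le>p. \<exists>r\<le>q. \<exists>n b. ae r (\<lambda>g. X g n = b) \<and> (z \<^bold>= op (nn n) (dg b)) r)"
  unfolding realname_def
  using fmem_fam[where f = "\<lambda>(n, b). op (nn n) (dg b)" and C = UNIV and p = p and x = z
      and P = "\<lambda>(n, b) p. ae p (\<lambda>g. X g n = b)", OF small_nat_bool reg_realname_aux[OF assms]]
  by (simp add: split_paired_Ex)

lemma op_mem_realname: "rl X \<Longrightarrow> (op (nn n) (dg b) \<^bold>\<in> realname X) p \<longleftrightarrow> ae p (\<lambda>g. X g n = b)"
  unfolding realname_def
  using fmem_fam_self[where c = "(n, b)" and f = "\<lambda>(n, b). op (nn n) (dg b)" and C = UNIV and p = p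
      and P = "\<lambda>(n, b) p. ae p (\<lambda>g. X g n = b)", OF small_nat_bool reg_realname_aux]
  by (auto simp: op_eq_iff)

lemma is_cantor_iff: "is_cantor x p \<longleftrightarrow> fun2 x (canonical (nn ` UNIV)) p"
  by (simp add: is_cantor_def omega_unfold)

lemma good_is_cantor [good_intros]: "cong f \<Longrightarrow> good (\<lambda>x :: ('i, 'l cohen) name. is_cantor (f x))"
  unfolding is_cantor_def by (intro good_intros)

lemma reg_is_cantor [simp]: "reg (is_cantor (x :: ('i, 'l cohen) name))"
  unfolding is_cantor_def by simp

lemma is_cantor_realname: assumes X: "rl X" shows "is_cantor (realname X) p"
  unfolding is_cantor_iff
proof (rule is_funI)
  fix q z assume "(z \<^bold>\<in> realname X) q"
  then obtain r n b where "r \<le> q" "(z \<^bold>= op (nn n) (dg b)) r"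
    unfolding mem_realname_iff[OF X] by blast
  then show "\<exists>r\<le>q. \<exists>x y. (x \<^bold>\<in> canonical (range nn)) r \<and> (y \<^bold>\<in> two) r \<and> (z \<^bold>= op x y) r"
    using fmem_canonicalI[OF small_nn, of "nn n" UNIV] dg_mem_two by blast
next
  fix q and x :: "('i, 'l cohen) name" assume "(x \<^bold>\<in> canonical (range nn)) q"
  then obtain r n where r: "r \<le> q" "(x \<^bold>= nn n) r" unfolding fmem_canonical[OF small_nn] by blast
  obtain s b where s: "s \<le> r" "ae s (\<lambda>g. X g n = b)" using ae_value[OF rl_eq[OF X]] by blast
  have "(op x (dg b) \<^bold>\<in> realname X) s"
    using s op_mem_realname[OF X] fmem_cong1[OF op_cong[OF feq_sym[OF feq_mono[OF r(2) s(1)]] feq_refl]] by blast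
  then show "\<exists>r\<le>q. \<exists>y. (op x y \<^bold>\<in> realname X) r" using r s by (meson order_trans)
next
  fix q x y y' assume q: "(op x y \<^bold>\<in> realname X) q" "(op x y' \<^bold>\<in> realname X) q"
  show "(y \<^bold>= y') q"
  proof (rule reg_dense[OF reg_feq])
    fix q' assume q': "q' \<le> q"
    obtain r n b where r: "r \<le> q'" "ae r (\<lambda>g. X g n = b)" "(op x y \<^bold>= op (nn n) (dg b)) r"
      using q(1) q' unfolding mem_realname_iff[OF X] by blast
    have "(op x y' \<^bold>\<in> realname X) r" using q(2) q' r fmem_mono by (meson order_trans)
    then obtain s m c where s: "s \<le> r" "ae s (\<lambda>g. X g m = c)" "(op x y' \<^bold>= op (nn m) (dg c)) s"
      unfolding mem_realname_iff[OF X] by blast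
    have "(x \<^bold>= nn n) s" "(y \<^bold>= dg b) s" "(x \<^bold>= nn m) s" "(y' \<^bold>= dg c) s"
      using r(3) s feq_mono by (auto simp: op_eq_iff)
    moreover from this have "n = m" using feq_trans[OF feq_sym] nn_eq_iff by blast
    moreover have "b = c" using ae_witness[OF ae_conj[OF ae_mono[OF r(2) s(1)] s(2)]] \<open>n = m\<close> by blast
    ultimately have "(y \<^bold>= y') s" using feq_trans feq_sym by blast
    then show "\<exists>r\<le>q'. (y \<^bold>= y') r" using r s by (meson order_trans)
  qed
qed simp

lemma cantor_rep:
  assumes "is_cantor x p"
  shows "(x \<^bold>= realname (\<lambda>g n. ev (op (nn n) (dg True) \<^bold>\<in> x) g)) p"
proof -
  let ?X = "\<lambda>g n. ev (op (nn n) (dg True) \<^bold>\<in> x) g"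
  have X: "rl ?X" by (rule rl_ev) simp
  show ?thesis
  proof (rule fun2_eqI[OF assms[unfolded is_cantor_iff] is_cantor_realname[OF X, unfolded is_cantor_iff]])
    fix n b q assume q: "q \<le> p" "(op (nn n) (dg b) \<^bold>\<in> x) q"
    show "(op (nn n) (dg b) \<^bold>\<in> realname ?X) q"
    proof (cases b)
      case True
      then show ?thesis using q by (simp add: op_mem_realname[OF X] ae_ev)
    next
      case False
      have "ae q (\<lambda>g. \<not> ?X g n)"
      proof (subst ae_not_iff[OF rlD[OF X]], intro allI impI notI)
        fix r assume r: "r \<le> q" "ae r (\<lambda>g. ?X g n)"
        then have t: "(op (nn n) (dg True) \<^bold>\<in> x) r" by (simp add: ae_ev)
        have "is_cantor x r" using assms q r reg_mono[OF reg_is_cantor] by (meson order_trans)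
        then show False using fun2_unique[OF _ fmem_mono[OF q(2) r(1)] t] False unfolding is_cantor_iff by blast
      qed
      then show ?thesis using False by (simp add: op_mem_realname[OF X])
    qed
  qed
qed

lemma cantorE:
  assumes "is_cantor x p" obtains X where "rl X" "(x \<^bold>= realname X) p"
  using cantor_rep[OF assms] rl_ev[of "\<lambda>n. op (nn n) (dg True) \<^bold>\<in> x"] by auto

lemma realname_eq_iff:
  assumes X: "rl X" and Y: "rl Y"
  shows "(realname X \<^bold>= realname Y) p \<longleftrightarrow> ae p (\<lambda>g. X g = Y g)"
proof
  assume e: "(realname X \<^bold>= realname Y) p"
  have "ae p (\<lambda>g. X g n = Y g n)" for n
  proof (rule ae_dense)
    show "bp UNIV (\<lambda>g. X g n = Y g n)"
      by (rule bp_app2[of _ "\<lambda>g. X g n" "\<lambda>g. Y g n"]) (auto simp: bpf_bool rlD[OF X] rlD[OF Y])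
    fix q assume q: "q \<le> p"
    obtain r b where r: "r \<le> q" "ae r (\<lambda>g. X g n = b)" using ae_value[OF rl_eq[OF X]] by blast
    then have "(op (nn n) (dg b) \<^bold>\<in> realname X) r" using op_mem_realname[OF X] by blast
    then have "(op (nn n) (dg b) \<^bold>\<in> realname Y) r" using e q r fmem_cong2 feq_mono by (meson order_trans)
    then have "ae r (\<lambda>g. Y g n = b)" using op_mem_realname[OF Y] by blast
    then have "ae r (\<lambda>g. X g n = Y g n)" by (rule ae_mp2[OF r(2)]) simp
    then show "\<exists>r\<le>q. ae r (\<lambda>g. X g n = Y g n)" using r by blast
  qed
  then have "ae p (\<lambda>g. \<forall>n. X g n = Y g n)" by (rule ae_all)
  then show "ae p (\<lambda>g. X g = Y g)" by (rule ae_mp) auto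
next
  assume a: "ae p (\<lambda>g. X g = Y g)"
  show "(realname X \<^bold>= realname Y) p"
  proof (rule fun2_eqI[OF is_cantor_realname[OF X, unfolded is_cantor_iff] is_cantor_realname[OF Y, unfolded is_cantor_iff]])
    fix i b q assume q: "q \<le> p" "(op (nn i) (dg b) \<^bold>\<in> realname X) q"
    have "ae q (\<lambda>g. Y g i = b)"
      by (rule ae_mp2[OF ae_mono[OF a q(1)] q(2)[unfolded op_mem_realname[OF X]]]) simp
    then show "(op (nn i) (dg b) \<^bold>\<in> realname Y) q" by (simp add: op_mem_realname[OF Y])
  qed
qed

lemma bpf_rst: "(\<And>n. bp S (\<lambda>g. X g n)) \<Longrightarrow> bpf S (\<lambda>g. rst (X g) n)"
  by (rule bpf_map) (simp add: bpf_bool)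

lemma bp_mem_clop:
  assumes "\<And>n. bp S (\<lambda>g. X g n)" "bpf S D" shows "bp S (\<lambda>g. X g \<in> clop (D g))"
proof (rule bp_subst[OF assms(2), of "\<lambda>e g. X g \<in> clop e"])
  fix e
  have "bp S (\<lambda>g. rst (X g) (mx e) \<in> lev (mx e) e)" by (rule bp_app[OF bpf_rst[OF assms(1)]])
  then show "bp S (\<lambda>g. X g \<in> clop e)" by (simp add: lev_rst)
qed

lemma rl_clop: "rl X \<Longrightarrow> bp UNIV (\<lambda>g. X g \<in> clop e)"
  by (rule bp_mem_clop) (auto simp: rlD bpf_const)

subsection \<open>Finite binary strings\<close>

definition strname :: "bool list \<Rightarrow> ('i, 'l cohen) name" where
  "strname s = fn {..<length s} nn (\<lambda>i. dg (s ! i))"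

lemma fun2_strname': "fun2 (strname s) (canonical (nn ` {..<length s})) p"
  unfolding strname_def by (rule is_fun_fn) (auto simp: small_nat)

lemma fun2_strname: "length s = n \<Longrightarrow> fun2 (strname s) (nn n) p"
  using fun2_strname' nn_unfold by metis

lemma op_mem_strname: "(op (nn i) (dg b) \<^bold>\<in> strname s) p \<longleftrightarrow> i < length s \<and> s ! i = b"
  unfolding strname_def by (subst op_fn_iff) (auto simp: small_nat)

lemma strname_eq_iff: assumes "length s = length t" shows "(strname s \<^bold>= strname t) p \<longleftrightarrow> s = t"
proof
  assume a: "(strname s \<^bold>= strname t) p"
  have "s ! i = t ! i" if "i < length s" for i
  proof -
    have "(op (nn i) (dg (s ! i)) \<^bold>\<in> strname s) p" using that by (simp add: op_mem_strname)
    then have "(op (nn i) (dg (s ! i)) \<^bold>\<in> strname t) p" using fmem_cong2[OF a] by blast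
    then show ?thesis by (simp add: op_mem_strname)
  qed
  then show "s = t" using assms by (simp add: nth_equalityI)
qed simp

lemma strname_sub_realname:
  assumes X: "rl X" shows "(strname s \<^bold>\<subseteq> realname X) p \<longleftrightarrow> ae p (\<lambda>g. pre s (X g))"
proof
  assume a: "(strname s \<^bold>\<subseteq> realname X) p"
  have "ae p (\<lambda>g. i < length s \<longrightarrow> s ! i = X g i)" for i
  proof (cases "i < length s")
    case True
    then have "(op (nn i) (dg (s ! i)) \<^bold>\<in> strname s) p" by (simp add: op_mem_strname)
    then have "(op (nn i) (dg (s ! i)) \<^bold>\<in> realname X) p" using a unfolding fsub_iff by blast
    then have "ae p (\<lambda>g. X g i = s ! i)" using op_mem_realname[OF X] by blast
    then show ?thesis by (rule ae_mp) simp
  qed (simp add: aeI)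
  then show "ae p (\<lambda>g. pre s (X g))" unfolding pre_def by (rule ae_all)
next
  assume a: "ae p (\<lambda>g. pre s (X g))"
  note f = fun2_strname'[of s p]
  show "(strname s \<^bold>\<subseteq> realname X) p"
    by (rule fun2_subI[OF f], unfold op_mem_realname[OF X] op_mem_strname, rule ae_mp[OF ae_mono[OF a]])
       (auto simp: pre_def)
qed

text \<open>Successive extensions make the decisions and regularity preserves the earlier ones. This
  is what turns finite objects of the extension, such as strings, codes and finite bijections, into
  ground model objects.\<close>

lemma finite_decide:
  assumes "finite F" "\<And>x q. x \<in> F \<Longrightarrow> q \<le> p \<Longrightarrow> \<exists>r\<le>q. \<exists>c. \<phi> x c r" "\<And>x c. reg (\<phi> x c)"
  shows "\<exists>r\<le>(p :: 'p::order_top). \<exists>f. \<forall>x\<in>F. \<phi> x (f x) r"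
  using assms(1,2)
proof (induction F rule: finite_induct)
  case (insert x F)
  obtain r f where r: "r \<le> p" "\<forall>x\<in>F. \<phi> x (f x) r" using insert.IH insert.prems by blast
  obtain s c where s: "s \<le> r" "\<phi> x c s" using insert.prems r by blast
  have "\<forall>y\<in>insert x F. \<phi> y ((f(x := c)) y) s"
    using s r insert.hyps reg_mono[OF assms(3)] by auto
  then show ?case using s r by (meson order_trans)
qed auto

lemma string_rep:
  assumes s: "fun2 s (nn n) p"
  obtains r t where "r \<le> p" "length t = n" "(s \<^bold>= strname t) r"
proof -
  have s': "fun2 s (canonical (nn ` {..<n})) p" using s by (subst (asm) nn_unfold)
  obtain r f where r: "r \<le> p" "\<forall>i\<in>{..<n}. (op (nn i) (dg (f i)) \<^bold>\<in> s) r"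
    using finite_decide[of "{..<n}" p "\<lambda>i b. op (nn i) (dg b) \<^bold>\<in> s"] fun2_decide[OF s'] by (metis finite_lessThan reg_fmem)
  let ?t = "map f [0..<n]"
  have t: "fun2 (strname ?t) (canonical (nn ` {..<n})) r"
    using fun2_strname'[of ?t r] by simp
  have "(strname ?t \<^bold>= s) r"
    by (rule fun2_eqI[OF t fun2_mono[OF s' r(1)]]) (use r(2) in \<open>auto simp: op_mem_strname intro: fmem_mono\<close>)
  then show thesis using that[OF r(1), of ?t, OF _ feq_sym] by simp
qed

subsection \<open>Clopen sets\<close>

definition clopname :: "code \<Rightarrow> ('i, 'l cohen) name" where
  "clopname e = fam {X. rl X} realname (\<lambda>X p. ae p (\<lambda>g. X g \<in> clop e))"

lemma reg_clopname_aux: "X \<in> {X. rl X} \<Longrightarrow> reg (\<lambda>p. ae p (\<lambda>g. X g \<in> clop e))"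
  by (simp add: reg_ae[OF rl_clop])

lemma mem_clopname_iff:
  "(z \<^bold>\<in> clopname e) p \<longleftrightarrow> (\<forall>q\<le>p. \<exists>r\<le>q. \<exists>X. rl X \<and> ae r (\<lambda>g. X g \<in> clop e) \<and> (z \<^bold>= realname X) r)"
  unfolding clopname_def
  using fmem_fam[where f = realname and C = "{X. rl X}" and P = "\<lambda>X p. ae p (\<lambda>g. X g \<in> clop e)",
      OF small_gen_fun reg_clopname_aux] by simp

lemma mem_clopname: "rl X \<Longrightarrow> (realname X \<^bold>\<in> clopname e) p \<longleftrightarrow> ae p (\<lambda>g. X g \<in> clop e)"
  unfolding clopname_def
proof (rule fmem_fam_self[OF small_gen_fun reg_clopname_aux])
  fix Y r assume a: "rl X" "Y \<in> {X. rl X}" "(realname X \<^bold>= realname Y) r" "ae r (\<lambda>g. Y g \<in> clop e)"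
  then have "ae r (\<lambda>g. X g = Y g)" by (simp add: realname_eq_iff)
  then show "ae r (\<lambda>g. X g \<in> clop e)" by (rule ae_mp2[OF _ a(4)]) simp
qed auto

lemma is_cantorI:
  assumes "\<And>q. q \<le> p \<Longrightarrow> \<exists>r\<le>q. \<exists>X. rl X \<and> (x \<^bold>= realname X) r"
  shows "is_cantor x p"
  by (rule reg_dense[OF reg_is_cantor])
     (meson assms is_cantor_realname good_cong[OF good_is_cantor[OF cong_id]] feq_sym)

lemma clopname_cantor: "(x \<^bold>\<in> clopname e) p \<Longrightarrow> is_cantor x p"
  by (rule is_cantorI) (unfold mem_clopname_iff, blast)

lemma reals_eqI:
  assumes x: "\<And>q z. q \<le> p \<Longrightarrow> (z \<^bold>\<in> x) q \<Longrightarrow> is_cantor z q"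
    and y: "\<And>q z. q \<le> p \<Longrightarrow> (z \<^bold>\<in> y) q \<Longrightarrow> is_cantor z q"
    and e: "\<And>X q. rl X \<Longrightarrow> q \<le> p \<Longrightarrow> (realname X \<^bold>\<in> x) q \<longleftrightarrow> (realname X \<^bold>\<in> y) q"
  shows "(x \<^bold>= y) p"
proof (rule feqI)
  fix q z assume q: "q \<le> p" "(z \<^bold>\<in> x) q"
  obtain X where X: "rl X" "(z \<^bold>= realname X) q" using cantorE[OF x[OF q]] .
  then show "(z \<^bold>\<in> y) q" using e[OF X(1) q(1)] fmem_cong1[OF X(2) q(2)] fmem_cong1[OF feq_sym[OF X(2)]] by blast
next
  fix q z assume q: "q \<le> p" "(z \<^bold>\<in> y) q"
  obtain X where X: "rl X" "(z \<^bold>= realname X) q" using cantorE[OF y[OF q]] .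
  then show "(z \<^bold>\<in> x) q" using e[OF X(1) q(1)] fmem_cong1[OF X(2) q(2)] fmem_cong1[OF feq_sym[OF X(2)]] by blast
qed

lemma rl_const: "rl (\<lambda>g. x)"
  by (simp add: rl_def bp_const)

text \<open>Constant names test the inclusion on ground model points; conversely an inclusion
  between coded sets applies pointwise at every g.\<close>

lemma clopname_sub_iff: "(clopname e \<^bold>\<subseteq> clopname e') p \<longleftrightarrow> clop e \<subseteq> clop e'"
proof
  assume a: "(clopname e \<^bold>\<subseteq> clopname e') p"
  show "clop e \<subseteq> clop e'"
  proof
    fix x assume "x \<in> clop e"
    then have "(realname (\<lambda>g. x) \<^bold>\<in> clopname e) p" by (simp add: mem_clopname rl_const)
    then have "(realname (\<lambda>g. x) \<^bold>\<in> clopname e') p" using a unfolding fsub_iff by blast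
    then show "x \<in> clop e'" by (simp add: mem_clopname rl_const)
  qed
next
  assume a: "clop e \<subseteq> clop e'"
  show "(clopname e \<^bold>\<subseteq> clopname e') p"
    unfolding fsub_iff
  proof (intro allI impI)
    fix q z assume q: "(z \<^bold>\<in> clopname e) q"
    obtain X where X: "rl X" "(z \<^bold>= realname X) q" using cantorE[OF clopname_cantor[OF q]] .
    have "ae q (\<lambda>g. X g \<in> clop e)" using fmem_cong1[OF X(2) q] mem_clopname[OF X(1)] by blast
    then have "ae q (\<lambda>g. X g \<in> clop e')" by (rule ae_mp) (use a in blast)
    then show "(z \<^bold>\<in> clopname e') q" using mem_clopname[OF X(1)] fmem_cong1[OF feq_sym[OF X(2)]] by blast
  qed
qed

end

context cohen_setting begin

subsection \<open>Open and clopen classes\<close>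

lemma good_agree [good_intros]:
  "cong n \<Longrightarrow> cong f \<Longrightarrow> cong h \<Longrightarrow> good (\<lambda>x :: ('i, 'l cohen) name. agree (n x) (f x) (h x))"
  unfolding agree_def by (intro good_intros)

lemma reg_agree [simp]: "reg (agree n x y)"
  unfolding agree_def by simp

lemma agree_realname_aux:
  assumes X: "rl X" and Y: "rl Y" and a: "ae q (\<lambda>g. X g i = Y g i)" and m: "(op (nn i) j \<^bold>\<in> realname X) q"
  shows "(op (nn i) j \<^bold>\<in> realname Y) q"
proof (rule reg_dense[OF reg_fmem])
  fix q' assume q': "q' \<le> q"
  obtain r n b where r: "r \<le> q'" "ae r (\<lambda>g. X g n = b)" "(op (nn i) j \<^bold>= op (nn n) (dg b)) r"
    using m q' unfolding mem_realname_iff[OF X] by blast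
  have n: "i = n" using r(3) by (simp add: op_eq_iff)
  have "r \<le> q" using r q' by (meson order_trans)
  then have "ae r (\<lambda>g. X g i = Y g i)" by (rule ae_mono[OF a])
  then have "ae r (\<lambda>g. Y g n = b)" by (rule ae_mp2[OF r(2)]) (simp add: n)
  then have "(op (nn n) (dg b) \<^bold>\<in> realname Y) r" by (simp add: op_mem_realname[OF Y])
  then show "\<exists>r\<le>q'. (op (nn i) j \<^bold>\<in> realname Y) r" using fmem_cong1[OF feq_sym[OF r(3)]] r(1) by blast
qed

lemma agree_iff:
  assumes X: "rl X" and Y: "rl Y"
  shows "agree (nn n) (realname X) (realname Y) p \<longleftrightarrow> ae p (\<lambda>g. rst (X g) n = rst (Y g) n)"
proof -
  have g: "good (\<lambda>k. \<^bold>\<forall>j. op k j \<^bold>\<in> realname X \<^bold>\<longleftrightarrow> op k j \<^bold>\<in> realname Y)" by (intro good_intros)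
  have "agree (nn n) (realname X) (realname Y) p \<longleftrightarrow>
      (\<forall>i<n. (\<^bold>\<forall>j. op (nn i) j \<^bold>\<in> realname X \<^bold>\<longleftrightarrow> op (nn i) j \<^bold>\<in> realname Y) p)"
    unfolding all_nn[OF g, symmetric] by (auto simp: agree_def fall_def[of "\<lambda>k. k \<^bold>\<in> _ \<^bold>\<longrightarrow> _ k"] fimp_iff)
  also have "\<dots> \<longleftrightarrow> (\<forall>i<n. ae p (\<lambda>g. X g i = Y g i))"
  proof (intro all_cong)
    fix i
    show "(\<^bold>\<forall>j. op (nn i) j \<^bold>\<in> realname X \<^bold>\<longleftrightarrow> op (nn i) j \<^bold>\<in> realname Y) p \<longleftrightarrow> ae p (\<lambda>g. X g i = Y g i)"
    proof
      assume a: "(\<^bold>\<forall>j. op (nn i) j \<^bold>\<in> realname X \<^bold>\<longleftrightarrow> op (nn i) j \<^bold>\<in> realname Y) p"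
      show "ae p (\<lambda>g. X g i = Y g i)"
      proof (rule ae_dense)
        show "bp UNIV (\<lambda>g. X g i = Y g i)"
          by (rule bp_app2[of _ "\<lambda>g. X g i" "\<lambda>g. Y g i"]) (auto simp: bpf_bool rlD[OF X] rlD[OF Y])
        fix q assume q: "q \<le> p"
        obtain r b where r: "r \<le> q" "ae r (\<lambda>g. X g i = b)" using ae_value[OF rl_eq[OF X]] by blast
        have rp: "r \<le> p" using r q by (meson order_trans)
        have "(op (nn i) (dg b) \<^bold>\<in> realname X) r" using r by (simp add: op_mem_realname[OF X])
        then have "(op (nn i) (dg b) \<^bold>\<in> realname Y) r" using a rp by (auto simp: fbasic fiff_iff)
        then have "ae r (\<lambda>g. Y g i = b)" by (simp add: op_mem_realname[OF Y])
        then have "ae r (\<lambda>g. X g i = Y g i)" by (rule ae_mp2[OF r(2)]) simp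
        then show "\<exists>r\<le>q. ae r (\<lambda>g. X g i = Y g i)" using r by blast
      qed
    next
      assume a: "ae p (\<lambda>g. X g i = Y g i)"
      then have a': "ae p (\<lambda>g. Y g i = X g i)" by (rule ae_mp) simp
      show "(\<^bold>\<forall>j. op (nn i) j \<^bold>\<in> realname X \<^bold>\<longleftrightarrow> op (nn i) j \<^bold>\<in> realname Y) p"
        using agree_realname_aux[OF X Y ae_mono[OF a]] agree_realname_aux[OF Y X ae_mono[OF a']]
        by (auto simp: fbasic fiff_iff)
    qed
  qed
  also have "\<dots> \<longleftrightarrow> ae p (\<lambda>g. \<forall>i. i < n \<longrightarrow> X g i = Y g i)"
    unfolding ae_all_iff by (rule all_cong1) (auto intro: aeI elim: ae_mp)
  also have "\<dots> \<longleftrightarrow> ae p (\<lambda>g. rst (X g) n = rst (Y g) n)"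
    by (rule arg_cong[of _ _ "ae p"]) auto
  finally show ?thesis .
qed

text \<open>The content of \<open>is_open_class\<close> once points are given by functions with
  \<open>rl\<close>; see \<open>is_open_class_iff\<close>. Here \<open>V X q\<close> is read as q
  forcing the point X into the class.\<close>

definition openf :: "(('l gen \<Rightarrow> nat \<Rightarrow> bool) \<Rightarrow> 'l cohen fprop) \<Rightarrow> 'l cohen \<Rightarrow> bool" where
  "openf V p \<longleftrightarrow> (\<forall>X. rl X \<longrightarrow> (\<forall>q\<le>p. V X q \<longrightarrow> (\<exists>r\<le>q. \<exists>n. \<forall>Y. rl Y \<longrightarrow>
      (\<forall>s\<le>r. ae s (\<lambda>g. rst (X g) n = rst (Y g) n) \<longrightarrow> V Y s))))"

lemma is_open_class_iff:
  fixes W :: "('i, 'l cohen) fclass"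
  assumes W: "good W"
  shows "is_open_class W p \<longleftrightarrow>
    (\<forall>q\<le>p. \<forall>x. W x q \<longrightarrow> is_cantor x q) \<and> openf (\<lambda>X. W (realname X)) p"
proof -
  have g: "good (\<lambda>n. \<^bold>\<forall>y. is_cantor y \<^bold>\<and> agree n x y \<^bold>\<longrightarrow> W y)" for x
    by (intro good_intros good_const good_reg[OF W])
  have gx: "good (\<lambda>x. \<^bold>\<forall>y. is_cantor y \<^bold>\<and> agree n x y \<^bold>\<longrightarrow> W y)" for n
    by (intro good_intros good_const good_reg[OF W])
  have [simp]: "reg (W x)" for x by (rule good_reg[OF W])
  have 1: "(\<^bold>\<forall>y. is_cantor y \<^bold>\<and> agree (nn n) (realname X) y \<^bold>\<longrightarrow> W y) r \<longleftrightarrow>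
     (\<forall>Y. rl Y \<longrightarrow> (\<forall>s\<le>r. ae s (\<lambda>g. rst (X g) n = rst (Y g) n) \<longrightarrow> W (realname Y) s))"
    if X: "rl X" for X n r
  proof
    assume a: "(\<^bold>\<forall>y. is_cantor y \<^bold>\<and> agree (nn n) (realname X) y \<^bold>\<longrightarrow> W y) r"
    show "\<forall>Y. rl Y \<longrightarrow> (\<forall>s\<le>r. ae s (\<lambda>g. rst (X g) n = rst (Y g) n) \<longrightarrow> W (realname Y) s)"
      using a is_cantor_realname agree_iff[OF X] by (simp add: fbasic fimp_iff)
  next
    assume a: "\<forall>Y. rl Y \<longrightarrow> (\<forall>s\<le>r. ae s (\<lambda>g. rst (X g) n = rst (Y g) n) \<longrightarrow> W (realname Y) s)"
    have "W y s" if s: "s \<le> r" "is_cantor y s" "agree (nn n) (realname X) y s" for y s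
    proof -
      obtain Y where Y: "rl Y" "(y \<^bold>= realname Y) s" using cantorE[OF s(2)] .
      have "good (\<lambda>y. agree (nn n) (realname X) y)" by (intro good_intros)
      then have "agree (nn n) (realname X) (realname Y) s"
        by (rule good_cong[of "\<lambda>y. agree (nn n) (realname X) y", OF _ Y(2) s(3)])
      then have "W (realname Y) s" using a Y(1) s(1) by (simp add: agree_iff[OF X])
      then show ?thesis using good_cong[OF W feq_sym[OF Y(2)]] by blast
    qed
    then show "(\<^bold>\<forall>y. is_cantor y \<^bold>\<and> agree (nn n) (realname X) y \<^bold>\<longrightarrow> W y) r"
      by (simp add: fbasic fimp_iff)
  qed
  show ?thesis
  proof
    assume a: "is_open_class W p"
    have c: "is_cantor x q" if "q \<le> p" "W x q" for q x
      using a that unfolding is_open_class_def by (simp add: fbasic fimp_iff)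
    have "\<exists>r\<le>q. \<exists>n. \<forall>Y. rl Y \<longrightarrow> (\<forall>s\<le>r. ae s (\<lambda>g. rst (X g) n = rst (Y g) n) \<longrightarrow> W (realname Y) s)"
      if X: "rl X" "q \<le> p" "W (realname X) q" for X q
    proof -
      obtain r n where r: "r \<le> q" "(n \<^bold>\<in> omega) r" "(\<^bold>\<forall>y. is_cantor y \<^bold>\<and> agree n (realname X) y \<^bold>\<longrightarrow> W y) r"
        using a X(2,3) unfolding is_open_class_def by (simp add: fconj_def fall_def[of "\<lambda>x. W x \<^bold>\<longrightarrow> _ x"] fimp_iff fex_iff) blast
      obtain s m where s: "s \<le> r" "(n \<^bold>= nn m) s" using r(2) unfolding mem_omega_iff by blast
      have "(\<^bold>\<forall>y. is_cantor y \<^bold>\<and> agree (nn m) (realname X) y \<^bold>\<longrightarrow> W y) s"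
        using good_cong[OF g s(2) reg_mono[OF good_reg[OF g] r(3) s(1)]] .
      then show ?thesis using 1[OF X(1)] r s by (meson order_trans)
    qed
    then show "(\<forall>q\<le>p. \<forall>x. W x q \<longrightarrow> is_cantor x q) \<and> openf (\<lambda>X. W (realname X)) p"
      unfolding openf_def using c by blast
  next
    assume a: "(\<forall>q\<le>p. \<forall>x. W x q \<longrightarrow> is_cantor x q) \<and> openf (\<lambda>X. W (realname X)) p"
    have "\<exists>r\<le>q'. \<exists>n. (n \<^bold>\<in> omega) r \<and> (\<^bold>\<forall>y. is_cantor y \<^bold>\<and> agree n x y \<^bold>\<longrightarrow> W y) r"
      if q: "q \<le> p" "W x q" "q' \<le> q" for q x q'
    proof -
      have q'p: "q' \<le> p" using q by (meson order_trans)
      have Wq: "W x q'" using reg_mono[OF good_reg[OF W] q(2,3)] .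
      then have "is_cantor x q'" using a q'p by blast
      then obtain X where X: "rl X" "(x \<^bold>= realname X) q'" using cantorE by blast
      have "W (realname X) q'" using good_cong[OF W X(2) Wq] .
      then obtain r n where r: "r \<le> q'"
        "\<forall>Y. rl Y \<longrightarrow> (\<forall>s\<le>r. ae s (\<lambda>g. rst (X g) n = rst (Y g) n) \<longrightarrow> W (realname Y) s)"
        using a X(1) q'p unfolding openf_def by blast
      then have "(\<^bold>\<forall>y. is_cantor y \<^bold>\<and> agree (nn n) (realname X) y \<^bold>\<longrightarrow> W y) r" using 1[OF X(1)] by blast
      then have "(\<^bold>\<forall>y. is_cantor y \<^bold>\<and> agree (nn n) x y \<^bold>\<longrightarrow> W y) r"
        using good_cong[OF gx feq_sym[OF feq_mono[OF X(2) r(1)]]] by blast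
      then show ?thesis using r(1) nn_mem_omega by blast
    qed
    then show "is_open_class W p"
      unfolding is_open_class_def using a
      by (simp add: fconj_def fall_def[of "\<lambda>x. W x \<^bold>\<longrightarrow> _ x"] fimp_iff fex_iff)
  qed
qed

lemma good_is_open_class:
  "(\<And>y :: ('i, 'l cohen) name. good (\<lambda>x :: ('i, 'l cohen) name. V x y)) \<Longrightarrow> good (\<lambda>x. is_open_class (V x))"
  unfolding is_open_class_def by (intro good_intros)

lemma good_is_open [good_intros]: "cong f \<Longrightarrow> good (\<lambda>x :: ('i, 'l cohen) name. is_open (f x))"
  unfolding is_open_def by (intro good_is_open_class good_intros)

lemma good_is_clopen [good_intros]: "cong f \<Longrightarrow> good (\<lambda>x :: ('i, 'l cohen) name. is_clopen (f x))"
  unfolding is_clopen_def by (intro good_is_open_class good_intros)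

lemma reg_is_open [simp]: "reg (is_open (c :: ('i, 'l cohen) name))"
  using good_reg[OF good_is_open[OF cong_id]] .

lemma reg_is_clopen [simp]: "reg (is_clopen (c :: ('i, 'l cohen) name))"
  using good_reg[OF good_is_clopen[OF cong_id]] .

lemma is_open_iff:
  "is_open (c :: ('i, 'l cohen) name) p \<longleftrightarrow>
    (\<forall>q\<le>p. \<forall>x. (x \<^bold>\<in> c) q \<longrightarrow> is_cantor x q) \<and> openf (\<lambda>X. realname X \<^bold>\<in> c) p"
  unfolding is_open_def by (rule is_open_class_iff) (intro good_intros)

lemma is_clopen_iff:
  "is_clopen (c :: ('i, 'l cohen) name) p \<longleftrightarrow>
    (\<forall>q\<le>p. \<forall>x. (x \<^bold>\<in> c) q \<longrightarrow> is_cantor x q) \<and> openf (\<lambda>X. realname X \<^bold>\<in> c) p \<and>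
    openf (\<lambda>X. \<^bold>\<not> realname X \<^bold>\<in> c) p"
proof -
  have "good (\<lambda>x. is_cantor x \<^bold>\<and> \<^bold>\<not> x \<^bold>\<in> c)" by (intro good_intros)
  then have "is_open_class (\<lambda>x. is_cantor x \<^bold>\<and> \<^bold>\<not> x \<^bold>\<in> c) p \<longleftrightarrow>
      openf (\<lambda>X. is_cantor (realname X) \<^bold>\<and> \<^bold>\<not> realname X \<^bold>\<in> c) p"
    by (subst is_open_class_iff) (auto simp: fconj_def)
  also have "\<dots> \<longleftrightarrow> openf (\<lambda>X. \<^bold>\<not> realname X \<^bold>\<in> c) p"
    unfolding openf_def by (auto simp: fconj_def is_cantor_realname) 
  finally show ?thesis unfolding is_clopen_def by (simp add: fconj_def is_open_iff)
qed

lemma rst_clop_cong: "mx e \<le> n \<Longrightarrow> rst x n = rst y n \<Longrightarrow> x \<in> clop e \<longleftrightarrow> y \<in> clop e"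
  by (metis lev_rst)

lemma is_clopen_clopname: "is_clopen (clopname e) p"
  unfolding is_clopen_iff
proof (intro conjI allI impI)
  show "is_cantor x q" if "(x \<^bold>\<in> clopname e) q" for x q using clopname_cantor[OF that] .
  show "openf (\<lambda>X. realname X \<^bold>\<in> clopname e) p"
    unfolding openf_def
  proof (intro allI impI)
    fix X q assume a: "rl X" "(realname X \<^bold>\<in> clopname e) q"
    have "(realname Y \<^bold>\<in> clopname e) s"
      if Y: "rl Y" "s \<le> q" "ae s (\<lambda>g. rst (X g) (mx e) = rst (Y g) (mx e))" for Y s
    proof -
      have "ae s (\<lambda>g. X g \<in> clop e)" using fmem_mono[OF a(2) Y(2)] by (simp add: mem_clopname a)
      then have "ae s (\<lambda>g. Y g \<in> clop e)" by (rule ae_mp2[OF Y(3)]) (use rst_clop_cong in blast)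
      then show ?thesis by (simp add: mem_clopname Y)
    qed
    then show "\<exists>r\<le>q. \<exists>n. \<forall>Y. rl Y \<longrightarrow> (\<forall>s\<le>r. ae s (\<lambda>g. rst (X g) n = rst (Y g) n) \<longrightarrow> (realname Y \<^bold>\<in> clopname e) s)"
      by blast
  qed
  show "openf (\<lambda>X. \<^bold>\<not> realname X \<^bold>\<in> clopname e) p"
    unfolding openf_def
  proof (intro allI impI)
    fix X q assume a: "rl X" "(\<^bold>\<not> realname X \<^bold>\<in> clopname e) q"
    have "(\<^bold>\<not> realname Y \<^bold>\<in> clopname e) s"
      if Y: "rl Y" "s \<le> q" "ae s (\<lambda>g. rst (X g) (mx e) = rst (Y g) (mx e))" for Y s
      unfolding fneg_def
    proof (intro allI impI notI)
      fix r assume r: "r \<le> s" "(realname Y \<^bold>\<in> clopname e) r"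
      then have "ae r (\<lambda>g. Y g \<in> clop e)" by (simp add: mem_clopname Y)
      then have "ae r (\<lambda>g. X g \<in> clop e)" by (rule ae_mp2[OF ae_mono[OF Y(3) r(1)]]) (use rst_clop_cong in blast)
      then have "(realname X \<^bold>\<in> clopname e) r" by (simp add: mem_clopname a)
      moreover have "r \<le> q" using r Y by (meson order_trans)
      ultimately show False using a(2) unfolding fneg_def by blast
    qed
    then show "\<exists>r\<le>q. \<exists>n. \<forall>Y. rl Y \<longrightarrow> (\<forall>s\<le>r. ae s (\<lambda>g. rst (X g) n = rst (Y g) n) \<longrightarrow> (\<^bold>\<not> realname Y \<^bold>\<in> clopname e) s)"
      by blast
  qed
qed

subsection \<open>Compactness\<close>

lemma bp_inf_above: "(\<And>s. bp S (\<lambda>g. T g s)) \<Longrightarrow> bp S (\<lambda>g. inf_above (T g) s)"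
  unfolding inf_above_def by (intro bp_intros)

lemma bpf_br:
  assumes "\<And>s. bp S (\<lambda>g. T g s)" shows "bpf S (\<lambda>g. br (T g) n)"
proof (induction n)
  case (Suc n)
  have "bp S (\<lambda>g. \<not> inf_above (T g) (br (T g) n @ [False]))"
    by (rule bp_subst[OF Suc, of "\<lambda>c g. \<not> inf_above (T g) (c @ [False])"])
       (intro bp_intros bp_inf_above assms)
  then have "bpf S (\<lambda>g. \<not> inf_above (T g) (br (T g) n @ [False]))" by (simp add: bpf_bool)
  then show ?case using bpf_app2[OF Suc, of _ "\<lambda>s b. s @ [b]"] by simp
qed (simp add: bpf_const)

lemma bp_lb:
  assumes "\<And>s. bp S (\<lambda>g. T g s)" shows "bp S (\<lambda>g. lb (T g) n)"
  unfolding lb_def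
  by (rule bp_subst[OF bpf_br[OF assms], of "\<lambda>c g. \<not> inf_above (T g) (c @ [False])"])
     (intro bp_intros bp_inf_above assms)

text \<open>Unfolded form of the statement that the cone of s is included in the class V.\<close>

definition boxs :: "(('l gen \<Rightarrow> nat \<Rightarrow> bool) \<Rightarrow> 'l cohen fprop) \<Rightarrow> bool list \<Rightarrow> 'l cohen fprop" where
  "boxs V s p \<longleftrightarrow> (\<forall>X. rl X \<longrightarrow> (\<forall>q\<le>p. ae q (\<lambda>g. pre s (X g)) \<longrightarrow> V X q))"

lemma reg_boxs:
  assumes "\<And>X. reg (V X)" shows "reg (boxs V s)"
proof (rule regI)
  fix p q assume "boxs V s p" "q \<le> p"
  then show "boxs V s q" unfolding boxs_def by (meson order_trans)
next
  fix p assume a: "\<And>q. q \<le> p \<Longrightarrow> \<exists>r\<le>q. boxs V s r"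
  show "boxs V s p"
    unfolding boxs_def
  proof (intro allI impI)
    fix X q assume q: "rl X" "q \<le> p" "ae q (\<lambda>g. pre s (X g))"
    show "V X q"
    proof (rule reg_dense[OF assms])
      fix q' assume q': "q' \<le> q"
      then obtain r where r: "r \<le> q'" "boxs V s r" using a q by (meson order_trans)
      have "r \<le> q" using r q' by (meson order_trans)
      then have "V X r" using r(2) q(1) ae_mono[OF q(3)] unfolding boxs_def by blast
      then show "\<exists>r\<le>q'. V X r" using r by blast
    qed
  qed
qed

lemma boxs_append: "boxs V s p \<Longrightarrow> boxs V (s @ t) p"
  unfolding boxs_def
proof (intro allI impI)
  fix X q assume a: "\<forall>X. rl X \<longrightarrow> (\<forall>q\<le>p. ae q (\<lambda>g. pre s (X g)) \<longrightarrow> V X q)"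
    "rl X" "q \<le> p" "ae q (\<lambda>g. pre (s @ t) (X g))"
  have "ae q (\<lambda>g. pre s (X g))" by (rule ae_mp[OF a(4)]) (rule pre_append)
  then show "V X q" using a by blast
qed

lemma ev_boxs_append: "ev (boxs V s) g \<Longrightarrow> ev (boxs V (s @ t)) g"
  unfolding ev_def using boxs_append by blast

lemma openf_boxs:
  assumes V: "\<And>X. reg (V X)" and "openf V p" "rl X" "V X p"
  obtains r n s where "r \<le> p" "ae r (\<lambda>g. rst (X g) n = s)" "boxs V s r"
proof -
  obtain r n where r: "r \<le> p" "\<And>Y s. rl Y \<Longrightarrow> s \<le> r \<Longrightarrow> ae s (\<lambda>g. rst (X g) n = rst (Y g) n) \<Longrightarrow> V Y s"
    using assms(2-4) unfolding openf_def by (meson order_refl)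
  obtain q s where q: "q \<le> r" "ae q (\<lambda>g. rst (X g) n = s)"
    using ae_value[where f = "\<lambda>g. rst (X g) n", OF bpfD[OF bpf_rst[OF rlD[OF assms(3)]]]] by metis
  have len: "length s = n" using ae_witness[OF q(2)] by auto
  have "boxs V s q"
    unfolding boxs_def
  proof (intro allI impI)
    fix Y q' assume Y: "rl Y" "q' \<le> q" "ae q' (\<lambda>g. pre s (Y g))"
    have "ae q' (\<lambda>g. rst (X g) n = rst (Y g) n)"
      by (rule ae_mp2[OF ae_mono[OF q(2) Y(2)] Y(3)]) (use len in \<open>simp add: pre_eq_rst\<close>)
    then show "V Y q'" using r(2)[OF Y(1)] Y(2) q(1) by (meson order_trans)
  qed
  then show thesis using that q r(1) by (meson order_trans)
qed

text \<open>Compactness of Cantor space in the extension. The tree of strings whose cones are not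
  decided to lie inside or outside c cannot be infinite: its branch would be a point inside or
  outside c, and openness of that side decides a cone around it. So some level is decided
  completely, and its strings inside c are the code.\<close>

lemma clopen_code:
  fixes c :: "('i, 'l cohen) name"
  assumes "is_clopen c p"
  shows "\<exists>r\<le>p. \<exists>e. (c \<^bold>= clopname e) r"
proof -
  \<comment> \<open>Index b selects the set or its complement, both of which are open, so one
    argument serves for both.\<close>
  define V where "V b X = (if b then realname X \<^bold>\<in> c else \<^bold>\<not> realname X \<^bold>\<in> c)" for b X
  have V: "reg (V b X)" for b X by (simp add: V_def)
  have op: "openf (V b) q" if "q \<le> p" for b q
  proof -
    have "is_clopen c q" using reg_mono[OF reg_is_clopen assms that] .
    then show ?thesis unfolding is_clopen_iff V_def by (cases b) simp_all
  qed
  define T where "T g s \<longleftrightarrow> \<not> ev (boxs (V True) s) g \<and> \<not> ev (boxs (V False) s) g" for g s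
  have T: "bp UNIV (\<lambda>g. T g s)" for s
    unfolding T_def by (intro bp_conj bp_not bp_ev_UNIV reg_boxs V)
  have Tpre: "T g s" if "T g (s @ t)" for g s t
    using that unfolding T_def by (metis ev_boxs_append)
  define X where "X g = lb (T g)" for g
  have X: "rl X" unfolding rl_def X_def by (intro allI bp_lb T)
  let ?Q = "\<lambda>g. \<forall>N. \<exists>t. length t = N \<and> T g t"
  have bQ: "bp UNIV ?Q" by (intro bp_intros T)
  have False if r: "r \<le> p" "ae r ?Q" for r
  proof -
    have br: "ae r (\<lambda>g. \<forall>n. T g (rst (X g) n))"
    proof (rule ae_mp[OF r(2)], intro allI)
      fix g n assume "\<forall>N. \<exists>t. length t = N \<and> T g t"
      then show "T g (rst (X g) n)" unfolding X_def by (intro konig[of "T g", OF Tpre]) auto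
    qed
    obtain r1 where r1': "r1 \<le> r" "(realname X \<^bold>\<in> c) r1 \<or> (\<^bold>\<not> realname X \<^bold>\<in> c) r1"
      using reg_decide[OF reg_fmem, of r "realname X" c] by blast
    then obtain b where r1: "r1 \<le> r" "V b X r1" unfolding V_def by (metis (full_types))
    have "r1 \<le> p" using r r1 by (meson order_trans)
    then obtain r2 n s where r2: "r2 \<le> r1" "ae r2 (\<lambda>g. rst (X g) n = s)" "boxs (V b) s r2"
      using openf_boxs[where V = "V b" and X = X and p = r1, OF V op X r1(2)] by metis
    have "ae r2 (\<lambda>g. \<forall>n. T g (rst (X g) n))" using ae_mono[OF br] r1 r2 by (meson order_trans)
    then have "ae r2 (\<lambda>g. False)"
    proof (rule ae_mp2[OF _ r2(2)])
      fix g assume g: "ext r2 g" "\<forall>n. T g (rst (X g) n)" "rst (X g) n = s"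
      have "ev (boxs (V b) s) g" unfolding ev_def using g(1) r2(3) by blast
      then show False using g(2,3) unfolding T_def by (cases b) metis+
    qed
    then show False by simp
  qed
  then have nQ: "ae p (\<lambda>g. \<not> ?Q g)" using ae_not_iff[OF bQ] by blast
  have 1: "ae p (\<lambda>g. \<exists>N. \<forall>t. length t = N \<longrightarrow> \<not> T g t)" by (rule ae_mp[OF nQ]) blast
  have 2: "bp UNIV (\<lambda>g. \<forall>t. length t = N \<longrightarrow> \<not> T g t)" for N by (intro bp_intros T)
  have "\<exists>r\<le>p. \<exists>N. ae r (\<lambda>g. \<forall>t. length t = N \<longrightarrow> \<not> T g t)"
    by (rule ae_ex[where Q = "\<lambda>N g. \<forall>t. length t = N \<longrightarrow> \<not> T g t", OF 2 1]) blast
  then obtain r N where r: "r \<le> p" "ae r (\<lambda>g. \<forall>t. length t = N \<longrightarrow> \<not> T g t)" by blast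
  \<comment> \<open>So far every string of length N is decided by some condition depending on g; now
    one condition has to decide them all.\<close>
  have "\<exists>s\<le>r. \<exists>f. \<forall>t\<in>{t. length t = N}. boxs (V (f t)) t s"
  proof (rule finite_decide[OF finite_strings])
    fix t :: "bool list" and q assume t: "t \<in> {t. length t = N}" and q: "q \<le> r"
    have "ae q (\<lambda>g. \<forall>t. length t = N \<longrightarrow> \<not> T g t)" using ae_mono[OF r(2) q] .
    then obtain g where g: "ext q g" "\<forall>t. length t = N \<longrightarrow> \<not> T g t" using ae_witness by blast
    then obtain b where "ev (boxs (V b) t) g" using t unfolding T_def by (metis mem_Collect_eq)
    then obtain s where s: "ext s g" "boxs (V b) t s" unfolding ev_def by blast
    then have "boxs (V b) t (join q s)"
      using reg_mono[OF reg_boxs[OF V] s(2) ext_compat(3)[OF g(1) s(1)]] by blast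
    then show "\<exists>s\<le>q. \<exists>b. boxs (V b) t s" using ext_compat(2)[OF g(1) s(1)] by blast
  qed (rule reg_boxs[OF V])
  then obtain s f where s: "s \<le> r" "\<And>t. length t = N \<Longrightarrow> boxs (V (f t)) t s" by blast
  have sp: "s \<le> p" using s r by (meson order_trans)
  obtain e where e: "set e = {t. length t = N \<and> f t}"
    using finite_list[of "{t. length t = N \<and> f t}"] finite_subset[OF _ finite_strings[of N]] by (metis (no_types, lifting) Collect_mono)
  have "(c \<^bold>= clopname e) s"
  proof (rule reals_eqI)
    show "is_cantor z q" if "q \<le> s" "(z \<^bold>\<in> c) q" for q z
      using that assms sp unfolding is_clopen_iff by (meson order_trans)
    show "is_cantor z q" if "(z \<^bold>\<in> clopname e) q" for q z using clopname_cantor[OF that] .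
    fix Y q assume Y: "rl Y" and q: "q \<le> s"
    have d: "\<exists>r\<le>q'. \<exists>t. length t = N \<and> ae r (\<lambda>g. Y g \<in> clop e \<longleftrightarrow> f t) \<and> V (f t) Y r" if q': "q' \<le> q" for q'
    proof -
      obtain r t where r: "r \<le> q'" "ae r (\<lambda>g. rst (Y g) N = t)"
        using ae_value[where f = "\<lambda>g. rst (Y g) N", OF bpfD[OF bpf_rst[OF rlD[OF Y]]]] by metis
      have len: "length t = N" using ae_witness[OF r(2)] by auto
      have pt: "ae r (\<lambda>g. pre t (Y g))" by (rule ae_mp[OF r(2)]) auto
      have "r \<le> s" using r q' q by (meson order_trans)
      then have "V (f t) Y r" using s(2)[OF len] Y pt unfolding boxs_def by blast
      moreover have "ae r (\<lambda>g. Y g \<in> clop e \<longleftrightarrow> f t)"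
      proof (rule ae_mp[OF r(2)])
        fix g assume g: "rst (Y g) N = t"
        have "Y g \<in> clop e \<longleftrightarrow> (\<exists>u. length u = N \<and> f u \<and> pre u (Y g))" by (auto simp: clop_def e)
        also have "\<dots> \<longleftrightarrow> f t" using g len by (auto simp: pre_eq_rst)
        finally show "Y g \<in> clop e \<longleftrightarrow> f t" .
      qed
      ultimately show ?thesis using r len by blast
    qed
    show "(realname Y \<^bold>\<in> c) q \<longleftrightarrow> (realname Y \<^bold>\<in> clopname e) q"
    proof
      assume a: "(realname Y \<^bold>\<in> c) q"
      show "(realname Y \<^bold>\<in> clopname e) q"
      proof (rule reg_dense[OF reg_fmem])
        fix q' assume q': "q' \<le> q"
        obtain r t where r: "r \<le> q'" "ae r (\<lambda>g. Y g \<in> clop e \<longleftrightarrow> f t)" "V (f t) Y r" using d[OF q'] by blast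
        have "(realname Y \<^bold>\<in> c) r" using fmem_mono[OF a] r q' by (meson order_trans)
        then have "f t" using r(3) by (cases "f t") (auto simp: fneg_def V_def)
        then have "ae r (\<lambda>g. Y g \<in> clop e)" using r(2) by simp
        then show "\<exists>r\<le>q'. (realname Y \<^bold>\<in> clopname e) r" using r(1) by (auto simp: mem_clopname[OF Y])
      qed
    next
      assume a: "(realname Y \<^bold>\<in> clopname e) q"
      show "(realname Y \<^bold>\<in> c) q"
      proof (rule reg_dense[OF reg_fmem])
        fix q' assume q': "q' \<le> q"
        obtain r t where r: "r \<le> q'" "ae r (\<lambda>g. Y g \<in> clop e \<longleftrightarrow> f t)" "V (f t) Y r" using d[OF q'] by blast
        have "(realname Y \<^bold>\<in> clopname e) r" using fmem_mono[OF a] r q' by (meson order_trans)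
        then have "ae r (\<lambda>g. Y g \<in> clop e)" by (simp add: mem_clopname[OF Y])
        then have "f t" using ae_witness[OF ae_conj[OF _ r(2)]] by blast
        then show "\<exists>r\<le>q'. (realname Y \<^bold>\<in> c) r" using r by (auto simp: V_def)
      qed
    qed
  qed
  then show ?thesis using sp by blast
qed

end

context cohen_setting begin

subsection \<open>The measure of clopen sets\<close>

lemma fexD: "fex \<Phi> p \<Longrightarrow> \<exists>r\<le>p. \<exists>x. \<Phi> x r"
  unfolding fex_iff by blast

lemma reg_False: "reg (\<lambda>_. False)"
  unfolding reg_def by auto

lemma is_injD:
  assumes "is_inj f a B p" "\<And>y. reg (B y)" "q \<le> p" "(op x y \<^bold>\<in> f) q" "(op x' y \<^bold>\<in> f) q"
  shows "(x \<^bold>= x') q"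
proof -
  have "(\<^bold>\<forall>x x' y. op x y \<^bold>\<in> f \<^bold>\<and> op x' y \<^bold>\<in> f \<^bold>\<longrightarrow> x \<^bold>= x') p"
    using assms(1) by (simp add: is_inj_def fconj_def)
  then have "(op x y \<^bold>\<in> f \<^bold>\<and> op x' y \<^bold>\<in> f \<^bold>\<longrightarrow> x \<^bold>= x') p" unfolding fall_def by blast
  then show ?thesis by (rule fimpD) (use assms(3-5) in \<open>simp_all add: fconj_def\<close>)
qed

lemma good_fun2: "good (\<lambda>s :: ('i, 'l cohen) name. fun2 s a)"
  by (intro good_intros)

lemma reg_clopen_measure_le [simp]: "reg (clopen_measure_le c (k :: ('i, 'l cohen) name))"
  unfolding clopen_measure_le_def by simp

text \<open>The objects in the witness are finite, so extending the condition decides them: first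
  which strings of length N lie in A, then the values of g on all pairs. The decided values form an
  actual injection, which gives the inequality of cardinalities.\<close>

lemma measure_leD:
  assumes "clopen_measure_le (clopname e) (nn k) p" shows "mu e \<le> 1 / 2 ^ k"
proof -
  obtain r n A D g where r: "r \<le> p" "(n \<^bold>\<in> omega) r"
      "(\<^bold>\<forall>s. s \<^bold>\<in> A \<^bold>\<longrightarrow> fun2 s n) r"
      "(\<^bold>\<forall>x. x \<^bold>\<in> clopname e \<^bold>\<longleftrightarrow> (is_cantor x \<^bold>\<and> (\<^bold>\<exists>s. s \<^bold>\<in> A \<^bold>\<and> s \<^bold>\<subseteq> x))) r"
      "(\<^bold>\<forall>z. z \<^bold>\<in> D \<^bold>\<longleftrightarrow> (\<^bold>\<exists>s t. s \<^bold>\<in> A \<^bold>\<and> fun2 t (nn k) \<^bold>\<and> z \<^bold>= op s t)) r"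
      "is_inj g D (\<lambda>u. fun2 u n) r"
  proof -
    from assms have "\<exists>r1\<le>p. \<exists>n. \<exists>r2\<le>r1. \<exists>A. \<exists>r3\<le>r2. \<exists>D. \<exists>r4\<le>r3. \<exists>g. (n \<^bold>\<in> omega \<^bold>\<and>
       (\<^bold>\<forall>s. s \<^bold>\<in> A \<^bold>\<longrightarrow> fun2 s n) \<^bold>\<and>
       (\<^bold>\<forall>x. x \<^bold>\<in> clopname e \<^bold>\<longleftrightarrow> (is_cantor x \<^bold>\<and> (\<^bold>\<exists>s. s \<^bold>\<in> A \<^bold>\<and> s \<^bold>\<subseteq> x))) \<^bold>\<and>
       (\<^bold>\<forall>z. z \<^bold>\<in> D \<^bold>\<longleftrightarrow> (\<^bold>\<exists>s t. s \<^bold>\<in> A \<^bold>\<and> fun2 t (nn k) \<^bold>\<and> z \<^bold>= op s t)) \<^bold>\<and>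
       is_inj g D (\<lambda>u. fun2 u n)) r4"
      unfolding clopen_measure_le_def by (fast dest!: fexD)
    then show thesis unfolding fconj_def[of "_ \<^bold>\<in> omega"] fconj_def[of "fall _"] using that by (meson order_trans)
  qed
  obtain r1 N where r1: "r1 \<le> r" "(n \<^bold>= nn N) r1" using r(2) unfolding mem_omega_iff by blast
  have g1: "good (\<lambda>n. \<^bold>\<forall>s. s \<^bold>\<in> A \<^bold>\<longrightarrow> fun2 s n)" by (intro good_intros)
  have g2: "good (\<lambda>n. is_inj g D (\<lambda>u. fun2 u n))" unfolding is_inj_def by (intro good_intros)
  have A: "fun2 s (nn N) q" if "q \<le> r1" "(s \<^bold>\<in> A) q" for s q
    using good_cong[OF g1 r1(2) reg_mono[OF good_reg[OF g1] r(3) r1(1)]] that by (simp add: fbasic fimp_iff)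
  have inj: "is_inj g D (\<lambda>u. fun2 u (nn N)) r1"
    using good_cong[OF g2 r1(2) reg_mono[OF good_reg[OF g2] r(6) r1(1)]] .
  have "\<exists>r2\<le>r1. \<exists>f. \<forall>t\<in>{t. length t = N}. (if f t then strname t \<^bold>\<in> A else \<^bold>\<not> strname t \<^bold>\<in> A) r2"
  proof (rule finite_decide[OF finite_strings])
    fix t :: "bool list" and q
    obtain s where "s \<le> q" "(strname t \<^bold>\<in> A) s \<or> (\<^bold>\<not> strname t \<^bold>\<in> A) s" using reg_decide[OF reg_fmem] by blast
    then show "\<exists>s\<le>q. \<exists>b. (if b then strname t \<^bold>\<in> A else \<^bold>\<not> strname t \<^bold>\<in> A) s" by (metis (full_types))
  qed simp
  then obtain r2 f where r2: "r2 \<le> r1" "\<And>t. length t = N \<Longrightarrow> (if f t then strname t \<^bold>\<in> A else \<^bold>\<not> strname t \<^bold>\<in> A) r2"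
    by blast
  have r2r: "r2 \<le> r" using r1 r2 by (meson order_trans)
  define A' where "A' = {t. length t = N \<and> f t}"
  have fA: "finite A'" unfolding A'_def by (rule finite_subset[OF _ finite_strings[of N]]) blast
  obtain e' where e': "set e' = A'" using finite_list[OF fA] by blast
  \<comment> \<open>Two codes agree as soon as they agree on ground model points, so the description
    of the clopen set is only evaluated at constant names.\<close>
  have iff: "x \<in> clop e \<longleftrightarrow> x \<in> clop e'" for x
  proof -
    let ?x = "realname (\<lambda>g. x)"
    have "(?x \<^bold>\<in> clopname e) r2 \<longleftrightarrow> is_cantor ?x r2 \<and> (\<forall>q\<le>r2. \<exists>s\<le>q. \<exists>t. (t \<^bold>\<in> A) s \<and> (t \<^bold>\<subseteq> ?x) s)"
      using r(4) r2r by (simp add: fall_def fconj_def fiff_iff fex_iff)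
    then have *: "x \<in> clop e \<longleftrightarrow> (\<forall>q\<le>r2. \<exists>s\<le>q. \<exists>t. (t \<^bold>\<in> A) s \<and> (t \<^bold>\<subseteq> ?x) s)"
      by (simp add: mem_clopname rl_const is_cantor_realname)
    show ?thesis
    proof
      assume "x \<in> clop e"
      then obtain q t where q: "q \<le> r2" "(t \<^bold>\<in> A) q" "(t \<^bold>\<subseteq> ?x) q" using * by blast
      have "fun2 t (nn N) q" using A q r2 by (meson order_trans)
      then obtain s u where s: "s \<le> q" "length u = N" "(t \<^bold>= strname u) s" using string_rep by blast
      have "(strname u \<^bold>\<in> A) s" using fmem_cong1[OF s(3) fmem_mono[OF q(2) s(1)]] .
      moreover have "s \<le> r2" using s q by (meson order_trans)
      ultimately have "f u" using r2(2)[OF s(2)] by (cases "f u") (auto simp: fneg_def)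
      moreover have "(strname u \<^bold>\<subseteq> ?x) s"
        using q(3) s(1) fmem_cong2[OF feq_sym[OF feq_mono[OF s(3)]]] unfolding fsub_iff by (meson order_trans)
      then have "pre u x" by (simp add: strname_sub_realname rl_const)
      ultimately show "x \<in> clop e'" using s(2) by (auto simp: clop_def e' A'_def)
    next
      assume "x \<in> clop e'"
      then obtain u where u: "length u = N" "f u" "pre u x" by (auto simp: clop_def e' A'_def)
      have "(strname u \<^bold>\<subseteq> ?x) q" for q using u by (simp add: strname_sub_realname rl_const)
      moreover have "(strname u \<^bold>\<in> A) r2" using r2(2)[OF u(1)] u(2) by simp
      ultimately show "x \<in> clop e" unfolding * using fmem_mono[of "strname u" A r2] by blast
    qed
  qed
  have "clop e = clop e'" using iff by (intro set_eqI)
  then have "mu e = mu e'" using mu_mono[of e e'] mu_mono[of e' e] by simp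
  also have "mu e' = card A' / 2 ^ N"
  proof -
    have "mx e' \<le> N" unfolding mx_def by (rule Max.boundedI) (simp, simp, use e' in \<open>auto simp: A'_def\<close>)
    then have "mu e' = card (lev N e') / 2 ^ N" by (rule mu_eq_lev)
    moreover have "lev N e' = A'"
    proof (intro equalityI subsetI)
      fix t assume "t \<in> lev N e'"
      then obtain s where s: "s \<in> A'" "prefix s t" "length t = N" unfolding lev_def e' by blast
      then obtain u where "t = s @ u" by (auto elim: prefixE)
      then show "t \<in> A'" using s by (simp add: A'_def)
    next
      fix t assume "t \<in> A'"
      then show "t \<in> lev N e'" unfolding lev_def e' by (auto simp: A'_def)
    qed
    ultimately show ?thesis by simp
  qed
  finally have mu: "mu e = card A' / 2 ^ N" .
  let ?I = "A' \<times> {u :: bool list. length u = k}"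
  let ?d = "\<lambda>(t, u). op (strname t) (strname u)"
  have gf: "is_fun g D (\<lambda>u. fun2 u (nn N)) r2"
    using reg_mono[of "is_inj g D (\<lambda>u. fun2 u (nn N))", OF _ inj r2(1)] by (simp add: is_inj_def fconj_def)
  \<comment> \<open>The length requirement is folded into the predicate, with the never-forced
    formula as the other case, so that each instance is regular as \<open>finite_decide\<close>
    demands.\<close>
  have "\<exists>s\<le>r2. \<exists>h. \<forall>i\<in>?I. (if length (h i) = N then op (?d i) (strname (h i)) \<^bold>\<in> g else (\<lambda>_. False)) s"
  proof (rule finite_decide)
    show "finite ?I" using fA finite_strings by blast
    fix i q assume i: "i \<in> ?I" and q: "q \<le> r2"
    obtain t u where tu: "i = (t, u)" "length t = N" "f t" "length u = k" using i by (auto simp: A'_def)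
    have "(strname t \<^bold>\<in> A) r2" using r2(2)[OF tu(2)] tu(3) by simp
    then have "(strname t \<^bold>\<in> A) q" using q by (rule fmem_mono)
    then have "(strname t \<^bold>\<in> A \<^bold>\<and> fun2 (strname u) (nn k) \<^bold>\<and> op (strname t) (strname u) \<^bold>= op (strname t) (strname u)) q"
      using fun2_strname[OF tu(4)] by (simp add: fconj_def)
    then have "(\<^bold>\<exists>s t'. s \<^bold>\<in> A \<^bold>\<and> fun2 t' (nn k) \<^bold>\<and> op (strname t) (strname u) \<^bold>= op s t') q"
      by (intro fexI[of _ "strname t"] fexI[of _ "strname u"]) simp_all
    moreover have "q \<le> r" using q r2r by (meson order_trans)
    ultimately have "(op (strname t) (strname u) \<^bold>\<in> D) q"
      using r(5) by (simp add: fall_def fiff_iff)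
    then obtain s y where s: "s \<le> q" "(op (op (strname t) (strname u)) y \<^bold>\<in> g) s" "fun2 y (nn N) s"
      using is_fun_ex[OF gf good_fun2 q] by metis
    obtain s' w where s': "s' \<le> s" "length w = N" "(y \<^bold>= strname w) s'" using string_rep[OF s(3)] by metis
    have "(op (?d i) (strname w) \<^bold>\<in> g) s'"
      using fmem_cong1[OF op_cong[OF feq_refl s'(3)] fmem_mono[OF s(2) s'(1)]] by (simp add: tu)
    then show "\<exists>s\<le>q. \<exists>w. (if length w = N then op (?d i) (strname w) \<^bold>\<in> g else (\<lambda>_. False)) s"
      using s s' by (intro exI[of _ s']) auto
  next
    show "reg (if length w = N then op (?d i) (strname w) \<^bold>\<in> g else (\<lambda>_. False))" for i w
      by (simp add: reg_False)
  qed
  then obtain s h where s: "s \<le> r2"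
    "\<forall>i\<in>?I. (if length (h i) = N then op (?d i) (strname (h i)) \<^bold>\<in> g else (\<lambda>_. False)) s" by blast
  have h: "length (h i) = N" "(op (?d i) (strname (h i)) \<^bold>\<in> g) s" if "i \<in> ?I" for i
    using bspec[OF s(2) that] by (cases "length (h i) = N"; simp)+
  have "inj_on h ?I"
  proof (rule inj_onI)
    fix i j assume ij: "i \<in> ?I" "j \<in> ?I" "h i = h j"
    have "s \<le> r1" using s r2 by (meson order_trans)
    then have "(?d i \<^bold>= ?d j) s"
      using is_injD[OF inj _ _ h(2)[OF ij(1)] h(2)[OF ij(2), folded ij(3)]] by simp
    moreover obtain t u where i: "i = (t, u)" "length t = N" "length u = k" using ij(1) by (auto simp: A'_def)
    moreover obtain t' u' where j: "j = (t', u')" "length t' = N" "length u' = k" using ij(2) by (auto simp: A'_def)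
    ultimately show "i = j"
      using strname_eq_iff[of t t' s] strname_eq_iff[of u u' s] by (simp add: op_eq_iff)
  qed
  moreover have "h ` ?I \<subseteq> {t. length t = N}" using h(1) by blast
  ultimately have "card ?I \<le> card {t :: bool list. length t = N}" using card_inj_on_le finite_strings by blast
  then have "card A' * 2 ^ k \<le> 2 ^ N" by (simp add: card_cartesian_product card_strings)
  then have "real (card A' * 2 ^ k) \<le> real (2 ^ N)" using of_nat_le_iff by blast
  then show ?thesis unfolding mu by (simp add: field_simps)
qed

text \<open>The level at \<open>mx e\<close> serves as A and the injection exists by counting in the
  ground model; what remains is to verify the formula for their canonical names.\<close>

lemma measure_leI:
  assumes "mu e \<le> 1 / 2 ^ k" shows "clopen_measure_le (clopname e) (nn k) p"
proof -
  define N where "N = mx e"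
  define L where "L = lev N e"
  let ?S = "{u :: bool list. length u = k}"
  let ?I = "L \<times> ?S"
  let ?d = "\<lambda>(t, u). op (strname t) (strname u)"
  have fin: "finite L" "finite ?I" by (auto simp: L_def finite_strings)
  have "real (card L * 2 ^ k) \<le> real (2 ^ N)"
    using assms mu_eq_lev[of e N] by (simp add: L_def N_def field_simps)
  then have "card ?I \<le> card {t :: bool list. length t = N}"
    by (simp only: card_cartesian_product card_strings of_nat_le_iff)
  then obtain h where h: "h ` ?I \<subseteq> {t :: bool list. length t = N}" "inj_on h ?I"
    using card_le_inj[OF fin(2) finite_strings[of N]] by blast
  define A where "A = canonical (strname ` L)"
  define D where "D = canonical (?d ` ?I)"
  define g where "g = fn ?I ?d (\<lambda>i. strname (h i))"
  have sL: "small (strname ` L)" "small ?I" by (auto intro: small_finite fin small_image)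
  have len: "length t = N" if "t \<in> L" for t using that by (simp add: L_def lev_def)
  have c1: "(\<^bold>\<forall>s. s \<^bold>\<in> A \<^bold>\<longrightarrow> fun2 s (nn N)) p"
    using fall_canonical[OF sL(1) good_fun2, of p "nn N"] fun2_strname[OF len]
    by (auto simp: fall_def fimp_iff A_def)
  have c2: "(\<^bold>\<forall>x. x \<^bold>\<in> clopname e \<^bold>\<longleftrightarrow> (is_cantor x \<^bold>\<and> (\<^bold>\<exists>s. s \<^bold>\<in> A \<^bold>\<and> s \<^bold>\<subseteq> x))) p"
  proof -
    have "(x \<^bold>\<in> clopname e) q \<longleftrightarrow> is_cantor x q \<and> (\<forall>q'\<le>q. \<exists>r\<le>q'. \<exists>s. (s \<^bold>\<in> A) r \<and> (s \<^bold>\<subseteq> x) r)" for x q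
    proof (intro iffI conjI allI impI)
      assume a: "(x \<^bold>\<in> clopname e) q"
      show "is_cantor x q" using clopname_cantor[OF a] .
      then obtain X where X: "rl X" "(x \<^bold>= realname X) q" using cantorE by blast
      have ax: "ae q (\<lambda>g. X g \<in> clop e)" using fmem_cong1[OF X(2) a] by (simp add: mem_clopname[OF X(1)])
      fix q' assume q': "q' \<le> q"
      obtain r t where r: "r \<le> q'" "ae r (\<lambda>g. rst (X g) N = t)"
        using ae_value[where f = "\<lambda>g. rst (X g) N", OF bpfD[OF bpf_rst[OF rlD[OF X(1)]]]] by metis
      have rq: "r \<le> q" using r q' by (meson order_trans)
      have "t \<in> L" using ae_witness[OF ae_conj[OF r(2) ae_mono[OF ax rq]]] lev_rst[of e N] by (auto simp: L_def N_def)
      then have "(strname t \<^bold>\<in> A) r" unfolding A_def by (intro fmem_canonicalI[OF sL(1)]) simp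
      moreover have "ae r (\<lambda>g. pre t (X g))" by (rule ae_mp[OF r(2)]) auto
      then have "(strname t \<^bold>\<subseteq> realname X) r" by (simp add: strname_sub_realname[OF X(1)])
      then have "(strname t \<^bold>\<subseteq> x) r"
        unfolding fsub_iff using fmem_cong2[OF feq_sym[OF feq_mono[OF X(2)]]] rq by (meson order_trans)
      ultimately show "\<exists>r\<le>q'. \<exists>s. (s \<^bold>\<in> A) r \<and> (s \<^bold>\<subseteq> x) r" using r(1) by blast
    next
      assume a: "is_cantor x q \<and> (\<forall>q'\<le>q. \<exists>r\<le>q'. \<exists>s. (s \<^bold>\<in> A) r \<and> (s \<^bold>\<subseteq> x) r)"
      obtain X where X: "rl X" "(x \<^bold>= realname X) q" using cantorE a by blast
      show "(x \<^bold>\<in> clopname e) q"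
      proof (rule reg_dense[OF reg_fmem])
        fix q' assume q': "q' \<le> q"
        obtain r s where r: "r \<le> q'" "(s \<^bold>\<in> A) r" "(s \<^bold>\<subseteq> x) r" using a q' by blast
        obtain r' t where r': "r' \<le> r" "t \<in> L" "(s \<^bold>= strname t) r'"
          using r(2) unfolding A_def fmem_canonical[OF sL(1)] by blast
        have rq: "r' \<le> q" "r' \<le> q'" using r r' q' by (meson order_trans)+
        have "(z \<^bold>\<in> realname X) u" if u: "u \<le> r'" "(z \<^bold>\<in> strname t) u" for z u
        proof -
          have "(z \<^bold>\<in> s) u" using fmem_cong2[OF feq_sym[OF feq_mono[OF r'(3) u(1)]] u(2)] .
          then have "(z \<^bold>\<in> x) u" using r(3) u(1) r'(1) unfolding fsub_iff by (meson order_trans)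
          moreover have "u \<le> q" using u rq by (meson order_trans)
          ultimately show ?thesis using fmem_cong2[OF feq_mono[OF X(2)]] by blast
        qed
        then have "(strname t \<^bold>\<subseteq> realname X) r'" unfolding fsub_iff by blast
        then have "ae r' (\<lambda>g. pre t (X g))" by (simp add: strname_sub_realname[OF X(1)])
        then have "ae r' (\<lambda>g. X g \<in> clop e)"
          by (rule ae_mp) (use r'(2) lev_mem[of e N t] in \<open>simp add: L_def N_def\<close>)
        then have "(realname X \<^bold>\<in> clopname e) r'" by (simp add: mem_clopname[OF X(1)])
        then have "(x \<^bold>\<in> clopname e) r'" using fmem_cong1[OF feq_sym[OF feq_mono[OF X(2) rq(1)]]] by blast
        then show "\<exists>r\<le>q'. (x \<^bold>\<in> clopname e) r" using rq by blast
      qed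
    qed
    then show ?thesis by (simp add: fall_def fconj_def fiff_iff fex_iff)
  qed
  have c3: "(\<^bold>\<forall>z. z \<^bold>\<in> D \<^bold>\<longleftrightarrow> (\<^bold>\<exists>s t. s \<^bold>\<in> A \<^bold>\<and> fun2 t (nn k) \<^bold>\<and> z \<^bold>= op s t)) p"
  proof -
    have "(z \<^bold>\<in> D) q \<longleftrightarrow> (\<^bold>\<exists>s t. s \<^bold>\<in> A \<^bold>\<and> fun2 t (nn k) \<^bold>\<and> z \<^bold>= op s t) q" for z q
    proof
      assume a: "(z \<^bold>\<in> D) q"
      show "(\<^bold>\<exists>s t. s \<^bold>\<in> A \<^bold>\<and> fun2 t (nn k) \<^bold>\<and> z \<^bold>= op s t) q"
      proof (rule reg_dense[of "\<^bold>\<exists>s t. s \<^bold>\<in> A \<^bold>\<and> fun2 t (nn k) \<^bold>\<and> z \<^bold>= op s t"])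
        fix q' assume "q' \<le> q"
        then obtain r t u where r: "r \<le> q'" "t \<in> L" "length u = k" "(z \<^bold>= op (strname t) (strname u)) r"
          using a unfolding D_def fmem_canonical[OF small_image[OF sL(2)]] by force
        have "(strname t \<^bold>\<in> A) r" unfolding A_def by (intro fmem_canonicalI[OF sL(1)]) (use r in simp)
        then have "(strname t \<^bold>\<in> A \<^bold>\<and> fun2 (strname u) (nn k) \<^bold>\<and> z \<^bold>= op (strname t) (strname u)) r"
          using r fun2_strname by (simp add: fconj_def)
        then have "(\<^bold>\<exists>s t. s \<^bold>\<in> A \<^bold>\<and> fun2 t (nn k) \<^bold>\<and> z \<^bold>= op s t) r"
          by (intro fexI[of _ "strname t"] fexI[of _ "strname u"]) simp_all
        then show "\<exists>r\<le>q'. (\<^bold>\<exists>s t. s \<^bold>\<in> A \<^bold>\<and> fun2 t (nn k) \<^bold>\<and> z \<^bold>= op s t) r" using r by blast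
      qed simp
    next
      assume a: "(\<^bold>\<exists>s t. s \<^bold>\<in> A \<^bold>\<and> fun2 t (nn k) \<^bold>\<and> z \<^bold>= op s t) q"
      show "(z \<^bold>\<in> D) q"
      proof (rule reg_dense[OF reg_fmem])
        fix q' assume "q' \<le> q"
        then obtain r s t where r: "r \<le> q'" "(s \<^bold>\<in> A) r" "fun2 t (nn k) r" "(z \<^bold>= op s t) r"
          using a unfolding fex_iff fconj_def by (meson order_refl order_trans)
        obtain r1 u where r1: "r1 \<le> r" "u \<in> L" "(s \<^bold>= strname u) r1"
          using r(2) unfolding A_def fmem_canonical[OF sL(1)] by blast
        obtain r2 w where r2: "r2 \<le> r1" "length w = k" "(t \<^bold>= strname w) r2"
          using string_rep[OF fun2_mono[OF r(3) r1(1)]] by metis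
        have "(op s t \<^bold>= op (strname u) (strname w)) r2" using feq_mono[OF r1(3) r2(1)] r2(3) by (simp add: op_eq_iff)
        then have "(z \<^bold>= op (strname u) (strname w)) r2" using feq_trans[OF feq_mono[OF r(4)]] r1 r2 by (meson order_trans)
        moreover have "(op (strname u) (strname w) \<^bold>\<in> D) r2"
          unfolding D_def by (intro fmem_canonicalI[OF small_image[OF sL(2)]]) (use r1 r2 in force)
        ultimately have "(z \<^bold>\<in> D) r2" using fmem_cong1 feq_sym by blast
        then show "\<exists>r\<le>q'. (z \<^bold>\<in> D) r" using r r1 r2 by (meson order_trans)
      qed
    qed
    then show ?thesis by (simp add: fall_def fiff_iff)
  qed
  have c4: "is_inj g D (\<lambda>u. fun2 u (nn N)) p"
    unfolding g_def D_def
  proof (rule is_inj_fn[OF sL(2)])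
    fix i assume "i \<in> ?I"
    then show "fun2 (strname (h i)) (nn N) p" using h(1) by (intro fun2_strname) auto
  next
    fix i j q assume ij: "i \<in> ?I" "j \<in> ?I"
    obtain t u where i: "i = (t, u)" "length t = N" "length u = k" using ij(1) len by auto
    obtain t' u' where j: "j = (t', u')" "length t' = N" "length u' = k" using ij(2) len by auto
    have "(?d i \<^bold>= ?d j) q \<longleftrightarrow> i = j"
      using strname_eq_iff[of t t' q] strname_eq_iff[of u u' q] i j by (simp add: op_eq_iff)
    moreover have "length (h i) = length (h j)" using h(1) ij by auto
    then have "(strname (h i) \<^bold>= strname (h j)) q \<longleftrightarrow> i = j"
      using inj_on_eq_iff[OF h(2) ij] strname_eq_iff[of "h i" "h j" q] by simp
    ultimately show "(?d i \<^bold>= ?d j) q \<longleftrightarrow> (strname (h i) \<^bold>= strname (h j)) q" by blast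
  qed simp
  have "(nn N \<^bold>\<in> omega \<^bold>\<and> (\<^bold>\<forall>s. s \<^bold>\<in> A \<^bold>\<longrightarrow> fun2 s (nn N)) \<^bold>\<and>
       (\<^bold>\<forall>x. x \<^bold>\<in> clopname e \<^bold>\<longleftrightarrow> (is_cantor x \<^bold>\<and> (\<^bold>\<exists>s. s \<^bold>\<in> A \<^bold>\<and> s \<^bold>\<subseteq> x))) \<^bold>\<and>
       (\<^bold>\<forall>z. z \<^bold>\<in> D \<^bold>\<longleftrightarrow> (\<^bold>\<exists>s t. s \<^bold>\<in> A \<^bold>\<and> fun2 t (nn k) \<^bold>\<and> z \<^bold>= op s t)) \<^bold>\<and>
       is_inj g D (\<lambda>u. fun2 u (nn N))) p"
    using c1 c2 c3 c4 nn_mem_omega by (simp only: fconj_def simp_thms)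
  then show ?thesis unfolding clopen_measure_le_def
    by (intro fexI[of _ "nn N"] fexI[of _ A] fexI[of _ D] fexI[of _ g]) simp_all
qed

end

context cohen_setting begin

section \<open>Sequences of clopen sets\<close>

definition bq :: "'l set \<Rightarrow> ('l gen \<Rightarrow> nat \<Rightarrow> code) \<Rightarrow> bool" where
  "bq S D \<longleftrightarrow> (\<forall>n. bpf S (\<lambda>g. D g n))"

lemma bqD: "bq S D \<Longrightarrow> bpf S (\<lambda>g. D g n)" by (simp add: bq_def)

lemma bq_UNIV: "bq S D \<Longrightarrow> bq UNIV D"
  unfolding bq_def using bpf_UNIV by blast

lemma bq_mono: "bq S D \<Longrightarrow> S \<subseteq> S' \<Longrightarrow> bq S' D"
  unfolding bq_def using bpf_mono by blast

definition seqname :: "('l gen \<Rightarrow> nat \<Rightarrow> code) \<Rightarrow> ('i, 'l cohen) name" where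
  "seqname D = fam UNIV (\<lambda>(n, e). op (nn n) (clopname e)) (\<lambda>(n, e) p. ae p (\<lambda>g. D g n = e))"

lemma small_nat_code: "small (S :: (nat \<times> code) set)"
  by (rule small_countable) simp

lemma reg_seqname_aux: "bq UNIV D \<Longrightarrow> reg ((\<lambda>(n, e) p. ae p (\<lambda>g. D g n = e)) c)"
  by (cases c) (auto intro: reg_ae[OF bpfD[OF bqD]])

lemma mem_seqname_iff:
  assumes "bq UNIV D"
  shows "(z \<^bold>\<in> seqname D) p \<longleftrightarrow>
    (\<forall>q\<le>p. \<exists>r\<le>q. \<exists>n e. ae r (\<lambda>g. D g n = e) \<and> (z \<^bold>= op (nn n) (clopname e)) r)"
  unfolding seqname_def
  using fmem_fam[where f = "\<lambda>(n, e). op (nn n) (clopname e)" and C = UNIV and p = p and x = z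
      and P = "\<lambda>(n, e) p. ae p (\<lambda>g. D g n = e)", OF small_nat_code reg_seqname_aux[OF assms]]
  by (simp add: split_paired_Ex)

lemma op_seqnameI: "bq UNIV D \<Longrightarrow> ae p (\<lambda>g. D g n = e) \<Longrightarrow> (op (nn n) (clopname e) \<^bold>\<in> seqname D) p"
  unfolding mem_seqname_iff using ae_mono feq_refl order_refl by metis

lemma op_seqname_iff:
  assumes D: "bq UNIV D"
  shows "(op (nn n) a \<^bold>\<in> seqname D) p \<longleftrightarrow>
    (\<forall>q\<le>p. \<exists>r\<le>q. \<exists>e. ae r (\<lambda>g. D g n = e) \<and> (a \<^bold>= clopname e) r)"
  unfolding mem_seqname_iff[OF D] by (simp add: op_eq_iff)

lemma seq_decide:
  assumes "bq UNIV D" shows "\<exists>r\<le>p. \<exists>e. ae r (\<lambda>g. D g n = e)"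
  by (rule ae_value[OF bpfD[OF bqD[OF assms, of n]], of p]) blast

lemma good_clopen: "good (is_clopen :: ('i, 'l cohen) fclass)"
  using good_is_clopen[OF cong_id] by simp

lemma seqname_fun: assumes D: "bq UNIV D" shows "is_fun (seqname D) omega is_clopen p"
proof (rule is_funI)
  fix q z assume "(z \<^bold>\<in> seqname D) q"
  then obtain r n e where "r \<le> q" "(z \<^bold>= op (nn n) (clopname e)) r" unfolding mem_seqname_iff[OF D] by blast
  then show "\<exists>r\<le>q. \<exists>x y. (x \<^bold>\<in> omega) r \<and> is_clopen y r \<and> (z \<^bold>= op x y) r"
    using nn_mem_omega is_clopen_clopname by blast
next
  fix q and x :: "('i, 'l cohen) name" assume "(x \<^bold>\<in> omega) q"
  then obtain r n where r: "r \<le> q" "(x \<^bold>= nn n) r" unfolding mem_omega_iff by blast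
  obtain s e where s: "s \<le> r" "ae s (\<lambda>g. D g n = e)" using seq_decide[OF D] by blast
  have "(op x (clopname e) \<^bold>\<in> seqname D) s"
    using fmem_cong1[OF op_cong[OF feq_sym[OF feq_mono[OF r(2) s(1)]] feq_refl] op_seqnameI[OF D s(2)]] .
  then show "\<exists>r\<le>q. \<exists>y. (op x y \<^bold>\<in> seqname D) r" using r s by (meson order_trans)
next
  fix q x y y' assume q: "(x \<^bold>\<in> omega) q" "(op x y \<^bold>\<in> seqname D) q" "(op x y' \<^bold>\<in> seqname D) q"
  show "(y \<^bold>= y') q"
  proof (rule reg_dense[OF reg_feq])
    fix q' assume q': "q' \<le> q"
    obtain r n where r: "r \<le> q'" "(x \<^bold>= nn n) r" using q(1) q' unfolding mem_omega_iff by blast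
    have rq: "r \<le> q" using r q' by (meson order_trans)
    have y: "(op (nn n) y \<^bold>\<in> seqname D) r" "(op (nn n) y' \<^bold>\<in> seqname D) r"
      using fmem_cong1[OF op_cong[OF r(2) feq_refl]] fmem_mono[OF q(2) rq] fmem_mono[OF q(3) rq] by blast+
    obtain s e where s: "s \<le> r" "ae s (\<lambda>g. D g n = e)" "(y \<^bold>= clopname e) s"
      using y(1) unfolding op_seqname_iff[OF D] by blast
    obtain t e' where t: "t \<le> s" "ae t (\<lambda>g. D g n = e')" "(y' \<^bold>= clopname e') t"
      using y(2) s(1) unfolding op_seqname_iff[OF D] by blast
    have "e = e'" using ae_witness[OF ae_conj[OF ae_mono[OF s(2) t(1)] t(2)]] by auto
    then have "(y \<^bold>= y') t" using feq_trans[OF feq_mono[OF s(3) t(1)]] feq_sym[OF t(3)] by blast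
    then show "\<exists>r\<le>q'. (y \<^bold>= y') r" using r s t by (meson order_trans)
  qed
qed simp

lemma seq_fun_eqI:
  fixes c d :: "('i, 'l cohen) name"
  assumes c: "is_fun c omega is_clopen p" and d: "is_fun d omega is_clopen p"
    and e: "\<And>q n. q \<le> p \<Longrightarrow> \<exists>r\<le>q. \<exists>a. (op (nn n) a \<^bold>\<in> c) r \<and> (op (nn n) a \<^bold>\<in> d) r"
  shows "(c \<^bold>= d) p"
proof -
  have *: "(z \<^bold>\<in> d) q"
    if c: "is_fun c omega is_clopen p"
      and e: "\<And>q n. q \<le> p \<Longrightarrow> \<exists>r\<le>q. \<exists>a. (op (nn n) a \<^bold>\<in> c) r \<and> (op (nn n) a \<^bold>\<in> d) r"
      and q: "q \<le> p" "(z \<^bold>\<in> c) q" for c d z :: "('i, 'l cohen) name" and q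
  proof (rule reg_dense[OF reg_fmem])
    fix q' assume q': "q' \<le> q"
    have q'p: "q' \<le> p" using q q' by (meson order_trans)
    obtain r x y where r: "r \<le> q'" "(x \<^bold>\<in> omega) r" "(z \<^bold>= op x y) r"
      using c q(2) q' q'p fmem_mono unfolding is_fun_iff[OF reg_is_clopen] by (meson order_refl order_trans)
    obtain s n where s: "s \<le> r" "(x \<^bold>= nn n) s" using r(2) unfolding mem_omega_iff by blast
    have sp: "s \<le> p" "s \<le> q" using s r q' q'p by (meson order_trans)+
    obtain t a where t: "t \<le> s" "(op (nn n) a \<^bold>\<in> c) t" "(op (nn n) a \<^bold>\<in> d) t" using e[OF sp(1)] by blast
    have tp: "t \<le> p" "t \<le> q" using sp t by (meson order_trans)+
    have z: "(z \<^bold>= op (nn n) y) t"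
      using feq_trans[OF feq_mono[OF r(3)] op_cong[OF feq_mono[OF s(2) t(1)] feq_refl]] s t by (meson order_trans)
    have "(op (nn n) y \<^bold>\<in> c) t" using fmem_cong1[OF z fmem_mono[OF q(2) tp(2)]] .
    then have "(y \<^bold>= a) t" using is_fun_unique[OF c good_clopen tp(1) _ t(2)] by blast
    then have "(z \<^bold>= op (nn n) a) t" using feq_trans[OF z op_cong[OF feq_refl]] by blast
    then have "(z \<^bold>\<in> d) t" using fmem_cong1[OF feq_sym t(3)] by blast
    then show "\<exists>r\<le>q'. (z \<^bold>\<in> d) r" using r s t by (meson order_trans)
  qed
  have e': "\<And>q n. q \<le> p \<Longrightarrow> \<exists>r\<le>q. \<exists>a. (op (nn n) a \<^bold>\<in> d) r \<and> (op (nn n) a \<^bold>\<in> c) r" using e by meson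
  show ?thesis by (rule feqI) (use *[OF c e] *[OF d e'] in blast)+
qed

text \<open>Each of the countably many statements that the n-th term has the i-th code has a
  countable support, and S is the union of these. Taking the least true i turns the name into a
  function of g supported in S.\<close>

lemma seq_rep:
  fixes c :: "('i, 'l cohen) name"
  assumes c: "is_fun c omega is_clopen p"
  obtains S D where "countable S" "bq S D" "(c \<^bold>= seqname D) p"
proof -
  define \<phi> where "\<phi> n i = (op (nn n) (clopname (from_nat i)) \<^bold>\<in> c)" for n i
  have \<phi>: "reg (\<phi> n i)" for n i by (simp add: \<phi>_def)
  obtain Sf where Sf: "\<And>n i. countable (Sf n i)" "\<And>n i. supp (Sf n i) (\<phi> n i)"
    using countable_supp[OF \<phi>] by metis
  define S where "S = (\<Union>n. \<Union>i. Sf n i)"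
  have S: "countable S" unfolding S_def using Sf(1) by simp
  have "Sf n i \<subseteq> S" for n i unfolding S_def by (intro subset_trans[OF UN_upper[of i UNIV] UN_upper[of n UNIV]]) simp_all
  then have "supp S (\<phi> n i)" for n i by (rule supp_mono[OF Sf(2) _ \<phi>])
  then have bpS: "bp S (ev (\<phi> n i))" for n i by (rule bp_ev[OF \<phi>])
  define l where "l n g = (LEAST i. ev (\<phi> n i) g)" for n g
  have l: "bpf S (l n)" for n unfolding l_def by (rule bpf_Least[OF bpS])
  define D where "D g n = (from_nat (l n g) :: code)" for g n
  have D: "bq S D" unfolding bq_def D_def by (rule allI, rule bpf_app, rule l)
  have D': "bq UNIV D" by (rule bq_UNIV[OF D])
  have "(c \<^bold>= seqname D) p"
  proof (rule seq_fun_eqI[OF c seqname_fun[OF D']])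
    fix q n assume q: "q \<le> p"
    obtain r a where r: "r \<le> q" "(op (nn n) a \<^bold>\<in> c) r" "is_clopen a r"
      using is_fun_ex[OF c good_clopen q nn_mem_omega] by metis
    obtain s e where s: "s \<le> r" "(a \<^bold>= clopname e) s" using clopen_code[OF r(3)] by blast
    have "\<phi> n (to_nat e) s" unfolding \<phi>_def using fmem_cong1[OF op_cong[OF feq_refl s(2)] fmem_mono[OF r(2) s(1)]] by simp
    then have "ae s (ev (\<phi> n (to_nat e)))" by (simp add: ae_ev[OF \<phi>])
    then have ex: "ae s (\<lambda>g. ev (\<phi> n (l n g)) g)" unfolding l_def by (rule ae_mp) (rule LeastI)
    obtain t j where t: "t \<le> s" "ae t (\<lambda>g. l n g = j)" by (rule ae_value[OF bpfD[OF l, of n], of s])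
    have "ae t (ev (\<phi> n j))" by (rule ae_mp2[OF t(2) ae_mono[OF ex t(1)]]) simp
    then have "\<phi> n j t" by (simp add: ae_ev[OF \<phi>])
    then have "(op (nn n) (clopname (from_nat j)) \<^bold>\<in> c) t" by (simp add: \<phi>_def)
    moreover have "ae t (\<lambda>g. D g n = from_nat j)" by (rule ae_mp[OF t(2)]) (simp add: D_def)
    then have "(op (nn n) (clopname (from_nat j)) \<^bold>\<in> seqname D) t" by (rule op_seqnameI[OF D'])
    ultimately show "\<exists>r\<le>q. \<exists>a. (op (nn n) a \<^bold>\<in> c) r \<and> (op (nn n) a \<^bold>\<in> seqname D) r"
      using r s t by (meson order_trans)
  qed
  then show thesis using that S D by blast
qed

subsection \<open>Finite sets\<close>

lemma good_is_finite [good_intros]: "cong f \<Longrightarrow> good (\<lambda>x :: ('i, 'l cohen) name. is_finite (f x))"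
  unfolding is_finite_def by (intro good_intros)

lemma reg_is_finite [simp]: "reg (is_finite (x :: ('i, 'l cohen) name))"
  unfolding is_finite_def by simp

lemma bp_bounded: "rl A \<Longrightarrow> bp UNIV (\<lambda>g. \<forall>n. m \<le> n \<longrightarrow> \<not> A g n)"
  by (intro bp_intros rlD)

text \<open>A forced bijection from a natural number has finitely many values, which an extension
  decides, and any bound of them bounds A. Conversely, once a bound is decided, A can be decided to
  be a finite ground model set, whose enumeration is a bijection in the extension.\<close>

lemma is_finite_iff:
  assumes A: "rl A"
  shows "is_finite (setname A) p \<longleftrightarrow> ae p (\<lambda>g. \<exists>m. \<forall>n. m \<le> n \<longrightarrow> \<not> A g n)"
proof
  assume a: "is_finite (setname A) p"
  show "ae p (\<lambda>g. \<exists>m. \<forall>n. m \<le> n \<longrightarrow> \<not> A g n)"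
  proof (rule ae_dense)
    show "bp UNIV (\<lambda>g. \<exists>m. \<forall>n. m \<le> n \<longrightarrow> \<not> A g n)" by (rule bp_ex[OF bp_bounded[OF A]])
    fix q assume q: "q \<le> p"
    obtain r n where r: "r \<le> q" "(n \<^bold>\<in> omega) r" "equinum n (setname A) r"
      using a q unfolding is_finite_def fex_iff fconj_def by blast
    obtain r1 k where r1: "r1 \<le> r" "(n \<^bold>= nn k) r1" using r(2) unfolding mem_omega_iff by blast
    have "good (\<lambda>n. equinum n (setname A))" by (intro good_intros)
    then have "equinum (nn k) (setname A) r1"
      by (rule good_cong[of "\<lambda>n. equinum n (setname A)", OF _ r1(2)]) (rule reg_mono[OF reg_equinum r(3) r1(1)])
    then obtain r2 f where r2: "r2 \<le> r1" "is_inj f (nn k) (\<lambda>y. y \<^bold>\<in> setname A) r2"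
      "(\<^bold>\<forall>y. y \<^bold>\<in> setname A \<^bold>\<longrightarrow> (\<^bold>\<exists>x. op x y \<^bold>\<in> f)) r2"
      unfolding equinum_def fex_iff[of "\<lambda>f. is_inj f _ _ \<^bold>\<and> _ f"] fconj_def by blast
    have f: "is_fun f (nn k) (\<lambda>y. y \<^bold>\<in> setname A) r2" using r2(2) by (simp add: is_inj_def fconj_def)
    have "\<exists>s\<le>r2. \<exists>h. \<forall>i\<in>{..<k}. (op (nn i) (nn (h i)) \<^bold>\<in> f) s"
    proof (rule finite_decide)
      fix i t assume i: "i \<in> {..<k}" and t: "t \<le> r2"
      have "(nn i \<^bold>\<in> nn k) t" using i by simp
      then obtain s y where s: "s \<le> t" "(op (nn i) y \<^bold>\<in> f) s" "(y \<^bold>\<in> setname A) s"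
        using is_fun_ex[OF f good_mem t] by metis
      have "(y \<^bold>\<in> omega) s" using setname_sub_omega[OF A, of s] s(3) unfolding fsub_iff by blast
      then obtain s' m where s': "s' \<le> s" "(y \<^bold>= nn m) s'" unfolding mem_omega_iff by blast
      have "(op (nn i) (nn m) \<^bold>\<in> f) s'" using fmem_cong1[OF op_cong[OF feq_refl s'(2)] fmem_mono[OF s(2) s'(1)]] .
      then show "\<exists>s\<le>t. \<exists>m. (op (nn i) (nn m) \<^bold>\<in> f) s" using s s' by (meson order_trans)
    qed auto
    then obtain s h where s: "s \<le> r2" "\<And>i. i < k \<Longrightarrow> (op (nn i) (nn (h i)) \<^bold>\<in> f) s" by blast
    obtain M where M: "\<And>i. i < k \<Longrightarrow> h i < M"
      using finite_nat_bounded[of "h ` {..<k}"] by auto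
    have "ae s (\<lambda>g. M \<le> n \<longrightarrow> \<not> A g n)" for n
    proof (cases "M \<le> n")
      case True
      have "ae s (\<lambda>g. \<not> A g n)"
      proof (subst ae_not_iff[OF rlD[OF A]], intro allI impI notI)
        fix t assume t: "t \<le> s" "ae t (\<lambda>g. A g n)"
        then have n: "(nn n \<^bold>\<in> setname A) t" by (simp add: nn_mem_setname[OF A])
        have tr: "t \<le> r2" using t s by (meson order_trans)
        then have "(\<^bold>\<exists>x. op x (nn n) \<^bold>\<in> f) t" using r2(3) n by (simp add: fall_def fimp_iff)
        then obtain u x where u: "u \<le> t" "(op x (nn n) \<^bold>\<in> f) u" using fexD by blast
        have ur: "u \<le> r2" using u tr by (meson order_trans)
        have "(x \<^bold>\<in> nn k) u" using is_fun_mem[OF f good_mem ur u(2)] by blast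
        then obtain v i where v: "v \<le> u" "i < k" "(x \<^bold>= nn i) v" unfolding mem_nn_iff by blast
        have 1: "(op (nn i) (nn n) \<^bold>\<in> f) v"
          using fmem_cong1[OF op_cong[OF v(3) feq_refl] fmem_mono[OF u(2) v(1)]] .
        have vs: "v \<le> s" "v \<le> r2" using v u t ur by (meson order_trans)+
        have "(nn n \<^bold>= nn (h i)) v"
          using is_fun_unique[OF f good_mem vs(2) 1 fmem_mono[OF s(2)[OF v(2)] vs(1)]] .
        then show False using M[OF v(2)] True by simp
      qed
      then show ?thesis by (rule ae_mp) simp
    qed (simp add: aeI)
    then have "ae s (\<lambda>g. \<forall>n. M \<le> n \<longrightarrow> \<not> A g n)" by (rule ae_all)
    then have "ae s (\<lambda>g. \<exists>m. \<forall>n. m \<le> n \<longrightarrow> \<not> A g n)" by (rule ae_mp) blast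
    then show "\<exists>r\<le>q. ae r (\<lambda>g. \<exists>m. \<forall>n. m \<le> n \<longrightarrow> \<not> A g n)" using s r2 r1 r by (meson order_trans)
  qed
next
  assume a: "ae p (\<lambda>g. \<exists>m. \<forall>n. m \<le> n \<longrightarrow> \<not> A g n)"
  show "is_finite (setname A) p"
  proof (rule reg_dense[OF reg_is_finite])
    fix q assume q: "q \<le> p"
    have "\<exists>r\<le>q. \<exists>m. ae r (\<lambda>g. \<forall>n. m \<le> n \<longrightarrow> \<not> A g n)"
      by (rule ae_ex[where Q = "\<lambda>m g. \<forall>n. m \<le> n \<longrightarrow> \<not> A g n", OF bp_bounded[OF A] ae_mono[OF a q]]) blast
    then obtain r m where r: "r \<le> q" "ae r (\<lambda>g. \<forall>n. m \<le> n \<longrightarrow> \<not> A g n)" by blast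
    have "\<exists>s\<le>r. \<exists>f. \<forall>n\<in>{..<m}. ae s (\<lambda>g. A g n = f n)"
    proof (rule finite_decide)
      fix n t
      show "\<exists>s\<le>t. \<exists>b. ae s (\<lambda>g. A g n = b)" by (rule ae_value[OF rl_eq[OF A], of t n]) blast
    qed (auto intro: reg_ae[OF rl_eq[OF A]])
    then obtain s f where s: "s \<le> r" "\<And>n. n < m \<Longrightarrow> ae s (\<lambda>g. A g n = f n)" by blast
    define B where "B = {n. n < m \<and> f n}"
    have dec: "ae s (\<lambda>g. A g n = (n \<in> B))" for n
    proof (cases "n < m")
      case True
      show ?thesis by (rule ae_mp[OF s(2)[OF True]]) (simp add: B_def True)
    next
      case False
      show ?thesis by (rule ae_mp[OF ae_mono[OF r(2) s(1)]]) (use False in \<open>simp add: B_def\<close>)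
    qed
    have "finite B" by (simp add: B_def)
    then obtain h where h: "bij_betw h {..<card B} B" using ex_bij_betw_nat_finite[of B] by (auto simp: atLeast0LessThan)
    have "equinum (canonical (nn ` {..<card B})) (canonical ((\<lambda>i. nn (h i)) ` {..<card B})) s"
      by (rule equinum_fn) (use h in \<open>auto simp: small_nat bij_betw_def inj_on_eq_iff\<close>)
    moreover have "(\<lambda>i. nn (h i)) ` {..<card B} = nn ` B"
      unfolding image_image[of nn h, symmetric] bij_betw_imp_surj_on[OF h] ..
    ultimately have e1: "equinum (nn (card B)) (canonical (nn ` B)) s" using nn_unfold[of "card B"] by metis
    have e2: "(canonical (nn ` B) \<^bold>= setname A) s"
    proof (rule subset_omega_eqI[OF _ setname_sub_omega[OF A]])
      show "(canonical (nn ` B) \<^bold>\<subseteq> omega) s" unfolding fsub_iff fmem_canonical[OF small_nn] mem_omega_iff by blast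
      fix n t assume t: "t \<le> s"
      have "(nn n \<^bold>\<in> canonical (nn ` B)) t \<longleftrightarrow> n \<in> B" unfolding fmem_canonical[OF small_nn] by auto
      moreover have "ae t (\<lambda>g. A g n) \<longleftrightarrow> ae t (\<lambda>g. n \<in> B)" by (rule ae_cong[OF ae_mono[OF dec t]])
      ultimately show "(nn n \<^bold>\<in> canonical (nn ` B)) t \<longleftrightarrow> (nn n \<^bold>\<in> setname A) t" by (simp add: nn_mem_setname[OF A])
    qed
    have ge: "good (\<lambda>x. equinum (nn (card B)) x)" by (intro good_intros)
    have "equinum (nn (card B)) (setname A) s" by (rule good_cong[OF ge e2 e1])
    then have "(nn (card B) \<^bold>\<in> omega \<^bold>\<and> equinum (nn (card B)) (setname A)) s" by (simp add: fconj_def)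
    then have "is_finite (setname A) s" unfolding is_finite_def by (intro fexI[of _ "nn (card B)"]) simp_all
    then show "\<exists>r\<le>q. is_finite (setname A) r" using r s by (meson order_trans)
  qed
qed

subsection \<open>Hit sets\<close>

definition hit :: "('l gen \<Rightarrow> nat \<Rightarrow> bool) \<Rightarrow> ('l gen \<Rightarrow> nat \<Rightarrow> code) \<Rightarrow> 'l gen \<Rightarrow> nat \<Rightarrow> bool" where
  "hit X D g n \<longleftrightarrow> X g \<in> clop (D g n)"

lemma bp_hit: "(\<And>n. bp S (\<lambda>g. X g n)) \<Longrightarrow> bq S D \<Longrightarrow> bp S (\<lambda>g. hit X D g n)"
  unfolding hit_def by (rule bp_mem_clop) (auto simp: bqD)

lemma rl_hit: "rl X \<Longrightarrow> bq UNIV D \<Longrightarrow> rl (hit X D)"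
  unfolding rl_def[of "hit X D"] using bp_hit[of UNIV X D] rlD[of X] by blast

lemma good_in_nth [good_intros]:
  "cong f \<Longrightarrow> cong h \<Longrightarrow> cong k \<Longrightarrow> good (\<lambda>x :: ('i, 'l cohen) name. in_nth (f x) (h x) (k x))"
  unfolding in_nth_def by (intro good_intros)

lemma reg_in_nth [simp]: "reg (in_nth x c n)"
  unfolding in_nth_def by simp

lemma good_is_hit_set [good_intros]:
  "cong f \<Longrightarrow> cong h \<Longrightarrow> cong k \<Longrightarrow> good (\<lambda>x :: ('i, 'l cohen) name. is_hit_set (f x) (h x) (k x))"
  unfolding is_hit_set_def by (intro good_intros)

lemma reg_is_hit_set [simp]: "reg (is_hit_set s x c)"
  unfolding is_hit_set_def by simp

lemma in_nth_iff:
  assumes X: "rl X" and D: "bq UNIV D"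
  shows "in_nth (realname X) (seqname D) (nn n) p \<longleftrightarrow> ae p (\<lambda>g. hit X D g n)"
proof
  assume a: "in_nth (realname X) (seqname D) (nn n) p"
  show "ae p (\<lambda>g. hit X D g n)"
  proof (rule ae_dense[OF rlD[OF rl_hit[OF X D]]])
    fix q assume "q \<le> p"
    then obtain r a where r: "r \<le> q" "(op (nn n) a \<^bold>\<in> seqname D) r" "(realname X \<^bold>\<in> a) r"
      using a unfolding in_nth_def fex_iff fconj_def by blast
    obtain s e where s: "s \<le> r" "ae s (\<lambda>g. D g n = e)" "(a \<^bold>= clopname e) s"
      using r(2) unfolding op_seqname_iff[OF D] by blast
    have "(realname X \<^bold>\<in> clopname e) s" using fmem_cong2[OF s(3) fmem_mono[OF r(3) s(1)]] .
    then have "ae s (\<lambda>g. X g \<in> clop e)" by (simp add: mem_clopname[OF X])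
    then have "ae s (\<lambda>g. hit X D g n)" by (rule ae_mp2[OF s(2)]) (simp add: hit_def)
    then show "\<exists>r\<le>q. ae r (\<lambda>g. hit X D g n)" using r s by (meson order_trans)
  qed
next
  assume a: "ae p (\<lambda>g. hit X D g n)"
  show "in_nth (realname X) (seqname D) (nn n) p"
  proof (rule reg_dense[OF reg_in_nth])
    fix q assume q: "q \<le> p"
    obtain r e where r: "r \<le> q" "ae r (\<lambda>g. D g n = e)" using seq_decide[OF D] by blast
    have rp: "r \<le> p" using r q by (meson order_trans)
    have "ae r (\<lambda>g. X g \<in> clop e)" by (rule ae_mp2[OF ae_mono[OF a rp] r(2)]) (simp add: hit_def)
    then have "(op (nn n) (clopname e) \<^bold>\<in> seqname D \<^bold>\<and> realname X \<^bold>\<in> clopname e) r"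
      using op_seqnameI[OF D r(2)] by (simp add: fconj_def mem_clopname[OF X])
    then have "in_nth (realname X) (seqname D) (nn n) r"
      unfolding in_nth_def by (intro fexI[of _ "clopname e"]) simp_all
    then show "\<exists>r\<le>q. in_nth (realname X) (seqname D) (nn n) r" using r by blast
  qed
qed

lemma is_hit_set_iff:
  assumes X: "rl X" and D: "bq UNIV D"
  shows "is_hit_set s (realname X) (seqname D) p \<longleftrightarrow> (s \<^bold>= setname (hit X D)) p"
proof
  assume "is_hit_set s (realname X) (seqname D) p"
  then have h: "(n \<^bold>\<in> s) q \<longleftrightarrow> (n \<^bold>\<in> omega) q \<and> in_nth (realname X) (seqname D) n q" if "q \<le> p" for n q
    using that unfolding is_hit_set_def by (simp add: fall_def fiff_iff fconj_def)
  show "(s \<^bold>= setname (hit X D)) p"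
  proof (rule subset_omega_eqI[OF _ setname_sub_omega[OF rl_hit[OF X D]]])
    show "(s \<^bold>\<subseteq> omega) p" unfolding fsub_iff using h by blast
    show "(nn n \<^bold>\<in> s) q \<longleftrightarrow> (nn n \<^bold>\<in> setname (hit X D)) q" if "q \<le> p" for n q
      using h[OF that] by (simp add: in_nth_iff[OF X D] nn_mem_setname[OF rl_hit[OF X D]])
  qed
next
  assume e: "(s \<^bold>= setname (hit X D)) p"
  have "(n \<^bold>\<in> setname (hit X D)) q \<longleftrightarrow> (n \<^bold>\<in> omega) q \<and> in_nth (realname X) (seqname D) n q" for n q
  proof -
    let ?\<Phi> = "\<lambda>n. n \<^bold>\<in> setname (hit X D) \<^bold>\<longleftrightarrow> in_nth (realname X) (seqname D) n"
    have "good ?\<Phi>" by (intro good_intros)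
    moreover have "?\<Phi> (nn m) q" for m
      by (simp add: fiff_iff in_nth_iff[OF X D] nn_mem_setname[OF rl_hit[OF X D]])
    ultimately have "\<forall>q'\<le>q. \<forall>x. (x \<^bold>\<in> omega) q' \<longrightarrow> ?\<Phi> x q'" using all_omega[of ?\<Phi> q] by blast
    then have "(n \<^bold>\<in> setname (hit X D)) q \<longleftrightarrow> in_nth (realname X) (seqname D) n q" if "(n \<^bold>\<in> omega) q"
      using that by (simp add: fiff_iff) (meson order_refl)
    moreover have "(n \<^bold>\<in> omega) q" if "(n \<^bold>\<in> setname (hit X D)) q"
      using that setname_sub_omega[OF rl_hit[OF X D], of q] unfolding fsub_iff by blast
    ultimately show ?thesis by blast
  qed
  then have "is_hit_set (setname (hit X D)) (realname X) (seqname D) p"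
    unfolding is_hit_set_def by (simp add: fall_def fiff_iff fconj_def)
  moreover have "good (\<lambda>s. is_hit_set s (realname X) (seqname D))" by (intro good_intros)
  ultimately show "is_hit_set s (realname X) (seqname D) p"
    using feq_sym[OF e] by (intro good_cong[of "\<lambda>s. is_hit_set s (realname X) (seqname D)" "setname (hit X D)" s])
qed

text \<open>The hit set is unique up to forced equality, so the existential in \<open>N_inf\<close>,
  \<open>N_pos\<close> and \<open>N_dual\<close> amounts to evaluating \<Psi> at its canonical
  representative.\<close>

lemma ex_hit_set_iff:
  assumes X: "rl X" and D: "bq UNIV D" and \<Psi>: "good \<Psi>"
  shows "(\<^bold>\<exists>s. is_hit_set s (realname X) (seqname D) \<^bold>\<and> \<Psi> s) p \<longleftrightarrow> \<Psi> (setname (hit X D)) p"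
proof
  assume a: "(\<^bold>\<exists>s. is_hit_set s (realname X) (seqname D) \<^bold>\<and> \<Psi> s) p"
  show "\<Psi> (setname (hit X D)) p"
  proof (rule reg_dense[OF good_reg[OF \<Psi>]])
    fix q assume "q \<le> p"
    then obtain r s where r: "r \<le> q" "is_hit_set s (realname X) (seqname D) r" "\<Psi> s r"
      using a unfolding fex_iff fconj_def by blast
    then have "\<Psi> (setname (hit X D)) r" using good_cong[OF \<Psi>] is_hit_set_iff[OF X D] by blast
    then show "\<exists>r\<le>q. \<Psi> (setname (hit X D)) r" using r by blast
  qed
next
  assume "\<Psi> (setname (hit X D)) p"
  then have "(is_hit_set (setname (hit X D)) (realname X) (seqname D) \<^bold>\<and> \<Psi> (setname (hit X D))) p"
    by (simp add: fconj_def is_hit_set_iff[OF X D])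
  then show "(\<^bold>\<exists>s. is_hit_set s (realname X) (seqname D) \<^bold>\<and> \<Psi> s) p"
    by (intro fexI[of _ "setname (hit X D)"]) (simp_all add: good_reg[OF \<Psi>])
qed

lemma good_N_inf [good_intros]:
  "cong f \<Longrightarrow> cong h \<Longrightarrow> good (\<lambda>x :: ('i, 'l cohen) name. N_inf (f x) (h x))"
  unfolding N_inf_def by (intro good_intros)

lemma reg_N_inf [simp]: "reg (N_inf c (x :: ('i, 'l cohen) name))"
  unfolding N_inf_def by simp

lemma N_inf_iff:
  assumes X: "rl X" and D: "bq UNIV D"
  shows "N_inf (seqname D) (realname X) p \<longleftrightarrow> ae p (\<lambda>g. \<forall>m. \<exists>n. m \<le> n \<and> hit X D g n)"
proof -
  have g: "good (\<lambda>s :: ('i, 'l cohen) name. \<^bold>\<not> is_finite s)" by (rule good_fneg[OF good_is_finite[OF cong_id]])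
  have b: "bp UNIV (\<lambda>g. \<exists>m. \<forall>n. m \<le> n \<longrightarrow> \<not> hit X D g n)" by (rule bp_ex[OF bp_bounded[OF rl_hit[OF X D]]])
  have "N_inf (seqname D) (realname X) p \<longleftrightarrow> (\<^bold>\<not> is_finite (setname (hit X D))) p"
    unfolding N_inf_def by (simp add: fconj_def[of "is_cantor _"] is_cantor_realname[OF X] ex_hit_set_iff[OF X D g])
  also have "\<dots> \<longleftrightarrow> (\<forall>q\<le>p. \<not> ae q (\<lambda>g. \<exists>m. \<forall>n. m \<le> n \<longrightarrow> \<not> hit X D g n))"
    unfolding fneg_def is_finite_iff[OF rl_hit[OF X D]] ..
  also have "\<dots> \<longleftrightarrow> ae p (\<lambda>g. \<not> (\<exists>m. \<forall>n. m \<le> n \<longrightarrow> \<not> hit X D g n))" by (rule ae_not_iff[OF b, symmetric])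
  also have "\<dots> \<longleftrightarrow> ae p (\<lambda>g. \<forall>m. \<exists>n. m \<le> n \<and> hit X D g n)" by simp
  finally show ?thesis .
qed

end

context cohen_setting begin

subsection \<open>Null sequences\<close>

lemma bpf_map_list:
  assumes "\<And>i. bpf S (f i :: _ \<Rightarrow> 'c::countable)" shows "bpf S (\<lambda>g. map (\<lambda>i. f i g) xs)"
proof (induction xs)
  case (Cons x xs)
  have "bpf S (\<lambda>g. f x g # map (\<lambda>i. f i g) xs)" by (rule bpf_app2[OF assms Cons])
  then show ?case by simp
qed (simp add: bpf_const)

lemma bpf_subst:
  assumes "bpf S (f :: _ \<Rightarrow> 'c::countable)" "\<And>c. bpf S (h c)" shows "bpf S (\<lambda>g. h (f g) g)"
  unfolding bpf_def
proof
  fix d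
  show "bp S (\<lambda>g. h (f g) g = d)"
    by (rule bp_subst[OF assms(1), of "\<lambda>c g. h c g = d"]) (rule bpfD[OF assms(2)])
qed

lemma bpf_concat_map: "bq S D \<Longrightarrow> bpf S (\<lambda>g. concat (map (D g) xs))"
  by (rule bpf_app[of _ "\<lambda>g. map (D g) xs"], rule bpf_map_list[of S "\<lambda>i g. D g i"]) (rule bqD)

definition rset :: "('l gen \<Rightarrow> (nat \<Rightarrow> bool) \<Rightarrow> bool) \<Rightarrow> ('i, 'l cohen) name" where
  "rset Q = fam {X. rl X} realname (\<lambda>X p. ae p (\<lambda>g. Q g (X g)))"

lemma mem_rset_iff:
  assumes "\<And>X. rl X \<Longrightarrow> bp UNIV (\<lambda>g. Q g (X g))"
  shows "(z \<^bold>\<in> rset Q) p \<longleftrightarrow> (\<forall>q\<le>p. \<exists>r\<le>q. \<exists>X. rl X \<and> ae r (\<lambda>g. Q g (X g)) \<and> (z \<^bold>= realname X) r)"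
proof -
  have "reg (\<lambda>p. ae p (\<lambda>g. Q g (X g)))" if "X \<in> {X. rl X}" for X using reg_ae[OF assms] that by simp
  then show ?thesis
    unfolding rset_def
    using fmem_fam[where f = realname and C = "{X. rl X}" and P = "\<lambda>X p. ae p (\<lambda>g. Q g (X g))" and x = z and p = p, OF small_gen_fun]
    by simp
qed

lemma mem_rset:
  assumes Q: "\<And>X. rl X \<Longrightarrow> bp UNIV (\<lambda>g. Q g (X g))" and X: "rl X"
  shows "(realname X \<^bold>\<in> rset Q) p \<longleftrightarrow> ae p (\<lambda>g. Q g (X g))"
proof -
  have r: "reg (\<lambda>p. ae p (\<lambda>g. Q g (X g)))" if "X \<in> {X. rl X}" for X using reg_ae[OF Q] that by simp
  show ?thesis
    unfolding rset_def
  proof (rule fmem_fam_self[where f = realname and P = "\<lambda>X p. ae p (\<lambda>g. Q g (X g))", OF small_gen_fun r])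
    fix Y r assume a: "Y \<in> {X. rl X}" "(realname X \<^bold>= realname Y) r" "ae r (\<lambda>g. Q g (Y g))"
    then have "ae r (\<lambda>g. X g = Y g)" by (simp add: realname_eq_iff X)
    then show "ae r (\<lambda>g. Q g (X g))" by (rule ae_mp2[OF _ a(3)]) simp
  qed (use X in auto)
qed

lemma rset_cantor:
  assumes "\<And>X. rl X \<Longrightarrow> bp UNIV (\<lambda>g. Q g (X g))" "(z \<^bold>\<in> rset Q) p" shows "is_cantor z p"
proof -
  have "\<forall>q\<le>p. \<exists>r\<le>q. \<exists>X. rl X \<and> ae r (\<lambda>g. Q g (X g)) \<and> (z \<^bold>= realname X) r"
    using assms by (simp add: mem_rset_iff)
  then show ?thesis by (intro is_cantorI) blast
qed

abbreviation null_cover :: "('i, 'l cohen) fclass \<Rightarrow> ('i, 'l cohen) name \<Rightarrow> 'l cohen fprop" where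
  "null_cover X k \<equiv> (\<^bold>\<exists>U. is_open U \<^bold>\<and> (\<^bold>\<forall>x. X x \<^bold>\<longrightarrow> x \<^bold>\<in> U) \<^bold>\<and>
         (\<^bold>\<forall>c. is_clopen c \<^bold>\<and> c \<^bold>\<subseteq> U \<^bold>\<longrightarrow> clopen_measure_le c k))"

lemma good_clopen_measure_le [good_intros]:
  "cong f \<Longrightarrow> cong h \<Longrightarrow> good (\<lambda>x :: ('i, 'l cohen) name. clopen_measure_le (f x) (h x))"
  unfolding clopen_measure_le_def is_inj_def by (intro good_intros)

lemma is_null_iff:
  assumes "\<And>x. reg (X x)"
  shows "is_null X p \<longleftrightarrow> (\<forall>k. null_cover X (nn k) p)"
proof -
  have g: "good (null_cover X)" by (intro good_intros good_const assms)
  have [simp]: "reg (null_cover X k)" for k by (rule good_reg[OF g])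
  show ?thesis
    unfolding is_null_def all_omega[OF g, symmetric] by (simp add: fall_def[of "\<lambda>k. k \<^bold>\<in> omega \<^bold>\<longrightarrow> _ k"] fimp_iff) blast
qed

lemma good_Omega_bar [good_intros]: "cong f \<Longrightarrow> good (\<lambda>x :: ('i, 'l cohen) name. Omega_bar (f x))"
  unfolding Omega_bar_def is_null_def by (intro good_intros)

lemma reg_Omega_bar [simp]: "reg (Omega_bar (x :: ('i, 'l cohen) name))"
  using good_reg[OF good_Omega_bar[OF cong_id]] .

section \<open>Small tails give null sets\<close>

lemma bp_covT: assumes "bq S D" shows "bp S (\<lambda>g. covT (D g) m e s)"
  unfolding covT_def
proof (intro bp_conj bp_const bp_all bp_imp bp_not)
  show "bp S (\<lambda>g. \<forall>x. pre s x \<longrightarrow> x \<in> clop (D g n))" for n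
    by (rule bp_app[OF bqD[OF assms]])
qed

lemma bp_konig: "(\<And>s :: bool list. bp S (\<lambda>g. T g s)) \<Longrightarrow> bp S (\<lambda>g. \<forall>N. \<exists>t. length t = N \<and> T g t)"
  by (intro bp_intros)

text \<open>If the tree of \<open>covT\<close> were infinite, its leftmost branch would be a point
  of e in the extension outside all the sets said to cover e. So for some generic the tree has an
  empty level, and then e is covered by a finite union of measure at most 2^-k.\<close>

lemma measure_le_cover:
  assumes D: "bq UNIV D" and b: "ae q (\<lambda>g. \<forall>M. mu (concat (map (D g) [m..<M])) \<le> 1 / 2 ^ k)"
    and sub: "\<And>X r. rl X \<Longrightarrow> r \<le> q \<Longrightarrow> ae r (\<lambda>g. X g \<in> clop e) \<Longrightarrow> ae r (\<lambda>g. \<exists>n. m \<le> n \<and> X g \<in> clop (D g n))"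
  shows "mu e \<le> 1 / 2 ^ k"
proof -
  define T where "T g = covT (D g) m e" for g
  have T: "bp UNIV (\<lambda>g. T g s)" for s unfolding T_def by (rule bp_covT[OF D])
  define X where "X g = lb (T g)" for g
  have X: "rl X" unfolding rl_def X_def by (intro allI bp_lb T)
  obtain r where r: "r \<le> q" "ae r (\<lambda>g. \<forall>N. \<exists>t. length t = N \<and> T g t) \<or> ae r (\<lambda>g. \<not> (\<forall>N. \<exists>t. length t = N \<and> T g t))"
    using ae_decide[OF bp_konig[of UNIV T, OF T], of q] by blast
  have "\<not> ae r (\<lambda>g. \<forall>N. \<exists>t. length t = N \<and> T g t)"
  proof
    assume a: "ae r (\<lambda>g. \<forall>N. \<exists>t. length t = N \<and> T g t)"
    have br: "ae r (\<lambda>g. X g \<in> clop e \<and> (\<forall>n\<ge>m. X g \<notin> clop (D g n)))"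
    proof (rule ae_mp[OF a])
      fix g assume g: "\<forall>N. \<exists>t. length t = N \<and> T g t"
      have "T g (rst (X g) n)" for n unfolding X_def
        by (rule konig) (use g covT_prefix in \<open>auto simp: T_def\<close>)
      then show "X g \<in> clop e \<and> (\<forall>n\<ge>m. X g \<notin> clop (D g n))"
        unfolding T_def using covT_branch[of "D g" m e "X g"] by blast
    qed
    then have "ae r (\<lambda>g. X g \<in> clop e)" by (rule ae_mp) simp
    then have "ae r (\<lambda>g. \<exists>n. m \<le> n \<and> X g \<in> clop (D g n))" by (rule sub[OF X r(1)])
    then show False using ae_witness[OF ae_conj[OF br]] by blast
  qed
  then have "ae r (\<lambda>g. \<not> (\<forall>N. \<exists>t. length t = N \<and> T g t))" using r(2) by blast
  then obtain g where g: "\<not> (\<forall>N. \<exists>t. length t = N \<and> T g t)" "\<forall>M. mu (concat (map (D g) [m..<M])) \<le> 1 / 2 ^ k"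
    using ae_witness[OF ae_conj[OF _ ae_mono[OF b r(1)]]] by blast
  then obtain N where "\<And>t. length t = N \<Longrightarrow> \<not> covT (D g) m e t" unfolding T_def by blast
  then have "clop e \<subseteq> clop (concat (map (D g) [m..<N]))" by (rule covT_finite)
  then show ?thesis using mu_mono g(2) order_trans by blast
qed

lemma Omega_bar_tail:
  assumes D: "bq UNIV D" and t: "ae p (\<lambda>g. tail (D g))"
  shows "Omega_bar (seqname D) p"
proof -
  have "null_cover (N_inf (seqname D)) (nn k) p" for k
  proof (rule reg_dense[of "null_cover (N_inf (seqname D)) (nn k)"])
    fix q assume q: "q \<le> p"
    have tq: "ae q (\<lambda>g. \<exists>m. \<forall>M. mu (concat (map (D g) [m..<M])) \<le> 1 / 2 ^ k)"
      by (rule ae_mp[OF ae_mono[OF t q]]) (simp add: tail_def)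
    have bm: "bp UNIV (\<lambda>g. \<forall>M. mu (concat (map (D g) [m..<M])) \<le> 1 / 2 ^ k)" for m
      by (rule bp_all, rule bp_app[OF bpf_concat_map[OF D]])
    have "\<exists>r\<le>q. \<exists>m. ae r (\<lambda>g. \<forall>M. mu (concat (map (D g) [m..<M])) \<le> 1 / 2 ^ k)"
      by (rule ae_ex[where Q = "\<lambda>m g. \<forall>M. mu (concat (map (D g) [m..<M])) \<le> 1 / 2 ^ k", OF bm tq]) blast
    then obtain r m where r: "r \<le> q" "ae r (\<lambda>g. \<forall>M. mu (concat (map (D g) [m..<M])) \<le> 1 / 2 ^ k)" by blast
    \<comment> \<open>With m decided, the union of the terms from m on is the open cover; it
      contains the limes superior since every point there is hit beyond m.\<close>
    define Q where "Q g x \<longleftrightarrow> (\<exists>n. m \<le> n \<and> x \<in> clop (D g n))" for g x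
    have bQn: "bp UNIV (\<lambda>g. m \<le> n \<and> X g \<in> clop (D g n))" if "rl X" for X n
      by (intro bp_conj bp_const bp_mem_clop bqD[OF D] rlD that)
    have bQ: "bp UNIV (\<lambda>g. Q g (X g))" if "rl X" for X
      unfolding Q_def by (rule bp_ex[OF bQn[OF that]])
    have mQ: "(realname X \<^bold>\<in> rset Q) s \<longleftrightarrow> ae s (\<lambda>g. Q g (X g))" if "rl X" for X s
      by (rule mem_rset[OF bQ that])
    have c1: "is_open (rset Q) r"
      unfolding is_open_iff
    proof (intro conjI allI impI)
      show "is_cantor x s" if "(x \<^bold>\<in> rset Q) s" for x s by (rule rset_cantor[OF bQ that])
      show "openf (\<lambda>X. realname X \<^bold>\<in> rset Q) r"
        unfolding openf_def
      proof (intro allI impI)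
        fix X s assume X: "rl X" and a: "(realname X \<^bold>\<in> rset Q) s"
        then have a': "ae s (\<lambda>g. \<exists>n. m \<le> n \<and> X g \<in> clop (D g n))" by (simp add: mQ Q_def)
        have "\<exists>s'\<le>s. \<exists>n. ae s' (\<lambda>g. m \<le> n \<and> X g \<in> clop (D g n))"
          by (rule ae_ex[where Q = "\<lambda>n g. m \<le> n \<and> X g \<in> clop (D g n)", OF bQn[OF X] a']) blast
        then obtain s' n where s': "s' \<le> s" "ae s' (\<lambda>g. m \<le> n \<and> X g \<in> clop (D g n))" by blast
        obtain u e where u: "u \<le> s'" "ae u (\<lambda>g. D g n = e)" using seq_decide[OF D] by blast
        have "(realname Y \<^bold>\<in> rset Q) v"
          if Y: "rl Y" "v \<le> u" "ae v (\<lambda>g. rst (X g) (mx e) = rst (Y g) (mx e))" for Y v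
        proof -
          have vs: "v \<le> s'" using Y u by (meson order_trans)
          have "ae v (\<lambda>g. Q g (Y g))"
          proof (rule ae_mp3[OF Y(3) ae_mono[OF u(2) Y(2)] ae_mono[OF s'(2) vs]])
            fix g assume "rst (X g) (mx e) = rst (Y g) (mx e)" "D g n = e" "m \<le> n \<and> X g \<in> clop (D g n)"
            then show "Q g (Y g)" unfolding Q_def using rst_clop_cong[of e "mx e" "X g" "Y g"] by auto
          qed
          then show ?thesis by (simp add: mQ[OF Y(1)])
        qed
        then show "\<exists>r\<le>s. \<exists>n. \<forall>Y. rl Y \<longrightarrow> (\<forall>s\<le>r. ae s (\<lambda>g. rst (X g) n = rst (Y g) n) \<longrightarrow> (realname Y \<^bold>\<in> rset Q) s)"
          using u s' by (meson order_trans)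
      qed
    qed
    have c2: "(x \<^bold>\<in> rset Q) s" if s: "s \<le> r" "N_inf (seqname D) x s" for x s
    proof -
      have "is_cantor x s" using s(2) by (simp add: N_inf_def fconj_def)
      then obtain X where X: "rl X" "(x \<^bold>= realname X) s" using cantorE by blast
      have gN: "good (\<lambda>x. N_inf (seqname D) x)" by (intro good_intros)
      have "N_inf (seqname D) (realname X) s" by (rule good_cong[OF gN X(2) s(2)])
      then have "ae s (\<lambda>g. \<forall>m. \<exists>n. m \<le> n \<and> hit X D g n)" by (simp add: N_inf_iff[OF X(1) D])
      then have "ae s (\<lambda>g. Q g (X g))" by (rule ae_mp) (simp add: Q_def hit_def)
      then show ?thesis using fmem_cong1[OF feq_sym[OF X(2)]] mQ[OF X(1)] by blast
    qed
    have c3: "clopen_measure_le c (nn k) s" if s: "s \<le> r" "is_clopen c s" "(c \<^bold>\<subseteq> rset Q) s" for c s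
    proof (rule reg_dense[OF reg_clopen_measure_le])
      fix s' assume s': "s' \<le> s"
      obtain u e where u: "u \<le> s'" "(c \<^bold>= clopname e) u"
        using clopen_code[OF reg_mono[OF reg_is_clopen s(2) s']] by blast
      have us: "u \<le> s" "u \<le> r" using u s' s by (meson order_trans)+
      have "mu e \<le> 1 / 2 ^ k"
      proof (rule measure_le_cover[OF D ae_mono[OF r(2) us(2)]])
        fix X v assume X: "rl X" "v \<le> u" "ae v (\<lambda>g. X g \<in> clop e)"
        then have "(realname X \<^bold>\<in> clopname e) v" by (simp add: mem_clopname)
        then have "(realname X \<^bold>\<in> c) v" using fmem_cong2[OF feq_sym[OF feq_mono[OF u(2) X(2)]]] by blast
        then have "(realname X \<^bold>\<in> rset Q) v" using s(3) X(2) us unfolding fsub_iff by (meson order_trans)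
        then show "ae v (\<lambda>g. \<exists>n. m \<le> n \<and> X g \<in> clop (D g n))" by (simp add: mQ[OF X(1)] Q_def)
      qed
      then have le: "clopen_measure_le (clopname e) (nn k) u" by (rule measure_leI)
      have gm: "good (\<lambda>c :: ('i, 'l cohen) name. clopen_measure_le c (nn k))" by (intro good_intros)
      have "clopen_measure_le c (nn k) u" by (rule good_cong[OF gm feq_sym[OF u(2)] le])
      then show "\<exists>r\<le>s'. clopen_measure_le c (nn k) r" using u by blast
    qed
    have "(is_open (rset Q) \<^bold>\<and> (\<^bold>\<forall>x. N_inf (seqname D) x \<^bold>\<longrightarrow> x \<^bold>\<in> rset Q) \<^bold>\<and>
         (\<^bold>\<forall>c. is_clopen c \<^bold>\<and> c \<^bold>\<subseteq> rset Q \<^bold>\<longrightarrow> clopen_measure_le c (nn k))) r"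
      using c1 c2 c3 by (simp add: fconj_def fall_def fimp_iff)
    then have "null_cover (N_inf (seqname D)) (nn k) r" by (intro fexI[of _ "rset Q"]) simp_all
    then show "\<exists>r\<le>q. null_cover (N_inf (seqname D)) (nn k) r" using r by blast
  qed simp
  then have "is_null (N_inf (seqname D)) p" by (simp add: is_null_iff)
  then show ?thesis unfolding Omega_bar_def using seqname_fun[OF D] by (simp add: fconj_def)
qed

section \<open>A null limes superior has vanishing measures, in the extension\<close>

lemma BB_if: "BB a d m M = concat (map (\<lambda>i. if a i then d i else []) [m..<M])"
proof -
  have "concat (map d (filter a xs)) = concat (map (\<lambda>i. if a i then d i else []) xs)" for xs by (induction xs) auto
  then show ?thesis by (simp add: BB_def)
qed

lemma bpf_BB:
  assumes a: "\<And>n. bp S (\<lambda>g. a g n)" and D: "bq S D" shows "bpf S (\<lambda>g. BB (a g) (D g) m M)"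
  \<comment> \<open>With \<open>filter\<close> replaced by a conditional the list has a fixed
    length, so the closure rule for mapped lists applies.\<close>
  unfolding BB_if
  by (rule bpf_app[of _ "\<lambda>g. map (\<lambda>i. if a g i then D g i else []) [m..<M]" concat],
      rule bpf_map_list[of S "\<lambda>i g. if a g i then D g i else []"])
     (intro bpf_if a bqD[OF D] bpf_const)

lemma bpf_Ms:
  assumes a: "\<And>n. bp S (\<lambda>g. a g n)" and D: "bq S D" shows "bpf S (\<lambda>g. Ms (a g) (D g) k i)"
proof (induction i)
  case (Suc i)
  have "bp S (\<lambda>g. good_step (a g) (D g) k i m M)" for m M
    unfolding good_step_def
  proof (intro bp_conj bp_const bp_all)
    show "bp S (\<lambda>g. mu (BB (a g) (D g) m M') \<le> mu (BB (a g) (D g) m M) + 1 / 2 ^ (k + i + 3))" for M'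
      by (rule bp_app2[OF bpf_BB[OF a D] bpf_BB[OF a D]])
  qed
  then have "bp S (\<lambda>g. good_step (a g) (D g) k i (Ms (a g) (D g) k i) M)" for M
    by (rule bp_subst[OF Suc, of "\<lambda>m g. good_step (a g) (D g) k i m M"])
  then have "bpf S (\<lambda>g. LEAST M. good_step (a g) (D g) k i (Ms (a g) (D g) k i) M)" by (rule bpf_Least)
  then show ?case by simp
qed (simp add: bpf_const)

lemma bp_hit_tree:
  assumes a: "\<And>n. bp S (\<lambda>g. a g n)" and D: "bq S D" and u: "\<And>s. bp S (\<lambda>g. u g s)"
  shows "bp S (\<lambda>g. hit_tree (a g) (D g) k (u g) s)"
proof -
  have "bpf S (\<lambda>g. BB (a g) (D g) (Ms (a g) (D g) k i) M)" for i M
    by (rule bpf_subst[OF bpf_Ms[OF a D], of "\<lambda>m g. BB (a g) (D g) m M"]) (rule bpf_BB[OF a D])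
  then have "bpf S (\<lambda>g. Bi (a g) (D g) k i)" for i
    by (rule bpf_subst[OF bpf_Ms[OF a D], of "\<lambda>M g. BB (a g) (D g) (Ms (a g) (D g) k i) M"])
  then have "bp S (\<lambda>g. \<exists>x. pre s x \<and> x \<in> clop (Bi (a g) (D g) k i))" for i
    by (rule bp_app)
  then show ?thesis unfolding hit_tree_def by (intro bp_conj bp_not bp_all bp_imp bp_const u)
qed

lemma ext_finite_join:
  assumes "finite F" "ext r g" "\<And>s. s \<in> F \<Longrightarrow> ev (\<phi> s) g" "\<And>s. reg (\<phi> s)"
  shows "\<exists>q\<le>r. ext q g \<and> (\<forall>s\<in>F. \<phi> s q)"
  using assms(1,3)
proof (induction F rule: finite_induct)
  case empty then show ?case using assms(2) by blast
next
  case (insert s F)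
  obtain q where q: "q \<le> r" "ext q g" "\<forall>s\<in>F. \<phi> s q" using insert by blast
  obtain t where t: "ext t g" "\<phi> s t" using insert.prems unfolding ev_def by blast
  have "\<phi> s (join q t)" using reg_mono[OF assms(4) t(2) ext_compat(3)[OF q(2) t(1)]] .
  moreover have "\<phi> u (join q t)" if "u \<in> F" for u
    using reg_mono[OF assms(4) _ ext_compat(2)[OF q(2) t(1)]] q(3) that by blast
  moreover have "join q t \<le> r" using ext_compat(2)[OF q(2) t(1)] q(1) by (meson order_trans)
  ultimately show ?case using ext_compat(1)[OF q(2) t(1)] by blast
qed

lemma ae_contrI:
  assumes "bp S Q" "\<And>q. q \<le> p \<Longrightarrow> ae q (\<lambda>g. \<not> Q g) \<Longrightarrow> False" shows "ae p Q"
  by (rule ae_dense[OF assms(1)]) (metis assms(2) ae_decide[OF assms(1)] order_trans)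

text \<open>Otherwise some 2^-k is exceeded infinitely often. Cover the limes superior by an open W
  of measure at most 2^-(k+1) and let u mark the strings whose cones are in W. The branch Y of the
  hit tree lies in the limes superior, hence in W, hence some cone around it lies in W, although Y
  avoids u.\<close>

lemma Omega_bar_vanishing:
  assumes D: "bq UNIV D" and O: "Omega_bar (seqname D) p"
  shows "ae p (\<lambda>g. vanishing (D g))"
proof (rule ae_contrI)
  have bn: "bp UNIV (\<lambda>g. h (D g n))" for h :: "code \<Rightarrow> bool" and n by (rule bp_app[OF bqD[OF D]])
  show "bp UNIV (\<lambda>g. vanishing (D g))"
    unfolding vanishing_def by (intro bp_all bp_ex bp_imp bp_const bn)
  fix q assume q: "q \<le> p" "ae q (\<lambda>g. \<not> vanishing (D g))"
  have ex: "ae q (\<lambda>g. \<exists>k. \<forall>m. \<exists>n. m \<le> n \<and> 1 / 2 ^ k < mu (D g n))"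
    by (rule ae_mp[OF q(2)]) (auto simp: vanishing_def not_le)
  have bk: "bp UNIV (\<lambda>g. \<forall>m. \<exists>n. m \<le> n \<and> 1 / 2 ^ k < mu (D g n))" for k
    by (intro bp_all bp_ex bp_conj bp_const bn)
  have "\<exists>r\<le>q. \<exists>k. ae r (\<lambda>g. \<forall>m. \<exists>n. m \<le> n \<and> 1 / 2 ^ k < mu (D g n))"
    by (rule ae_ex[where Q = "\<lambda>k g. \<forall>m. \<exists>n. m \<le> n \<and> 1 / 2 ^ k < mu (D g n)", OF bk ex]) blast
  then obtain r k where r: "r \<le> q" "ae r (\<lambda>g. \<forall>m. \<exists>n. m \<le> n \<and> 1 / 2 ^ k < mu (D g n))" by blast
  have rp: "r \<le> p" using r q by (meson order_trans)
  have "Omega_bar (seqname D) r" by (rule reg_mono[OF reg_Omega_bar O rp])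
  \<comment> \<open>The exponent k + 1 gives the largest measure that \<open>hit_tree_level\<close>
    allows u to have.\<close>
  then have "null_cover (N_inf (seqname D)) (nn (k + 1)) r"
    unfolding Omega_bar_def by (simp add: fconj_def[of "is_fun _ _ _"] is_null_iff)
  then obtain r1 W where r1: "r1 \<le> r" "is_open W r1" "(\<^bold>\<forall>x. N_inf (seqname D) x \<^bold>\<longrightarrow> x \<^bold>\<in> W) r1"
      "(\<^bold>\<forall>c. is_clopen c \<^bold>\<and> c \<^bold>\<subseteq> W \<^bold>\<longrightarrow> clopen_measure_le c (nn (k + 1))) r1"
    unfolding fex_iff[of "\<lambda>U. is_open U \<^bold>\<and> _ U"] fconj_def[of "is_open _"] fconj_def[of "fall _"] by blast
  define a where "a g n \<longleftrightarrow> 1 / 2 ^ k < mu (D g n)" for g n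
  define V where "V X = (realname X \<^bold>\<in> W)" for X
  have V: "reg (V X)" for X by (simp add: V_def)
  define u where "u g s = ev (boxs V s) g" for g s
  define Y where "Y g = lb (hit_tree (a g) (D g) k (u g))" for g
  have ba: "bp UNIV (\<lambda>g. a g n)" for n unfolding a_def by (rule bn)
  have bu: "bp UNIV (\<lambda>g. u g s)" for s unfolding u_def by (intro bp_ev_UNIV reg_boxs V)
  have Y: "rl Y" unfolding rl_def Y_def by (intro allI bp_lb bp_hit_tree ba bu D)
  \<comment> \<open>For fixed N the marked strings are finitely many, so one condition t puts all
    their cones into W; their union is then a clopen subset of W, and the bound on the measure of W
    applies to it.\<close>
  have card: "card {s. length s = N \<and> u g s} * 2 ^ (k + 1) \<le> (2 :: nat) ^ N" if g: "ext r1 g" for g N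
  proof -
    let ?F = "{s. length s = N \<and> u g s}"
    have fF: "finite ?F" by (rule finite_subset[OF _ finite_strings[of N]]) blast
    have rb: "reg (boxs V s)" for s by (rule reg_boxs[OF V])
    have "\<exists>t\<le>r1. ext t g \<and> (\<forall>s\<in>?F. boxs V s t)"
      by (rule ext_finite_join[OF fF g]) (auto simp: u_def rb)
    then obtain t where t: "t \<le> r1" "\<And>s. s \<in> ?F \<Longrightarrow> boxs V s t" by blast
    obtain e where e: "set e = ?F" using finite_list[OF fF] by blast
    have "(clopname e \<^bold>\<subseteq> W) t"
      unfolding fsub_iff
    proof (intro allI impI)
      fix s z assume s: "s \<le> t" "(z \<^bold>\<in> clopname e) s"
      obtain X where X: "rl X" "(z \<^bold>= realname X) s" using cantorE[OF clopname_cantor[OF s(2)]] .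
      have "ae s (\<lambda>g. X g \<in> clop e)" using fmem_cong1[OF X(2) s(2)] by (simp add: mem_clopname[OF X(1)])
      then have ex': "ae s (\<lambda>g. \<exists>w. w \<in> set e \<and> pre w (X g))" by (rule ae_mp) (auto simp: clop_def)
      have bw: "bp UNIV (\<lambda>g. w \<in> set e \<and> pre w (X g))" for w
        unfolding pre_def by (intro bp_conj bp_const bp_all bp_imp rl_eq[OF X(1), unfolded eq_commute[of "X _ _"]])
      have "(realname X \<^bold>\<in> W) s"
      proof (rule reg_dense[OF reg_fmem])
        fix s' assume s': "s' \<le> s"
        have "\<exists>v\<le>s'. \<exists>w. ae v (\<lambda>g. w \<in> set e \<and> pre w (X g))"
          by (rule ae_ex[where Q = "\<lambda>w g. w \<in> set e \<and> pre w (X g)", OF bw ae_mono[OF ex' s']]) blast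
        then obtain v w where v: "v \<le> s'" "ae v (\<lambda>g. w \<in> set e \<and> pre w (X g))" by blast
        have w: "w \<in> ?F" using ae_witness[OF v(2)] e by blast
        have "ae v (\<lambda>g. pre w (X g))" by (rule ae_mp[OF v(2)]) simp
        moreover have "v \<le> t" using v s' s by (meson order_trans)
        ultimately have "V X v" using t(2)[OF w] X(1) unfolding boxs_def by blast
        then show "\<exists>v\<le>s'. (realname X \<^bold>\<in> W) v" using v unfolding V_def by blast
      qed
      then show "(z \<^bold>\<in> W) s" using fmem_cong1[OF feq_sym[OF X(2)]] by blast
    qed
    then have "clopen_measure_le (clopname e) (nn (k + 1)) t"
      using r1(4) t(1) is_clopen_clopname by (simp add: fall_def fimp_iff fconj_def)
    then have "mu e \<le> 1 / 2 ^ (k + 1)" by (rule measure_leD)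
    moreover have "mu e = card ?F / 2 ^ N"
    proof -
      have "mx e \<le> N" unfolding mx_def by (rule Max.boundedI) (simp, simp, use e in auto)
      then have "mu e = card (lev N e) / 2 ^ N" by (rule mu_eq_lev)
      moreover have "lev N e = ?F"
      proof (intro equalityI subsetI)
        fix t assume "t \<in> lev N e"
        then obtain s where s: "s \<in> ?F" "prefix s t" "length t = N" unfolding lev_def e by blast
        then obtain w where "t = s @ w" by (auto elim: prefixE)
        then show "t \<in> ?F" using s by simp
      next
        fix t assume "t \<in> ?F"
        then show "t \<in> lev N e" unfolding lev_def e by blast
      qed
      ultimately show ?thesis by simp
    qed
    ultimately have "real (card ?F * 2 ^ (k + 1)) \<le> real (2 ^ N)" by (simp add: field_simps)
    then show ?thesis using of_nat_le_iff by blast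
  qed
  have br: "ae r1 (\<lambda>g. (\<forall>n. \<not> u g (rst (Y g) n)) \<and> (\<forall>m. \<exists>n. m \<le> n \<and> hit Y D g n))"
  proof (rule ae_mp[OF ae_mono[OF r(2) r1(1)]])
    fix g assume g: "ext r1 g" "\<forall>m. \<exists>n. m \<le> n \<and> 1 / 2 ^ k < mu (D g n)"
    have up: "u g (s @ t)" if "u g s" for s t using that ev_boxs_append unfolding u_def by blast
    have inf: "\<exists>n\<ge>m. a g n" for m using g(2) unfolding a_def by blast
    have big: "1 / 2 ^ k < mu (D g n)" if "a g n" for n using that unfolding a_def .
    have 1: "\<not> u g (rst (Y g) n)" for n unfolding Y_def
      by (rule hit_tree_branch(1)[of "a g" k "D g" "u g"]) (use inf big up card[OF g(1)] in blast)+
    have 2: "\<exists>n\<ge>m. a g n \<and> Y g \<in> clop (D g n)" for m unfolding Y_def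
      by (rule hit_tree_branch(2)[of "a g" k "D g" "u g"]) (use inf big up card[OF g(1)] in blast)+
    show "(\<forall>n. \<not> u g (rst (Y g) n)) \<and> (\<forall>m. \<exists>n. m \<le> n \<and> hit Y D g n)"
      using 1 2 unfolding hit_def by blast
  qed
  then have "ae r1 (\<lambda>g. \<forall>m. \<exists>n. m \<le> n \<and> hit Y D g n)" by (rule ae_mp) simp
  then have "N_inf (seqname D) (realname Y) r1" by (simp add: N_inf_iff[OF Y D])
  then have YW: "V Y r1" using r1(3) unfolding V_def by (simp add: fall_def fimp_iff)
  have op: "openf V r1" using r1(2) unfolding is_open_iff V_def by blast
  obtain r2 n s where r2: "r2 \<le> r1" "ae r2 (\<lambda>g. rst (Y g) n = s)" "boxs V s r2"
    by (rule openf_boxs[of V r1 Y, OF V op Y YW])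
  have "ae r2 (\<lambda>g. False)"
  proof (rule ae_mp2[OF r2(2) ae_mono[OF br r2(1)]])
    fix g assume g: "ext r2 g" "rst (Y g) n = s" "(\<forall>n. \<not> u g (rst (Y g) n)) \<and> (\<forall>m. \<exists>n. m \<le> n \<and> hit Y D g n)"
    have "u g s" unfolding u_def ev_def using g(1) r2(3) by blast
    then show False using g(2,3) by blast
  qed
  then show False by simp
qed

end

section \<open>Cohen reals dominate\<close>

lemma bp_atom: "bp {\<alpha>} (\<lambda>g. g (\<alpha>, m))"
proof -
  define \<phi> where "\<phi> p \<longleftrightarrow> Rep_cohen p (\<alpha>, m) = Some True" for p
  have up: "\<exists>q\<le>p. Rep_cohen q (\<alpha>, m) = Some b" if "Rep_cohen p (\<alpha>, m) = None" for p b
  proof -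
    let ?q = "Abs_cohen ((Rep_cohen p)((\<alpha>, m) \<mapsto> b))"
    have "Rep_cohen ?q = (Rep_cohen p)((\<alpha>, m) \<mapsto> b)" by (rule Abs_cohen_inverse) (simp add: finite_Rep)
    then show ?thesis using that by (intro exI[of _ ?q]) (auto simp: less_eq_cohen_def map_le_def)
  qed
  have mono: "Rep_cohen q (\<alpha>, m) = Some b" if "Rep_cohen p (\<alpha>, m) = Some b" "q \<le> p" for p q b
    using that unfolding less_eq_cohen_def map_le_def by (metis domI)
  have "reg \<phi>"
  proof (rule regI)
    show "\<phi> q" if "\<phi> p" "q \<le> p" for p q using that mono unfolding \<phi>_def by blast
    fix p assume a: "\<And>q. q \<le> p \<Longrightarrow> \<exists>r\<le>q. \<phi> r"
    show "\<phi> p"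
    proof (cases "Rep_cohen p (\<alpha>, m)")
      case None
      then obtain q where q: "q \<le> p" "Rep_cohen q (\<alpha>, m) = Some False" using up by blast
      then obtain r where "r \<le> q" "\<phi> r" using a by blast
      then show ?thesis using mono[OF q(2)] by (simp add: \<phi>_def)
    next
      case (Some b)
      obtain r where "r \<le> p" "\<phi> r" using a by blast
      then show ?thesis using mono[OF Some] Some by (simp add: \<phi>_def)
    qed
  qed
  moreover have "supp {\<alpha>} \<phi>" unfolding supp_def \<phi>_def by (simp add: Rep_rs)
  ultimately have b: "bp {\<alpha>} (ev \<phi>)" by (rule bp_ev)
  have "ev \<phi> g \<longleftrightarrow> g (\<alpha>, m)" for g
  proof
    assume "ev \<phi> g"
    then show "g (\<alpha>, m)" unfolding ev_def ext_def \<phi>_def map_le_def by (metis domI option.sel)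
  next
    assume g: "g (\<alpha>, m)"
    let ?q = "Abs_cohen [(\<alpha>, m) \<mapsto> True]"
    have "Rep_cohen ?q = [(\<alpha>, m) \<mapsto> True]" by (rule Abs_cohen_inverse) simp
    then have "ext ?q g" "\<phi> ?q" using g by (auto simp: ext_def \<phi>_def map_le_def)
    then show "ev \<phi> g" unfolding ev_def by blast
  qed
  then show ?thesis by (rule bp_cong[OF b])
qed

lemma bpf_cohen_code: "bpf {\<alpha>} (\<lambda>g. cohen_code \<alpha> g k)"
  unfolding cohen_code_def by (rule bpf_app, rule bpf_Least, rule bp_atom)

context cohen_setting begin

lemma bq_cohen_seq: "bq {\<alpha>} (cohen_seq \<alpha>)"
  unfolding bq_def
proof
  fix n
  let ?h = "\<lambda>k c. if fst c = n then cut k c else []"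
  have "bpf {\<alpha>} (\<lambda>g. map (\<lambda>k. ?h k (cohen_code \<alpha> g k)) [0..<Suc n])"
    by (rule bpf_map_list[of "{\<alpha>}" "\<lambda>k g. ?h k (cohen_code \<alpha> g k)"], rule bpf_app[OF bpf_cohen_code])
  then show "bpf {\<alpha>} (\<lambda>g. cohen_seq \<alpha> g n)" unfolding cohen_seq_def by (rule bpf_app)
qed

lemma bp_avoid_real: "bp {\<alpha> :: 'l} (\<lambda>g. avoid_real \<alpha> g n)"
  unfolding avoid_real_def by (rule bp_lb, rule bp_covT[OF bq_cohen_seq])

definition covered :: "'l \<Rightarrow> ('l gen \<Rightarrow> nat \<Rightarrow> code) \<Rightarrow> 'l gen \<Rightarrow> nat \<Rightarrow> bool" where
  "covered \<beta> D g n \<longleftrightarrow> clop (D g n) \<subseteq> clop (cohen_seq \<beta> g n)"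

lemma bp_covered: "bq S D \<Longrightarrow> \<beta> \<in> S \<Longrightarrow> bp S (\<lambda>g. covered \<beta> D g n)"
  unfolding covered_def by (rule bp_app2[OF bqD bqD], assumption, rule bq_mono[OF bq_cohen_seq]) simp

text \<open>A finite condition mentions only finitely many blocks k of the Cohen real, so the code
  at some block can still be chosen freely.\<close>

lemma fresh_index: "\<exists>k. \<forall>j. Rep_cohen q (\<alpha>, prod_encode (k, j)) = None"
proof -
  let ?F = "(\<lambda>x. fst (prod_decode (snd x))) ` dom (Rep_cohen q)"
  have "finite ?F" by (simp add: finite_Rep)
  then obtain k where k: "k \<notin> ?F" using ex_new_if_finite[OF infinite_UNIV_nat] by blast
  have "Rep_cohen q (\<alpha>, prod_encode (k, j)) = None" for j
  proof (rule ccontr)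
    assume "Rep_cohen q (\<alpha>, prod_encode (k, j)) \<noteq> None"
    then have "(\<alpha>, prod_encode (k, j)) \<in> dom (Rep_cohen q)" by auto
    then have "fst (prod_decode (snd (\<alpha>, prod_encode (k, j)))) \<in> ?F" by (rule imageI)
    then show False using k by simp
  qed
  then show ?thesis by blast
qed

lemma force_cohen_code:
  assumes "\<And>j. Rep_cohen t (\<alpha>, prod_encode (k, j)) = None"
  obtains w where "w \<le> t" "\<And>g. ext w g \<Longrightarrow> cohen_code \<alpha> g k = c"
proof -
  let ?j = "to_nat c"
  let ?x = "\<lambda>i. (\<alpha>, prod_encode (k, i))"
  \<comment> \<open>False before the position \<open>to_nat c\<close> and True at it, so the first
    True of block k codes c.\<close>
  let ?m = "\<lambda>x. if x \<in> ?x ` {..?j} then Some (x = ?x ?j) else None"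
  let ?w = "Abs_cohen (Rep_cohen t ++ ?m)"
  have fin: "finite (dom (Rep_cohen t ++ ?m))"
  proof -
    have "dom ?m \<subseteq> ?x ` {..?j}" by (auto split: if_splits)
    then have "finite (dom ?m)" by (rule finite_subset) simp
    then show ?thesis using finite_Rep[of t] by simp
  qed
  have R: "Rep_cohen ?w = Rep_cohen t ++ ?m" by (rule Abs_cohen_inverse) (use fin in simp)
  have "?w \<le> t"
    unfolding less_eq_cohen_def R map_le_def
  proof
    fix x assume "x \<in> dom (Rep_cohen t)"
    then have "x \<notin> ?x ` {..?j}" using assms by auto
    then show "Rep_cohen t x = (Rep_cohen t ++ ?m) x" by (simp add: map_add_def)
  qed
  moreover have "cohen_code \<alpha> g k = c" if g: "ext ?w g" for g
  proof -
    have *: "g (?x i) \<longleftrightarrow> i = ?j" if "i \<le> ?j" for i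
    proof -
      have m: "(Rep_cohen t ++ ?m) (?x i) = Some (?x i = ?x ?j)" using that by (simp add: map_add_def)
      then have "?x i \<in> dom (Rep_cohen ?w)" unfolding R by (rule domI)
      then have "Rep_cohen ?w (?x i) = Some (g (?x i))" using g unfolding ext_def map_le_def by blast
      then show ?thesis unfolding R m by simp
    qed
    have "(LEAST i. g (?x i)) = ?j"
      by (rule Least_equality) (use *[of ?j] * in \<open>auto simp: not_le dest: less_imp_le, metis less_imp_le not_le\<close>)
    then show ?thesis by (simp add: cohen_code_def)
  qed
  ultimately show thesis using that by blast
qed

lemma real_le_pow2: "real n \<le> 2 ^ n"
  using less_exp[of n] by (metis less_imp_le of_nat_le_iff of_nat_numeral of_nat_power)

text \<open>Given q', pick a block k of \<alpha> that q' leaves untouched. Below the S-part of q'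
  find a late n in A at which all the sets to be covered have tiny measure, and decide these sets.
  All this has support S, which omits \<alpha>, so block k is still free to request their union at
  n.\<close>

lemma cohen_dominates:
  assumes \<alpha>: "\<alpha> \<notin> S" and A: "\<And>n. bp S (\<lambda>g. A g n)" and fin: "finite \<D>" and D: "\<And>D. D \<in> \<D> \<Longrightarrow> bq S D"
    and inf: "ae q (\<lambda>g. \<forall>m. \<exists>n. m \<le> n \<and> A g n)"
    and van: "\<And>D. D \<in> \<D> \<Longrightarrow> ae q (\<lambda>g. vanishing (D g))"
  shows "ae q (\<lambda>g. \<forall>m. \<exists>n. m \<le> n \<and> A g n \<and> (\<forall>D\<in>\<D>. covered \<alpha> D g n))"
proof (rule ae_all)
  fix m
  have bAA: "bp UNIV (\<lambda>g. \<forall>D\<in>\<D>. covered \<alpha> D g n)" for n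
    by (rule bp_finite_ball[OF fin]) (rule bp_covered[OF bq_UNIV[OF D]], auto)
  show "ae q (\<lambda>g. \<exists>n. m \<le> n \<and> A g n \<and> (\<forall>D\<in>\<D>. covered \<alpha> D g n))"
  proof (rule ae_dense)
    show "bp UNIV (\<lambda>g. \<exists>n. m \<le> n \<and> A g n \<and> (\<forall>D\<in>\<D>. covered \<alpha> D g n))"
      by (intro bp_ex bp_conj bp_const bp_UNIV[OF A] bAA)
    fix q' assume q': "q' \<le> q"
    obtain k where k: "\<And>j. Rep_cohen q' (\<alpha>, prod_encode (k, j)) = None" using fresh_index[of q' \<alpha>] by blast
    define q0 where "q0 = rs S q'"
    \<comment> \<open>The union of c0 sets of measure at most 2^-(k+2+c0) has measure at most c0 *
      2^-c0 * 2^-(k+2); since c0 is at most 2^c0, this is within the bound for request k.\<close>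
    define c0 where "c0 = card \<D>"
    have bm: "bp S (\<lambda>g. \<forall>m. \<exists>n. m \<le> n \<and> A g n)" by (intro bp_all bp_ex bp_conj bp_const A)
    have bh: "bp S (\<lambda>g. h (D g n))" if "D \<in> \<D>" for h :: "code \<Rightarrow> bool" and D n by (rule bp_app[OF bqD[OF D[OF that]]])
    have bv: "bp S (\<lambda>g. vanishing (D g))" if "D \<in> \<D>" for D
      unfolding vanishing_def by (intro bp_all bp_ex bp_imp bp_const bh that)
    have inf0: "ae q0 (\<lambda>g. \<forall>m. \<exists>n. m \<le> n \<and> A g n)" unfolding q0_def by (rule ae_rs[OF bm ae_mono[OF inf q']])
    have van0: "ae q0 (\<lambda>g. \<forall>D\<in>\<D>. vanishing (D g))"
      unfolding q0_def by (rule ae_ball[OF fin], rule ae_rs[OF bv ae_mono[OF van q']])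
    have ex: "ae q0 (\<lambda>g. \<exists>n. max m k \<le> n \<and> A g n \<and> (\<forall>D\<in>\<D>. mu (D g n) \<le> 1 / 2 ^ (k + 2 + c0)))"
    proof (rule ae_mp2[OF inf0 van0])
      fix g assume g: "\<forall>m. \<exists>n. m \<le> n \<and> A g n" "\<forall>D\<in>\<D>. vanishing (D g)"
      have "\<forall>D\<in>\<D>. \<exists>m. \<forall>n\<ge>m. mu (D g n) \<le> 1 / 2 ^ (k + 2 + c0)" using g(2) unfolding vanishing_def by blast
      then obtain M where M: "\<And>D n. D \<in> \<D> \<Longrightarrow> M D \<le> n \<Longrightarrow> mu (D g n) \<le> 1 / 2 ^ (k + 2 + c0)" by metis
      obtain M0 where M0: "\<And>D. D \<in> \<D> \<Longrightarrow> M D < M0" using finite_nat_bounded[of "M ` \<D>"] fin by auto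
      obtain n where n: "max (max m k) M0 \<le> n" "A g n" using g(1) by blast
      then show "\<exists>n. max m k \<le> n \<and> A g n \<and> (\<forall>D\<in>\<D>. mu (D g n) \<le> 1 / 2 ^ (k + 2 + c0))"
        using M M0 by (meson less_imp_le max.boundedE order_trans)
    qed
    have bn: "bp S (\<lambda>g. max m k \<le> n \<and> A g n \<and> (\<forall>D\<in>\<D>. mu (D g n) \<le> 1 / 2 ^ (k + 2 + c0)))" for n
      by (intro bp_conj bp_const A bp_finite_ball[OF fin] bh)
    have "\<exists>r\<le>q0. \<exists>n. ae r (\<lambda>g. max m k \<le> n \<and> A g n \<and> (\<forall>D\<in>\<D>. mu (D g n) \<le> 1 / 2 ^ (k + 2 + c0)))"
      by (rule ae_ex[where Q = "\<lambda>n g. max m k \<le> n \<and> A g n \<and> (\<forall>D\<in>\<D>. mu (D g n) \<le> 1 / 2 ^ (k + 2 + c0))", OF bn ex]) blast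
    then obtain r1 n where r1: "r1 \<le> q0"
      "ae r1 (\<lambda>g. max m k \<le> n \<and> A g n \<and> (\<forall>D\<in>\<D>. mu (D g n) \<le> 1 / 2 ^ (k + 2 + c0)))" by blast
    \<comment> \<open>The conditional makes the predicate regular for all arguments, also those
      outside the finite set, as \<open>finite_decide\<close> demands.\<close>
    have "\<exists>r\<le>r1. \<exists>f. \<forall>D\<in>\<D>. (if D \<in> \<D> then (\<lambda>p. ae p (\<lambda>g. D g n = f D)) else (\<lambda>_. False)) r"
    proof (rule finite_decide[OF fin])
      fix D s assume "D \<in> \<D>"
      then show "\<exists>r\<le>s. \<exists>e. (if D \<in> \<D> then (\<lambda>p. ae p (\<lambda>g. D g n = e)) else (\<lambda>_. False)) r"
        using seq_decide[OF bq_UNIV[OF D]] by simp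
    next
      fix D e
      show "reg (if D \<in> \<D> then (\<lambda>p. ae p (\<lambda>g. D g n = e)) else (\<lambda>_. False))"
        using reg_ae[OF bpfD[OF bqD[OF D]]] by (simp add: reg_False)
    qed
    then obtain r2 f where r2: "r2 \<le> r1" "\<And>D. D \<in> \<D> \<Longrightarrow> ae r2 (\<lambda>g. D g n = f D)" by auto
    \<comment> \<open>Extending to decide the terms may have written into block k; restricting to S
      erases that and, by \<open>ae_rs\<close>, keeps the decisions.\<close>
    define r3 where "r3 = rs S r2"
    have r3S: "rs S r3 = r3" unfolding r3_def by (simp add: rs_rs)
    have r3q: "r3 \<le> rs S q'"
    proof -
      have "r2 \<le> rs S q'" using r2 r1 unfolding q0_def by (meson order_trans)
      then have "rs S r2 \<le> rs S (rs S q')" by (rule rs_mono)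
      then show ?thesis by (simp add: r3_def rs_rs)
    qed
    have a1: "ae r3 (\<lambda>g. max m k \<le> n \<and> A g n \<and> (\<forall>D\<in>\<D>. mu (D g n) \<le> 1 / 2 ^ (k + 2 + c0)))"
      unfolding r3_def by (rule ae_rs[OF bn ae_mono[OF r1(2) r2(1)]])
    have a2: "ae r3 (\<lambda>g. \<forall>D\<in>\<D>. D g n = f D)"
      unfolding r3_def by (rule ae_ball[OF fin], rule ae_rs[OF bpfD[OF bqD[OF D]] r2(2)])
    obtain g0 where g0: "max m k \<le> n" "\<And>D. D \<in> \<D> \<Longrightarrow> mu (f D) \<le> 1 / 2 ^ (k + 2 + c0)"
      using ae_witness[OF ae_conj[OF a1 a2]] by auto
    obtain ds where ds: "set ds = \<D>" "distinct ds" using finite_distinct_list[OF fin] by blast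
    define e where "e = concat (map f ds)"
    have "mu e \<le> length (map f ds) * (1 / 2 ^ (k + 2 + c0))"
      unfolding e_def by (rule mu_concat_le) (use ds g0(2) in auto)
    also have "\<dots> = real c0 * (1 / 2 ^ (k + 2 + c0))" using ds distinct_card[of ds] by (simp add: c0_def)
    also have "\<dots> \<le> 2 ^ c0 * (1 / 2 ^ (k + 2 + c0))" by (rule mult_right_mono[OF real_le_pow2]) simp
    also have "\<dots> = 1 / 2 ^ (k + 2)" by (simp add: power_add)
    finally have mu_e: "mu e \<le> 1 / 2 ^ (k + 2)" .
    let ?t = "join q' r3"
    have t: "?t \<le> q'" "?t \<le> r3" using amalg(1)[OF r3S r3q] join_le2 by auto
    have "Rep_cohen ?t (\<alpha>, prod_encode (k, j)) = None" for j
    proof -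
      have "Rep_cohen r3 (\<alpha>, prod_encode (k, j)) = None" unfolding r3_def Rep_rs using \<alpha> by simp
      then show ?thesis using k by (simp add: Rep_join map_add_def)
    qed
    then obtain w where w: "w \<le> ?t" "\<And>g. ext w g \<Longrightarrow> cohen_code \<alpha> g k = (n, e)" 
      by (rule force_cohen_code[where c = "(n, e)"]) blast
    have w3: "w \<le> r3" "w \<le> q'" using w t by (meson order_trans)+
    have "ae w (\<lambda>g. \<exists>n. m \<le> n \<and> A g n \<and> (\<forall>D\<in>\<D>. covered \<alpha> D g n))"
    proof (rule ae_mp2[OF ae_mono[OF a1 w3(1)] ae_mono[OF a2 w3(1)]])
      fix g assume g: "ext w g" "max m k \<le> n \<and> A g n \<and> (\<forall>D\<in>\<D>. mu (D g n) \<le> 1 / 2 ^ (k + 2 + c0))"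
        "\<forall>D\<in>\<D>. D g n = f D"
      have cohen_code: "cohen_code \<alpha> g k = (n, e)" by (rule w(2)[OF g(1)])
      have c1: "clop e \<subseteq> clop (cohen_seq \<alpha> g n)"
        unfolding clop_cohen_seq using cohen_code g(2) mu_e by (force simp: cut_def)
      have c2: "clop (f D) \<subseteq> clop e" if "D \<in> \<D>" for D using that ds unfolding e_def clop_concat by auto
      have "covered \<alpha> D g n" if D: "D \<in> \<D>" for D
      proof -
        have "D g n = f D" using g(3) D by blast
        then show ?thesis unfolding covered_def using subset_trans[OF c2[OF D] c1] by simp
      qed
      then show "\<exists>n. m \<le> n \<and> A g n \<and> (\<forall>D\<in>\<D>. covered \<alpha> D g n)" using g(2) by auto
    qed
    then show "\<exists>r\<le>q'. ae r (\<lambda>g. \<exists>n. m \<le> n \<and> A g n \<and> (\<forall>D\<in>\<D>. covered \<alpha> D g n))" using w3 by blast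
  qed
qed

end

section \<open>The ultrafilter\<close>

text \<open>The set K stands for \<kappa>; the assumption on countable subsets is its uncountable
  cofinality, which \<open>countable_bounded\<close> obtains from the forced regularity.\<close>

locale chain_setting = cohen_setting U e0 for U :: "'i set" and e0 :: "'l set set \<Rightarrow> 'i" +
  fixes lam :: "'l rel" and K :: "'l set"
  assumes wo: "Well_order lam" and fld: "Field lam = UNIV"
    and cofK: "\<And>C. countable C \<Longrightarrow> C \<subseteq> K \<Longrightarrow> \<exists>\<alpha>\<in>K. \<forall>\<gamma>\<in>C. (\<gamma>, \<alpha>) \<in> lam \<and> \<gamma> \<noteq> \<alpha>"
begin

definition lt :: "'l \<Rightarrow> 'l \<Rightarrow> bool" where
  "lt \<alpha> \<beta> \<longleftrightarrow> (\<alpha>, \<beta>) \<in> lam \<and> \<alpha> \<noteq> \<beta>"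

lemma lt_trans: "lt \<alpha> \<beta> \<Longrightarrow> lt \<beta> \<gamma> \<Longrightarrow> lt \<alpha> \<gamma>"
  using wo unfolding lt_def well_order_on_def linear_order_on_def partial_order_on_def preorder_on_def
  by (metis antisymD transD)

lemma lt_linear: "lt \<alpha> \<beta> \<or> \<alpha> = \<beta> \<or> lt \<beta> \<alpha>"
  using wo fld unfolding lt_def well_order_on_def linear_order_on_def total_on_def by blast

lemma lt_irrefl: "\<not> lt \<alpha> \<alpha>" by (simp add: lt_def)

text \<open>Indices outside K count as earlier than every \<beta>, so only the part of a support
  inside K has to be bounded.\<close>

definition supp_below :: "'l \<Rightarrow> 'l set" where
  "supp_below \<beta> = {\<gamma>. \<gamma> \<notin> K \<or> lt \<gamma> \<beta>}"

lemma finite_lt_max: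
  assumes "finite F" "F \<noteq> {}" shows "\<exists>a\<in>F. \<forall>b\<in>F. b = a \<or> lt b a"
  using assms
proof (induction F rule: finite_ne_induct)
  case (insert x F)
  then obtain a where a: "a \<in> F" "\<forall>b\<in>F. b = a \<or> lt b a" by blast
  consider "lt x a" | "x = a" | "lt a x" using lt_linear by blast
  then show ?case
  proof cases
    case 3
    then have "\<forall>b\<in>insert x F. b = x \<or> lt b x" using a by (metis insertE lt_trans)
    then show ?thesis by blast
  qed (use a in blast)+
qed simp

text \<open>Induction on the number of distinct indices, removing the largest one \<alpha>. The
  requirements for smaller indices are supported in \<open>supp_below \<alpha>\<close>, which omits
  \<alpha>, so by \<open>cohen_dominates\<close> the Cohen sequence of \<alpha> meets all its own
  requirements at infinitely many places where the others hold.\<close>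

lemma fip_base:
  assumes "finite B" "\<And>\<beta> D. (\<beta>, D) \<in> B \<Longrightarrow> \<beta> \<in> K \<and> bq (supp_below \<beta>) D \<and> ae q (\<lambda>g. vanishing (D g))"
  shows "ae q (\<lambda>g. \<forall>m. \<exists>n. m \<le> n \<and> (\<forall>(\<beta>, D)\<in>B. covered \<beta> D g n))"
  using assms
proof (induction "card (fst ` B)" arbitrary: B rule: less_induct)
  case less
  show ?case
  proof (cases "B = {}")
    case True
    then show ?thesis by (auto intro: aeI)
  next
    case False
    then obtain \<alpha> where \<alpha>: "\<alpha> \<in> fst ` B" "\<And>\<beta>. \<beta> \<in> fst ` B \<Longrightarrow> \<beta> = \<alpha> \<or> lt \<beta> \<alpha>"
      using finite_lt_max[of "fst ` B"] less.prems(1) by blast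
    define B1 where "B1 = {x\<in>B. fst x \<noteq> \<alpha>}"
    define \<D> where "\<D> = snd ` {x\<in>B. fst x = \<alpha>}"
    have fB1: "finite B1" and f\<D>: "finite \<D>" using less.prems(1) by (auto simp: B1_def \<D>_def)
    have "fst ` B1 \<subset> fst ` B" using \<alpha>(1) by (auto simp: B1_def)
    then have "card (fst ` B1) < card (fst ` B)" using less.prems(1) by (intro psubset_card_mono) auto
    moreover have B1: "\<beta> \<in> K \<and> bq (supp_below \<beta>) D \<and> ae q (\<lambda>g. vanishing (D g))" if "(\<beta>, D) \<in> B1" for \<beta> D
      using less.prems(2) that by (auto simp: B1_def)
    ultimately have IH: "ae q (\<lambda>g. \<forall>m. \<exists>n. m \<le> n \<and> (\<forall>(\<beta>, D)\<in>B1. covered \<beta> D g n))"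
      using less.hyps[OF _ fB1] by blast
    have D\<alpha>: "\<alpha> \<in> K \<and> bq (supp_below \<alpha>) D \<and> ae q (\<lambda>g. vanishing (D g))" if "D \<in> \<D>" for D
      using that less.prems(2) by (force simp: \<D>_def)
    have \<alpha>K: "\<alpha> \<in> K" using \<alpha>(1) less.prems(2) by force
    have nS: "\<alpha> \<notin> supp_below \<alpha>" using \<alpha>K by (simp add: supp_below_def lt_irrefl)
    have bA: "bp (supp_below \<alpha>) (\<lambda>g. \<forall>(\<beta>, D)\<in>B1. covered \<beta> D g n)" for n
    proof (rule bp_finite_ball[OF fB1])
      fix x assume x: "x \<in> B1"
      obtain \<beta> D where xD: "x = (\<beta>, D)" by (cases x)
      have lt: "lt \<beta> \<alpha>" using x xD \<alpha>(2)[of \<beta>] by (force simp: B1_def)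
      have "bq (supp_below \<beta>) D" using B1 x xD by blast
      moreover have "supp_below \<beta> \<subseteq> supp_below \<alpha>" using lt lt_trans by (auto simp: supp_below_def)
      ultimately have "bq (supp_below \<alpha>) D" by (rule bq_mono)
      then have "bp (supp_below \<alpha>) (\<lambda>g. covered \<beta> D g n)" by (rule bp_covered) (use lt in \<open>simp add: supp_below_def\<close>)
      then show "bp (supp_below \<alpha>) (\<lambda>g. case x of (\<beta>, D) \<Rightarrow> covered \<beta> D g n)" by (simp add: xD)
    qed
    have "ae q (\<lambda>g. \<forall>m. \<exists>n. m \<le> n \<and> (\<forall>(\<beta>, D)\<in>B1. covered \<beta> D g n) \<and> (\<forall>D\<in>\<D>. covered \<alpha> D g n))"
      by (rule cohen_dominates[OF nS bA f\<D> _ IH]) (use D\<alpha> in auto)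
    moreover have "(\<forall>(\<beta>, D)\<in>B. covered \<beta> D g n)" if "\<forall>(\<beta>, D)\<in>B1. covered \<beta> D g n" "\<forall>D\<in>\<D>. covered \<alpha> D g n" for g n
    proof (clarify)
      fix \<beta> D assume b: "(\<beta>, D) \<in> B"
      show "covered \<beta> D g n"
      proof (cases "\<beta> = \<alpha>")
        case True
        then have "D \<in> \<D>" using b unfolding \<D>_def by force
        then show ?thesis using that(2) True by blast
      next
        case False
        then have "(\<beta>, D) \<in> B1" using b by (simp add: B1_def)
        then show ?thesis using that(1) by blast
      qed
    qed
    ultimately show ?thesis by (elim ae_mp) meson
  qed
qed

text \<open>
  A pair \<open>(A, p)\<close> stands for the requirement that \<open>p\<close> forces the set named by \<open>A\<close> into the
  ultrafilter. Maximality is taken over such families of pairs in the ground model.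
\<close>

definition fip :: "(('l gen \<Rightarrow> nat \<Rightarrow> bool) \<times> 'l cohen) set \<Rightarrow> bool" where
  "fip M \<longleftrightarrow> (\<forall>F q. finite F \<longrightarrow> F \<subseteq> M \<longrightarrow> (\<forall>x\<in>F. q \<le> snd x) \<longrightarrow>
     ae q (\<lambda>g. \<forall>m. \<exists>n. m \<le> n \<and> (\<forall>x\<in>F. fst x g n)))"

definition base_family :: "(('l gen \<Rightarrow> nat \<Rightarrow> bool) \<times> 'l cohen) set" where
  "base_family = {(covered \<beta> D, p) |\<beta> D p. \<beta> \<in> K \<and> bq (supp_below \<beta>) D \<and> ae p (\<lambda>g. vanishing (D g))}"

lemma rl_covered: "bq S D \<Longrightarrow> rl (covered \<beta> D)"
  unfolding rl_def using bp_covered[OF bq_UNIV] by blast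

lemma fip_base_family: "fip base_family"
  unfolding fip_def
proof (intro allI impI)
  fix F q assume F: "finite F" "F \<subseteq> base_family" "\<forall>x\<in>F. q \<le> snd x"
  have "\<forall>x\<in>F. \<exists>\<beta> D. fst x = covered \<beta> D \<and> \<beta> \<in> K \<and> bq (supp_below \<beta>) D \<and> ae q (\<lambda>g. vanishing (D g))"
  proof
    fix x assume x: "x \<in> F"
    then obtain \<beta> D p where p: "x = (covered \<beta> D, p)" "\<beta> \<in> K" "bq (supp_below \<beta>) D" "ae p (\<lambda>g. vanishing (D g))"
      using F(2) unfolding base_family_def by blast
    have "q \<le> p" using F(3) x p(1) by auto
    then have "ae q (\<lambda>g. vanishing (D g))" by (rule ae_mono[OF p(4)])
    then show "\<exists>\<beta> D. fst x = covered \<beta> D \<and> \<beta> \<in> K \<and> bq (supp_below \<beta>) D \<and> ae q (\<lambda>g. vanishing (D g))" using p by auto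
  qed
  then obtain b d where bd: "\<And>x. x \<in> F \<Longrightarrow> fst x = covered (b x) (d x)"
    "\<And>x. x \<in> F \<Longrightarrow> b x \<in> K \<and> bq (supp_below (b x)) (d x) \<and> ae q (\<lambda>g. vanishing (d x g))" by metis
  let ?B = "(\<lambda>x. (b x, d x)) ` F"
  have "ae q (\<lambda>g. \<forall>m. \<exists>n. m \<le> n \<and> (\<forall>(\<beta>, D)\<in>?B. covered \<beta> D g n))"
    by (rule fip_base) (use F(1) bd(2) in auto)
  then show "ae q (\<lambda>g. \<forall>m. \<exists>n. m \<le> n \<and> (\<forall>x\<in>F. fst x g n))"
    by (rule ae_mp) (use bd(1) in simp)
qed

definition admissible :: "(('l gen \<Rightarrow> nat \<Rightarrow> bool) \<times> 'l cohen) set set" where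
  "admissible = {M. base_family \<subseteq> M \<and> M \<subseteq> {x. rl (fst x)} \<and> fip M}"

lemma maximal_exists: "\<exists>M\<in>admissible. \<forall>M'\<in>admissible. M \<subseteq> M' \<longrightarrow> M' = M"
proof (rule subset_Zorn_nonempty)
  have "base_family \<in> admissible" unfolding admissible_def using fip_base_family rl_covered by (auto simp: base_family_def)
  then show "admissible \<noteq> {}" by blast
  fix C assume C: "C \<noteq> {}" "subset.chain admissible C"
  have sub: "C \<subseteq> admissible" using C(2) by (simp add: subset.chain_def)
  have "fip (\<Union>C)"
    unfolding fip_def
  proof (intro allI impI)
    fix F q assume F: "finite F" "F \<subseteq> \<Union>C" "\<forall>x\<in>F. q \<le> snd x"
    obtain M where "M \<in> C" "F \<subseteq> M"
      using finite_subset_Union_chain[OF F(1,2) C] by blast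
    then show "ae q (\<lambda>g. \<forall>m. \<exists>n. m \<le> n \<and> (\<forall>x\<in>F. fst x g n))"
      using sub F unfolding admissible_def fip_def by blast
  qed
  then show "\<Union>C \<in> admissible" using sub C(1) unfolding admissible_def by blast
qed

section \<open>The ultrafilter generated by a maximal family\<close>

definition max_family :: "(('l gen \<Rightarrow> nat \<Rightarrow> bool) \<times> 'l cohen) set" where
  "max_family = (SOME M. M \<in> admissible \<and> (\<forall>M'\<in>admissible. M \<subseteq> M' \<longrightarrow> M' = M))"

lemma max_family: "base_family \<subseteq> max_family" "x \<in> max_family \<Longrightarrow> rl (fst x)" "fip max_family" "M' \<in> admissible \<Longrightarrow> max_family \<subseteq> M' \<Longrightarrow> M' = max_family"
proof -
  have "\<exists>M. M \<in> admissible \<and> (\<forall>M'\<in>admissible. M \<subseteq> M' \<longrightarrow> M' = M)"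
    using maximal_exists by (simp only: Bex_def)
  then have "max_family \<in> admissible \<and> (\<forall>M'\<in>admissible. max_family \<subseteq> M' \<longrightarrow> M' = max_family)"
    unfolding max_family_def by (rule someI_ex)
  then show "base_family \<subseteq> max_family" "x \<in> max_family \<Longrightarrow> rl (fst x)" "fip max_family" "M' \<in> admissible \<Longrightarrow> max_family \<subseteq> M' \<Longrightarrow> M' = max_family"
    unfolding admissible_def by blast+
qed

definition wit :: "(('l gen \<Rightarrow> nat \<Rightarrow> bool) \<times> 'l cohen) set \<Rightarrow> ('l gen \<Rightarrow> nat \<Rightarrow> bool) \<Rightarrow> 'l cohen \<Rightarrow> bool" where
  "wit F A r \<longleftrightarrow> finite F \<and> F \<subseteq> max_family \<and> (\<forall>x\<in>F. r \<le> snd x) \<and>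
     ae r (\<lambda>g. \<exists>m. \<forall>n. m \<le> n \<longrightarrow> (\<forall>x\<in>F. fst x g n) \<longrightarrow> A g n)"

text \<open>Different extensions may use different finite subfamilies, hence the closure under
  density; by maximality of the family every A is decided (\<open>ult_ultra\<close>).\<close>

definition ult :: "('l gen \<Rightarrow> nat \<Rightarrow> bool) \<Rightarrow> 'l cohen fprop" where
  "ult A p \<longleftrightarrow> (\<forall>q\<le>p. \<exists>r\<le>q. \<exists>F. wit F A r)"

lemma reg_ult [simp]: "reg (ult A)"
proof -
  have "ult A = (\<lambda>p. \<forall>q\<le>p. \<exists>r\<le>q. \<exists>F. wit F A r)" by (rule HOL.ext) (simp add: ult_def)
  then show ?thesis by simp
qed

lemma wit_mono: "wit F A r \<Longrightarrow> s \<le> r \<Longrightarrow> wit F A s"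
  unfolding wit_def
  using ae_mono[of r "\<lambda>g. \<exists>m. \<forall>n. m \<le> n \<longrightarrow> (\<forall>x\<in>F. fst x g n) \<longrightarrow> A g n" s] by (meson order_trans)

lemma ult_mono:
  assumes "ae p (\<lambda>g. \<exists>m. \<forall>n. m \<le> n \<longrightarrow> A g n \<longrightarrow> B g n)" "ult A p" shows "ult B p"
  unfolding ult_def
proof (intro allI impI)
  fix q assume q: "q \<le> p"
  obtain r F where r: "r \<le> q" "wit F A r" using assms(2) q unfolding ult_def by blast
  have w: "ae r (\<lambda>g. \<exists>m. \<forall>n. m \<le> n \<longrightarrow> (\<forall>x\<in>F. fst x g n) \<longrightarrow> A g n)" using r(2) by (simp add: wit_def)
  have rp: "r \<le> p" using r q by (meson order_trans)
  have "ae r (\<lambda>g. \<exists>m. \<forall>n. m \<le> n \<longrightarrow> (\<forall>x\<in>F. fst x g n) \<longrightarrow> B g n)"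
  proof (rule ae_mp2[OF ae_mono[OF assms(1) rp] w])
    fix g assume "\<exists>m. \<forall>n. m \<le> n \<longrightarrow> A g n \<longrightarrow> B g n" "\<exists>m. \<forall>n. m \<le> n \<longrightarrow> (\<forall>x\<in>F. fst x g n) \<longrightarrow> A g n"
    then obtain m1 m2 where "\<forall>n. m1 \<le> n \<longrightarrow> A g n \<longrightarrow> B g n" "\<forall>n. m2 \<le> n \<longrightarrow> (\<forall>x\<in>F. fst x g n) \<longrightarrow> A g n" by blast
    then show "\<exists>m. \<forall>n. m \<le> n \<longrightarrow> (\<forall>x\<in>F. fst x g n) \<longrightarrow> B g n" by (intro exI[of _ "max m1 m2"]) auto
  qed
  then have "wit F B r" using r(2) by (simp add: wit_def)
  then show "\<exists>r\<le>q. \<exists>F. wit F B r" using r by blast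
qed

lemma ult_mono': "ult A p \<Longrightarrow> ae p (\<lambda>g. \<forall>n. A g n \<longrightarrow> B g n) \<Longrightarrow> ult B p"
  by (rule ult_mono[of p A B], erule ae_mp) auto

lemma ult_conj:
  assumes "ult A p" "ult B p" shows "ult (\<lambda>g n. A g n \<and> B g n) p"
  unfolding ult_def
proof (intro allI impI)
  fix q assume q: "q \<le> p"
  obtain r F where r: "r \<le> q" "wit F A r" using assms(1) q unfolding ult_def by blast
  have "r \<le> p" using r q by (meson order_trans)
  then obtain s G where s: "s \<le> r" "wit G B s" using assms(2) unfolding ult_def by blast
  have "wit F A s" by (rule wit_mono[OF r(2) s(1)])
  then have 1: "ae s (\<lambda>g. \<exists>m. \<forall>n. m \<le> n \<longrightarrow> (\<forall>x\<in>F. fst x g n) \<longrightarrow> A g n)" and FA: "finite F" "F \<subseteq> max_family" "\<forall>x\<in>F. s \<le> snd x"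
    by (simp_all add: wit_def)
  have 2: "ae s (\<lambda>g. \<exists>m. \<forall>n. m \<le> n \<longrightarrow> (\<forall>x\<in>G. fst x g n) \<longrightarrow> B g n)" and GB: "finite G" "G \<subseteq> max_family" "\<forall>x\<in>G. s \<le> snd x"
    using s(2) by (simp_all add: wit_def)
  have "ae s (\<lambda>g. \<exists>m. \<forall>n. m \<le> n \<longrightarrow> (\<forall>x\<in>F \<union> G. fst x g n) \<longrightarrow> A g n \<and> B g n)"
  proof (rule ae_mp2[OF 1 2])
    fix g assume "\<exists>m. \<forall>n. m \<le> n \<longrightarrow> (\<forall>x\<in>F. fst x g n) \<longrightarrow> A g n" "\<exists>m. \<forall>n. m \<le> n \<longrightarrow> (\<forall>x\<in>G. fst x g n) \<longrightarrow> B g n"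
    then obtain m1 m2 where "\<forall>n. m1 \<le> n \<longrightarrow> (\<forall>x\<in>F. fst x g n) \<longrightarrow> A g n" "\<forall>n. m2 \<le> n \<longrightarrow> (\<forall>x\<in>G. fst x g n) \<longrightarrow> B g n" by blast
    then show "\<exists>m. \<forall>n. m \<le> n \<longrightarrow> (\<forall>x\<in>F \<union> G. fst x g n) \<longrightarrow> A g n \<and> B g n"
      by (intro exI[of _ "max m1 m2"]) auto
  qed
  then have "wit (F \<union> G) (\<lambda>g n. A g n \<and> B g n) s" using FA GB by (auto simp: wit_def)
  then show "\<exists>r\<le>q. \<exists>F. wit F (\<lambda>g n. A g n \<and> B g n) r" using r s by (meson order_trans)
qed

lemma ult_cofinite: assumes "ae p (\<lambda>g. \<exists>m. \<forall>n. m \<le> n \<longrightarrow> A g n)" shows "ult A p"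
proof -
  have "wit {} A q" if "q \<le> p" for q unfolding wit_def using ae_mono[OF assms that] by simp
  then show ?thesis unfolding ult_def by blast
qed

lemma ult_mem: assumes "(A, p) \<in> max_family" shows "ult A p"
proof -
  have "wit {(A, p)} A q" if "q \<le> p" for q unfolding wit_def using that assms by (auto intro: aeI)
  then show ?thesis unfolding ult_def by blast
qed

lemma ult_covered: "\<beta> \<in> K \<Longrightarrow> bq (supp_below \<beta>) D \<Longrightarrow> ae p (\<lambda>g. vanishing (D g)) \<Longrightarrow> ult (covered \<beta> D) p"
  by (rule ult_mem, rule subsetD[OF max_family(1)]) (auto simp: base_family_def)

lemma ult_infinite: assumes "rl A" "ult A p" shows "ae p (\<lambda>g. \<forall>m. \<exists>n. m \<le> n \<and> A g n)"
proof (rule ae_dense)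
  show "bp UNIV (\<lambda>g. \<forall>m. \<exists>n. m \<le> n \<and> A g n)" by (intro bp_all bp_ex bp_conj bp_const rlD assms(1))
  fix q assume "q \<le> p"
  then obtain r F where r: "r \<le> q" "wit F A r" using assms(2) unfolding ult_def by blast
  have 1: "ae r (\<lambda>g. \<exists>m. \<forall>n. m \<le> n \<longrightarrow> (\<forall>x\<in>F. fst x g n) \<longrightarrow> A g n)" using r(2) by (simp add: wit_def)
  have 2: "ae r (\<lambda>g. \<forall>m. \<exists>n. m \<le> n \<and> (\<forall>x\<in>F. fst x g n))" using r(2) max_family(3) by (simp add: wit_def fip_def)
  have "ae r (\<lambda>g. \<forall>m. \<exists>n. m \<le> n \<and> A g n)"
  proof (rule ae_mp2[OF 1 2], rule allI)
    fix g m assume a: "\<exists>m. \<forall>n. m \<le> n \<longrightarrow> (\<forall>x\<in>F. fst x g n) \<longrightarrow> A g n" "\<forall>m. \<exists>n. m \<le> n \<and> (\<forall>x\<in>F. fst x g n)"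
    obtain m1 where m1: "\<forall>n. m1 \<le> n \<longrightarrow> (\<forall>x\<in>F. fst x g n) \<longrightarrow> A g n" using a(1) by blast
    obtain n where n: "max m m1 \<le> n" "\<forall>x\<in>F. fst x g n" using a(2) by blast
    then have "A g n" using m1 by simp
    then show "\<exists>n. m \<le> n \<and> A g n" using n by auto
  qed
  then show "\<exists>r\<le>q. ae r (\<lambda>g. \<forall>m. \<exists>n. m \<le> n \<and> A g n)" using r by blast
qed

text \<open>If (A, p) is not in the family, adding it violates \<open>fip\<close> by maximality. The
  violating finite set must contain (A, p), and below some q' the intersection of its other members
  is almost disjoint from A, which witnesses the complement.\<close>

lemma ult_ultra: assumes A: "rl A" shows "\<exists>q\<le>p. ult A q \<or> ult (\<lambda>g n. \<not> A g n) q"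
proof (cases "(A, p) \<in> max_family")
  case True
  then show ?thesis using ult_mem by blast
next
  case False
  let ?M = "insert (A, p) max_family"
  have "?M \<notin> admissible" using max_family(4)[of ?M] False by blast
  then have "\<not> fip ?M" unfolding admissible_def using max_family(1,2) A by auto
  then obtain F q where F: "finite F" "F \<subseteq> ?M" "\<forall>x\<in>F. q \<le> snd x"
    "\<not> ae q (\<lambda>g. \<forall>m. \<exists>n. m \<le> n \<and> (\<forall>x\<in>F. fst x g n))" unfolding fip_def by blast
  have "(A, p) \<in> F"
  proof (rule ccontr)
    assume "(A, p) \<notin> F"
    then have "F \<subseteq> max_family" using F(2) by blast
    then show False using max_family(3) F unfolding fip_def by blast
  qed
  then have qp: "q \<le> p" using F(3) by auto
  have b: "bp UNIV (\<lambda>g. \<forall>m. \<exists>n. m \<le> n \<and> (\<forall>x\<in>F. fst x g n))"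
  proof (intro bp_all bp_ex bp_conj bp_const bp_finite_ball[OF F(1)])
    fix n x assume "x \<in> F"
    then have "x = (A, p) \<or> x \<in> max_family" using F(2) by blast
    then have "rl (fst x)" using max_family(2)[of x] A by auto
    then show "bp UNIV (\<lambda>g. fst x g n)" by (rule rlD)
  qed
  obtain q' where q': "q' \<le> q" "ae q' (\<lambda>g. \<not> (\<forall>m. \<exists>n. m \<le> n \<and> (\<forall>x\<in>F. fst x g n)))"
    using ae_contrI[OF b] F(4) by blast
  let ?F = "F - {(A, p)}"
  have "ae q' (\<lambda>g. \<exists>m. \<forall>n. m \<le> n \<longrightarrow> (\<forall>x\<in>?F. fst x g n) \<longrightarrow> \<not> A g n)"
  proof (rule ae_mp[OF q'(2)])
    fix g assume "\<not> (\<forall>m. \<exists>n. m \<le> n \<and> (\<forall>x\<in>F. fst x g n))"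
    then obtain m where m: "\<And>n. m \<le> n \<Longrightarrow> \<not> (\<forall>x\<in>F. fst x g n)" by blast
    have "\<not> A g n" if n: "m \<le> n" "\<forall>x\<in>?F. fst x g n" for n
    proof
      assume "A g n"
      then have "\<forall>x\<in>F. fst x g n" using n(2) by auto
      then show False using m[OF n(1)] by blast
    qed
    then show "\<exists>m. \<forall>n. m \<le> n \<longrightarrow> (\<forall>x\<in>?F. fst x g n) \<longrightarrow> \<not> A g n" by blast
  qed
  moreover have "\<forall>x\<in>?F. q' \<le> snd x" using F(3) q'(1) by (meson DiffD1 order_trans)
  ultimately have w: "wit ?F (\<lambda>g n. \<not> A g n) q'" using F(1,2) unfolding wit_def by auto
  have "ult (\<lambda>g n. \<not> A g n) q'" unfolding ult_def using wit_mono[OF w] by blast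
  then show ?thesis using q' qp by (meson order_trans)
qed

lemma rl_not: "rl A \<Longrightarrow> rl (\<lambda>g n. \<not> A g n)"
  unfolding rl_def by (auto intro: bp_not)

lemma ult_consistent: assumes "rl A" "ult A p" "ult (\<lambda>g n. \<not> A g n) p" shows False
proof -
  have "ult (\<lambda>g n. A g n \<and> \<not> A g n) p" by (rule ult_conj[OF assms(2,3)])
  then have "ult (\<lambda>g n. False) p" by (rule ult_mono') (auto intro: aeI)
  moreover have "rl (\<lambda>g n. False)" by (simp add: rl_def bp_const)
  ultimately have "ae p (\<lambda>g. \<forall>m :: nat. \<exists>n. m \<le> n \<and> False)" using ult_infinite by blast
  then show False by simp
qed

lemma ult_not_iff: assumes "rl A" shows "(\<forall>q\<le>p. \<not> ult A q) \<longleftrightarrow> ult (\<lambda>g n. \<not> A g n) p"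
proof
  assume a: "\<forall>q\<le>p. \<not> ult A q"
  show "ult (\<lambda>g n. \<not> A g n) p"
    by (rule reg_dense[OF reg_ult]) (metis a ult_ultra[OF assms] order_trans)
next
  assume a: "ult (\<lambda>g n. \<not> A g n) p"
  show "\<forall>q\<le>p. \<not> ult A q" using ult_consistent[OF assms] reg_mono[OF reg_ult a] by blast
qed

end

context cohen_setting begin

section \<open>Names of subsets of omega given by comprehension\<close>

lemma ae_iffI:
  assumes Q: "bp UNIV Q" and R: "bp UNIV R" and e: "\<And>q. q \<le> p \<Longrightarrow> ae q Q \<longleftrightarrow> ae q R"
  shows "ae p (\<lambda>g. Q g \<longleftrightarrow> R g)"
proof (rule ae_dense)
  show "bp UNIV (\<lambda>g. Q g \<longleftrightarrow> R g)"
    by (rule bp_app2[of _ Q R]) (simp_all add: bpf_bool Q R)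
  fix q assume q: "q \<le> p"
  obtain r where r: "r \<le> q" "ae r Q \<or> ae r (\<lambda>g. \<not> Q g)" using ae_decide[OF Q] by blast
  have rp: "r \<le> p" using r q by (meson order_trans)
  have "ae r (\<lambda>g. Q g \<longleftrightarrow> R g)"
    using r(2)
  proof
    assume a: "ae r Q"
    then have "ae r R" using e[OF rp] by blast
    then show ?thesis by (rule ae_mp2[OF a]) simp
  next
    assume a: "ae r (\<lambda>g. \<not> Q g)"
    have "ae r (\<lambda>g. \<not> R g)"
      unfolding ae_not_iff[OF R]
    proof (intro allI impI notI)
      fix s assume s: "s \<le> r" "ae s R"
      have "s \<le> p" using s rp by (meson order_trans)
      then have "ae s Q" using e s(2) by blast
      then show False using ae_contr[OF _ ae_mono[OF a s(1)]] by blast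
    qed
    then show ?thesis by (rule ae_mp2[OF a]) simp
  qed
  then show "\<exists>r\<le>q. ae r (\<lambda>g. Q g \<longleftrightarrow> R g)" using r by blast
qed

lemma setname_eqD:
  assumes A: "rl A" and B: "rl B" and e: "(setname A \<^bold>= setname B) p"
  shows "ae p (\<lambda>g. \<forall>n. A g n \<longleftrightarrow> B g n)"
proof (rule ae_all, rule ae_iffI[OF rlD[OF A] rlD[OF B]])
  fix n q assume q: "q \<le> p"
  have "(nn n \<^bold>\<in> setname A) q \<longleftrightarrow> (nn n \<^bold>\<in> setname B) q"
    using fmem_cong2[OF feq_mono[OF e q]] fmem_cong2[OF feq_sym[OF feq_mono[OF e q]]] by blast
  then show "ae q (\<lambda>g. A g n) \<longleftrightarrow> ae q (\<lambda>g. B g n)" by (simp add: nn_mem_setname[OF A] nn_mem_setname[OF B])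
qed

lemma subset_omegaE:
  assumes "((x :: ('i, 'l cohen) name) \<^bold>\<subseteq> omega) p" obtains A where "rl A" "(x \<^bold>= setname A) p"
  using setname_rep[OF assms] rl_ev[of "\<lambda>n. nn n \<^bold>\<in> x"] by auto

text \<open>Both sides describe subsets of omega, so agreement at the names \<open>nn n\<close> is
  enough; used for the sets occurring in \<open>dual\<close> and \<open>sub_mod\<close>.\<close>

lemma comprehension_iff:
  fixes W :: "('i, 'l cohen) fclass"
  assumes W: "good W" and B: "rl B" and e: "\<And>n q. W (nn n) q \<longleftrightarrow> ae q (\<lambda>g. B g n)"
  shows "(\<^bold>\<forall>n. n \<^bold>\<in> s \<^bold>\<longleftrightarrow> (n \<^bold>\<in> omega \<^bold>\<and> W n)) p \<longleftrightarrow> (s \<^bold>= setname B) p"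
proof -
  have [simp]: "reg (W n)" for n by (rule good_reg[OF W])
  have u: "(\<^bold>\<forall>n. n \<^bold>\<in> s \<^bold>\<longleftrightarrow> (n \<^bold>\<in> omega \<^bold>\<and> W n)) p \<longleftrightarrow>
      (\<forall>q\<le>p. \<forall>n. (n \<^bold>\<in> s) q \<longleftrightarrow> (n \<^bold>\<in> omega) q \<and> W n q)"
    by (simp add: fall_def fiff_iff fconj_def) blast
  have c: "(n \<^bold>\<in> setname B) q \<longleftrightarrow> (n \<^bold>\<in> omega) q \<and> W n q" for n q
  proof -
    let ?\<Phi> = "\<lambda>n. n \<^bold>\<in> setname B \<^bold>\<longleftrightarrow> W n"
    have "good ?\<Phi>" by (intro good_fiff W good_intros)
    moreover have "?\<Phi> (nn m) q" for m by (simp add: fiff_iff e nn_mem_setname[OF B])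
    ultimately have "\<forall>q'\<le>q. \<forall>x. (x \<^bold>\<in> omega) q' \<longrightarrow> ?\<Phi> x q'" using all_omega[of ?\<Phi> q] by blast
    then have "(n \<^bold>\<in> setname B) q \<longleftrightarrow> W n q" if "(n \<^bold>\<in> omega) q"
      using that by (simp add: fiff_iff) (meson order_refl)
    moreover have "(n \<^bold>\<in> omega) q" if "(n \<^bold>\<in> setname B) q"
      using that setname_sub_omega[OF B, of q] unfolding fsub_iff by blast
    ultimately show ?thesis by blast
  qed
  show ?thesis unfolding u
  proof
    assume h: "\<forall>q\<le>p. \<forall>n. (n \<^bold>\<in> s) q \<longleftrightarrow> (n \<^bold>\<in> omega) q \<and> W n q"
    show "(s \<^bold>= setname B) p" by (rule feqI) (use h c in blast)+
  next
    assume h: "(s \<^bold>= setname B) p"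
    show "\<forall>q\<le>p. \<forall>n. (n \<^bold>\<in> s) q \<longleftrightarrow> (n \<^bold>\<in> omega) q \<and> W n q"
      using fmem_cong2[OF feq_mono[OF h]] fmem_cong2[OF feq_sym[OF feq_mono[OF h]]] c by blast
  qed
qed

end

context chain_setting begin

section \<open>The maximal ideal\<close>

definition ult_ideal :: "('i, 'l cohen) name" where
  "ult_ideal = fam {A. rl A} setname (\<lambda>A p. ult (\<lambda>g n. \<not> A g n) p)"

lemma mem_ult_ideal: assumes A: "rl A" shows "(setname A \<^bold>\<in> ult_ideal) p \<longleftrightarrow> ult (\<lambda>g n. \<not> A g n) p"
  unfolding ult_ideal_def
proof (rule fmem_fam_self[where f = setname and P = "\<lambda>A p. ult (\<lambda>g n. \<not> A g n) p", OF small_gen_fun])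
  fix B r assume B: "B \<in> {A. rl A}" "(setname A \<^bold>= setname B) r" "ult (\<lambda>g n. \<not> B g n) r"
  have "ae r (\<lambda>g. \<forall>n. A g n \<longleftrightarrow> B g n)" using setname_eqD[OF A _ B(2)] B(1) by blast
  then have "ae r (\<lambda>g. \<forall>n. \<not> B g n \<longrightarrow> \<not> A g n)" by (rule ae_mp) blast
  then show "ult (\<lambda>g n. \<not> A g n) r" by (rule ult_mono'[OF B(3)])
qed (use A in auto)

lemma ult_ideal_sub_omega: assumes "(x \<^bold>\<in> ult_ideal) p" shows "(x \<^bold>\<subseteq> omega) p"
proof (rule reg_dense[OF reg_fsub])
  fix q assume "q \<le> p"
  then obtain r A where r: "r \<le> q" "rl A" "(x \<^bold>= setname A) r"
    using assms fmem_fam[where f = setname and C = "{A. rl A}" and P = "\<lambda>A p. ult (\<lambda>g n. \<not> A g n) p" and x = x and p = p, OF small_gen_fun reg_ult]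
    unfolding ult_ideal_def by blast
  have g: "good (\<lambda>x :: ('i, 'l cohen) name. x \<^bold>\<subseteq> omega)" by (intro good_intros)
  have "(x \<^bold>\<subseteq> omega) r" by (rule good_cong[OF g feq_sym[OF r(3)] setname_sub_omega[OF r(2)]])
  then show "\<exists>r\<le>q. (x \<^bold>\<subseteq> omega) r" using r by blast
qed

lemma omega_setname: "(omega \<^bold>= setname (\<lambda>g n. True)) p"
proof -
  have T: "rl (\<lambda>g n. True)" by (simp add: rl_def bp_const)
  show ?thesis
    by (rule subset_omega_eqI[OF _ setname_sub_omega[OF T]]) (simp_all add: fsub_iff nn_mem_setname[OF T])
qed

lemma is_ideal_ult_ideal: "is_ideal ult_ideal p"
proof -
  have 1: "(\<^bold>\<forall>a. a \<^bold>\<in> ult_ideal \<^bold>\<longrightarrow> a \<^bold>\<subseteq> omega) p" using ult_ideal_sub_omega by (simp add: fall_def fimp_iff)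
  have "(b \<^bold>\<in> ult_ideal) q" if q: "(a \<^bold>\<in> ult_ideal) q" "(b \<^bold>\<subseteq> a) q" for a b q
  proof -
    have a: "(a \<^bold>\<subseteq> omega) q" by (rule ult_ideal_sub_omega[OF q(1)])
    then have b: "(b \<^bold>\<subseteq> omega) q" using q(2) unfolding fsub_iff by blast
    obtain A where A: "rl A" "(a \<^bold>= setname A) q" using subset_omegaE[OF a] .
    obtain B where B: "rl B" "(b \<^bold>= setname B) q" using subset_omegaE[OF b] .
    have FA: "ult (\<lambda>g n. \<not> A g n) q" using fmem_cong1[OF A(2) q(1)] by (simp add: mem_ult_ideal[OF A(1)])
    have "ae q (\<lambda>g. B g n \<longrightarrow> A g n)" for n
    proof (rule ae_contrI[OF bp_imp[OF rlD[OF B(1)] rlD[OF A(1)]]])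
      fix r assume r: "r \<le> q" "ae r (\<lambda>g. \<not> (B g n \<longrightarrow> A g n))"
      have "ae r (\<lambda>g. B g n)" by (rule ae_mp[OF r(2)]) simp
      then have "(nn n \<^bold>\<in> setname B) r" by (simp add: nn_mem_setname[OF B(1)])
      then have "(nn n \<^bold>\<in> b) r" using fmem_cong2[OF feq_sym[OF feq_mono[OF B(2) r(1)]]] by blast
      then have "(nn n \<^bold>\<in> a) r" using q(2) r(1) unfolding fsub_iff by blast
      then have "(nn n \<^bold>\<in> setname A) r" using fmem_cong2[OF feq_mono[OF A(2) r(1)]] by blast
      then have "ae r (\<lambda>g. A g n)" by (simp add: nn_mem_setname[OF A(1)])
      then have "ae r (\<lambda>g. False)" by (rule ae_mp2[OF r(2)]) simp
      then show False by simp
    qed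
    then have "ae q (\<lambda>g. \<forall>n. B g n \<longrightarrow> A g n)" by (rule ae_all)
    then have "ae q (\<lambda>g. \<forall>n. \<not> A g n \<longrightarrow> \<not> B g n)" by (rule ae_mp) blast
    then have "ult (\<lambda>g n. \<not> B g n) q" by (rule ult_mono'[OF FA])
    then show ?thesis using fmem_cong1[OF feq_sym[OF B(2)]] by (simp add: mem_ult_ideal[OF B(1)])
  qed
  then have 2: "(\<^bold>\<forall>a b. a \<^bold>\<in> ult_ideal \<^bold>\<and> b \<^bold>\<subseteq> a \<^bold>\<longrightarrow> b \<^bold>\<in> ult_ideal) p" by (auto simp: fbasic fimp_iff)
  have "(u \<^bold>\<in> ult_ideal) q"
    if q: "(a \<^bold>\<in> ult_ideal) q" "(b \<^bold>\<in> ult_ideal) q" "(\<^bold>\<forall>n. n \<^bold>\<in> u \<^bold>\<longleftrightarrow> (n \<^bold>\<in> a \<^bold>\<or> n \<^bold>\<in> b)) q" for a b u q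
  proof -
    have h: "(n \<^bold>\<in> u) r \<longleftrightarrow> (n \<^bold>\<in> a \<^bold>\<or> n \<^bold>\<in> b) r" if "r \<le> q" for n r
      using q(3) that by (simp add: fall_def fiff_iff)
    have a: "(a \<^bold>\<subseteq> omega) q" by (rule ult_ideal_sub_omega[OF q(1)])
    have b: "(b \<^bold>\<subseteq> omega) q" by (rule ult_ideal_sub_omega[OF q(2)])
    have u: "(u \<^bold>\<subseteq> omega) q"
      unfolding fsub_iff
    proof (intro allI impI)
      fix r z assume r: "r \<le> q" "(z \<^bold>\<in> u) r"
      show "(z \<^bold>\<in> omega) r"
      proof (rule reg_dense[OF reg_fmem])
        fix r' assume r': "r' \<le> r"
        obtain s where s: "s \<le> r'" "(z \<^bold>\<in> a) s \<or> (z \<^bold>\<in> b) s"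
          using h[OF r(1)] r(2) r' unfolding fdisj_iff by blast
        have "s \<le> q" using s r' r by (meson order_trans)
        then show "\<exists>s\<le>r'. (z \<^bold>\<in> omega) s" using s a b unfolding fsub_iff by blast
      qed
    qed
    obtain A where A: "rl A" "(a \<^bold>= setname A) q" using subset_omegaE[OF a] .
    obtain B where B: "rl B" "(b \<^bold>= setname B) q" using subset_omegaE[OF b] .
    obtain V where V: "rl V" "(u \<^bold>= setname V) q" using subset_omegaE[OF u] .
    have "ult (\<lambda>g n. \<not> A g n) q" using fmem_cong1[OF A(2) q(1)] by (simp add: mem_ult_ideal[OF A(1)])
    moreover have "ult (\<lambda>g n. \<not> B g n) q" using fmem_cong1[OF B(2) q(2)] by (simp add: mem_ult_ideal[OF B(1)])
    ultimately have FAB: "ult (\<lambda>g n. \<not> A g n \<and> \<not> B g n) q" by (rule ult_conj)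
    have "ae q (\<lambda>g. \<not> A g n \<and> \<not> B g n \<longrightarrow> \<not> V g n)" for n
    proof (rule ae_contrI)
      show "bp UNIV (\<lambda>g. \<not> A g n \<and> \<not> B g n \<longrightarrow> \<not> V g n)" by (intro bp_imp bp_conj bp_not rlD A(1) B(1) V(1))
      fix r assume r: "r \<le> q" "ae r (\<lambda>g. \<not> (\<not> A g n \<and> \<not> B g n \<longrightarrow> \<not> V g n))"
      have "ae r (\<lambda>g. V g n)" by (rule ae_mp[OF r(2)]) simp
      then have "(nn n \<^bold>\<in> setname V) r" by (simp add: nn_mem_setname[OF V(1)])
      then have "(nn n \<^bold>\<in> u) r" using fmem_cong2[OF feq_sym[OF feq_mono[OF V(2) r(1)]]] by blast
      then obtain s where s: "s \<le> r" "(nn n \<^bold>\<in> a) s \<or> (nn n \<^bold>\<in> b) s" using h[OF r(1)] unfolding fdisj_iff by blast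
      have sq: "s \<le> q" using s r by (meson order_trans)
      have "(nn n \<^bold>\<in> setname A) s \<or> (nn n \<^bold>\<in> setname B) s"
        using s(2) fmem_cong2[OF feq_mono[OF A(2) sq]] fmem_cong2[OF feq_mono[OF B(2) sq]] by blast
      then have "ae s (\<lambda>g. A g n) \<or> ae s (\<lambda>g. B g n)" by (simp add: nn_mem_setname[OF A(1)] nn_mem_setname[OF B(1)])
      then have "ae s (\<lambda>g. A g n \<or> B g n)" by (auto elim: ae_mp)
      then have "ae s (\<lambda>g. False)" by (rule ae_mp2[OF ae_mono[OF r(2) s(1)]]) simp
      then show False by simp
    qed
    then have "ae q (\<lambda>g. \<forall>n. \<not> A g n \<and> \<not> B g n \<longrightarrow> \<not> V g n)" by (rule ae_all)
    then have "ult (\<lambda>g n. \<not> V g n) q" by (rule ult_mono'[OF FAB])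
    then show ?thesis using fmem_cong1[OF feq_sym[OF V(2)]] by (simp add: mem_ult_ideal[OF V(1)])
  qed
  then have 3: "(\<^bold>\<forall>a b u. a \<^bold>\<in> ult_ideal \<^bold>\<and> b \<^bold>\<in> ult_ideal \<^bold>\<and> (\<^bold>\<forall>n. n \<^bold>\<in> u \<^bold>\<longleftrightarrow> (n \<^bold>\<in> a \<^bold>\<or> n \<^bold>\<in> b)) \<^bold>\<longrightarrow> u \<^bold>\<in> ult_ideal) p"
    by (auto simp: fall_def[of "\<lambda>a. fall (\<lambda>b. fall (_ a b))"] fall_def[of "\<lambda>b. fall (_ b)"] fall_def[of "\<lambda>u. _ u \<^bold>\<longrightarrow> u \<^bold>\<in> ult_ideal"] fconj_def fimp_iff)
  have "(a \<^bold>\<in> ult_ideal) q" if q: "(a \<^bold>\<subseteq> omega) q" "is_finite a q" for a q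
  proof -
    obtain A where A: "rl A" "(a \<^bold>= setname A) q" using subset_omegaE[OF q(1)] .
    have g: "good (is_finite :: ('i, 'l cohen) fclass)" using good_is_finite[OF cong_id] by simp
    have "is_finite (setname A) q" by (rule good_cong[OF g A(2) q(2)])
    then have "ult (\<lambda>g n. \<not> A g n) q" unfolding is_finite_iff[OF A(1)] by (rule ult_cofinite)
    then show ?thesis using fmem_cong1[OF feq_sym[OF A(2)]] by (simp add: mem_ult_ideal[OF A(1)])
  qed
  then have 4: "(\<^bold>\<forall>a. a \<^bold>\<subseteq> omega \<^bold>\<and> is_finite a \<^bold>\<longrightarrow> a \<^bold>\<in> ult_ideal) p" by (auto simp: fbasic fimp_iff)
  have "\<not> (omega \<^bold>\<in> ult_ideal) q" for q
  proof
    assume "(omega \<^bold>\<in> ult_ideal) q"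
    then have "(setname (\<lambda>g n. True) \<^bold>\<in> ult_ideal) q" by (rule fmem_cong1[OF omega_setname])
    then have "ult (\<lambda>g n. False) q" by (simp add: mem_ult_ideal rl_def bp_const)
    then have "ae q (\<lambda>g. \<forall>m :: nat. \<exists>n. m \<le> n \<and> False)" by (rule ult_infinite[rotated]) (simp add: rl_def bp_const)
    then show False by simp
  qed
  then have 5: "(\<^bold>\<not> omega \<^bold>\<in> ult_ideal) p" by (simp add: fneg_def)
  show ?thesis unfolding is_ideal_def using 1 2 3 4 5 by (simp only: fconj_def simp_thms)
qed

lemma good_is_ideal: "good (is_ideal :: ('i, 'l cohen) fclass)"
  unfolding is_ideal_def by (intro good_intros)

lemma is_maximal_ideal_ult_ideal: "is_maximal_ideal ult_ideal p"
proof -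
  have [simp]: "reg (is_ideal (L :: ('i, 'l cohen) name))" for L by (rule good_reg[OF good_is_ideal])
  have "(L \<^bold>= ult_ideal) q" if L: "is_ideal L q" "(ult_ideal \<^bold>\<subseteq> L) q" for L q
  proof (rule feqI)
    show "(z \<^bold>\<in> L) r" if "r \<le> q" "(z \<^bold>\<in> ult_ideal) r" for r z using that L(2) unfolding fsub_iff by blast
    fix r z assume r: "r \<le> q" "(z \<^bold>\<in> L) r"
    have i: "(\<^bold>\<forall>a. a \<^bold>\<in> L \<^bold>\<longrightarrow> a \<^bold>\<subseteq> omega) q"
      "(\<^bold>\<forall>a b u. a \<^bold>\<in> L \<^bold>\<and> b \<^bold>\<in> L \<^bold>\<and> (\<^bold>\<forall>n. n \<^bold>\<in> u \<^bold>\<longleftrightarrow> (n \<^bold>\<in> a \<^bold>\<or> n \<^bold>\<in> b)) \<^bold>\<longrightarrow> u \<^bold>\<in> L) q"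
      "(\<^bold>\<not> omega \<^bold>\<in> L) q"
      using L(1) unfolding is_ideal_def by (simp_all only: fconj_def simp_thms)
    have zo: "(z \<^bold>\<subseteq> omega) r" using i(1) r by (simp add: fall_def fimp_iff)
    obtain A where A: "rl A" "(z \<^bold>= setname A) r" using subset_omegaE[OF zo] .
    show "(z \<^bold>\<in> ult_ideal) r"
    proof (rule reg_dense[OF reg_fmem])
      fix r' assume r': "r' \<le> r"
      obtain s where s: "s \<le> r'" "ult A s \<or> ult (\<lambda>g n. \<not> A g n) s" using ult_ultra[OF A(1)] by blast
      have sr: "s \<le> r" using s r' by (meson order_trans)
      have sq: "s \<le> q" using sr r by (meson order_trans)
      \<comment> \<open>If A were in the ultrafilter, its complement would be in the ideal and so in
        L, and A together with its complement would put omega into L.\<close>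
      have "\<not> ult A s"
      proof
        assume "ult A s"
        let ?B = "\<lambda>g n. \<not> A g n"
        have B: "rl ?B" by (rule rl_not[OF A(1)])
        have "(setname ?B \<^bold>\<in> ult_ideal) s" unfolding mem_ult_ideal[OF B] using \<open>ult A s\<close> by simp
        then have BL: "(setname ?B \<^bold>\<in> L) s" using L(2) sq unfolding fsub_iff by blast
        have AL: "(setname A \<^bold>\<in> L) s" using fmem_cong1[OF feq_mono[OF A(2) sr] fmem_mono[OF r(2) sr]] .
        have "(n \<^bold>\<in> omega) t \<longleftrightarrow> (n \<^bold>\<in> setname A \<^bold>\<or> n \<^bold>\<in> setname ?B) t" for n t
        proof
          assume a: "(n \<^bold>\<in> omega) t"
          let ?\<Phi> = "\<lambda>n. n \<^bold>\<in> setname A \<^bold>\<or> n \<^bold>\<in> setname ?B"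
          have "good ?\<Phi>" by (intro good_intros)
          moreover have "?\<Phi> (nn m) t" for m
            unfolding fdisj_iff nn_mem_setname[OF A(1)] nn_mem_setname[OF B]
            using ae_decide[OF rlD[OF A(1)]] by blast
          ultimately show "?\<Phi> n t" using all_omega[of ?\<Phi> t] a by (meson order_refl)
        next
          assume a: "(n \<^bold>\<in> setname A \<^bold>\<or> n \<^bold>\<in> setname ?B) t"
          show "(n \<^bold>\<in> omega) t"
            by (rule reg_dense[OF reg_fmem])
               (use a setname_sub_omega[OF A(1)] setname_sub_omega[OF B] in \<open>unfold fdisj_iff fsub_iff, meson order_refl\<close>)
        qed
        then have c: "(\<^bold>\<forall>n. n \<^bold>\<in> omega \<^bold>\<longleftrightarrow> (n \<^bold>\<in> setname A \<^bold>\<or> n \<^bold>\<in> setname ?B)) s" by (simp add: fall_def fiff_iff)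
        have "(setname A \<^bold>\<in> L \<^bold>\<and> setname ?B \<^bold>\<in> L \<^bold>\<and> (\<^bold>\<forall>n. n \<^bold>\<in> omega \<^bold>\<longleftrightarrow> (n \<^bold>\<in> setname A \<^bold>\<or> n \<^bold>\<in> setname ?B)) \<^bold>\<longrightarrow> omega \<^bold>\<in> L) q"
          using i(2) unfolding fall_def[of "\<lambda>a. fall (\<lambda>b. fall (_ a b))"] fall_def[of "\<lambda>b. fall (_ b)"] fall_def[of "\<lambda>u. _ u \<^bold>\<longrightarrow> u \<^bold>\<in> L"] by blast
        then have "(omega \<^bold>\<in> L) s"
          by (rule fimpD) (use AL BL c sq in \<open>simp_all add: fconj_def\<close>)
        then show False using i(3) sq unfolding fneg_def by blast
      qed
      then have "(setname A \<^bold>\<in> ult_ideal) s" using s(2) by (simp add: mem_ult_ideal[OF A(1)])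
      then have "(z \<^bold>\<in> ult_ideal) s" using fmem_cong1[OF feq_sym[OF feq_mono[OF A(2) sr]]] by blast
      then show "\<exists>s\<le>r'. (z \<^bold>\<in> ult_ideal) s" using s by blast
    qed
  qed
  then show ?thesis unfolding is_maximal_ideal_def using is_ideal_ult_ideal by (auto simp: fbasic fimp_iff)
qed

subsection \<open>Positive, dual and almost inclusion\<close>

lemma reg_positive [simp]: "reg (positive J s)" unfolding Defs.positive_def by simp
lemma reg_dual [simp]: "reg (dual J s)" unfolding dual_def by simp

lemma good_positive [good_intros]: "cong f \<Longrightarrow> good (\<lambda>x :: ('i, 'l cohen) name. positive J (f x))"
  unfolding Defs.positive_def by (intro good_intros)

lemma good_dual [good_intros]: "cong f \<Longrightarrow> good (\<lambda>x :: ('i, 'l cohen) name. dual J (f x))"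
  unfolding dual_def by (intro good_intros)

lemma positive_iff: assumes A: "rl A" shows "positive ult_ideal (setname A) p \<longleftrightarrow> ult A p"
proof -
  have "positive ult_ideal (setname A) p \<longleftrightarrow> (\<forall>q\<le>p. \<not> ult (\<lambda>g n. \<not> A g n) q)"
    unfolding Defs.positive_def by (simp add: fconj_def fneg_def setname_sub_omega[OF A] mem_ult_ideal[OF A])
  also have "\<dots> \<longleftrightarrow> ult A p" using ult_not_iff[OF rl_not[OF A], of p] by simp
  finally show ?thesis .
qed

text \<open>Together with \<open>positive_iff\<close> this is the effect of maximality: positive and
  dual sets coincide, both being the sets in the ultrafilter.\<close>

lemma dual_iff: assumes A: "rl A" shows "dual ult_ideal (setname A) p \<longleftrightarrow> ult A p"
proof -
  have c: "(\<^bold>\<forall>n. n \<^bold>\<in> setname A \<^bold>\<longleftrightarrow> (n \<^bold>\<in> omega \<^bold>\<and> \<^bold>\<not> n \<^bold>\<in> setname B)) q \<longleftrightarrow> (setname A \<^bold>= setname (\<lambda>g n. \<not> B g n)) q"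
    if B: "rl B" for B q
  proof (rule comprehension_iff[OF _ rl_not[OF B]])
    show "good (\<lambda>n. \<^bold>\<not> n \<^bold>\<in> setname B)" by (intro good_intros)
    show "(\<^bold>\<not> nn n \<^bold>\<in> setname B) q \<longleftrightarrow> ae q (\<lambda>g. \<not> B g n)" for n q
      unfolding fneg_def nn_mem_setname[OF B] ae_not_iff[OF rlD[OF B]] ..
  qed
  show ?thesis
  proof
    assume a: "dual ult_ideal (setname A) p"
    show "ult A p"
    proof (rule reg_dense[OF reg_ult])
      fix q assume "q \<le> p"
      then obtain r b where r: "r \<le> q" "(b \<^bold>\<in> ult_ideal) r" "(\<^bold>\<forall>n. n \<^bold>\<in> setname A \<^bold>\<longleftrightarrow> (n \<^bold>\<in> omega \<^bold>\<and> \<^bold>\<not> n \<^bold>\<in> b)) r"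
        using a unfolding dual_def fex_iff fconj_def[of "_ \<^bold>\<in> ult_ideal"] by blast
      obtain B where B: "rl B" "(b \<^bold>= setname B) r" using subset_omegaE[OF ult_ideal_sub_omega[OF r(2)]] .
      have g: "good (\<lambda>b. \<^bold>\<forall>n. n \<^bold>\<in> setname A \<^bold>\<longleftrightarrow> (n \<^bold>\<in> omega \<^bold>\<and> \<^bold>\<not> n \<^bold>\<in> b))" by (intro good_intros)
      have "(setname A \<^bold>= setname (\<lambda>g n. \<not> B g n)) r" using good_cong[OF g B(2) r(3)] c[OF B(1)] by blast
      then have "ae r (\<lambda>g. \<forall>n. A g n \<longleftrightarrow> \<not> B g n)" by (rule setname_eqD[OF A rl_not[OF B(1)]])
      then have "ae r (\<lambda>g. \<forall>n. \<not> B g n \<longrightarrow> A g n)" by (rule ae_mp) blast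
      moreover have "ult (\<lambda>g n. \<not> B g n) r" using fmem_cong1[OF B(2) r(2)] by (simp add: mem_ult_ideal[OF B(1)])
      ultimately have "ult A r" by (rule ult_mono'[rotated])
      then show "\<exists>r\<le>q. ult A r" using r by blast
    qed
  next
    assume a: "ult A p"
    let ?B = "\<lambda>g n. \<not> A g n"
    have B: "rl ?B" by (rule rl_not[OF A])
    have "(setname ?B \<^bold>\<in> ult_ideal) p" unfolding mem_ult_ideal[OF B] using a by simp
    moreover have "(\<^bold>\<forall>n. n \<^bold>\<in> setname A \<^bold>\<longleftrightarrow> (n \<^bold>\<in> omega \<^bold>\<and> \<^bold>\<not> n \<^bold>\<in> setname ?B)) p"
      unfolding c[OF B] by simp
    ultimately have "(setname ?B \<^bold>\<in> ult_ideal \<^bold>\<and> (\<^bold>\<forall>n. n \<^bold>\<in> setname A \<^bold>\<longleftrightarrow> (n \<^bold>\<in> omega \<^bold>\<and> \<^bold>\<not> n \<^bold>\<in> setname ?B))) p"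
      by (simp only: fconj_def simp_thms)
    then show "dual ult_ideal (setname A) p" unfolding dual_def by (intro fexI[of _ "setname ?B"]) simp_all
  qed
qed

lemma N_pos_iff:
  assumes X: "rl X" and D: "bq UNIV D"
  shows "N_pos ult_ideal (seqname D) (realname X) p \<longleftrightarrow> ult (hit X D) p"
proof -
  have g: "good (\<lambda>s :: ('i, 'l cohen) name. positive ult_ideal s)" by (rule good_positive[OF cong_id])
  show ?thesis unfolding N_pos_def
    by (simp add: fconj_def[of "is_cantor _"] is_cantor_realname[OF X] ex_hit_set_iff[OF X D g] positive_iff[OF rl_hit[OF X D]])
qed

lemma N_dual_iff:
  assumes X: "rl X" and D: "bq UNIV D"
  shows "N_dual ult_ideal (seqname D) (realname X) p \<longleftrightarrow> ult (hit X D) p"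
proof -
  have g: "good (\<lambda>s :: ('i, 'l cohen) name. dual ult_ideal s)" by (rule good_dual[OF cong_id])
  show ?thesis unfolding N_dual_def
    by (simp add: fconj_def[of "is_cantor _"] is_cantor_realname[OF X] ex_hit_set_iff[OF X D g] dual_iff[OF rl_hit[OF X D]])
qed

definition subs :: "('l gen \<Rightarrow> nat \<Rightarrow> code) \<Rightarrow> ('l gen \<Rightarrow> nat \<Rightarrow> code) \<Rightarrow> 'l gen \<Rightarrow> nat \<Rightarrow> bool" where
  "subs D E g n \<longleftrightarrow> clop (D g n) \<subseteq> clop (E g n)"

lemma rl_subs: "bq UNIV D \<Longrightarrow> bq UNIV E \<Longrightarrow> rl (subs D E)"
  unfolding rl_def subs_def by (rule allI, rule bp_app2[OF bqD bqD])

abbreviation nsub :: "('i, 'l cohen) name \<Rightarrow> ('i, 'l cohen) name \<Rightarrow> ('i, 'l cohen) name \<Rightarrow> 'l cohen fprop" where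
  "nsub c d n \<equiv> (\<^bold>\<exists>a b. op n a \<^bold>\<in> c \<^bold>\<and> op n b \<^bold>\<in> d \<^bold>\<and> \<^bold>\<not> a \<^bold>\<subseteq> b)"

lemma nsub_iff:
  assumes D: "bq UNIV D" and E: "bq UNIV E"
  shows "nsub (seqname D) (seqname E) (nn n) p \<longleftrightarrow> ae p (\<lambda>g. \<not> subs D E g n)"
proof
  assume a: "nsub (seqname D) (seqname E) (nn n) p"
  show "ae p (\<lambda>g. \<not> subs D E g n)"
  proof (rule ae_dense[OF bp_not[OF rlD[OF rl_subs[OF D E]]]])
    fix q assume q: "q \<le> p"
    obtain r a b where r: "r \<le> q" "(op (nn n) a \<^bold>\<in> seqname D) r" "(op (nn n) b \<^bold>\<in> seqname E) r" "(\<^bold>\<not> a \<^bold>\<subseteq> b) r"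
      using a q unfolding fex_iff fconj_def by (meson order_refl order_trans)
    obtain s e where s: "s \<le> r" "ae s (\<lambda>g. D g n = e)" "(a \<^bold>= clopname e) s"
      using r(2) unfolding op_seqname_iff[OF D] by blast
    obtain t f where t: "t \<le> s" "ae t (\<lambda>g. E g n = f)" "(b \<^bold>= clopname f) t"
      using r(3) s(1) unfolding op_seqname_iff[OF E] by blast
    have "\<not> clop e \<subseteq> clop f"
    proof
      assume "clop e \<subseteq> clop f"
      then have "(clopname e \<^bold>\<subseteq> clopname f) t" by (simp add: clopname_sub_iff)
      moreover have "good (\<lambda>a. a \<^bold>\<subseteq> clopname f)" "good (\<lambda>b. a \<^bold>\<subseteq> b)" by (intro good_intros)+
      ultimately have "(a \<^bold>\<subseteq> b) t"
        using good_cong[of "\<lambda>a. a \<^bold>\<subseteq> clopname f", OF _ feq_sym[OF feq_mono[OF s(3) t(1)]]]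
          good_cong[of "\<lambda>b. a \<^bold>\<subseteq> b", OF _ feq_sym[OF t(3)]] by blast
      then show False using r(4) s(1) t(1) unfolding fneg_def by (meson order_trans)
    qed
    then have "ae t (\<lambda>g. \<not> subs D E g n)"
      by (intro ae_mp2[OF ae_mono[OF s(2) t(1)] t(2)]) (simp add: subs_def)
    then show "\<exists>r\<le>q. ae r (\<lambda>g. \<not> subs D E g n)" using r s t by (meson order_trans)
  qed
next
  assume a: "ae p (\<lambda>g. \<not> subs D E g n)"
  show "nsub (seqname D) (seqname E) (nn n) p"
  proof (rule reg_dense[of "nsub (seqname D) (seqname E) (nn n)"])
    fix q assume q: "q \<le> p"
    obtain r e where r: "r \<le> q" "ae r (\<lambda>g. D g n = e)" using seq_decide[OF D] by blast
    obtain s f where s: "s \<le> r" "ae s (\<lambda>g. E g n = f)" using seq_decide[OF E] by blast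
    have sp: "s \<le> p" using s r q by (meson order_trans)
    have "ae s (\<lambda>g. \<not> clop e \<subseteq> clop f)"
      by (rule ae_mp3[OF ae_mono[OF a sp] ae_mono[OF r(2) s(1)] s(2)]) (simp add: subs_def)
    then have "\<not> clop e \<subseteq> clop f" by simp
    then have "(op (nn n) (clopname e) \<^bold>\<in> seqname D \<^bold>\<and> op (nn n) (clopname f) \<^bold>\<in> seqname E \<^bold>\<and> \<^bold>\<not> clopname e \<^bold>\<subseteq> clopname f) s"
      using op_seqnameI[OF D ae_mono[OF r(2) s(1)]] op_seqnameI[OF E s(2)] by (simp add: fconj_def fneg_def clopname_sub_iff)
    then have "nsub (seqname D) (seqname E) (nn n) s"
      by (intro fexI[of _ "clopname e"] fexI[of _ "clopname f"]) simp_all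
    then show "\<exists>r\<le>q. nsub (seqname D) (seqname E) (nn n) r" using r s by (meson order_trans)
  qed simp
qed

lemma good_sub_mod [good_intros]:
  "cong f \<Longrightarrow> cong h \<Longrightarrow> good (\<lambda>x :: ('i, 'l cohen) name. sub_mod J (f x) (h x))"
  unfolding sub_mod_def by (intro good_intros)

lemma reg_sub_mod [simp]: "reg (sub_mod J c d)" unfolding sub_mod_def by simp

lemma sub_mod_iff:
  assumes D: "bq UNIV D" and E: "bq UNIV E"
  shows "sub_mod ult_ideal (seqname D) (seqname E) p \<longleftrightarrow> ult (subs D E) p"
proof -
  let ?B = "\<lambda>g n. \<not> subs D E g n"
  have B: "rl ?B" by (rule rl_not[OF rl_subs[OF D E]])
  have g: "good (\<lambda>n. nsub (seqname D) (seqname E) n)" by (intro good_intros)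
  have c: "(\<^bold>\<forall>n. n \<^bold>\<in> s \<^bold>\<longleftrightarrow> (n \<^bold>\<in> omega \<^bold>\<and> nsub (seqname D) (seqname E) n)) q \<longleftrightarrow> (s \<^bold>= setname ?B) q" for s q
    by (rule comprehension_iff[OF g B nsub_iff[OF D E]])
  show ?thesis
  proof
    assume a: "sub_mod ult_ideal (seqname D) (seqname E) p"
    show "ult (subs D E) p"
    proof (rule reg_dense[OF reg_ult])
      fix q assume "q \<le> p"
      then obtain r s where r: "r \<le> q" "(s \<^bold>\<in> ult_ideal) r"
        "(\<^bold>\<forall>n. n \<^bold>\<in> s \<^bold>\<longleftrightarrow> (n \<^bold>\<in> omega \<^bold>\<and> nsub (seqname D) (seqname E) n)) r"
        using a unfolding sub_mod_def fex_iff[of "\<lambda>s. s \<^bold>\<in> ult_ideal \<^bold>\<and> _ s"] fconj_def[of "_ \<^bold>\<in> ult_ideal"] by blast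
      have "(s \<^bold>= setname ?B) r" using r(3) unfolding c .
      then have "(setname ?B \<^bold>\<in> ult_ideal) r" by (rule fmem_cong1[OF _ r(2)])
      then have "ult (subs D E) r" unfolding mem_ult_ideal[OF B] by simp
      then show "\<exists>r\<le>q. ult (subs D E) r" using r by blast
    qed
  next
    assume a: "ult (subs D E) p"
    have "(setname ?B \<^bold>\<in> ult_ideal) p" unfolding mem_ult_ideal[OF B] using a by simp
    moreover have "(\<^bold>\<forall>n. n \<^bold>\<in> setname ?B \<^bold>\<longleftrightarrow> (n \<^bold>\<in> omega \<^bold>\<and> nsub (seqname D) (seqname E) n)) p" unfolding c by simp
    ultimately have "(setname ?B \<^bold>\<in> ult_ideal \<^bold>\<and> (\<^bold>\<forall>n. n \<^bold>\<in> setname ?B \<^bold>\<longleftrightarrow> (n \<^bold>\<in> omega \<^bold>\<and> nsub (seqname D) (seqname E) n))) p"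
      by (simp only: fconj_def simp_thms)
    then show "sub_mod ult_ideal (seqname D) (seqname E) p"
      unfolding sub_mod_def by (intro fexI[of _ "setname ?B"]) simp_all
  qed
qed

end

section \<open>Cofinal chains\<close>

context chain_setting begin

abbreviation chk :: "'l \<Rightarrow> ('i, 'l cohen) name" where "chk \<equiv> check_elem lam"

definition kappa :: "('i, 'l cohen) name" where "kappa = canonical (chk ` K)"

lemma chk_eq_iff [simp]: "(chk \<alpha> \<^bold>= chk \<beta>) p \<longleftrightarrow> \<alpha> = \<beta>"
  by (rule check_elem_eq_iff[OF wo small_l]) (simp_all add: fld)

lemma chk_mem_iff: "(chk \<alpha> \<^bold>\<in> chk \<beta>) p \<longleftrightarrow> lt \<alpha> \<beta>"
  unfolding lt_def by (rule check_elem_mem_iff[OF wo small_l]) (simp_all add: fld)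

lemma mem_chk_iff: "(x \<^bold>\<in> chk \<gamma>) p \<longleftrightarrow> (\<forall>q\<le>p. \<exists>r\<le>q. \<exists>\<alpha>. lt \<alpha> \<gamma> \<and> (x \<^bold>= chk \<alpha>) r)"
proof -
  have u: "underS lam \<gamma> = {\<alpha>. lt \<alpha> \<gamma>}" by (auto simp: underS_def lt_def)
  have s: "small (chk ` {\<alpha>. lt \<alpha> \<gamma>})" by (rule small_image[OF small_l])
  have e: "chk \<gamma> = canonical (chk ` {\<alpha>. lt \<alpha> \<gamma>})" using check_elem_unfold[OF wo, of \<gamma>] unfolding u .
  show ?thesis unfolding e fmem_canonical[OF s] by blast
qed

lemma mem_kappa_iff: "(x \<^bold>\<in> kappa) p \<longleftrightarrow> (\<forall>q\<le>p. \<exists>r\<le>q. \<exists>\<alpha>\<in>K. (x \<^bold>= chk \<alpha>) r)"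
  unfolding kappa_def by (simp add: fmem_canonical[OF small_image[OF small_l]])

lemma chk_mem_kappa: "\<alpha> \<in> K \<Longrightarrow> (chk \<alpha> \<^bold>\<in> kappa) p"
  unfolding mem_kappa_iff by (meson feq_refl order_refl)

lemma lt_least: assumes "S \<noteq> {}" shows "\<exists>\<alpha>\<in>S. \<forall>\<beta>\<in>S. \<not> lt \<beta> \<alpha>"
proof -
  have "wf (lam - Id)" using wo by (simp add: well_order_on_def)
  then obtain \<alpha> where "\<alpha> \<in> S" "\<And>\<beta>. (\<beta>, \<alpha>) \<in> lam - Id \<Longrightarrow> \<beta> \<notin> S" using assms wfE_min by (metis ex_in_conv)
  then show ?thesis unfolding lt_def by (intro bexI[of _ \<alpha>]) auto
qed

lemma K_no_max: "\<alpha> \<in> K \<Longrightarrow> \<exists>\<beta>\<in>K. lt \<alpha> \<beta>"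
  using cofK[of "{\<alpha>}"] unfolding lt_def by auto

definition le :: "'l \<Rightarrow> 'l \<Rightarrow> bool" where "le \<alpha> \<beta> \<longleftrightarrow> \<alpha> = \<beta> \<or> lt \<alpha> \<beta>"

end

lemma fall2I: "(\<And>x y. \<Phi> x y p) \<Longrightarrow> (\<^bold>\<forall>x y. \<Phi> x y) p"
  by (simp add: fall_def)

text \<open>One argument for both orders, \<open>Omega_bar\<close> under \<open>sub_mod\<close> and
  the null ideal under inclusion. The clause \<open>cofinal\<close> speaks of a whole final segment,
  so it also carries the eventual monotonicity of the chain.\<close>

locale cofinal_chain = chain_setting U e0 lam K
  for U :: "'i set" and e0 :: "'l set set \<Rightarrow> 'i" and lam :: "'l rel" and K :: "'l set" +
  fixes Dm :: "('i, 'l cohen) fclass"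
    and R :: "('i, 'l cohen) name \<Rightarrow> ('i, 'l cohen) name \<Rightarrow> 'l cohen fprop"
    and C :: "'l \<Rightarrow> ('i, 'l cohen) name"
    and p :: "'l cohen"
  assumes reg_card: "is_regular_cardinal kappa p"
    and good_Dm: "good Dm" and good_R1: "\<And>y. good (\<lambda>x. R x y)" and good_R2: "\<And>x. good (\<lambda>y. R x y)"
    and C_Dm: "\<And>\<alpha> q. \<alpha> \<in> K \<Longrightarrow> Dm (C \<alpha>) q"
    and R_refl: "\<And>\<alpha> q. \<alpha> \<in> K \<Longrightarrow> R (C \<alpha>) (C \<alpha>) q"
    and R_trans: "\<And>x y z q. Dm x q \<Longrightarrow> Dm y q \<Longrightarrow> Dm z q \<Longrightarrow> R x y q \<Longrightarrow> R y z q \<Longrightarrow> R x z q"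
    and cofinal: "\<And>x q. Dm x q \<Longrightarrow> \<exists>r\<le>q. \<exists>\<alpha>\<in>K. \<forall>\<beta>\<in>K. le \<alpha> \<beta> \<longrightarrow> R x (C \<beta>) r"
    and strict: "\<And>\<alpha> \<beta> q. \<alpha> \<in> K \<Longrightarrow> \<beta> \<in> K \<Longrightarrow> lt \<alpha> \<beta> \<Longrightarrow> \<not> R (C \<beta>) (C \<alpha>) q"
begin

lemma reg_Dm [simp]: "reg (Dm x)" by (rule good_reg[OF good_Dm])
lemma reg_R [simp]: "reg (R x y)" by (rule good_reg[OF good_R1])

text \<open>
  \<open>least_bound f \<xi> \<alpha> s\<close> says that \<open>s\<close> decides \<open>\<alpha>\<close> to be the least index from which on the chain
  bounds the element that \<open>f\<close> maps to \<open>\<xi>\<close>. These indices form a function on a smaller ordinal,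
  which is bounded by regularity.
\<close>

definition bound_at :: "('i, 'l cohen) name \<Rightarrow> 'l \<Rightarrow> 'l \<Rightarrow> 'l cohen fprop" where
  "bound_at f \<xi> \<alpha> s \<longleftrightarrow> (\<forall>q\<le>s. \<forall>d. (op d (chk \<xi>) \<^bold>\<in> f) q \<longrightarrow> (\<forall>\<beta>\<in>K. le \<alpha> \<beta> \<longrightarrow> R d (C \<beta>) q))"

definition least_bound :: "('i, 'l cohen) name \<Rightarrow> 'l \<Rightarrow> 'l \<Rightarrow> 'l cohen fprop" where
  "least_bound f \<xi> \<alpha> s \<longleftrightarrow> bound_at f \<xi> \<alpha> s \<and> (\<forall>\<alpha>'\<in>K. lt \<alpha>' \<alpha> \<longrightarrow> (\<forall>q\<le>s. \<not> bound_at f \<xi> \<alpha>' q))"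

lemma reg_bound_at: "reg (bound_at f \<xi> \<alpha>)"
proof (rule regI)
  fix s q assume "bound_at f \<xi> \<alpha> s" "q \<le> s"
  then show "bound_at f \<xi> \<alpha> q" unfolding bound_at_def by (meson order_trans)
next
  fix s assume a: "\<And>q. q \<le> s \<Longrightarrow> \<exists>r\<le>q. bound_at f \<xi> \<alpha> r"
  show "bound_at f \<xi> \<alpha> s"
    unfolding bound_at_def
  proof (intro allI impI ballI)
    fix q d \<beta> assume q: "q \<le> s" "(op d (chk \<xi>) \<^bold>\<in> f) q" "\<beta> \<in> K" "le \<alpha> \<beta>"
    show "R d (C \<beta>) q"
    proof (rule reg_dense[OF reg_R])
      fix q' assume q': "q' \<le> q"
      have "q' \<le> s" using q' q by (meson order_trans)
      then obtain r where r: "r \<le> q'" "bound_at f \<xi> \<alpha> r" using a by blast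
      have "r \<le> q" using r q' by (meson order_trans)
      then have "(op d (chk \<xi>) \<^bold>\<in> f) r" by (rule fmem_mono[OF q(2)])
      then have "R d (C \<beta>) r" using r(2) q(3,4) unfolding bound_at_def by blast
      then show "\<exists>r\<le>q'. R d (C \<beta>) r" using r by blast
    qed
  qed
qed

lemma reg_least_bound: "reg (least_bound f \<xi> \<alpha>)"
proof (rule regI)
  fix s q assume a: "least_bound f \<xi> \<alpha> s" "q \<le> s"
  then show "least_bound f \<xi> \<alpha> q" unfolding least_bound_def using reg_mono[OF reg_bound_at] by (meson order_trans)
next
  fix s assume a: "\<And>q. q \<le> s \<Longrightarrow> \<exists>r\<le>q. least_bound f \<xi> \<alpha> r"
  have "bound_at f \<xi> \<alpha> s" by (rule reg_dense[OF reg_bound_at]) (use a in \<open>unfold least_bound_def, blast\<close>)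
  moreover have "\<not> bound_at f \<xi> \<alpha>' q" if i: "\<alpha>' \<in> K" "lt \<alpha>' \<alpha>" "q \<le> s" for \<alpha>' q
  proof
    assume P: "bound_at f \<xi> \<alpha>' q"
    obtain r where r: "r \<le> q" "least_bound f \<xi> \<alpha> r" using a[OF i(3)] by blast
    then show False using reg_mono[OF reg_bound_at P r(1)] i(1,2) r(2) unfolding least_bound_def by blast
  qed
  ultimately show "least_bound f \<xi> \<alpha> s" unfolding least_bound_def by blast
qed

lemma least_bound_exists:
  assumes f: "is_inj f F (\<lambda>y. y \<^bold>\<in> chk \<gamma>) s" and F: "\<And>c q. q \<le> s \<Longrightarrow> (c \<^bold>\<in> F) q \<Longrightarrow> Dm c q"
    and t: "t \<le> s" "(op d (chk \<xi>) \<^bold>\<in> f) t"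
  shows "\<exists>r\<le>t. \<exists>\<alpha>\<in>K. least_bound f \<xi> \<alpha> r"
proof -
  have ff: "is_fun f F (\<lambda>y. y \<^bold>\<in> chk \<gamma>) s" using f by (simp add: is_inj_def fconj_def)
  have "(d \<^bold>\<in> F) t" using is_fun_mem[OF ff good_mem t] by blast
  then have "Dm d t" by (rule F[OF t(1)])
  then obtain u \<alpha>0 where u: "u \<le> t" "\<alpha>0 \<in> K" "\<And>\<beta>. \<beta> \<in> K \<Longrightarrow> le \<alpha>0 \<beta> \<Longrightarrow> R d (C \<beta>) u" using cofinal by meson
  have us: "u \<le> s" using u t by (meson order_trans)
  have "bound_at f \<xi> \<alpha>0 u"
    unfolding bound_at_def
  proof (intro allI impI ballI)
    fix q d' \<beta> assume q: "q \<le> u" "(op d' (chk \<xi>) \<^bold>\<in> f) q" "\<beta> \<in> K" "le \<alpha>0 \<beta>"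
    have qs: "q \<le> s" "q \<le> t" using q us u by (meson order_trans)+
    \<comment> \<open>Injectivity of f makes d the only element over \<xi>, so bounding d bounds
      everything in the fibre.\<close>
    have "(d \<^bold>= d') q"
      by (rule is_injD[OF f _ qs(1) fmem_mono[OF t(2) qs(2)] q(2)]) simp
    moreover have "R d (C \<beta>) q" by (rule reg_mono[OF reg_R u(3)[OF q(3,4)] q(1)])
    ultimately show "R d' (C \<beta>) q" by (rule good_cong[OF good_R1])
  qed
  \<comment> \<open>Minimising over all extensions of u at once makes the index minimal also below
    the condition r where it is attained.\<close>
  then have "{\<alpha>\<in>K. \<exists>r\<le>u. bound_at f \<xi> \<alpha> r} \<noteq> {}" using u(2) by blast
  then obtain \<alpha> where \<alpha>: "\<alpha> \<in> {\<alpha>\<in>K. \<exists>r\<le>u. bound_at f \<xi> \<alpha> r}" "\<forall>\<alpha>'\<in>{\<alpha>\<in>K. \<exists>r\<le>u. bound_at f \<xi> \<alpha> r}. \<not> lt \<alpha>' \<alpha>"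
    using lt_least by meson
  then obtain r where r: "r \<le> u" "bound_at f \<xi> \<alpha> r" by blast
  have "least_bound f \<xi> \<alpha> r"
    unfolding least_bound_def
  proof (intro conjI ballI impI allI notI)
    fix \<alpha>' q assume a: "\<alpha>' \<in> K" "lt \<alpha>' \<alpha>" "q \<le> r" "bound_at f \<xi> \<alpha>' q"
    have "q \<le> u" using a r by (meson order_trans)
    then show False using \<alpha>(2) a by blast
  qed (rule r(2))
  moreover have "r \<le> t" by (rule order_trans[OF r(1) u(1)])
  moreover have "\<alpha> \<in> K" using \<alpha>(1) by blast
  ultimately show ?thesis by blast
qed

text \<open>Regularity of \<kappa> is a statement about the extension, so it is applied to a name: G
  sends \<xi> below \<gamma> to the least index bounding the element of F over \<xi>. The bound
  \<delta> of its values then bounds F along the chain.\<close>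

lemma small_family_bounded:
  assumes q: "q \<le> p" and F: "(\<^bold>\<forall>c. c \<^bold>\<in> F \<^bold>\<longrightarrow> Dm c) q" and a: "(a \<^bold>\<in> kappa) q" and e: "equinum F a q"
  shows "\<exists>r\<le>q. \<exists>\<delta>\<in>K. \<forall>s\<le>r. \<forall>d. (d \<^bold>\<in> F) s \<longrightarrow> R d (C \<delta>) s"
proof -
  obtain r0 \<gamma> where r0: "r0 \<le> q" "\<gamma> \<in> K" "(a \<^bold>= chk \<gamma>) r0" using a unfolding mem_kappa_iff by blast
  have ge: "good (\<lambda>a. equinum F a)" by (intro good_intros)
  have "equinum F (chk \<gamma>) r0" by (rule good_cong[OF ge r0(3) reg_mono[OF reg_equinum e r0(1)]])
  then obtain r1 f where r1: "r1 \<le> r0" "is_inj f F (\<lambda>y. y \<^bold>\<in> chk \<gamma>) r1"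
    "(\<^bold>\<forall>y. y \<^bold>\<in> chk \<gamma> \<^bold>\<longrightarrow> (\<^bold>\<exists>x. op x y \<^bold>\<in> f)) r1"
    unfolding equinum_def fex_iff[of "\<lambda>f. is_inj f _ _ \<^bold>\<and> _ f"] fconj_def by blast
  have r1p: "r1 \<le> q" "r1 \<le> p" using r1 r0 q by (meson order_trans)+
  have ff: "is_fun f F (\<lambda>y. y \<^bold>\<in> chk \<gamma>) r1" using r1(2) by (simp add: is_inj_def fconj_def)
  have FD: "Dm c s" if "s \<le> r1" "(c \<^bold>\<in> F) s" for c s
    using F that order_trans[OF that(1) r1p(1)] by (simp add: fall_def fimp_iff)
  let ?I = "{(\<xi>, \<alpha>). lt \<xi> \<gamma> \<and> \<alpha> \<in> K}"
  have sI: "small ?I" by (rule small_subset[OF small_Times[OF small_l small_l, of UNIV UNIV]]) simp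
  \<comment> \<open>Using the least index makes G single-valued.\<close>
  define G where "G = fam ?I (\<lambda>(\<xi>, \<alpha>). op (chk \<xi>) (chk \<alpha>)) (\<lambda>(\<xi>, \<alpha>). least_bound f \<xi> \<alpha>)"
  have rI: "reg ((\<lambda>(\<xi>, \<alpha>). least_bound f \<xi> \<alpha>) c)" for c by (cases c) (simp add: reg_least_bound)
  have mG: "(z \<^bold>\<in> G) s \<longleftrightarrow> (\<forall>q\<le>s. \<exists>r\<le>q. \<exists>\<xi> \<alpha>. lt \<xi> \<gamma> \<and> \<alpha> \<in> K \<and> least_bound f \<xi> \<alpha> r \<and> (z \<^bold>= op (chk \<xi>) (chk \<alpha>)) r)" for z s
    unfolding G_def
    using fmem_fam[where f = "\<lambda>(\<xi>, \<alpha>). op (chk \<xi>) (chk \<alpha>)" and C = ?I and P = "\<lambda>(\<xi>, \<alpha>). least_bound f \<xi> \<alpha>" and x = z and p = s, OF sI rI]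
    by (simp add: Bex_def split_paired_Ex conj_assoc)
  have GI: "(op (chk \<xi>) (chk \<alpha>) \<^bold>\<in> G) s" if "lt \<xi> \<gamma>" "\<alpha> \<in> K" "least_bound f \<xi> \<alpha> s" for \<xi> \<alpha> s
    unfolding mG using that reg_mono[OF reg_least_bound that(3)] feq_refl order_refl by blast
  have fib: "\<exists>r\<le>t. \<exists>d. (op d (chk \<xi>) \<^bold>\<in> f) r" if t: "t \<le> r1" "lt \<xi> \<gamma>" for t \<xi>
  proof -
    have "(chk \<xi> \<^bold>\<in> chk \<gamma>) t" using t(2) by (simp add: chk_mem_iff)
    then have "(\<^bold>\<exists>x. op x (chk \<xi>) \<^bold>\<in> f) t" using r1(3) t(1) by (simp add: fall_def fimp_iff)
    then show ?thesis by (rule fexD)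
  qed
  have Gfun: "is_fun G (chk \<gamma>) (\<lambda>y. y \<^bold>\<in> kappa) r1"
  proof (rule is_funI)
    fix s z assume "(z \<^bold>\<in> G) s"
    then obtain r \<xi> \<alpha> where "r \<le> s" "lt \<xi> \<gamma>" "\<alpha> \<in> K" "(z \<^bold>= op (chk \<xi>) (chk \<alpha>)) r" unfolding mG by blast
    then show "\<exists>r\<le>s. \<exists>x y. (x \<^bold>\<in> chk \<gamma>) r \<and> (y \<^bold>\<in> kappa) r \<and> (z \<^bold>= op x y) r"
      using chk_mem_iff chk_mem_kappa by blast
  next
    fix s x assume s: "s \<le> r1" "(x \<^bold>\<in> chk \<gamma>) s"
    then obtain t \<xi> where t: "t \<le> s" "lt \<xi> \<gamma>" "(x \<^bold>= chk \<xi>) t" unfolding mem_chk_iff by blast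
    have tr: "t \<le> r1" using t s by (meson order_trans)
    obtain u d where u: "u \<le> t" "(op d (chk \<xi>) \<^bold>\<in> f) u" using fib[OF tr t(2)] by blast
    have ur: "u \<le> r1" using u tr by (meson order_trans)
    obtain v \<alpha> where v: "v \<le> u" "\<alpha> \<in> K" "least_bound f \<xi> \<alpha> v" using least_bound_exists[OF r1(2) FD ur u(2)] by blast
    have vt: "v \<le> t" using v u by (meson order_trans)
    have "(op x (chk \<alpha>) \<^bold>\<in> G) v"
      using fmem_cong1[OF op_cong[OF feq_sym[OF feq_mono[OF t(3) vt]] feq_refl] GI[OF t(2) v(2,3)]] .
    then show "\<exists>r\<le>s. \<exists>y. (op x y \<^bold>\<in> G) r" using vt t by (meson order_trans)
  next
    fix s x y y' assume s: "(op x y \<^bold>\<in> G) s" "(op x y' \<^bold>\<in> G) s"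
    show "(y \<^bold>= y') s"
    proof (rule reg_dense[OF reg_feq])
      fix s' assume s': "s' \<le> s"
      obtain t \<xi> \<alpha> where t: "t \<le> s'" "\<alpha> \<in> K" "least_bound f \<xi> \<alpha> t" "(op x y \<^bold>= op (chk \<xi>) (chk \<alpha>)) t"
        using s(1) s' unfolding mG by blast
      have "t \<le> s" using t s' by (meson order_trans)
      then obtain u \<xi>' \<alpha>' where u: "u \<le> t" "\<alpha>' \<in> K" "least_bound f \<xi>' \<alpha>' u" "(op x y' \<^bold>= op (chk \<xi>') (chk \<alpha>')) u"
        using s(2) unfolding mG by blast
      have e1: "(x \<^bold>= chk \<xi>) u" "(y \<^bold>= chk \<alpha>) u" using feq_mono[OF t(4) u(1)] by (simp_all add: op_eq_iff)
      have e2: "(x \<^bold>= chk \<xi>') u" "(y' \<^bold>= chk \<alpha>') u" using u(4) by (simp_all add: op_eq_iff)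
      have \<xi>: "\<xi> = \<xi>'" using feq_trans[OF feq_sym[OF e1(1)] e2(1)] by simp
      have L: "least_bound f \<xi> \<alpha> u" "least_bound f \<xi> \<alpha>' u" using reg_mono[OF reg_least_bound t(3) u(1)] u(3) \<xi> by auto
      have "\<alpha> = \<alpha>'" using lt_linear[of \<alpha> \<alpha>'] L t(2) u(2) unfolding least_bound_def by blast
      then have "(y \<^bold>= y') u" using feq_trans[OF e1(2)] feq_sym[OF e2(2)] by blast
      then show "\<exists>r\<le>s'. (y \<^bold>= y') r" using t u by (meson order_trans)
    qed
  qed simp
  have "(\<^bold>\<forall>a f. a \<^bold>\<in> kappa \<^bold>\<and> is_fun f a (\<lambda>y. y \<^bold>\<in> kappa) \<^bold>\<longrightarrow>
        (\<^bold>\<exists>b. b \<^bold>\<in> kappa \<^bold>\<and> (\<^bold>\<forall>x y. op x y \<^bold>\<in> f \<^bold>\<longrightarrow> y \<^bold>\<in> b))) p"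
    using reg_card unfolding is_regular_cardinal_def by (simp only: fconj_def simp_thms)
  then have "(chk \<gamma> \<^bold>\<in> kappa \<^bold>\<and> is_fun G (chk \<gamma>) (\<lambda>y. y \<^bold>\<in> kappa) \<^bold>\<longrightarrow>
        (\<^bold>\<exists>b. b \<^bold>\<in> kappa \<^bold>\<and> (\<^bold>\<forall>x y. op x y \<^bold>\<in> G \<^bold>\<longrightarrow> y \<^bold>\<in> b))) p"
    unfolding fall_def[of "\<lambda>a. fall (_ a)"] fall_def[of "\<lambda>f. _ f \<^bold>\<longrightarrow> _ f"] by blast
  then have "(\<^bold>\<exists>b. b \<^bold>\<in> kappa \<^bold>\<and> (\<^bold>\<forall>x y. op x y \<^bold>\<in> G \<^bold>\<longrightarrow> y \<^bold>\<in> b)) r1"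
    by (rule fimpD) (use Gfun chk_mem_kappa[OF r0(2)] r1p in \<open>simp_all add: fconj_def\<close>)
  then obtain r2 b where r2: "r2 \<le> r1" "(b \<^bold>\<in> kappa) r2" "(\<^bold>\<forall>x y. op x y \<^bold>\<in> G \<^bold>\<longrightarrow> y \<^bold>\<in> b) r2"
    unfolding fex_iff fconj_def by blast
  obtain r3 \<delta> where r3: "r3 \<le> r2" "\<delta> \<in> K" "(b \<^bold>= chk \<delta>) r3" using r2(2) unfolding mem_kappa_iff by blast
  have bnd: "lt \<alpha> \<delta>" if "s \<le> r3" "(op x (chk \<alpha>) \<^bold>\<in> G) s" for x \<alpha> s
  proof -
    have "s \<le> r2" using that r3 by (meson order_trans)
    then have "(chk \<alpha> \<^bold>\<in> b) s" using r2(3) that(2) by (simp add: fall_def fimp_iff)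
    then have "(chk \<alpha> \<^bold>\<in> chk \<delta>) s" by (rule fmem_cong2[OF feq_mono[OF r3(3) that(1)]])
    then show ?thesis by (simp add: chk_mem_iff)
  qed
  have r3r: "r3 \<le> r1" using r3 r2 by (meson order_trans)
  have "R d (C \<delta>) s" if s: "s \<le> r3" "(d \<^bold>\<in> F) s" for s d
  proof (rule reg_dense[OF reg_R])
    fix s' assume s': "s' \<le> s"
    have s'r: "s' \<le> r3" "s' \<le> r1" using s s' r3r by (meson order_trans)+
    obtain t y where t: "t \<le> s'" "(op d y \<^bold>\<in> f) t" "(y \<^bold>\<in> chk \<gamma>) t"
      using is_fun_ex[OF ff good_mem s'r(2) fmem_mono[OF s(2) s']] by metis
    obtain u \<xi> where u: "u \<le> t" "lt \<xi> \<gamma>" "(y \<^bold>= chk \<xi>) u" using t(3) unfolding mem_chk_iff by blast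
    have df: "(op d (chk \<xi>) \<^bold>\<in> f) u" using fmem_cong1[OF op_cong[OF feq_refl u(3)] fmem_mono[OF t(2) u(1)]] .
    have ur: "u \<le> r1" "u \<le> r3" using u t s'r by (meson order_trans)+
    obtain v \<alpha> where v: "v \<le> u" "\<alpha> \<in> K" "least_bound f \<xi> \<alpha> v" using least_bound_exists[OF r1(2) FD ur(1) df] by blast
    have vr: "v \<le> r3" using v ur by (meson order_trans)
    have "lt \<alpha> \<delta>" by (rule bnd[OF vr GI[OF u(2) v(2,3)]])
    then have "R d (C \<delta>) v"
      using v(3) fmem_mono[OF df v(1)] r3(2) unfolding least_bound_def bound_at_def le_def by (meson order_refl)
    then show "\<exists>r\<le>s'. R d (C \<delta>) r" using v u t by (meson order_trans)
  qed
  moreover have "r3 \<le> q" using r3r r1p by (meson order_trans)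
  ultimately show ?thesis using r3(2) by blast
qed

section \<open>Both cardinal numbers of the order equal the length of the chain\<close>

definition chain_name :: "('i, 'l cohen) name" where "chain_name = canonical (C ` K)"

lemma small_CK: "small (C ` K)" by (rule small_image[OF small_l])

lemma C_mem_chain_name: "\<alpha> \<in> K \<Longrightarrow> (C \<alpha> \<^bold>\<in> chain_name) q"
  unfolding chain_name_def by (rule fmem_canonicalI[OF small_CK]) simp

lemma chain_name_Dm: "(\<^bold>\<forall>c. c \<^bold>\<in> chain_name \<^bold>\<longrightarrow> Dm c) q"
  using fall_canonical[OF small_CK good_Dm, of q] C_Dm unfolding chain_name_def by (simp add: fall_def fimp_iff)

text \<open>A forced equality would, by reflexivity, put the later term below the earlier one,
  against strictness. So the chain is listed without repetition, which gives its equinumerosity with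
  \<open>kappa\<close>.\<close>

lemma C_eq_iff: assumes "\<alpha> \<in> K" "\<beta> \<in> K" shows "(C \<alpha> \<^bold>= C \<beta>) q \<longleftrightarrow> \<alpha> = \<beta>"
proof
  assume e: "(C \<alpha> \<^bold>= C \<beta>) q"
  have "R (C \<beta>) (C \<alpha>) q" by (rule good_cong[OF good_R1 e R_refl[OF assms(1)]])
  moreover have "R (C \<alpha>) (C \<beta>) q" by (rule good_cong[OF good_R1 feq_sym[OF e] R_refl[OF assms(2)]])
  ultimately show "\<alpha> = \<beta>" using strict assms lt_linear by blast
qed simp

lemma chain_name_equinum: "equinum chain_name kappa q"
  unfolding chain_name_def kappa_def by (rule equinum_fn[OF small_l]) (simp add: C_eq_iff)

text \<open>A bound of the whole chain would lie below some \<open>C \<alpha>\<close>, and then so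
  would a later \<open>C \<beta>\<close>, against strictness. A family of size less than \<kappa> is
  bounded by a member of the chain.\<close>

lemma unbounded_least_size:
  "least_size (\<lambda>F. (\<^bold>\<forall>c. c \<^bold>\<in> F \<^bold>\<longrightarrow> Dm c) \<^bold>\<and> \<^bold>\<not> (\<^bold>\<exists>d. Dm d \<^bold>\<and> (\<^bold>\<forall>c. c \<^bold>\<in> F \<^bold>\<longrightarrow> R c d))) kappa p"
proof -
  let ?\<Phi> = "\<lambda>F. (\<^bold>\<forall>c. c \<^bold>\<in> F \<^bold>\<longrightarrow> Dm c) \<^bold>\<and> \<^bold>\<not> (\<^bold>\<exists>d. Dm d \<^bold>\<and> (\<^bold>\<forall>c. c \<^bold>\<in> F \<^bold>\<longrightarrow> R c d))"
  have 1: "is_cardinal kappa p" using reg_card unfolding is_regular_cardinal_def by (simp only: fconj_def)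
  have "\<not> (\<^bold>\<exists>d. Dm d \<^bold>\<and> (\<^bold>\<forall>c. c \<^bold>\<in> chain_name \<^bold>\<longrightarrow> R c d)) q" for q
  proof
    assume "(\<^bold>\<exists>d. Dm d \<^bold>\<and> (\<^bold>\<forall>c. c \<^bold>\<in> chain_name \<^bold>\<longrightarrow> R c d)) q"
    then obtain r d where r: "r \<le> q" "Dm d r" "(\<^bold>\<forall>c. c \<^bold>\<in> chain_name \<^bold>\<longrightarrow> R c d) r" unfolding fex_iff fconj_def by blast
    obtain s \<alpha> where s: "s \<le> r" "\<alpha> \<in> K" "\<forall>\<beta>\<in>K. le \<alpha> \<beta> \<longrightarrow> R d (C \<beta>) s" using cofinal[OF r(2)] by blast
    obtain \<beta> where \<beta>: "\<beta> \<in> K" "lt \<alpha> \<beta>" using K_no_max[OF s(2)] by blast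
    have "R (C \<beta>) d s" using r(3) s(1) C_mem_chain_name[OF \<beta>(1)] by (simp add: fall_def fimp_iff)
    moreover have "R d (C \<alpha>) s" using s(2,3) by (simp add: le_def)
    ultimately have "R (C \<beta>) (C \<alpha>) s"
      using R_trans[OF C_Dm[OF \<beta>(1)] reg_mono[OF reg_Dm r(2) s(1)] C_Dm[OF s(2)]] by blast
    then show False using strict s(2) \<beta> by blast
  qed
  then have "(?\<Phi> chain_name \<^bold>\<and> equinum chain_name kappa) p" using chain_name_Dm chain_name_equinum by (simp add: fconj_def fneg_def)
  then have 2: "(\<^bold>\<exists>F. ?\<Phi> F \<^bold>\<and> equinum F kappa) p" by (intro fexI[of _ chain_name]) simp_all
  have no: "\<not> equinum F a q" if q: "q \<le> p" "?\<Phi> F q" "(a \<^bold>\<in> kappa) q" for F a q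
  proof
    assume e: "equinum F a q"
    obtain r \<delta> where r: "r \<le> q" "\<delta> \<in> K" "\<forall>s\<le>r. \<forall>d. (d \<^bold>\<in> F) s \<longrightarrow> R d (C \<delta>) s"
      using small_family_bounded[OF q(1) _ q(3) e] q(2) unfolding fconj_def[of "fall _"] by blast
    have "(Dm (C \<delta>) \<^bold>\<and> (\<^bold>\<forall>c. c \<^bold>\<in> F \<^bold>\<longrightarrow> R c (C \<delta>))) r" using r(3) C_Dm[OF r(2)] by (simp add: fconj_def fall_def fimp_iff)
    then have "(\<^bold>\<exists>d. Dm d \<^bold>\<and> (\<^bold>\<forall>c. c \<^bold>\<in> F \<^bold>\<longrightarrow> R c d)) r" by (intro fexI[of _ "C \<delta>"]) simp_all
    then show False using q(2) r(1) unfolding fconj_def[of "fall _"] fneg_def by blast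
  qed
  have \<Phi>_mono: "?\<Phi> F r" if "?\<Phi> F q" "r \<le> q" for F q r using reg_mono[of "?\<Phi> F" q r] that by simp
  have 3: "(\<^bold>\<forall>F a. ?\<Phi> F \<^bold>\<and> a \<^bold>\<in> kappa \<^bold>\<longrightarrow> \<^bold>\<not> equinum F a) p"
  proof (rule fall2I, rule fimpI)
    fix F a q
    assume h: "q \<le> p" "(?\<Phi> F \<^bold>\<and> a \<^bold>\<in> kappa) q"
    then have h': "?\<Phi> F q" "(a \<^bold>\<in> kappa) q" unfolding fconj_def[of "?\<Phi> F"] by auto
    show "(\<^bold>\<not> equinum F a) q"
      unfolding fneg_def[of "equinum F a"]
    proof (intro allI impI)
      fix r assume r: "r \<le> q"
      have "r \<le> p" using r h(1) by (meson order_trans)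
      then show "\<not> equinum F a r" by (rule no[OF _ \<Phi>_mono[OF h'(1) r] fmem_mono[OF h'(2) r]])
    qed
  qed
  show ?thesis unfolding least_size_def using 1 2 3 by (simp only: fconj_def[of "is_cardinal kappa"] fconj_def[of "fex _"] simp_thms)
qed

text \<open>A family of size less than \<kappa> lies below one \<open>C \<delta>\<close>; if it were
  cofinal, a later \<open>C \<beta>\<close> would be below one of its members and hence below
  \<open>C \<delta>\<close>.\<close>

lemma cofinal_least_size:
  "least_size (\<lambda>F. (\<^bold>\<forall>c. c \<^bold>\<in> F \<^bold>\<longrightarrow> Dm c) \<^bold>\<and> (\<^bold>\<forall>c. Dm c \<^bold>\<longrightarrow> (\<^bold>\<exists>d. d \<^bold>\<in> F \<^bold>\<and> R c d))) kappa p"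
proof -
  let ?\<Phi> = "\<lambda>F. (\<^bold>\<forall>c. c \<^bold>\<in> F \<^bold>\<longrightarrow> Dm c) \<^bold>\<and> (\<^bold>\<forall>c. Dm c \<^bold>\<longrightarrow> (\<^bold>\<exists>d. d \<^bold>\<in> F \<^bold>\<and> R c d))"
  have 1: "is_cardinal kappa p" using reg_card unfolding is_regular_cardinal_def by (simp only: fconj_def)
  have "(\<^bold>\<exists>d. d \<^bold>\<in> chain_name \<^bold>\<and> R c d) q" if c: "Dm c q" for c q
    unfolding fex_iff
  proof (intro allI impI)
    fix q' assume q': "q' \<le> q"
    obtain s \<alpha> where s: "s \<le> q'" "\<alpha> \<in> K" "\<forall>\<beta>\<in>K. le \<alpha> \<beta> \<longrightarrow> R c (C \<beta>) s"
      using cofinal[OF reg_mono[OF reg_Dm c q']] by blast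
    have "R c (C \<alpha>) s" using s(2,3) by (simp add: le_def)
    then have "(C \<alpha> \<^bold>\<in> chain_name \<^bold>\<and> R c (C \<alpha>)) s" using C_mem_chain_name[OF s(2)] by (simp add: fconj_def)
    then show "\<exists>r\<le>q'. \<exists>d. (d \<^bold>\<in> chain_name \<^bold>\<and> R c d) r" using s(1) by blast
  qed
  then have "(\<^bold>\<forall>c. Dm c \<^bold>\<longrightarrow> (\<^bold>\<exists>d. d \<^bold>\<in> chain_name \<^bold>\<and> R c d)) p" unfolding fall_def[of "\<lambda>c. Dm c \<^bold>\<longrightarrow> _ c"] by (blast intro: fimpI)
  then have "(?\<Phi> chain_name \<^bold>\<and> equinum chain_name kappa) p" using chain_name_Dm chain_name_equinum by (simp only: fconj_def simp_thms)
  then have 2: "(\<^bold>\<exists>F. ?\<Phi> F \<^bold>\<and> equinum F kappa) p" by (intro fexI[of _ chain_name]) simp_all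
  have no: "\<not> equinum F a q" if q: "q \<le> p" "?\<Phi> F q" "(a \<^bold>\<in> kappa) q" for F a q
  proof
    assume e: "equinum F a q"
    have \<Phi>: "(\<^bold>\<forall>c. c \<^bold>\<in> F \<^bold>\<longrightarrow> Dm c) q" "(\<^bold>\<forall>c. Dm c \<^bold>\<longrightarrow> (\<^bold>\<exists>d. d \<^bold>\<in> F \<^bold>\<and> R c d)) q" using q(2) by (simp_all only: fconj_def)
    obtain r \<delta> where r: "r \<le> q" "\<delta> \<in> K" "\<forall>s\<le>r. \<forall>d. (d \<^bold>\<in> F) s \<longrightarrow> R d (C \<delta>) s"
      using small_family_bounded[OF q(1) \<Phi>(1) q(3) e] by blast
    obtain \<beta> where \<beta>: "\<beta> \<in> K" "lt \<delta> \<beta>" using K_no_max[OF r(2)] by blast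
    have "(Dm (C \<beta>) \<^bold>\<longrightarrow> (\<^bold>\<exists>d. d \<^bold>\<in> F \<^bold>\<and> R (C \<beta>) d)) q" using \<Phi>(2) unfolding fall_def[of "\<lambda>c. Dm c \<^bold>\<longrightarrow> _ c"] by blast
    then have "(\<^bold>\<exists>d. d \<^bold>\<in> F \<^bold>\<and> R (C \<beta>) d) r" by (rule fimpD) (use C_Dm[OF \<beta>(1)] r(1) in simp_all)
    then obtain s d where s: "s \<le> r" "(d \<^bold>\<in> F) s" "R (C \<beta>) d s" unfolding fex_iff fconj_def by blast
    have sq: "s \<le> q" using s r by (meson order_trans)
    have d: "Dm d s" using \<Phi>(1) s(2) sq by (simp add: fall_def fimp_iff)
    have "R d (C \<delta>) s" using r(3) s by blast
    then have "R (C \<beta>) (C \<delta>) s" by (rule R_trans[OF C_Dm[OF \<beta>(1)] d C_Dm[OF r(2)] s(3)])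
    then show False using strict r(2) \<beta> by blast
  qed
  have \<Phi>_mono: "?\<Phi> F r" if "?\<Phi> F q" "r \<le> q" for F q r using reg_mono[of "?\<Phi> F" q r] that by simp
  have 3: "(\<^bold>\<forall>F a. ?\<Phi> F \<^bold>\<and> a \<^bold>\<in> kappa \<^bold>\<longrightarrow> \<^bold>\<not> equinum F a) p"
  proof (rule fall2I, rule fimpI)
    fix F a q
    assume h: "q \<le> p" "(?\<Phi> F \<^bold>\<and> a \<^bold>\<in> kappa) q"
    then have h': "?\<Phi> F q" "(a \<^bold>\<in> kappa) q" unfolding fconj_def[of "?\<Phi> F"] by auto
    show "(\<^bold>\<not> equinum F a) q"
      unfolding fneg_def[of "equinum F a"]
    proof (intro allI impI)
      fix r assume r: "r \<le> q"
      have "r \<le> p" using r h(1) by (meson order_trans)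
      then show "\<not> equinum F a r" by (rule no[OF _ \<Phi>_mono[OF h'(1) r] fmem_mono[OF h'(2) r]])
    qed
  qed
  show ?thesis unfolding least_size_def using 1 2 3 by (simp only: fconj_def[of "is_cardinal kappa"] fconj_def[of "fex _"] simp_thms)
qed

end

section \<open>The null ideals of the ultrafilter\<close>

context cohen_setting begin

text \<open>Names occurring inside the names in F suffice as candidates, and they form a small
  set.\<close>

definition union_name :: "('i, 'l cohen) name \<Rightarrow> ('i, 'l cohen) name" where
  "union_name F = fam (\<Union>z\<in>elems F. fst ` elems (fst z)) (\<lambda>y. y) (\<lambda>y. \<^bold>\<exists>X. X \<^bold>\<in> F \<^bold>\<and> y \<^bold>\<in> X)"

lemma mem_union_name: "(x \<^bold>\<in> union_name F) p \<longleftrightarrow> (\<^bold>\<exists>X. X \<^bold>\<in> F \<^bold>\<and> x \<^bold>\<in> X) p"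
proof -
  let ?C = "\<Union>z\<in>elems F. fst ` elems (fst z)"
  let ?P = "\<lambda>y. \<^bold>\<exists>X. X \<^bold>\<in> F \<^bold>\<and> y \<^bold>\<in> X"
  have C: "small ?C" by (intro small_UN small_elems small_image)
  have g: "good ?P" by (intro good_intros)
  have iff: "(x \<^bold>\<in> union_name F) p \<longleftrightarrow> (\<forall>q\<le>p. \<exists>r\<le>q. \<exists>y\<in>?C. ?P y r \<and> (x \<^bold>= y) r)"
    unfolding union_name_def using fmem_fam[where f = "\<lambda>y. y" and P = ?P and C = ?C, OF C good_reg[OF g]] .
  show ?thesis
  proof
    assume a: "(x \<^bold>\<in> union_name F) p"
    show "?P x p"
    proof (rule reg_dense[OF good_reg[OF g]])
      fix q assume "q \<le> p"
      then obtain r y where r: "r \<le> q" "?P y r" "(x \<^bold>= y) r" using a unfolding iff by blast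
      have "?P x r" by (rule good_cong[OF g feq_sym[OF r(3)] r(2)])
      then show "\<exists>r\<le>q. ?P x r" using r by blast
    qed
  next
    assume a: "?P x p"
    show "(x \<^bold>\<in> union_name F) p"
      unfolding iff
    proof (intro allI impI)
      fix q assume q: "q \<le> p"
      then obtain r X where r: "r \<le> q" "(X \<^bold>\<in> F) r" "(x \<^bold>\<in> X) r" using a unfolding fex_iff fconj_def by blast
      obtain s X' t where s: "s \<le> r" "(X', t) \<in> elems F" "(X \<^bold>= X') s" using r(2) unfolding fmem_iff by blast
      have "(x \<^bold>\<in> X') s" by (rule fmem_cong2[OF s(3) fmem_mono[OF r(3) s(1)]])
      then obtain u y t' where u: "u \<le> s" "(y, t') \<in> elems X'" "(x \<^bold>= y) u" unfolding fmem_iff by blast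
      have "y \<in> ?C" using s(2) u(2) by force
      moreover have uq: "u \<le> q" using u s r by (meson order_trans)
      moreover have "?P x u" by (rule reg_mono[OF good_reg[OF g] a order_trans[OF uq q]])
      then have "?P y u" by (rule good_cong[OF g u(3)])
      ultimately show "\<exists>r\<le>q. \<exists>y\<in>?C. ?P y r \<and> (x \<^bold>= y) r" using u(3) by blast
    qed
  qed
qed

text \<open>Unions exist in the extension and I is closed downwards, so the union of F lies in I
  exactly if F has an upper bound in I. Additivity thereby takes the form treated for
  chains.\<close>

lemma add_eq_unbounded:
  fixes I :: "('i, 'l cohen) fclass"
  assumes I: "good I" and down: "\<And>X Y q. I Y q \<Longrightarrow> (X \<^bold>\<subseteq> Y) q \<Longrightarrow> I X q"
  shows "add_eq I k = least_size (\<lambda>F. (\<^bold>\<forall>X. X \<^bold>\<in> F \<^bold>\<longrightarrow> I X) \<^bold>\<and> \<^bold>\<not> (\<^bold>\<exists>Y. I Y \<^bold>\<and> (\<^bold>\<forall>X. X \<^bold>\<in> F \<^bold>\<longrightarrow> X \<^bold>\<subseteq> Y))) k"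
proof -
  have [simp]: "reg (I x)" for x by (rule good_reg[OF I])
  let ?A = "\<lambda>F. \<^bold>\<exists>U. (\<^bold>\<forall>x. x \<^bold>\<in> U \<^bold>\<longleftrightarrow> (\<^bold>\<exists>X. X \<^bold>\<in> F \<^bold>\<and> x \<^bold>\<in> X)) \<^bold>\<and> \<^bold>\<not> I U"
  let ?B = "\<lambda>F. \<^bold>\<exists>Y. I Y \<^bold>\<and> (\<^bold>\<forall>X. X \<^bold>\<in> F \<^bold>\<longrightarrow> X \<^bold>\<subseteq> Y)"
  have "?A F p \<longleftrightarrow> (\<^bold>\<not> ?B F) p" for F p
  proof
    assume a: "?A F p"
    have False if q: "q \<le> p" "?B F q" for q
    proof -
      obtain r Y where r: "r \<le> q" "I Y r" "(\<^bold>\<forall>X. X \<^bold>\<in> F \<^bold>\<longrightarrow> X \<^bold>\<subseteq> Y) r"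
        using q(2) unfolding fex_iff[of "\<lambda>Y. I Y \<^bold>\<and> _ Y"] fconj_def[of "I _"] by blast
      have "r \<le> p" using r q by (meson order_trans)
      then obtain s U where s: "s \<le> r" "(\<^bold>\<forall>x. x \<^bold>\<in> U \<^bold>\<longleftrightarrow> (\<^bold>\<exists>X. X \<^bold>\<in> F \<^bold>\<and> x \<^bold>\<in> X)) s" "(\<^bold>\<not> I U) s"
        using a unfolding fex_iff[of "\<lambda>U. _ U \<^bold>\<and> \<^bold>\<not> I U"] fconj_def[of _ "\<^bold>\<not> I _"] by blast
      have "(U \<^bold>\<subseteq> Y) s"
        unfolding fsub_iff
      proof (intro allI impI)
        fix t x assume t: "t \<le> s" "(x \<^bold>\<in> U) t"
        then have x: "(\<^bold>\<exists>X. X \<^bold>\<in> F \<^bold>\<and> x \<^bold>\<in> X) t" using s(2) by (simp add: fall_def fiff_iff)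
        show "(x \<^bold>\<in> Y) t"
        proof (rule fexE[OF x reg_fmem])
          fix u X assume u: "u \<le> t" "(X \<^bold>\<in> F \<^bold>\<and> x \<^bold>\<in> X) u"
          have ur: "u \<le> r" using u t s by (meson order_trans)
          have "(X \<^bold>\<subseteq> Y) u" using r(3) u(2) ur by (simp add: fall_def fimp_iff fconj_def)
          then show "(x \<^bold>\<in> Y) u" using u(2) unfolding fsub_iff fconj_def by (meson order_refl)
        qed
      qed
      then have "I U s" using down[OF reg_mono[OF good_reg[OF I] r(2) s(1)]] by blast
      then show False using s(3) unfolding fneg_def by (meson order_refl)
    qed
    then show "(\<^bold>\<not> ?B F) p" unfolding fneg_def[of "?B F"] by blast
  next
    assume a: "(\<^bold>\<not> ?B F) p"
    have "\<not> I (union_name F) q" if q: "q \<le> p" for q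
    proof
      assume i: "I (union_name F) q"
      have "(X \<^bold>\<subseteq> union_name F) r" if "(X \<^bold>\<in> F) r" for X r
        unfolding fsub_iff
      proof (intro allI impI)
        fix s z assume s: "s \<le> r" "(z \<^bold>\<in> X) s"
        then have "(X \<^bold>\<in> F \<^bold>\<and> z \<^bold>\<in> X) s" using fmem_mono[OF that s(1)] by (simp add: fconj_def)
        then show "(z \<^bold>\<in> union_name F) s" unfolding mem_union_name by (intro fexI[of _ X]) simp_all
      qed
      then have "(I (union_name F) \<^bold>\<and> (\<^bold>\<forall>X. X \<^bold>\<in> F \<^bold>\<longrightarrow> X \<^bold>\<subseteq> union_name F)) q"
        using i by (simp add: fconj_def fall_def fimp_iff)
      then have "?B F q" by (intro fexI[of _ "union_name F"]) simp_all
      then show False using a q unfolding fneg_def[of "?B F"] by blast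
    qed
    then have "((\<^bold>\<forall>x. x \<^bold>\<in> union_name F \<^bold>\<longleftrightarrow> (\<^bold>\<exists>X. X \<^bold>\<in> F \<^bold>\<and> x \<^bold>\<in> X)) \<^bold>\<and> \<^bold>\<not> I (union_name F)) p"
      by (simp add: fconj_def[of _ "fneg _"] fneg_def fall_def fiff_iff mem_union_name)
    then show "?A F p" by (intro fexI[of _ "union_name F"]) simp_all
  qed
  then have "?A F = (\<^bold>\<not> ?B F)" for F by blast
  then show ?thesis unfolding add_eq_def by simp
qed

end

context chain_setting begin

lemma good_N_pos [good_intros]:
  "cong f \<Longrightarrow> cong h \<Longrightarrow> good (\<lambda>x :: ('i, 'l cohen) name. N_pos J (f x) (h x))"
  unfolding N_pos_def by (intro good_intros)

lemma good_N_dual [good_intros]: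
  "cong f \<Longrightarrow> cong h \<Longrightarrow> good (\<lambda>x :: ('i, 'l cohen) name. N_dual J (f x) (h x))"
  unfolding N_dual_def by (intro good_intros)

lemma reg_N_pos [simp]: "reg (N_pos J c (x :: ('i, 'l cohen) name))" unfolding N_pos_def by simp
lemma reg_N_dual [simp]: "reg (N_dual J c (x :: ('i, 'l cohen) name))" unfolding N_dual_def by simp

lemma good_null_ideal: "good (null_ideal J :: ('i, 'l cohen) fclass)"
  unfolding null_ideal_def by (intro good_intros)

lemma Omega_barE:
  assumes "Omega_bar (c :: ('i, 'l cohen) name) p"
  obtains S D where "countable S" "bq S D" "(c \<^bold>= seqname D) p" "ae p (\<lambda>g. vanishing (D g))"
proof -
  have "is_fun c omega is_clopen p" using assms unfolding Omega_bar_def fconj_def by blast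
  then obtain S D where D: "countable S" "bq S D" "(c \<^bold>= seqname D) p" by (rule seq_rep)
  have "Omega_bar (seqname D) p" by (rule good_cong[OF good_Omega_bar[OF cong_id] D(3) assms])
  then have "ae p (\<lambda>g. vanishing (D g))" by (rule Omega_bar_vanishing[OF bq_UNIV[OF D(2)]])
  then show thesis using that D by blast
qed

lemma N_iff:
  assumes X: "rl X" and x: "(x \<^bold>= realname X) p" and D: "bq UNIV D" and c: "(c \<^bold>= seqname D) p"
  shows "N_pos ult_ideal c x p \<longleftrightarrow> ult (hit X D) p" and "N_dual ult_ideal c x p \<longleftrightarrow> ult (hit X D) p"
proof -
  have gp: "good (\<lambda>c. N_pos ult_ideal c x)" "good (\<lambda>x. N_pos ult_ideal (seqname D) x)" by (intro good_intros)+
  have gd: "good (\<lambda>c. N_dual ult_ideal c x)" "good (\<lambda>x. N_dual ult_ideal (seqname D) x)" by (intro good_intros)+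
  have "N_pos ult_ideal c x p \<longleftrightarrow> N_pos ult_ideal (seqname D) x p"
    using good_cong[OF gp(1) c] good_cong[OF gp(1) feq_sym[OF c]] by blast
  also have "\<dots> \<longleftrightarrow> N_pos ult_ideal (seqname D) (realname X) p"
    using good_cong[OF gp(2) x] good_cong[OF gp(2) feq_sym[OF x]] by blast
  finally show "N_pos ult_ideal c x p \<longleftrightarrow> ult (hit X D) p" by (simp add: N_pos_iff[OF X D])
  have "N_dual ult_ideal c x p \<longleftrightarrow> N_dual ult_ideal (seqname D) x p"
    using good_cong[OF gd(1) c] good_cong[OF gd(1) feq_sym[OF c]] by blast
  also have "\<dots> \<longleftrightarrow> N_dual ult_ideal (seqname D) (realname X) p"
    using good_cong[OF gd(2) x] good_cong[OF gd(2) feq_sym[OF x]] by blast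
  finally show "N_dual ult_ideal c x p \<longleftrightarrow> ult (hit X D) p" by (simp add: N_dual_iff[OF X D])
qed

lemma N_dual_eq_pos:
  assumes "Omega_bar (c :: ('i, 'l cohen) name) p" shows "N_dual ult_ideal c x p \<longleftrightarrow> N_pos ult_ideal c x p"
proof (cases "is_cantor x p")
  case True
  obtain X where X: "rl X" "(x \<^bold>= realname X) p" using cantorE[OF True] .
  obtain S D where D: "bq S D" "(c \<^bold>= seqname D) p" using Omega_barE[OF assms] by metis
  show ?thesis using N_iff[OF X bq_UNIV[OF D(1)] D(2)] by simp
next
  case False
  then show ?thesis by (simp add: N_dual_def N_pos_def fconj_def)
qed

lemma null_ideal_iff:
  "null_ideal J (X :: ('i, 'l cohen) name) p \<longleftrightarrow>
    (\<forall>q\<le>p. \<exists>r\<le>q. \<exists>c. Omega_bar c r \<and> (\<forall>x. \<forall>s\<le>r. (x \<^bold>\<in> X) s \<longrightarrow> N_pos J c x s))"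
  unfolding null_ideal_def fex_iff by (simp add: fconj_def fall_def fimp_iff)

lemma null_ideal_star_iff:
  "null_ideal_star J (X :: ('i, 'l cohen) name) p \<longleftrightarrow>
    (\<forall>q\<le>p. \<exists>r\<le>q. \<exists>c. Omega_bar c r \<and> (\<forall>x. \<forall>s\<le>r. (x \<^bold>\<in> X) s \<longrightarrow> N_dual J c x s))"
  unfolding null_ideal_star_def fex_iff by (simp add: fconj_def fall_def fimp_iff)

text \<open>Over the ultrafilter, \<open>N_dual\<close> and \<open>N_pos\<close> of a sequence
  agree; so the equations for the starred ideal reduce to those for the other one.\<close>

lemma null_ideal_star_eq: "null_ideal_star ult_ideal = null_ideal ult_ideal"
proof (intro ext)
  fix X :: "('i, 'l cohen) name" and p
  have "Omega_bar c r \<and> (\<forall>x. \<forall>s\<le>r. (x \<^bold>\<in> X) s \<longrightarrow> N_dual ult_ideal c x s) \<longleftrightarrow>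
    Omega_bar c r \<and> (\<forall>x. \<forall>s\<le>r. (x \<^bold>\<in> X) s \<longrightarrow> N_pos ult_ideal c x s)" for c r
    using N_dual_eq_pos[OF reg_mono[OF reg_Omega_bar]] by blast
  then show "null_ideal_star ult_ideal X p = null_ideal ult_ideal X p" unfolding null_ideal_iff null_ideal_star_iff by simp
qed

lemma null_ideal_down:
  assumes "null_ideal J (Y :: ('i, 'l cohen) name) q" "(X \<^bold>\<subseteq> Y) q" shows "null_ideal J X q"
  unfolding null_ideal_iff
proof (intro allI impI)
  fix q' assume q': "q' \<le> q"
  then obtain r c where r: "r \<le> q'" "Omega_bar c r" "\<forall>x. \<forall>s\<le>r. (x \<^bold>\<in> Y) s \<longrightarrow> N_pos J c x s"
    using assms(1) unfolding null_ideal_iff by blast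
  have "r \<le> q" by (rule order_trans[OF r(1) q'])
  then have "(X \<^bold>\<subseteq> Y) r" by (rule reg_mono[OF reg_fsub assms(2)])
  then have "\<forall>x. \<forall>s\<le>r. (x \<^bold>\<in> X) s \<longrightarrow> N_pos J c x s" using r(3) unfolding fsub_iff by blast
  then show "\<exists>r\<le>q'. \<exists>c. Omega_bar c r \<and> (\<forall>x. \<forall>s\<le>r. (x \<^bold>\<in> X) s \<longrightarrow> N_pos J c x s)" using r(1,2) by blast
qed

definition null_name :: "'l \<Rightarrow> ('i, 'l cohen) name" where
  "null_name \<beta> = fam {X. rl X} realname (\<lambda>X. ult (hit X (cohen_seq \<beta>)))"

lemma bq_cohen_seq_UNIV: "bq UNIV (cohen_seq \<beta>)" by (rule bq_UNIV[OF bq_cohen_seq])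

lemma mem_null_name: assumes X: "rl X" shows "(realname X \<^bold>\<in> null_name \<beta>) p \<longleftrightarrow> ult (hit X (cohen_seq \<beta>)) p"
  unfolding null_name_def
proof (rule fmem_fam_self[where f = realname and P = "\<lambda>X. ult (hit X (cohen_seq \<beta>))", OF small_gen_fun])
  fix Y r assume Y: "Y \<in> {X. rl X}" "(realname X \<^bold>= realname Y) r" "ult (hit Y (cohen_seq \<beta>)) r"
  have "ae r (\<lambda>g. X g = Y g)" using realname_eq_iff[OF X] Y(1,2) by simp
  then have "ae r (\<lambda>g. \<forall>n. hit Y (cohen_seq \<beta>) g n \<longrightarrow> hit X (cohen_seq \<beta>) g n)" by (rule ae_mp) (simp add: hit_def)
  then show "ult (hit X (cohen_seq \<beta>)) r" by (rule ult_mono'[OF Y(3)])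
qed (simp_all add: X)

lemma null_name_cantor: assumes "(x \<^bold>\<in> null_name \<beta>) p" shows "is_cantor x p"
proof (rule is_cantorI)
  fix q assume "q \<le> p"
  then show "\<exists>r\<le>q. \<exists>X. rl X \<and> (x \<^bold>= realname X) r"
    using assms fmem_fam[where f = realname and C = "{X. rl X}" and P = "\<lambda>X. ult (hit X (cohen_seq \<beta>))" and x = x and p = p, OF small_gen_fun reg_ult]
    unfolding null_name_def by blast
qed

lemma Omega_bar_cohen_seq: "Omega_bar (seqname (cohen_seq \<beta>)) p"
  by (rule Omega_bar_tail[OF bq_cohen_seq_UNIV aeI]) (rule tail_cohen_seq)

lemma null_ideal_null_name: "null_ideal ult_ideal (null_name \<beta>) p"
proof -
  have "N_pos ult_ideal (seqname (cohen_seq \<beta>)) x s" if x: "(x \<^bold>\<in> null_name \<beta>) s" for x s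
  proof -
    obtain X where X: "rl X" "(x \<^bold>= realname X) s" using cantorE[OF null_name_cantor[OF x]] .
    have "ult (hit X (cohen_seq \<beta>)) s" using fmem_cong1[OF X(2) x] by (simp add: mem_null_name[OF X(1)])
    then show ?thesis using N_iff(1)[OF X bq_cohen_seq_UNIV feq_refl] by simp
  qed
  then show ?thesis unfolding null_ideal_iff using Omega_bar_cohen_seq order_refl by blast
qed

section \<open>Cofinality and strictness of the chain of Cohen sequences\<close>

lemma covered_eq_subs: "covered \<beta> D = subs D (cohen_seq \<beta>)"
  by (intro ext) (simp add: covered_def subs_def)

text \<open>Here uncountable cofinality enters: the part of the countable support inside K is
  bounded in K, and for every \<beta> from the bound on the whole support is admissible.\<close>

lemma eventually_supp_below:
  assumes "countable S" shows "\<exists>\<alpha>\<in>K. \<forall>\<beta>\<in>K. le \<alpha> \<beta> \<longrightarrow> S \<subseteq> supp_below \<beta>"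
proof -
  have "countable (S \<inter> K)" using assms by (rule countable_Int1)
  then obtain \<alpha> where \<alpha>: "\<alpha> \<in> K" "\<And>\<gamma>. \<gamma> \<in> S \<inter> K \<Longrightarrow> lt \<gamma> \<alpha>" using cofK[of "S \<inter> K"] unfolding lt_def by blast
  have "S \<subseteq> supp_below \<beta>" if "le \<alpha> \<beta>" for \<beta> using that \<alpha>(2) lt_trans unfolding le_def supp_below_def by blast
  then show ?thesis using \<alpha>(1) by blast
qed

lemma eventually_subs:
  assumes "countable S" "bq S D" "ae p (\<lambda>g. vanishing (D g))"
  shows "\<exists>\<alpha>\<in>K. \<forall>\<beta>\<in>K. le \<alpha> \<beta> \<longrightarrow> ult (subs D (cohen_seq \<beta>)) p"
proof -
  obtain \<alpha> where \<alpha>: "\<alpha> \<in> K" "\<forall>\<beta>\<in>K. le \<alpha> \<beta> \<longrightarrow> S \<subseteq> supp_below \<beta>" using eventually_supp_below[OF assms(1)] by blast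
  have "ult (subs D (cohen_seq \<beta>)) p" if "\<beta> \<in> K" "le \<alpha> \<beta>" for \<beta>
    unfolding covered_eq_subs[symmetric] by (rule ult_covered[OF that(1) bq_mono[OF assms(2)] assms(3)]) (use \<alpha> that in blast)
  then show ?thesis using \<alpha>(1) by blast
qed

lemma ult_hit_subs:
  assumes "ult (hit X D) p" "ult (subs D E) p" shows "ult (hit X E) p"
  by (rule ult_mono'[OF ult_conj[OF assms]], rule aeI) (auto simp: hit_def subs_def)

lemma ult_subs_trans:
  assumes "ult (subs D E) p" "ult (subs E F) p" shows "ult (subs D F) p"
  by (rule ult_mono'[OF ult_conj[OF assms]], rule aeI) (auto simp: subs_def)

lemma sub_mod_rep:
  assumes D: "bq UNIV D" "(c \<^bold>= seqname D) p" and E: "bq UNIV E" "(d \<^bold>= seqname E) p"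
  shows "sub_mod ult_ideal c d p \<longleftrightarrow> ult (subs D E) p"
proof -
  have g: "good (\<lambda>c. sub_mod ult_ideal c d)" "good (\<lambda>d. sub_mod ult_ideal (seqname D) d)" by (intro good_intros)+
  have "sub_mod ult_ideal c d p \<longleftrightarrow> sub_mod ult_ideal (seqname D) d p"
    using good_cong[OF g(1) D(2)] good_cong[OF g(1) feq_sym[OF D(2)]] by blast
  also have "\<dots> \<longleftrightarrow> sub_mod ult_ideal (seqname D) (seqname E) p"
    using good_cong[OF g(2) E(2)] good_cong[OF g(2) feq_sym[OF E(2)]] by blast
  finally show ?thesis by (simp add: sub_mod_iff[OF D(1) E(1)])
qed

lemma sub_mod_cofinal:
  assumes "Omega_bar c p" shows "\<exists>\<alpha>\<in>K. \<forall>\<beta>\<in>K. le \<alpha> \<beta> \<longrightarrow> sub_mod ult_ideal c (seqname (cohen_seq \<beta>)) p"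
proof -
  obtain S D where D: "countable S" "bq S D" "(c \<^bold>= seqname D) p" "ae p (\<lambda>g. vanishing (D g))"
    by (rule Omega_barE[OF assms])
  have "sub_mod ult_ideal c (seqname (cohen_seq \<beta>)) p \<longleftrightarrow> ult (subs D (cohen_seq \<beta>)) p" for \<beta>
    by (rule sub_mod_rep[OF bq_UNIV[OF D(2)] D(3) bq_cohen_seq_UNIV feq_refl])
  then show ?thesis using eventually_subs[OF D(1,2,4)] by simp
qed

lemma sub_mod_trans:
  assumes "Omega_bar x p" "Omega_bar y p" "Omega_bar z p" "sub_mod ult_ideal x y p" "sub_mod ult_ideal y z p"
  shows "sub_mod ult_ideal x z p"
proof -
  obtain S D where D: "bq S D" "(x \<^bold>= seqname D) p" using Omega_barE[OF assms(1)] by metis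
  obtain S' E where E: "bq S' E" "(y \<^bold>= seqname E) p" using Omega_barE[OF assms(2)] by metis
  obtain S'' F where F: "bq S'' F" "(z \<^bold>= seqname F) p" using Omega_barE[OF assms(3)] by metis
  note D' = bq_UNIV[OF D(1)] D(2) and E' = bq_UNIV[OF E(1)] E(2) and F' = bq_UNIV[OF F(1)] F(2)
  show ?thesis
    using assms(4,5) ult_subs_trans unfolding sub_mod_rep[OF D' E'] sub_mod_rep[OF E' F'] sub_mod_rep[OF D' F'] by blast
qed

lemma null_ideal_cofinal:
  assumes "null_ideal ult_ideal X q" shows "\<exists>r\<le>q. \<exists>\<alpha>\<in>K. \<forall>\<beta>\<in>K. le \<alpha> \<beta> \<longrightarrow> (X \<^bold>\<subseteq> null_name \<beta>) r"
proof -
  obtain r c where r: "r \<le> q" "Omega_bar c r" "\<forall>x. \<forall>s\<le>r. (x \<^bold>\<in> X) s \<longrightarrow> N_pos ult_ideal c x s"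
    using assms unfolding null_ideal_iff by blast
  obtain S D where D: "countable S" "bq S D" "(c \<^bold>= seqname D) r" "ae r (\<lambda>g. vanishing (D g))"
    by (rule Omega_barE[OF r(2)])
  obtain \<alpha> where \<alpha>: "\<alpha> \<in> K" "\<forall>\<beta>\<in>K. le \<alpha> \<beta> \<longrightarrow> ult (subs D (cohen_seq \<beta>)) r" using eventually_subs[OF D(1,2,4)] by blast
  have "(X \<^bold>\<subseteq> null_name \<beta>) r" if \<beta>: "\<beta> \<in> K" "le \<alpha> \<beta>" for \<beta>
    unfolding fsub_iff
  proof (intro allI impI)
    fix s x assume s: "s \<le> r" "(x \<^bold>\<in> X) s"
    have n: "N_pos ult_ideal c x s" using r(3) s by blast
    then have "is_cantor x s" by (simp add: N_pos_def fconj_def)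
    then obtain Y where Y: "rl Y" "(x \<^bold>= realname Y) s" by (rule cantorE)
    have "ult (hit Y D) s" using n N_iff(1)[OF Y bq_UNIV[OF D(2)] feq_mono[OF D(3) s(1)]] by simp
    moreover have "ult (subs D (cohen_seq \<beta>)) s" using \<alpha>(2) \<beta> reg_mono[OF reg_ult _ s(1)] by blast
    ultimately have "ult (hit Y (cohen_seq \<beta>)) s" by (rule ult_hit_subs)
    then have "(realname Y \<^bold>\<in> null_name \<beta>) s" by (simp add: mem_null_name[OF Y(1)])
    then show "(x \<^bold>\<in> null_name \<beta>) s" by (rule fmem_cong1[OF feq_sym[OF Y(2)]])
  qed
  then show ?thesis using r(1) \<alpha>(1) by blast
qed

lemma rl_avoid_real: "rl (avoid_real \<alpha>)" unfolding rl_def by (intro allI bp_UNIV[OF bp_avoid_real])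

lemma not_ult_avoid_real: "\<not> ult (hit (avoid_real \<alpha>) (cohen_seq \<alpha>)) p"
proof
  assume "ult (hit (avoid_real \<alpha>) (cohen_seq \<alpha>)) p"
  then have "ae p (\<lambda>g. \<forall>m. \<exists>n. m \<le> n \<and> hit (avoid_real \<alpha>) (cohen_seq \<alpha>) g n)" by (rule ult_infinite[OF rl_hit[OF rl_avoid_real bq_cohen_seq_UNIV]])
  then show False by (simp add: hit_def avoid_real_avoids)
qed

text \<open>The cones around the real form a vanishing sequence depending only on the index
  \<alpha>, which is below \<beta>; so the Cohen sequence of \<beta> covers them on a set of the
  ultrafilter. With \<open>not_ult_avoid_real\<close> this separates the null sets of \<alpha> and
  \<beta>.\<close>

lemma ult_avoid_real: assumes "\<beta> \<in> K" "lt \<alpha> \<beta>" shows "ult (hit (avoid_real \<alpha>) (cohen_seq \<beta>)) p"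
proof -
  let ?E = "\<lambda>g. sq (avoid_real \<alpha> g)"
  have "bpf {\<alpha>} (\<lambda>g. rst (avoid_real \<alpha> g) n)" for n by (rule bpf_rst[OF bp_avoid_real])
  then have "bpf {\<alpha>} (\<lambda>g. [rst (avoid_real \<alpha> g) n])" for n by (rule bpf_app)
  then have "bq {\<alpha>} ?E" unfolding bq_def sq_def by blast
  then have "bq (supp_below \<beta>) ?E" by (rule bq_mono) (use assms in \<open>simp add: supp_below_def\<close>)
  moreover have "ae p (\<lambda>g. vanishing (?E g))" by (rule aeI, rule tail_imp_vanishing, rule tail_sq)
  ultimately have "ult (covered \<beta> ?E) p" by (rule ult_covered[OF assms(1)])
  then show ?thesis by (rule ult_mono', intro aeI) (auto simp: covered_def hit_def)
qed

lemma b_d_kappa: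
  assumes "is_regular_cardinal kappa p" shows "b_eq ult_ideal kappa p" "d_eq ult_ideal kappa p"
proof -
  interpret cofinal_chain U e0 lam K Omega_bar "sub_mod ult_ideal" "\<lambda>\<alpha>. seqname (cohen_seq \<alpha>)" p
  proof
    show "good (Omega_bar :: ('i, 'l cohen) fclass)" by (intro good_intros)
    show "good (\<lambda>x. sub_mod ult_ideal x y)" "good (\<lambda>y. sub_mod ult_ideal x y)" for x y by (intro good_intros)+
    show "sub_mod ult_ideal (seqname (cohen_seq \<alpha>)) (seqname (cohen_seq \<alpha>)) q" for \<alpha> q
      unfolding sub_mod_iff[OF bq_cohen_seq_UNIV bq_cohen_seq_UNIV] by (rule ult_cofinite, rule aeI) (simp add: subs_def)
    show "\<exists>r\<le>q. \<exists>\<alpha>\<in>K. \<forall>\<beta>\<in>K. le \<alpha> \<beta> \<longrightarrow> sub_mod ult_ideal x (seqname (cohen_seq \<beta>)) r" if "Omega_bar x q" for x q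
      using sub_mod_cofinal[OF that] by blast
    show "\<not> sub_mod ult_ideal (seqname (cohen_seq \<beta>)) (seqname (cohen_seq \<alpha>)) q" if "\<beta> \<in> K" "lt \<alpha> \<beta>" for \<alpha> \<beta> q
      \<comment> \<open>A reverse inclusion would transfer the hits of the avoiding real from the
        sequence of \<beta> to that of \<alpha>, whose terms it never meets.\<close>
      unfolding sub_mod_iff[OF bq_cohen_seq_UNIV bq_cohen_seq_UNIV] using ult_hit_subs[OF ult_avoid_real[OF that]] not_ult_avoid_real by blast
    show "sub_mod ult_ideal x z q" if "Omega_bar x q" "Omega_bar y q" "Omega_bar z q" "sub_mod ult_ideal x y q" "sub_mod ult_ideal y z q" for x y z q
      by (rule sub_mod_trans[OF that])
  qed (rule assms Omega_bar_cohen_seq)+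
  show "b_eq ult_ideal kappa p" unfolding b_eq_def by (rule unbounded_least_size)
  show "d_eq ult_ideal kappa p" unfolding d_eq_def by (rule cofinal_least_size)
qed

lemma add_cof_kappa:
  assumes "is_regular_cardinal kappa p" shows "add_eq (null_ideal ult_ideal) kappa p" "cof_eq (null_ideal ult_ideal) kappa p"
proof -
  interpret cofinal_chain U e0 lam K "null_ideal ult_ideal" "(\<^bold>\<subseteq>)" null_name p
  proof
    show "good (\<lambda>x. x \<^bold>\<subseteq> (y :: ('i, 'l cohen) name))" "good (\<lambda>y. x \<^bold>\<subseteq> (y :: ('i, 'l cohen) name))" for x y by (intro good_intros)+
    show "(null_name \<alpha> \<^bold>\<subseteq> null_name \<alpha>) q" for \<alpha> q by (simp add: fsub_iff)
    show "(x \<^bold>\<subseteq> z) q" if "(x \<^bold>\<subseteq> y) q" "(y \<^bold>\<subseteq> z) q" for x y z :: "('i, 'l cohen) name" and q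
      using that unfolding fsub_iff by blast
    show "\<not> (null_name \<beta> \<^bold>\<subseteq> null_name \<alpha>) q" if "\<beta> \<in> K" "lt \<alpha> \<beta>" for \<alpha> \<beta> q
    proof
      assume "(null_name \<beta> \<^bold>\<subseteq> null_name \<alpha>) q"
      moreover have "(realname (avoid_real \<alpha>) \<^bold>\<in> null_name \<beta>) q" unfolding mem_null_name[OF rl_avoid_real] by (rule ult_avoid_real[OF that])
      ultimately have "(realname (avoid_real \<alpha>) \<^bold>\<in> null_name \<alpha>) q" unfolding fsub_iff by (meson order_refl)
      then show False by (simp add: mem_null_name[OF rl_avoid_real] not_ult_avoid_real)
    qed
  qed (rule assms good_null_ideal null_ideal_null_name | erule null_ideal_cofinal)+
  show "add_eq (null_ideal ult_ideal) kappa p"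
    by (subst add_eq_unbounded[OF good_null_ideal], erule (1) null_ideal_down, rule unbounded_least_size)
  show "cof_eq (null_ideal ult_ideal) kappa p" unfolding cof_eq_def by (rule cofinal_least_size)
qed

end

section \<open>The forcing theorem\<close>

context index begin

lemma good_is_trans [good_intros]: "cong f \<Longrightarrow> good (\<lambda>x :: ('i, 'p::order_top) name. is_trans (f x))"
  unfolding is_trans_def by (intro good_intros)

lemma good_is_cardinal [good_intros]: "cong f \<Longrightarrow> good (\<lambda>x :: ('i, 'p::order_top) name. is_cardinal (f x))"
  unfolding is_cardinal_def is_ordinal_def by (intro good_intros)

lemma good_is_regular_cardinal:
  "good (is_regular_cardinal :: ('i, 'p::order_top) fclass)"
  unfolding is_regular_cardinal_def by (intro good_intros)

lemma good_least_size:
  assumes "\<And>F :: ('i, 'p::order_top) name. reg (\<Phi> F)" shows "good (least_size \<Phi>)"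
  unfolding least_size_def by (intro good_intros good_const assms)

end

abbreviation (input) six_cardinals :: "('i, 'l cohen) name \<Rightarrow> ('i, 'l cohen) name \<Rightarrow> 'l cohen fprop" where
  "six_cardinals J \<kappa> \<equiv>
       is_maximal_ideal J \<^bold>\<and>
       b_eq J \<kappa> \<^bold>\<and>
       add_eq (null_ideal J) \<kappa> \<^bold>\<and>
       add_eq (null_ideal_star J) \<kappa> \<^bold>\<and>
       cof_eq (null_ideal_star J) \<kappa> \<^bold>\<and>
       cof_eq (null_ideal J) \<kappa> \<^bold>\<and>
       d_eq J \<kappa>"

context chain_setting begin

lemma good_null_ideal_star: "good (null_ideal_star J :: ('i, 'l cohen) fclass)"
  unfolding null_ideal_star_def by (intro good_intros)

lemma good_six_cardinals: "good (six_cardinals J :: ('i, 'l cohen) fclass)"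
proof -
  have [simp]: "reg (is_ideal L)" "reg (null_ideal J L)" "reg (null_ideal_star J L)" for L :: "('i, 'l cohen) name"
    using good_reg[OF good_is_ideal] good_reg[OF good_null_ideal] good_reg[OF good_null_ideal_star] by auto
  have "reg (is_maximal_ideal J)" unfolding is_maximal_ideal_def by simp
  moreover have "good (b_eq J)" "good (d_eq J)"
    unfolding b_eq_def d_eq_def by (rule good_least_size, simp)+
  moreover have "good (add_eq (null_ideal J))" "good (add_eq (null_ideal_star J))"
    unfolding add_eq_def by (rule good_least_size, simp)+
  moreover have "good (cof_eq (null_ideal J))" "good (cof_eq (null_ideal_star J))"
    unfolding cof_eq_def by (rule good_least_size, simp)+
  ultimately show ?thesis by (intro good_fconj good_const)
qed

lemma good_fex_six_cardinals: "good (\<lambda>\<kappa> :: ('i, 'l cohen) name. \<^bold>\<exists>J. six_cardinals J \<kappa>)"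
  by (rule good_fex, rule good_six_cardinals)

lemma fex_six_cardinals_kappa:
  assumes "is_regular_cardinal kappa p" shows "(\<^bold>\<exists>J. six_cardinals J kappa) p"
proof (rule fexI[of _ ult_ideal])
  show "six_cardinals ult_ideal kappa p"
    using is_maximal_ideal_ult_ideal b_d_kappa[OF assms] add_cof_kappa[OF assms] by (simp add: fconj_def null_ideal_star_eq)
  show "reg (six_cardinals ult_ideal kappa)" by (rule good_reg[OF good_six_cardinals])
qed

end

context cohen_setting begin

text \<open>An enumeration of C in the ground model names a function from omega into the canonical
  name, and forced regularity bounds it. The bound is decided to be the check name of some \<beta>
  in K, and comparisons of check names are absolute.\<close>

lemma countable_bounded:
  fixes lam :: "'l rel"
  assumes wo: "Well_order lam" and fld: "Field lam = UNIV"
    and reg: "is_regular_cardinal (canonical (check_elem lam ` K) :: ('i, 'l cohen) name) u"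
    and om: "(omega \<^bold>\<in> (canonical (check_elem lam ` K) :: ('i, 'l cohen) name)) u"
    and C: "countable C" "C \<subseteq> K"
  shows "\<exists>\<alpha>\<in>K. \<forall>\<gamma>\<in>C. (\<gamma>, \<alpha>) \<in> lam \<and> \<gamma> \<noteq> \<alpha>"
proof (cases "C = {}")
  let ?k = "canonical (check_elem lam ` K) :: ('i, 'l cohen) name"
  have sm: "small (check_elem lam ` K :: ('i, 'l cohen) name set)" by (rule small_image[OF small_l])
  {
    case True
    have "K \<noteq> {}" using om unfolding fmem_canonical[OF sm] by (metis empty_iff image_empty order_refl)
    then show ?thesis using True by blast
  next
    case False
    define s where "s = from_nat_into C"
    have rs: "range s = C" unfolding s_def by (rule range_from_nat_into[OF False C(1)])
    have sK: "s n \<in> K" for n using rs C(2) by blast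
    let ?f = "fn UNIV nn (\<lambda>n. check_elem lam (s n)) :: ('i, 'l cohen) name"
    have "is_fun ?f (canonical (nn ` UNIV)) (\<lambda>y. y \<^bold>\<in> ?k) u"
      by (rule is_fun_fn[OF small_nat]) (use sK in \<open>auto intro!: fmem_canonicalI[OF sm]\<close>)
    then have f: "is_fun ?f omega (\<lambda>y. y \<^bold>\<in> ?k) u" by (simp add: omega_unfold)
    have "(\<^bold>\<forall>a f. a \<^bold>\<in> ?k \<^bold>\<and> is_fun f a (\<lambda>y. y \<^bold>\<in> ?k) \<^bold>\<longrightarrow>
          (\<^bold>\<exists>b. b \<^bold>\<in> ?k \<^bold>\<and> (\<^bold>\<forall>x y. op x y \<^bold>\<in> f \<^bold>\<longrightarrow> y \<^bold>\<in> b))) u"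
      using reg unfolding is_regular_cardinal_def by (simp only: fconj_def simp_thms)
    then have "(omega \<^bold>\<in> ?k \<^bold>\<and> is_fun ?f omega (\<lambda>y. y \<^bold>\<in> ?k) \<^bold>\<longrightarrow>
          (\<^bold>\<exists>b. b \<^bold>\<in> ?k \<^bold>\<and> (\<^bold>\<forall>x y. op x y \<^bold>\<in> ?f \<^bold>\<longrightarrow> y \<^bold>\<in> b))) u"
      unfolding fall_def[of "\<lambda>a. fall (_ a)"] fall_def[of "\<lambda>f. _ f \<^bold>\<longrightarrow> _ f"] by blast
    then have "(\<^bold>\<exists>b. b \<^bold>\<in> ?k \<^bold>\<and> (\<^bold>\<forall>x y. op x y \<^bold>\<in> ?f \<^bold>\<longrightarrow> y \<^bold>\<in> b)) u"
      by (rule fimpD) (use f om in \<open>simp_all add: fconj_def\<close>)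
    then obtain v b where v: "v \<le> u" "(b \<^bold>\<in> ?k) v" "(\<^bold>\<forall>x y. op x y \<^bold>\<in> ?f \<^bold>\<longrightarrow> y \<^bold>\<in> b) v"
      unfolding fex_iff fconj_def by blast
    obtain w \<beta> where w: "w \<le> v" "\<beta> \<in> K" "(b \<^bold>= check_elem lam \<beta>) w" using v(2) unfolding fmem_canonical[OF sm] by blast
    have "(s n, \<beta>) \<in> lam \<and> s n \<noteq> \<beta>" for n
    proof -
      have "(op (nn n) (check_elem lam (s n)) \<^bold>\<in> ?f) w" by (rule op_fnI[OF small_nat]) simp
      then have "(check_elem lam (s n) \<^bold>\<in> b) w" using v(3) w(1) by (simp add: fall_def fimp_iff)
      then have "(check_elem lam (s n) \<^bold>\<in> (check_elem lam \<beta> :: ('i, 'l cohen) name)) w" by (rule fmem_cong2[OF w(3)])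
      then show ?thesis by (subst (asm) check_elem_mem_iff[OF wo small_l]) (simp_all add: fld)
    qed
    then show ?thesis using w(2) rs by blast
  }
qed

text \<open>The existential is regular, so it is enough to find ideals densely often. K, and with it
  the ideal, is only determined below a condition that decides which ordinal \<kappa> is.\<close>

lemma fex_six_cardinals:
  fixes lam :: "'l rel" and \<kappa> :: "('i, 'l cohen) name"
  assumes wo: "Well_order lam" and fld: "Field lam = UNIV"
    and reg: "is_regular_cardinal \<kappa> p" and al: "(\<^bold>\<exists>a. is_aleph1 a \<^bold>\<and> ord_le a \<kappa>) p"
    and le: "ord_le \<kappa> (check_ord lam) p"
  shows "(\<^bold>\<exists>J. six_cardinals J \<kappa>) p"
proof (rule reg_dense[OF reg_fex])
  fix q assume q: "q \<le> p"
  \<comment> \<open>Below \<lambda> the ordinal is an initial segment of the well-order, and at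
    \<lambda> it is the whole field; either way it is the canonical name of a set of check
    names.\<close>
  have "\<exists>r\<le>q. \<exists>K. (\<kappa> \<^bold>= canonical (check_elem lam ` K)) r"
  proof -
    obtain r where r: "r \<le> q" "(\<kappa> \<^bold>\<in> check_ord lam) r \<or> (\<kappa> \<^bold>= check_ord lam) r"
      using le q unfolding ord_le_def fdisj_iff by blast
    from r(2) show ?thesis
    proof
      assume "(\<kappa> \<^bold>= check_ord lam) r"
      then show ?thesis using r(1) unfolding check_ord_def by blast
    next
      assume "(\<kappa> \<^bold>\<in> check_ord lam) r"
      then obtain s a where s: "s \<le> r" "(\<kappa> \<^bold>= check_elem lam a) s"
        unfolding check_ord_def fmem_canonical[OF small_image[OF small_l]] by blast
      have "(\<kappa> \<^bold>= canonical (check_elem lam ` underS lam a)) s" using s(2) check_elem_unfold[OF wo, of a] by metis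
      then show ?thesis using order_trans[OF s(1) r(1)] by blast
    qed
  qed
  then obtain r K where r: "r \<le> q" "(\<kappa> \<^bold>= canonical (check_elem lam ` K)) r" by blast
  let ?k = "canonical (check_elem lam ` K) :: ('i, 'l cohen) name"
  have rp: "r \<le> p" by (rule order_trans[OF r(1) q])
  obtain t a where t: "t \<le> r" "is_aleph1 a t" "ord_le a \<kappa> t"
    using al rp unfolding fex_iff[of "\<lambda>a. is_aleph1 a \<^bold>\<and> _ a"] fconj_def[of "is_aleph1 _"] by blast
  obtain u where u: "u \<le> t" "(a \<^bold>\<in> \<kappa>) u \<or> (a \<^bold>= \<kappa>) u" using t(3) unfolding ord_le_def fdisj_iff by blast
  have ur: "u \<le> r" by (rule order_trans[OF u(1) t(1)])
  have up: "u \<le> p" by (rule order_trans[OF ur rp])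
  have "(omega \<^bold>\<in> a) t" using t(2) unfolding is_aleph1_def by (simp only: fconj_def simp_thms)
  then have oa: "(omega \<^bold>\<in> a) u" by (rule fmem_mono[OF _ u(1)])
  have "is_trans \<kappa> p" using reg unfolding is_regular_cardinal_def is_cardinal_def is_ordinal_def by (simp only: fconj_def simp_thms)
  then have "(y \<^bold>\<subseteq> \<kappa>) s" if "(y \<^bold>\<in> \<kappa>) s" "s \<le> p" for y s
    using that unfolding is_trans_def by (simp add: fall_def fimp_iff)
  \<comment> \<open>From omega in aleph_1 and aleph_1 at most \<kappa>, using that \<kappa> is
    transitive.\<close>
  then have "(omega \<^bold>\<in> \<kappa>) u" using u(2) oa up fmem_cong2[of a \<kappa> u omega] unfolding fsub_iff by (meson order_refl)
  then have om: "(omega \<^bold>\<in> ?k) u" by (rule fmem_cong2[OF feq_mono[OF r(2) ur]])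
  have "is_regular_cardinal \<kappa> u" by (rule reg_mono[OF good_reg[OF good_is_regular_cardinal] reg up])
  then have rk: "is_regular_cardinal ?k u" by (rule good_cong[OF good_is_regular_cardinal feq_mono[OF r(2) ur]])
  interpret ch: chain_setting U e0 lam K
    by unfold_locales (rule wo fld countable_bounded[OF wo fld rk om], assumption?)+
  have "is_regular_cardinal ch.kappa u" unfolding ch.kappa_def by (rule rk)
  then have "(\<^bold>\<exists>J. six_cardinals J ch.kappa) u" by (rule ch.fex_six_cardinals_kappa)
  then have "(\<^bold>\<exists>J. six_cardinals J \<kappa>) u"
    unfolding ch.kappa_def by (rule good_cong[OF ch.good_fex_six_cardinals feq_sym[OF feq_mono[OF r(2) ur]]])
  then show "\<exists>r\<le>q. (\<^bold>\<exists>J. six_cardinals J \<kappa>) r" using order_trans[OF ur r(1)] by blast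
qed

end

theorem theorem6p3:
  fixes lam :: "'l rel"
  assumes "card_order lam"
    and "uncountable (UNIV :: 'l set)"
    and "\<exists>e :: 'l set set \<Rightarrow> 'i. inj e"
  shows "forced (\<^bold>\<forall>\<kappa> :: ('i, 'l cohen) name.
    (is_regular_cardinal \<kappa> \<^bold>\<and> (\<^bold>\<exists>a. is_aleph1 a \<^bold>\<and> ord_le a \<kappa>) \<^bold>\<and> ord_le \<kappa> (check_ord lam)) \<^bold>\<longrightarrow>
    (\<^bold>\<exists>J. is_maximal_ideal J \<^bold>\<and>
       b_eq J \<kappa> \<^bold>\<and>
       add_eq (null_ideal J) \<kappa> \<^bold>\<and>
       add_eq (null_ideal_star J) \<kappa> \<^bold>\<and>
       cof_eq (null_ideal_star J) \<kappa> \<^bold>\<and>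
       cof_eq (null_ideal J) \<kappa> \<^bold>\<and>
       d_eq J \<kappa>))"
proof -
  obtain e :: "'l set set \<Rightarrow> 'i" where e: "inj e" using assms(3) by blast
  have l: "infinite (UNIV :: 'l set)" using assms(2) countable_finite by blast
  have "infinite (UNIV :: 'i set)"
  proof
    assume "finite (UNIV :: 'i set)"
    then have "finite (range e)" by (rule finite_subset[OF subset_UNIV])
    then have "finite (UNIV :: 'l set set set)" using finite_imageD[OF _ e] by (simp add: Finite_Set.finite_set)
    then show False using l by (simp add: Finite_Set.finite_set)
  qed
  then interpret cohen_setting "UNIV :: 'i set" e by unfold_locales (use e l in auto)
  have wo: "Well_order lam" "Field lam = UNIV" using assms(1) card_order_on_Card_order[of UNIV lam] by (auto simp: card_order_on_def)
  have "((is_regular_cardinal \<kappa> \<^bold>\<and> (\<^bold>\<exists>a. is_aleph1 a \<^bold>\<and> ord_le a \<kappa>) \<^bold>\<and> ord_le \<kappa> (check_ord lam)) \<^bold>\<longrightarrow>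
    (\<^bold>\<exists>J. six_cardinals J \<kappa>)) p" for \<kappa> :: "('i, 'l cohen) name" and p
  proof (rule fimpI)
    fix q assume h: "(is_regular_cardinal \<kappa> \<^bold>\<and> (\<^bold>\<exists>a. is_aleph1 a \<^bold>\<and> ord_le a \<kappa>) \<^bold>\<and> ord_le \<kappa> (check_ord lam)) q"
    show "(\<^bold>\<exists>J. six_cardinals J \<kappa>) q"
      by (rule fex_six_cardinals[OF wo]) (use h in \<open>simp_all only: fconj_def simp_thms\<close>)
  qed
  then show ?thesis unfolding forced_def by (intro allI) (simp only: fall_def simp_thms)
qed

end
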